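(* Let $\gamma\in[-3,-2]$ and let $\nu\in\mathcal{P}(\mathcal{P}(\mathbb{R}^3))$ have finite mean Fisher information and mean second moment, i.e. with $\nu^j=\int_{\mathcal{P}(\mathbb{R}^3)}\rho^{\otimes j}\nu(d\rho)$, $$\sup_{j\ge1}I(\nu^j)<+\infty,\qquad\int_{\mathbb{R}^3}|v|^2\nu^1(dv)<+\infty.$$ Then $$\int_{\mathcal{P}(\mathbb{R}^3)}H(\rho)\,\nu(d\rho)=\lim_{j\to\infty}H(\nu^j),\qquad\int_{\mathcal{P}(\mathbb{R}^3)}I(\rho)\,\nu(d\rho)=\lim_{j\to\infty}I(\nu^j),$$ $$\int_{\mathcal{P}(\mathbb{R}^3)}D(\rho\otimes\rho)\,\nu(d\rho)=\lim_{j\to\infty}D^j(\nu^j),$$ $$\lim_{j\to\infty}\mathcal{K}^j(\nu^j)\le\int_{\mathcal{P}(\mathbb{R}^3)}\mathcal{K}(\rho\otimes\rho)\,\nu(d\rho)\le16\lim_{j\to\infty}\mathcal{K}^j(\nu^j),$$ and all the limits are along sequences that are non-decreasing in $j$ ($j\ge1$ for $H,I$; $j\ge2$ for $D^j,\mathcal{K}^j$). Here $H$, $I$, $D^j$, $D$, $\mathcal{K}^j$, $\mathcal{K}$ are defined in the context.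
   Context: $\mathcal{P}(X)$: Borel probability measures on $X$ with the weak topology. For a probability $F$ on $\mathbb{R}^{3n}$: $H(F)=\frac1n\int F\log F$ and $I(F)=\frac1n\int\frac{|\nabla F|^2}{F}$, with value $+\infty$ if $F$ has no density (or, for $I$, no gradient). $\alpha(r)=r^\gamma$, $a(z)=|z|^2\mathrm{Id}-z\otimes z$ on $\mathbb{R}^3$. $(\alpha^N)_{N\ge2}$ is a pointwise non-decreasing sequence of positive, smooth, bounded functions (regarded as smooth radial functions on $\mathbb{R}^3$), $\alpha^N\nearrow\alpha$, $\alpha^N=\alpha$ outside $B(0,\eta_N)$ with $\eta_N\to0$, and $r|(\alpha^N)'(r)|/\alpha^N(r)\le-\gamma/0.99$ for $r>0$. $b_k(v_1,v_2)=e_k\times(v_1-v_2)\in\mathbb{R}^3$ ($e_k$ the canonical basis, $k=1,2,3$), $\tilde b_k=(b_k,-b_k)\in\mathbb{R}^6$; $\nabla_{12}$ is the gradient in $(v_1,v_2)$. For $F$ a symmetric nonnegative function on $\mathbb{R}^{3n}$, $n\ge2$, and $N\ge2$: $$D^N(F)=\tfrac12\int\alpha^N(|v_1-v_2|)\,a(v_1-v_2):[(\nabla_1-\nabla_2)\log F]^{\otimes2}F\,dV=\tfrac12\sum_{k=1}^3\int\alpha^N\frac{(\tilde b_k\cdot\nabla_{12}F)^2}{F}dV,$$ $$\mathcal{K}^N(F)=\sum_{k=1}^3\int\frac{\alpha^N(|v_1-v_2|)}{|v_1-v_2|^2}\frac{\big((\tilde b_k\cdot\nabla_{12})(\tilde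 b_k\cdot\nabla_{12})F\big)^2}{F}dV.$$ $D$ and $\mathcal{K}$ are the same expressions with $\alpha$ in place of $\alpha^N$. These functionals are extended to all symmetric probability measures, with values in $[0,+\infty]$, by: $D^N(F)=\frac12\sum_k\sup_{\psi\in C^1_c}\int(\sqrt{\alpha^N}\tilde b_k\cdot\nabla_{12}\psi-\frac{\psi^2}4)dF$; $\mathcal{K}^N(F)=\sup_\chi\sum_k\sup_{\psi\in C^2_c}\int(\partial_{k,\chi}^2\psi-\frac{\psi^2}4)dF$ with $\partial_{k,\chi}=\chi(|v_1-v_2|)(\alpha^N(|v_1-v_2|))^{1/4}\tilde b_k\cdot\nabla_{12}$ and $\chi$ ranging over bounded functions with $0\le\chi(r)\le r^{-1/2}$ and $v\mapsto\chi(|v|)$ smooth; $D=\sup_ND^N$, $\mathcal{K}=\sup_N\mathcal{K}^N$. *)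

theory Defs
  imports "HOL-Probability.Probability" "HOL-Analysis.Cross3"
begin

section \<open>Phase space and differential operators\<close>

text \<open>A point of $\mathbb{R}^{3n}$ is an extensional function on \<open>{1..n}\<close>, so that the number of
  particles can vary inside a statement; \<open>V i\<close> is the $i$-th velocity $v_i$. The space
  $\mathbb{R}^3$ is identified with the case $n = 1$ where needed. The type
  \<^typ>\<open>nat \<Rightarrow> real^3\<close> carries the product topology, which induces the Euclidean one on
  \<open>phase n\<close>.\<close>

type_synonym velocities = "nat \<Rightarrow> real^3"

definition phase :: "nat \<Rightarrow> velocities set" where
  "phase n = PiE {1..n} (\<lambda>_. UNIV)"

definition leb :: "nat \<Rightarrow> velocities measure" where
  "leb n = PiM {1..n} (\<lambda>_. lborel)"

definition slice :: "nat \<Rightarrow> 3 \<Rightarrow> (velocities \<Rightarrow> real) \<Rightarrow> velocities \<Rightarrow> real \<Rightarrow> real" where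
  "slice i u \<psi> V = (\<lambda>t. \<psi> (V(i := V i + t *\<^sub>R axis u 1)))"

definition partial :: "nat \<Rightarrow> 3 \<Rightarrow> (velocities \<Rightarrow> real) \<Rightarrow> velocities \<Rightarrow> real" where
  "partial i u \<psi> V = deriv (slice i u \<psi> V) 0"

definition grad :: "nat \<Rightarrow> (velocities \<Rightarrow> real) \<Rightarrow> velocities \<Rightarrow> real^3" where
  "grad i \<psi> V = (\<chi> u. partial i u \<psi> V)"

primrec C_diff :: "nat \<Rightarrow> nat \<Rightarrow> (velocities \<Rightarrow> real) \<Rightarrow> bool" where
  "C_diff n 0 \<psi> \<longleftrightarrow> continuous_on (phase n) \<psi>"
| "C_diff n (Suc k) \<psi> \<longleftrightarrow> continuous_on (phase n) \<psi> \<and>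
     (\<forall>i\<in>{1..n}. \<forall>u. (\<forall>V\<in>phase n. slice i u \<psi> V differentiable (at 0)) \<and>
        C_diff n k (partial i u \<psi>))"

definition compact_supp :: "nat \<Rightarrow> (velocities \<Rightarrow> real) \<Rightarrow> bool" where
  "compact_supp n \<psi> \<longleftrightarrow> (\<exists>R. \<forall>V\<in>phase n. (\<exists>i\<in>{1..n}. norm (V i) > R) \<longrightarrow> \<psi> V = 0)"

definition Cc :: "nat \<Rightarrow> nat \<Rightarrow> (velocities \<Rightarrow> real) set" where
  "Cc n k = {\<psi>. C_diff n k \<psi> \<and> compact_supp n \<psi>}"

definition Cc_smooth :: "nat \<Rightarrow> (velocities \<Rightarrow> real) set" where
  "Cc_smooth n = {\<psi>. (\<forall>k. C_diff n k \<psi>) \<and> compact_supp n \<psi>}"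

text \<open>Smoothness of $v \mapsto f(|v|)$ on $\mathbb{R}^3$.\<close>

definition smooth_radial :: "(real \<Rightarrow> real) \<Rightarrow> bool" where
  "smooth_radial f \<longleftrightarrow> (\<forall>k. C_diff 1 k (\<lambda>V. f (norm (V 1))))"


section \<open>Probability measures on $\mathcal{P}(\mathbb{R}^3)$\<close>

definition prob_measures :: "'a::topological_space measure set" where
  "prob_measures = {\<rho>. prob_space \<rho> \<and> sets \<rho> = sets borel}"

text \<open>The coarsest topology making $\rho \mapsto \int \varphi\,d\rho$ continuous for all bounded
  continuous $\varphi$.\<close>

definition weak_topology :: "'a::topological_space measure topology" where
  "weak_topology = topology_generated_by
     {{\<rho>\<in>prob_measures. (LINT x|\<rho>. \<phi> x) \<in> U} | (\<phi> :: 'a \<Rightarrow> real) U.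
        continuous_on UNIV \<phi> \<and> bounded (range \<phi>) \<and> open U}"

definition weak_borel :: "'a::topological_space measure measure" where
  "weak_borel = sigma prob_measures {U. openin weak_topology U}"

definition tensor :: "nat \<Rightarrow> (real^3) measure \<Rightarrow> velocities measure" where
  "tensor j \<rho> = PiM {1..j} (\<lambda>_. \<rho>)"

definition mixture :: "nat \<Rightarrow> (real^3) measure measure \<Rightarrow> velocities measure" where
  "mixture j \<nu> = bind \<nu> (tensor j)"

text \<open>Integral of an extended-real function, positive part minus negative part. Under a
  second moment bound the entropies below have a finite negative part, so that the
  indeterminate difference, which is \<open>\<infinity>\<close> by convention, does not arise.\<close>

definition ext_integral :: "'a measure \<Rightarrow> ('a \<Rightarrow> ereal) \<Rightarrow> ereal" where
  "ext_integral M f =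
     enn2ereal (\<integral>\<^sup>+x. e2ennreal (f x) \<partial>M) - enn2ereal (\<integral>\<^sup>+x. e2ennreal (- f x) \<partial>M)"


section \<open>Entropy and Fisher information\<close>

definition has_density :: "nat \<Rightarrow> velocities measure \<Rightarrow> bool" where
  "has_density n F \<longleftrightarrow> (\<exists>f\<in>borel_measurable (leb n). density (leb n) f = F)"

definition dens :: "nat \<Rightarrow> velocities measure \<Rightarrow> velocities \<Rightarrow> real" where
  "dens n F V = enn2real (RN_deriv (leb n) F V)"

definition H_fun :: "nat \<Rightarrow> velocities measure \<Rightarrow> ereal" where
  "H_fun n F = (if has_density n F
     then ereal (1 / real n) * ext_integral (leb n) (\<lambda>V. ereal (dens n F V * ln (dens n F V)))
     else \<infinity>)"

text \<open>Gradients of densities are weak (distributional): \<open>g i\<close> is a locally integrable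
  representative of $\nabla_i f$.\<close>

definition weak_gradient ::
    "nat \<Rightarrow> (velocities \<Rightarrow> real) \<Rightarrow> (nat \<Rightarrow> velocities \<Rightarrow> real^3) \<Rightarrow> bool" where
  "weak_gradient n f g \<longleftrightarrow> (\<forall>i\<in>{1..n}.
     g i \<in> borel_measurable (leb n) \<and>
     (\<forall>R. set_integrable (leb n) {V\<in>phase n. \<forall>l\<in>{1..n}. norm (V l) \<le> R} (g i)) \<and>
     (\<forall>\<psi>\<in>Cc_smooth n. \<forall>u.
        (LINT V|leb n. f V * partial i u \<psi> V) = - (LINT V|leb n. g i V $ u * \<psi> V)))"

text \<open>The weak gradient is unique almost everywhere, so the choice below is immaterial. The
  quotient is taken in \<^typ>\<open>ennreal\<close>, where $0/0 = 0$ and $c/0 = \infty$ for $c > 0$.\<close>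

definition I_fun :: "nat \<Rightarrow> velocities measure \<Rightarrow> ennreal" where
  "I_fun n F = (if has_density n F \<and> (\<exists>g. weak_gradient n (dens n F) g)
     then (let g = (SOME g. weak_gradient n (dens n F) g) in
       ennreal (1 / real n) *
         (\<integral>\<^sup>+V. ennreal (\<Sum>i\<in>{1..n}. (norm (g i V))\<^sup>2) / ennreal (dens n F V) \<partial>leb n))
     else \<infinity>)"


section \<open>The functionals \<open>D\<close> and \<open>K\<close>\<close>

text \<open>\<open>A N\<close> is the regularised kernel $\alpha^N$, a function of $r = |v_1 - v_2| \ge 0$. The
  limit $\alpha(r) = r^\gamma$ is only considered for $r > 0$.\<close>

definition kernel_approx :: "real \<Rightarrow> (nat \<Rightarrow> real \<Rightarrow> real) \<Rightarrow> bool" where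
  "kernel_approx \<gamma> A \<longleftrightarrow>
     (\<forall>N\<ge>2. smooth_radial (A N) \<and> (\<forall>r\<ge>0. A N r > 0) \<and> (\<exists>C. \<forall>r\<ge>0. A N r \<le> C)) \<and>
     (\<forall>N\<ge>2. \<forall>r\<ge>0. A N r \<le> A (Suc N) r) \<and>
     (\<forall>r>0. (\<lambda>N. A N r) \<longlonglongrightarrow> r powr \<gamma>) \<and>
     (\<exists>\<eta>. (\<forall>N\<ge>2. \<eta> N > 0 \<and> (\<forall>r\<ge>\<eta> N. A N r = r powr \<gamma>)) \<and> \<eta> \<longlonglongrightarrow> 0) \<and>
     (\<forall>N\<ge>2. \<forall>r>0. r * \<bar>deriv (A N) r\<bar> / A N r \<le> - \<gamma> / 0.99)"

definition b_vec :: "3 \<Rightarrow> velocities \<Rightarrow> real^3" where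
  "b_vec k V = cross3 (axis k 1) (V 1 - V 2)"

text \<open>The operator $\tilde b_k \cdot \nabla_{12}$ with $\tilde b_k = (b_k, -b_k)$.\<close>

definition b_deriv :: "3 \<Rightarrow> (velocities \<Rightarrow> real) \<Rightarrow> velocities \<Rightarrow> real" where
  "b_deriv k \<psi> V = b_vec k V \<bullet> grad 1 \<psi> V + (- b_vec k V) \<bullet> grad 2 \<psi> V"

text \<open>In the suprema below, \<^const>\<open>ennreal\<close> truncates negative values to \<open>0\<close>; this is harmless
  because $\psi = 0$ is admissible and gives the value \<open>0\<close>.
  The first argument \<open>a\<close> is the regularised kernel $\alpha^N$.\<close>

definition D_reg :: "(real \<Rightarrow> real) \<Rightarrow> nat \<Rightarrow> velocities measure \<Rightarrow> ennreal" where
  "D_reg a n F = ennreal (1 / 2) * (\<Sum>k\<in>UNIV. SUP \<psi>\<in>Cc n 1.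
     ennreal (LINT V|F. sqrt (a (norm (V 1 - V 2))) * b_deriv k \<psi> V - (\<psi> V)\<^sup>2 / 4))"

text \<open>The functions written $\chi$ on paper are called \<open>\<theta>\<close>. The bound $r^{-1/2}$ is void at
  $r = 0$.\<close>

definition cutoffs :: "(real \<Rightarrow> real) set" where
  "cutoffs = {\<theta>. (\<exists>C. \<forall>r\<ge>0. \<theta> r \<le> C) \<and> (\<forall>r\<ge>0. 0 \<le> \<theta> r) \<and>
     (\<forall>r>0. \<theta> r \<le> r powr (- 1 / 2)) \<and> smooth_radial \<theta>}"

definition cut_deriv ::
    "(real \<Rightarrow> real) \<Rightarrow> (real \<Rightarrow> real) \<Rightarrow> 3 \<Rightarrow> (velocities \<Rightarrow> real) \<Rightarrow> velocities \<Rightarrow> real" where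
  "cut_deriv a \<theta> k \<psi> V =
     \<theta> (norm (V 1 - V 2)) * a (norm (V 1 - V 2)) powr (1 / 4) * b_deriv k \<psi> V"

definition K_reg :: "(real \<Rightarrow> real) \<Rightarrow> nat \<Rightarrow> velocities measure \<Rightarrow> ennreal" where
  "K_reg a n F = (SUP \<theta>\<in>cutoffs. \<Sum>k\<in>UNIV. SUP \<psi>\<in>Cc n 2.
     ennreal (LINT V|F. cut_deriv a \<theta> k (cut_deriv a \<theta> k \<psi>) V - (\<psi> V)\<^sup>2 / 4))"

definition D_fun :: "(nat \<Rightarrow> real \<Rightarrow> real) \<Rightarrow> nat \<Rightarrow> velocities measure \<Rightarrow> ennreal" where
  "D_fun A n F = (SUP N\<in>{2..}. D_reg (A N) n F)"

definition K_fun :: "(nat \<Rightarrow> real \<Rightarrow> real) \<Rightarrow> nat \<Rightarrow> velocities measure \<Rightarrow> ennreal" where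
  "K_fun A n F = (SUP N\<in>{2..}. K_reg (A N) n F)"

end

theory Submission
 imports Defs "HOL-Real_Asymp.Real_Asymp"
begin

text \<open>Each functional is a supremum of integrals of test integrands that act on one or two particles only:
 the Fisher information and the dissipations by completing the square, the entropy through the chain rule
 as a sum of conditional relative entropies with respect to a Gaussian. By the law of large numbers the
 remaining particles reveal the random measure \<open>\<rho>\<close>, so test functions of $j$ particles can select the
 best test function for \<open>\<rho>\<close>; hence the suprema increase to the average of the functional over \<open>\<nu>\<close>.
 The two suprema in the claim on $\mathcal{K}$ are in fact equal in the limit.\<close>

text \<open>The suprema run over uncountable families, so neither measurability in
  \<open>\<rho>\<close> nor a measurable choice of a near-optimal test is automatic. Both come from
  one countable family that works for every \<open>\<rho>\<close>: differentiable tests whose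
  integrands are uniformly dense, and for the entropy functions dense in L1 of every finite measure.
  Monotone convergence then leaves finitely many tests, chosen on the cells of a measurable
  partition of the set of laws. The cell indicators are replaced by smooth functions of the
  particles beyond the first \<open>m\<close>; these behave as constants, because only the first
  \<open>m\<close> particles are differentiated or redrawn. For \<open>K_reg\<close> the supremum
  over cutoffs stands outside the sum over \<open>k\<close>; it reduces to one increasing sequence
  of cutoffs, since \<open>b_deriv\<close> annihilates radial functions. For the Fisher information
  a finite supremum must be turned back into a density with a weak gradient: Riesz representation
  gives the gradient, continuity of translates the density when \<open>n = 1\<close>. For the
  entropy the normalisation 1/n makes a Cesaro mean out of the chain rule.\<close>

abbreviation "bmeas == borel_measurable"

abbreviation (input) sequence_limit (infix "---->" 60) where
 "f ----> l == f \<longlonglongrightarrow> l"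

lemmas Bintegrable_add = Bochner_Integration.integrable_add
lemmas Bintegrable_bound = Bochner_Integration.integrable_bound
lemmas Bintegrable_cong = Bochner_Integration.integrable_cong
lemmas Bintegrable_diff = Bochner_Integration.integrable_diff
lemmas Bintegrable_sum = Bochner_Integration.integrable_sum
lemmas Bintegral_add = Bochner_Integration.integral_add
lemmas Bintegral_cong = Bochner_Integration.integral_cong
lemmas Bintegral_diff = Bochner_Integration.integral_diff
lemmas Bintegral_sum = Bochner_Integration.integral_sum

section \<open>Calculus of differentiable functions on phase space\<close>

definition mv :: "velocities => nat => 3 => real => velocities" where
 "mv V i u t = V(i := V i + t *\<^sub>R axis u 1)"

lemma mv_0 [simp]: "mv V i u 0 = V" by (simp add: mv_def)

lemma slice_mv: "slice i u f V = (%t. f (mv V i u t))" by (simp add: slice_def mv_def)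

lemma phase_upd: "V : phase n ==> i : {1..n} ==> V(i := x) : phase n"
 by (auto simp: phase_def PiE_def extensional_def)

lemma mv_phase: "V : phase n ==> i : {1..n} ==> mv V i u t : phase n"
 by (simp only: mv_def phase_upd)

lemma slice_cong:
 assumes "!!V. V : phase n ==> f V = g V" "V : phase n" "i : {1..n}"
 shows "slice i u f V = slice i u g V" using assms by (auto simp: slice_def phase_upd fun_eq_iff)

lemma partial_cong:
 assumes "!!V. V : phase n ==> f V = g V" "V : phase n" "i : {1..n}"
 shows "partial i u f V = partial i u g V" unfolding partial_def by (subst slice_cong[of n f g]) (use assms in auto)

text \<open>Functions are defined on the whole type while only \<open>phase n\<close> matters.
  Moving a particle with index in {1..n} stays inside \<open>phase n\<close>, so slices, and hence
  all iterated partials, see only the values there.\<close>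

lemma C_diff_cong:
 assumes "!!V. V : phase n ==> f V = g V" and "C_diff n k f"
 shows "C_diff n k g" using assms
proof (induction k arbitrary: f g)
 case 0
 then show ?case by (auto cong: continuous_on_cong)
next
 case (Suc k)
 have c: "continuous_on (phase n) g" using Suc.prems by (auto cong: continuous_on_cong)
 have "slice i u g V differentiable at 0" if "V : phase n" "i : {1..n}" for i u V
 proof -
  have "slice i u f V differentiable at 0" using Suc.prems(2) that by auto
  then show ?thesis using slice_cong[of n f g V i u] Suc.prems(1) that by metis
 qed
 moreover have "C_diff n k (partial i u g)" if "i : {1..n}" for i u by (rule Suc.IH[of "partial i u f"])
   (use Suc.prems partial_cong[of n f g] that in auto)
 ultimately show ?case using c by auto
qed

lemma C_diff_SucD: "C_diff n (Suc k) f ==> C_diff n k f" by (induction k arbitrary: f) auto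

lemma C_diff_mono: "C_diff n k f ==> l <= k ==> C_diff n l f"
 by (induction k) (auto simp: le_Suc_eq dest: C_diff_SucD simp del: C_diff.simps)

lemma C_diff_continuous: "C_diff n k f ==> continuous_on (phase n) f" by (cases k) auto

lemma C_diff_partial: "C_diff n (Suc k) f ==> i : {1..n} ==> C_diff n k (partial i u f)" by auto

text \<open>\<open>C_diff\<close> records differentiability at parameter 0 only. Moving by
  \<open>t\<close> and then by \<open>s\<close> is moving by \<open>s + t\<close>, so the derivative
  at 0 from the shifted base point is the derivative at \<open>t\<close>.\<close>

lemma slice_has_derivative:
 assumes "C_diff n (Suc k) f" "V : phase n" "i : {1..n}"
 shows "((%t. f (mv V i u t)) has_real_derivative partial i u f (mv V i u t)) (at t)"
proof -
 have "mv V i u t : phase n" using assms mv_phase by blast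
 then have "slice i u f (mv V i u t) differentiable at 0" using assms by auto
 then have "(slice i u f (mv V i u t) has_real_derivative partial i u f (mv V i u t)) (at 0)"
  unfolding partial_def by (simp add: DERIV_deriv_iff_real_differentiable)
 moreover have "slice i u f (mv V i u t) = (%s. f (mv V i u (s + t)))"
  by (auto simp: slice_def mv_def algebra_simps fun_eq_iff)
 ultimately show ?thesis using DERIV_shift[of "%t. f (mv V i u t)" _ 0 t] by simp
qed

lemma slice_has_derivative0:
 assumes "C_diff n (Suc k) f" "V : phase n" "i : {1..n}"
 shows "((%t. f (mv V i u t)) has_real_derivative partial i u f V) (at 0)"
 using slice_has_derivative[OF assms, of u 0] by simp

lemma partialI:
 assumes "((%t. f (mv V i u t)) has_real_derivative d) (at 0)"
 shows "partial i u f V = d" using assms unfolding partial_def slice_mv by (rule DERIV_imp_deriv)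

text \<open>Introduction rule behind the closure properties below: it suffices to exhibit candidates
  \<open>g i u\<close> for the partials, so that \<open>deriv\<close> never has to be
  evaluated.\<close>

lemma C_diff_SucI:
 assumes c: "continuous_on (phase n) f"
  and d: "!!V i u. V : phase n ==> i : {1..n} ==>
   ((%t. f (mv V i u t)) has_real_derivative g i u V) (at 0)"
  and g: "!!i u. i : {1..n} ==> C_diff n k (g i u)"
 shows "C_diff n (Suc k) f"
proof -
 have "C_diff n k (partial i u f)" if "i : {1..n}" for i u
  by (rule C_diff_cong[OF _ g[of i u]]) (use partialI[OF d] that in auto)
 moreover have "slice i u f V differentiable at 0" if "V : phase n" "i : {1..n}" for i u V
  using d[OF that, of u] unfolding slice_mv by (meson real_differentiable_def)
 ultimately show ?thesis using c by auto
qed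

lemma C_diff_const: "C_diff n k (%V. c)"
proof (induction k arbitrary: c)
 case (Suc k)
 show ?case by (rule C_diff_SucI[where g="%i u V. 0"]) (auto intro: Suc.IH)
qed auto

lemma continuous_on_if_const:
 "(P ==> continuous_on S f) ==> (~ P ==> continuous_on S g) ==>
  continuous_on S (%x. if P then f x else g x)" by (cases P) auto

lemma continuous_on_vel: "continuous_on S (%V :: velocities. V i)"
 by (rule continuous_on_product_then_coordinatewise[OF continuous_on_id])

lemma continuous_on_coord: "continuous_on S (%V :: velocities. V i $ u)"
 by (rule continuous_on_component[OF continuous_on_vel])

lemma C_diff_coord: "C_diff n k (%V. V i $ u)"
proof (cases k)
 case (Suc l)
 have "C_diff n (Suc l) (%V. V i $ u)"
 proof (rule C_diff_SucI[where g="%j w V. if i = j & u = w then 1 else 0"])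
  show "continuous_on (phase n) (%V. V i $ u)" by (rule continuous_on_coord)
  show "C_diff n l (%V. if i = j & u = w then 1 else 0)" for j and w :: 3 by (auto intro: C_diff_const)
  show "((%t. mv V j w t i $ u) has_real_derivative (if i = j & u = w then 1 else 0)) (at 0)"
   for V :: velocities and j w by (cases "i = j"; cases "u = w") (auto simp: axis_def mv_def intro!: derivative_eq_intros)
 qed
 then show ?thesis using Suc by simp
qed (auto simp: continuous_on_coord)

lemma C_diff_add:
 "C_diff n k f ==> C_diff n k g ==> C_diff n k (%V. f V + g V)"
proof (induction k arbitrary: f g)
 case (Suc k)
 show ?case by (rule C_diff_SucI[where g="%i u V. partial i u f V + partial i u g V"])
   (use Suc in \<open>auto intro!: continuous_intros DERIV_add Suc.IH
    intro: slice_has_derivative0[OF Suc.prems(1)] slice_has_derivative0[OF Suc.prems(2)]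
    simp del: C_diff.simps intro: C_diff_continuous C_diff_partial\<close>)
qed (auto intro: continuous_intros)

lemma C_diff_mult:
 "C_diff n k f ==> C_diff n k g ==> C_diff n k (%V. f V * g V)"
proof (induction k arbitrary: f g)
 case (Suc k)
 have 1: "C_diff n k f" "C_diff n k g" using Suc.prems C_diff_SucD by auto
 show ?case
 proof (rule C_diff_SucI[where g="%i u V. partial i u f V * g V + partial i u g V * f V"])
  show "continuous_on (phase n) (%V. f V * g V)"
   by (intro continuous_intros C_diff_continuous[OF 1(1)] C_diff_continuous[OF 1(2)])
  fix i u assume i: "i : {1..n}"
  show "C_diff n k (%V. partial i u f V * g V + partial i u g V * f V)"
   by (intro C_diff_add Suc.IH C_diff_partial[OF Suc.prems(1) i]
     C_diff_partial[OF Suc.prems(2) i] 1)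
  fix V assume "V : phase n"
  show "((%t. f (mv V i u t) * g (mv V i u t)) has_real_derivative
    partial i u f V * g V + partial i u g V * f V) (at 0)"
   using DERIV_mult[OF slice_has_derivative0[OF Suc.prems(1) \<open>V : phase n\<close> i, of u]
    slice_has_derivative0[OF Suc.prems(2) \<open>V : phase n\<close> i, of u]] by simp
 qed
qed (auto intro: continuous_intros)

lemma C_diff_cmult: "C_diff n k f ==> C_diff n k (%V. c * f V)" using C_diff_mult[OF C_diff_const] .

lemma C_diff_minus: "C_diff n k f ==> C_diff n k (%V. - f V)" using C_diff_cmult[of n k f "-1"] by simp

lemma C_diff_diff:
 "C_diff n k f ==> C_diff n k g ==> C_diff n k (%V. f V - g V)"
 using C_diff_add[of n k f "%V. - g V"] C_diff_minus by auto

lemma C_diff_sum: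
 "(!!a. a : S ==> C_diff n k (f a)) ==> C_diff n k (%V. \<Sum>a\<in>S. f a V)"
 by (induction S rule: infinite_finite_induct) (auto intro: C_diff_const C_diff_add)

lemma C_diff_prod:
 "(!!a. a : S ==> C_diff n k (f a)) ==> C_diff n k (%V. \<Prod>a\<in>S. f a V)"
 by (induction S rule: infinite_finite_induct) (auto intro: C_diff_const C_diff_mult)

lemma C_diff_powr:
 assumes "C_diff n k f" "!!V. V : phase n ==> f V > 0"
 shows "C_diff n k (%V. f V powr s)" using assms
proof (induction k arbitrary: s)
 case 0
 then show ?case by (auto intro!: continuous_intros) (metis less_irrefl)
next
 case (Suc k)
 have 1: "C_diff n k f" using Suc.prems C_diff_SucD by auto
 show ?case
 proof (rule C_diff_SucI[where g="%i u V. (s * f V powr (s - 1)) * partial i u f V"])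
  show "continuous_on (phase n) (%V. f V powr s)" by (rule C_diff_continuous[OF Suc.IH[OF 1 Suc.prems(2)]])
  fix i u assume i: "i : {1..n}"
  show "C_diff n k (%V. (s * f V powr (s - 1)) * partial i u f V)"
   by (intro C_diff_mult C_diff_const Suc.IH[OF 1 Suc.prems(2)] C_diff_partial[OF Suc.prems(1) i])
  fix V assume V: "V : phase n"
  have "((%t. f (mv V i u t) powr s) has_real_derivative
    s * f (mv V i u 0) powr (s - of_nat 1) * partial i u f V) (at 0)"
   by (rule DERIV_fun_powr[OF slice_has_derivative0[OF Suc.prems(1) V i]])
    (use Suc.prems(2)[OF V] in simp)
  then show "((%t. f (mv V i u t) powr s) has_real_derivative
    (s * f V powr (s - 1)) * partial i u f V) (at 0)" by simp
 qed
qed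

text \<open>The building block of all test functions; the negative powers make the family closed under
 differentiation.\<close>

definition sE :: "nat => real => real" where
 "sE k x = (if x > 0 then (1 / x) ^ k * exp (- 1 / x) else 0)"

lemma sE_deriv: "(sE k has_real_derivative (sE (k + 2) x - real k * sE (k + 1) x)) (at x)"
proof -
 consider "x > 0" | "x = 0" | "x < 0" by linarith
 then show ?thesis
 proof cases
  case 1
  have d: "((%x. (1 / x) ^ k * exp (- 1 / x)) has_real_derivative
    (1 / x) ^ (k + 2) * exp (- 1 / x) - real k * ((1 / x) ^ (k + 1) * exp (- 1 / x))) (at x)"
   using 1 by (auto intro!: derivative_eq_intros simp: field_simps power2_eq_square split: nat_diff_split)
  have e: "eventually (%y. y > 0) (nhds x)" using 1 by (intro eventually_nhds_in_open[of "{0<..}", simplified]) auto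
  have "(sE k has_real_derivative
    (1 / x) ^ (k + 2) * exp (- 1 / x) - real k * ((1 / x) ^ (k + 1) * exp (- 1 / x))) (at x)"
   by (rule DERIV_cong_ev[THEN iffD2, OF refl _ refl d])
    (rule eventually_mono[OF e], simp add: sE_def)
  then show ?thesis using 1 by (simp add: sE_def)
 next
  case 3
  have e: "eventually (%y. y < 0) (nhds x)" using 3 by (intro eventually_nhds_in_open[of "{..<0}", simplified]) auto
  have "(sE k has_real_derivative 0) (at x)" by (rule DERIV_cong_ev[THEN iffD2, OF refl _ refl DERIV_const[of 0]])
    (rule eventually_mono[OF e], simp add: sE_def)
  then show ?thesis using 3 by (simp add: sE_def)
 next
  case 2
  \<comment> \<open>From the right the difference quotient at 0 is the same kind of function with
    exponent \<open>k + 1\<close>; from the left it vanishes identically. Both limits are 0, in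
    agreement with the formula at 0.\<close>
  have r: "((%y. (1 / y) ^ (k + 1) * exp (- 1 / y)) \<longlongrightarrow> 0) (at_right (0::real))" by real_asymp
  have "((%h. (sE k (0 + h) - sE k 0) / h) \<longlongrightarrow> 0) (at 0)" unfolding filterlim_at_split
  proof
   show "((%h. (sE k (0 + h) - sE k 0) / h) \<longlongrightarrow> 0) (at_left 0)"
    by (rule tendsto_eventually) (auto simp: sE_def eventually_at_filter)
   show "((%h. (sE k (0 + h) - sE k 0) / h) \<longlongrightarrow> 0) (at_right 0)"
    by (rule Lim_transform_eventually[OF r]) (auto simp: sE_def eventually_at_filter)
  qed
  then show ?thesis using 2 by (simp add: DERIV_def sE_def)
 qed
qed

lemma sE_continuous: "continuous_on UNIV (sE k)" using sE_deriv by (meson DERIV_isCont continuous_at_imp_continuous_on)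

lemma C_diff_sE: "C_diff n l f ==> C_diff n l (%V. sE k (f V))"
proof (induction l arbitrary: k)
 case 0
 then show ?case using continuous_on_compose2[OF sE_continuous] by auto
next
 case (Suc l)
 have 1: "C_diff n l f" using Suc.prems C_diff_SucD by auto
 show ?case
 proof (rule C_diff_SucI[where
    g="%i u V. (sE (k + 2) (f V) - real k * sE (k + 1) (f V)) * partial i u f V"])
  show "continuous_on (phase n) (%V. sE k (f V))" by (rule C_diff_continuous[OF Suc.IH[OF 1]])
  fix i u assume i: "i : {1..n}"
  show "C_diff n l (%V. (sE (k + 2) (f V) - real k * sE (k + 1) (f V)) * partial i u f V)"
   by (intro C_diff_mult C_diff_diff C_diff_const Suc.IH[OF 1] C_diff_partial[OF Suc.prems i])
  fix V assume V: "V : phase n"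
  show "((%t. sE k (f (mv V i u t))) has_real_derivative
   (sE (k + 2) (f V) - real k * sE (k + 1) (f V)) * partial i u f V) (at 0)"
   using DERIV_chain2[OF sE_deriv slice_has_derivative0[OF Suc.prems V i]] by simp
 qed
qed

lemma sE_range: "0 <= sE 0 x" "sE 0 x <= 1" by (auto simp: sE_def)

lemma sE_limit: "(%p. sE 0 (real p * x)) ----> (if x > 0 then 1 else 0)"
proof (cases "x > 0")
 case True
 have "(%p. exp (- 1 / (real p * x))) ----> 1" using True by real_asymp
 then have "(%p. sE 0 (real p * x)) ----> 1" by (rule Lim_transform_eventually)
   (rule eventually_mono[OF eventually_gt_at_top[of 0]], use True in \<open>simp add: sE_def\<close>)
 then show ?thesis using True by simp
next
 case False
 then have "sE 0 (real p * x) = 0" for p by (simp add: sE_def not_less mult_nonneg_nonpos)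
 then show ?thesis using False by simp
qed

text \<open>Induction with \<open>g\<close> generalised: the partials in the first particle are
  \<open>D u\<close> of the difference, in the second its negative, in the others 0, and
  \<open>D u\<close> is again a function of one velocity to which the induction hypothesis
  applies.\<close>

lemma C_diff_rel:
 assumes "C_diff 1 k (%V. g (V 1))" "n >= 2"
 shows "C_diff n k (%V. g (V 1 - V 2))" using assms(1)
proof (induction k arbitrary: g)
 case 0
 \<comment> \<open>Continuity on \<open>phase 1\<close> is pulled back to \<open>real^3\<close>
   along the embedding that sends \<open>x\<close> to the one-particle configuration.\<close>
 have "g = (%V. g (V 1)) \<circ> (%x. \<lambda>i\<in>{1..1::nat}. x)" by (rule ext) simp
 moreover have "continuous_on UNIV (%x :: real^3. (\<lambda>i\<in>{1..1::nat}. x))"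
  by (intro continuous_on_coordinatewise_then_product, case_tac "i = 1") auto
 ultimately have "continuous_on UNIV g"
  using 0 by (metis (no_types, lifting) C_diff.simps(1) continuous_on_compose continuous_on_subset
    image_subsetI phase_def restrict_PiE_iff UNIV_I)
 then show ?case using assms by (auto intro!: continuous_on_compose2[of UNIV g]
    continuous_on_diff continuous_on_vel)
next
 case (Suc k)
 define D where "D u x = deriv (%t. g (x + t *\<^sub>R axis u 1)) 0" for u x
 have p: "partial 1 u (%V. g (V 1)) = (%V. D u (V 1))" for u by (auto simp: partial_def slice_def mv_def D_def)
 have s: "((%t. g (x + t *\<^sub>R axis u 1)) has_real_derivative D u x) (at 0)" for x u
  using slice_has_derivative0[OF Suc.prems, of "\<lambda>i\<in>{1..1}. x" 1 u] unfolding p by (simp add: phase_def mv_def)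
 have s': "((%t. g (x - t *\<^sub>R axis u 1)) has_real_derivative - D u x) (at 0)" for x u
 proof -
  have "((%t. (%r. g (x + r *\<^sub>R axis u 1)) (- t)) has_real_derivative D u x * (- 1)) (at 0)"
   by (rule DERIV_chain2) (use s[of x u] in \<open>auto intro!: derivative_eq_intros\<close>)
  then show ?thesis by simp
 qed
 have D: "C_diff n k (%V. D u (V 1 - V 2))" for u by (rule Suc.IH) (use C_diff_partial[OF Suc.prems, of 1 u] p in simp)
 have cont: "C_diff n k (%V. g (V 1 - V 2))" by (rule Suc.IH[OF C_diff_SucD[OF Suc.prems]])
 show ?case
 proof (rule C_diff_SucI[where g="%i u V. (if i = 1 then 1 else if i = 2 then - 1 else 0) * D u (V 1 - V 2)"])
  show "continuous_on (phase n) (%V. g (V 1 - V 2))" using cont C_diff_continuous by blast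
  show "C_diff n k (%V. (if i = 1 then 1 else if i = 2 then - 1 else 0) * D u (V 1 - V 2))" for i u
   by (rule C_diff_cmult[OF D])
  fix V :: velocities and i :: nat and u
  show "((%t. g (mv V i u t 1 - mv V i u t 2)) has_real_derivative
   (if i = 1 then 1 else if i = 2 then - 1 else 0) * D u (V 1 - V 2)) (at 0)"
   using s[of "V 1 - V 2" u] s'[of "V 1 - V 2" u] by (auto simp: algebra_simps mv_def)
 qed
qed

section \<open>Restriction, freezing, translation and permutation of particles\<close>

lemma restrict_phase: "restrict V {1..n} : phase n" by (auto simp: phase_def)

lemma continuous_on_restr: "continuous_on S (%V :: velocities. restrict V {1..m})"
 by (intro continuous_on_coordinatewise_then_product)
  (auto simp: restrict_def intro!: continuous_on_if_const continuous_on_add continuous_on_const continuous_on_vel)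

lemma C_diff_lift:
 assumes "C_diff m k f" "m <= n"
 shows "C_diff n k (%V. f (restrict V {1..m}))" using assms(1)
proof (induction k arbitrary: f)
 case 0
 have "continuous_on (phase n) (%V. f (restrict V {1..m}))"
  by (rule continuous_on_compose2[OF _ continuous_on_restr, of "phase m"])
   (use 0 restrict_phase in \<open>auto simp del: One_nat_def\<close>)
 then show ?case by (simp only: C_diff.simps)
next
 case (Suc k)
 show ?case
 proof (rule C_diff_SucI[where g="%i u V. if i <= m then partial i u f (restrict V {1..m}) else 0"])
  show "continuous_on (phase n) (%V. f (restrict V {1..m}))"
   by (rule C_diff_continuous[OF Suc.IH[OF C_diff_SucD[OF Suc.prems]]])
  show "C_diff n k (%V. if i <= m then partial i u f (restrict V {1..m}) else 0)"
   if "i : {1..n}" for i u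
  proof (cases "i <= m")
   case True
   then have "C_diff n k (%V. partial i u f (restrict V {1..m}))"
    using Suc.IH[OF C_diff_partial[OF Suc.prems]] that by fastforce
   then show ?thesis using True by (simp only: if_True)
  qed (simp add: C_diff_const)
  fix V i u assume "V : phase n" "i : {1..n}"
  have r: "restrict (mv V i u t) {1..m} = (if i <= m then mv (restrict V {1..m}) i u t else restrict V {1..m})" for t
   using \<open>i : {1..n}\<close> by (auto simp: restrict_def fun_eq_iff mv_def)
  show "((%t. f (restrict (mv V i u t) {1..m})) has_real_derivative
    (if i <= m then partial i u f (restrict V {1..m}) else 0)) (at 0)"
   unfolding r using slice_has_derivative0[OF Suc.prems restrict_phase[of V m], of i u] \<open>i : {1..n}\<close> by auto
 qed
qed

lemma partial_lift:
 assumes "i : {1..m}" 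
 shows "partial i u (%V. f (restrict V {1..m})) V = partial i u f (restrict V {1..m})"
proof -
 have "restrict (mv V i u t) {1..m} = mv (restrict V {1..m}) i u t" for t
  using assms by (auto simp: restrict_def fun_eq_iff mv_def)
 then show ?thesis by (simp add: partial_def slice_mv)
qed

text \<open>The first \<open>m\<close> velocities come from \<open>x\<close>, the others are frozen
  at \<open>x'\<close>. Freezing turns a test function of \<open>n\<close> particles into one of
  \<open>m\<close> particles, and Fubini writes an integral against \<open>tensor n \<rho>\<close>
  as an average over \<open>x'\<close> of integrals of such functions.\<close>

definition frz :: "nat => nat => velocities => velocities => velocities" where
 "frz m n x' x = merge {1..m} {m+1..n} (x, x')"

lemma frz_apply: "frz m n x' x i =
  (if i : {1..m} then x i else if i : {m+1..n} then x' i else undefined)" by (auto simp: frz_def merge_def)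

lemma frz_phase: "m <= n ==> frz m n x' x : phase n"
 by (auto simp: phase_def PiE_def extensional_def frz_apply)

lemma frz_mv: "i : {1..m} ==> frz m n x' (mv x i u t) = mv (frz m n x' x) i u t"
 by (auto simp: frz_apply fun_eq_iff mv_def)

lemma continuous_on_frz: "continuous_on S (frz m n x')" by (intro continuous_on_coordinatewise_then_product)
  (auto simp: frz_apply intro!: continuous_on_if_const continuous_on_add continuous_on_const continuous_on_vel)

lemma partial_frz:
 "i : {1..m} ==> partial i u (%x. f (frz m n x' x)) x = partial i u f (frz m n x' x)"
 by (simp add: partial_def slice_mv frz_mv)

lemma C_diff_frz:
 assumes "C_diff n k f" "m <= n"
 shows "C_diff m k (%x. f (frz m n x' x))" using assms(1)
proof (induction k arbitrary: f)
 case 0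
 have "continuous_on (phase m) (%x. f (frz m n x' x))"
  by (rule continuous_on_compose2[OF _ continuous_on_frz]) (use 0 frz_phase assms in auto)
 then show ?case by (simp only: C_diff.simps)
next
 case (Suc k)
 show ?case
 proof (rule C_diff_SucI[where g="%i u x. partial i u f (frz m n x' x)"])
  show "continuous_on (phase m) (%x. f (frz m n x' x))"
   by (rule C_diff_continuous[OF Suc.IH[OF C_diff_SucD[OF Suc.prems]]])
  fix i u assume i: "i : {1..m}"
  then have i': "i : {1..n}" using assms by auto
  show "C_diff m k (%x. partial i u f (frz m n x' x))" by (rule Suc.IH[OF C_diff_partial[OF Suc.prems i']])
  show "((%t. f (frz m n x' (mv V i u t))) has_real_derivative partial i u f (frz m n x' V)) (at 0)" for V
   using slice_has_derivative0[OF Suc.prems frz_phase[OF assms(2)] i', of _ _ u] i by (simp add: frz_mv)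
 qed
qed

lemma C_diff_shift:
 assumes "C_diff n k f" "j : {1..n}"
 shows "C_diff n k (%V. f (V(j := V j + c)))" using assms(1)
proof (induction k arbitrary: f)
 case 0
 have *: "continuous_on (phase n) (%V. V(j := V j + c) :: velocities)"
  by (intro continuous_on_coordinatewise_then_product)
   (auto simp: fun_upd_def intro!: continuous_on_if_const continuous_on_add continuous_on_const continuous_on_vel)
 have "continuous_on (phase n) (%V. f (V(j := V j + c)))"
  by (rule continuous_on_compose2[OF _ *]) (use 0 phase_upd assms in auto)
 then show ?case by (simp only: C_diff.simps)
next
 case (Suc k)
 have m: "(mv V i u t)(j := mv V i u t j + c) = mv (V(j := V j + c)) i u t" for V i u t by (auto simp: fun_eq_iff mv_def)
 show ?case
 proof (rule C_diff_SucI[where g="%i u V. partial i u f (V(j := V j + c))"])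
  show "continuous_on (phase n) (%V. f (V(j := V j + c)))"
   by (rule C_diff_continuous[OF Suc.IH[OF C_diff_SucD[OF Suc.prems]]])
  fix i u assume i: "i : {1..n}"
  show "C_diff n k (%V. partial i u f (V(j := V j + c)))" by (rule Suc.IH[OF C_diff_partial[OF Suc.prems i]])
  show "((%t. f ((mv V i u t)(j := mv V i u t j + c))) has_real_derivative partial i u f (V(j := V j + c))) (at 0)"
   if "V : phase n" for V unfolding m using slice_has_derivative0[OF Suc.prems phase_upd[OF that assms(2)] i] .
 qed
qed

lemma partial_shift: "partial i u (%V. f (V(j := V j + c))) V = partial i u f (V(j := V j + c))"
proof -
 have "(mv V i u t)(j := mv V i u t j + c) = mv (V(j := V j + c)) i u t" for t by (auto simp: fun_eq_iff mv_def)
 then show ?thesis by (simp add: partial_def slice_mv)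
qed

abbreviation swp :: "nat => velocities => velocities" where
 "swp p V \<equiv> V \<circ> Transposition.transpose 1 p"

lemma swp_phase: "p : {1..n} ==> V : phase n ==> swp p V : phase n"
 by (auto simp: phase_def PiE_def extensional_def Transposition.transpose_def)

lemma swp_mv: "swp p (mv V i u t) = mv (swp p V) (Transposition.transpose 1 p i) u t"
 by (auto simp: fun_eq_iff mv_def Transposition.transpose_def)

lemma partial_swp:
 "partial i u (%V. f (swp p V)) V = partial (Transposition.transpose 1 p i) u f (swp p V)"
 by (simp only: partial_def slice_mv swp_mv)

lemma C_diff_swp:
 assumes "C_diff n k f" "p : {1..n}"
 shows "C_diff n k (%V. f (swp p V))" using assms(1)
proof (induction k arbitrary: f)
 case 0
 have *: "continuous_on (phase n) (%V. swp p V)" by (intro continuous_on_coordinatewise_then_product)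
   (auto intro!: continuous_on_if_const continuous_on_add continuous_on_const continuous_on_vel)
 have "continuous_on (phase n) (%V. f (swp p V))"
  by (rule continuous_on_compose2[OF _ *]) (use 0 swp_phase assms in auto)
 then show ?case by (simp only: C_diff.simps)
next
 case (Suc k)
 show ?case
 proof (rule C_diff_SucI[where g="%i u V. partial (Transposition.transpose 1 p i) u f (swp p V)"])
  show "continuous_on (phase n) (%V. f (swp p V))" by (rule C_diff_continuous[OF Suc.IH[OF C_diff_SucD[OF Suc.prems]]])
  fix i u assume "i : {1..n}"
  then have i: "Transposition.transpose 1 p i : {1..n}" using assms by (auto simp: Transposition.transpose_def)
  show "C_diff n k (%V. partial (Transposition.transpose 1 p i) u f (swp p V))"
   by (rule Suc.IH[OF C_diff_partial[OF Suc.prems i]])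
  show "((%t. f (swp p (mv V i u t))) has_real_derivative
    partial (Transposition.transpose 1 p i) u f (swp p V)) (at 0)" if "V : phase n" for V unfolding swp_mv
   using slice_has_derivative0[OF Suc.prems swp_phase[OF assms(2) that] i] .
 qed
qed

section \<open>Test functions and approximation of measurable sets\<close>

abbreviation velM :: "nat set => velocities measure" where
 "velM I \<equiv> PiM I (%_. borel)"

lemma space_velM: "space (velM {1..n}) = phase n" by (simp add: space_PiM phase_def)

lemma sets_leb: "sets (leb n) = sets (velM {1..n})" unfolding leb_def by (rule sets_PiM_cong) auto

lemma space_leb: "space (leb n) = phase n" by (simp add: leb_def space_PiM phase_def)

text \<open>Coordinates outside {1..n} are constantly \<open>undefined\<close> on the product space,
  so the inclusion into the full function type is Borel measurable coordinate by coordinate; the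
  function is then composed with it.\<close>

lemma continuous_measurable:
 fixes f :: "velocities => real"
 assumes "continuous_on (phase n) f"
 shows "f : bmeas (velM {1..n})"
proof -
 have c: "(%V. V i) : bmeas (velM {1..n})" for i
 proof (cases "i : {1..n}")
  case False
  have "(%V. V i) : bmeas (velM {1..n}) \<longleftrightarrow>
    (%V. undefined :: real^3) : bmeas (velM {1..n})"
   by (rule measurable_cong) (use False in \<open>auto simp: space_PiM PiE_def extensional_def\<close>)
  then show ?thesis by simp
 qed simp
 have "(%V. V) : velM {1..n} \<rightarrow>\<^sub>M borel" by (rule measurable_coordinatewise_then_product[OF c])
 then have "(%V. V) : velM {1..n} \<rightarrow>\<^sub>M restrict_space borel (phase n)"
  by (intro measurable_restrict_space2) (auto simp: space_velM[symmetric])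
 from measurable_comp[OF this borel_measurable_continuous_on_restrict[OF assms]]
 show ?thesis by (simp add: comp_def)
qed

lemma C_diff_measurable: "C_diff n k f ==> f : bmeas (velM {1..n})"
 by (intro continuous_measurable C_diff_continuous)

section \<open>Compact supports and classes of test functions\<close>

definition kset :: "nat => real => velocities set" where
 "kset n R = {V : phase n. \<forall>i\<in>{1..n}. norm (V i) <= R}"

text \<open>Tychonoff over all indices: closed balls for the particles 1..n and the one-point set
  \<open>{undefined}\<close> elsewhere.\<close>

lemma compact_kset: "compact (kset n R)"
proof -
 let ?S = "%i. if i : {1..n} then cball (0 :: real^3) R else {undefined}"
 have e: "kset n R = PiE UNIV ?S"
 proof (rule set_eqI)
  fix V
  show "V : kset n R \<longleftrightarrow> V : PiE UNIV ?S"
   by (auto simp: kset_def phase_def PiE_def extensional_def Pi_iff split: if_splits)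
 qed
 have "compactin (product_topology (%i. euclidean) UNIV) (PiE UNIV ?S)" unfolding compactin_PiE by auto
 then show ?thesis unfolding e euclidean_product_topology by simp
qed

definition supp_in :: "nat => real => (velocities => real) => bool" where
 "supp_in n R psi \<longleftrightarrow> (\<forall>V\<in>phase n. (\<exists>i\<in>{1..n}. norm (V i) > R) --> psi V = 0)"

lemma compact_supp_iff: "compact_supp n psi \<longleftrightarrow> (\<exists>R. supp_in n R psi)"
 by (simp add: compact_supp_def supp_in_def)

lemma supp_in_0: "supp_in n R psi ==> V : phase n ==> V \<notin> kset n R ==> psi V = 0"
 by (force simp: supp_in_def kset_def)

lemma supp_in_mono: "supp_in n R psi ==> R <= R' ==> supp_in n R' psi"
 unfolding supp_in_def by (meson le_less_trans)

lemma supp_in_bounded: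
 assumes "continuous_on (phase n) psi" "supp_in n R psi"
 obtains B where "B >= 0" "!!V. V : phase n ==> \<bar>psi V\<bar> <= B"
proof -
 have "continuous_on (kset n R) psi" by (rule continuous_on_subset[OF assms(1)]) (auto simp: kset_def)
 then have "bounded (psi ` kset n R)" using compact_kset compact_continuous_image compact_imp_bounded by blast
 then obtain B where B: "!!V. V : kset n R ==> \<bar>psi V\<bar> <= B" by (auto simp: bounded_iff)
 show ?thesis
 proof (rule that[of "max B 0"])
  show "\<bar>psi V\<bar> <= max B 0" if "V : phase n" for V
   using B[of V] supp_in_0[OF assms(2) that] by (cases "V : kset n R") auto
 qed auto
qed

text \<open>A set \<open>K\<close> of orders covers both kinds of tests at once: \<open>{k}\<close>
  gives \<open>Cc n k\<close> and \<open>UNIV\<close> gives \<open>Cc_smooth n\<close>.\<close>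

definition Cg :: "nat => nat set => (velocities => real) set" where
 "Cg n K = {psi. (\<forall>k\<in>K. C_diff n k psi) & compact_supp n psi}"

lemma Cc_eq: "Cc n k = Cg n {k}" and Cc_smooth_eq: "Cc_smooth n = Cg n UNIV" by (auto simp: Cc_def Cc_smooth_def Cg_def)

lemma Cg_C_diff: "psi : Cg n K ==> k : K ==> l <= k ==> C_diff n l psi"
 by (auto simp: Cg_def intro: C_diff_mono)

lemma Cg_supp: "psi : Cg n K ==> \<exists>R. supp_in n R psi" by (auto simp: Cg_def compact_supp_iff)

lemma Cg_mult:
 assumes "psi : Cg n K" "!!k. k : K ==> C_diff n k p"
 shows "(%V. p V * psi V) : Cg n K"
 using assms unfolding Cg_def compact_supp_def by (auto intro!: C_diff_mult) blast

lemma Cg_zero: "(%V. 0) : Cg n K" by (auto simp: Cg_def compact_supp_def C_diff_const)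

lemma Cg_add:
 assumes "psi : Cg n K" "phi : Cg n K"
 shows "(%V. psi V + phi V) : Cg n K"
proof -
 obtain R R' where "supp_in n R psi" "supp_in n R' phi" using assms Cg_supp by blast
 then have "supp_in n (max R R') (%V. psi V + phi V)" unfolding supp_in_def by fastforce
 then show ?thesis using assms by (auto simp: Cg_def compact_supp_iff intro!: C_diff_add)
qed

lemma Cg_sum: "(!!a. a : S ==> f a : Cg n K) ==> (%V. \<Sum>a\<in>S. f a V) : Cg n K"
 by (induction S rule: infinite_finite_induct) (auto intro: Cg_zero Cg_add)

text \<open>The generators are smoothed indicators of half-spaces for single particles; complement
  and product imitate the set operations. Members are smooth, take values in [0,1] and depend on
  finitely many particles in \<open>J\<close>, even if \<open>J\<close> is infinite.\<close>

inductive_set sm :: "nat set => (velocities => real) set" for J where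
 base: "i : J ==> (%V. sE 0 (c * V i $ u + d)) : sm J"
| compl: "q : sm J ==> (%V. 1 - q V) : sm J"
| mult: "q : sm J ==> r : sm J ==> (%V. q V * r V) : sm J"

lemma sm_range: "q : sm J ==> 0 <= q V & q V <= 1"
 by (induction rule: sm.induct) (auto simp: sE_range mult_le_one)

lemma sm_C_diff: "q : sm J ==> C_diff n k q" by (induction rule: sm.induct)
  (auto intro!: C_diff_sE C_diff_add C_diff_mult C_diff_diff C_diff_const C_diff_coord)

lemma sm_fin: "q : sm J ==> \<exists>j0. \<forall>V W. (\<forall>i\<in>J. i <= j0 --> V i = W i) --> q V = q W"
proof (induction rule: sm.induct)
 case (base i c u d)
 then show ?case by (intro exI[of _ i]) auto
next
 case (compl q)
 then show ?case by metis
next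
 case (mult q r)
 then obtain a b where "!!V W. (\<forall>i\<in>J. i <= a --> V i = W i) ==> q V = q W"
  "!!V W. (\<forall>i\<in>J. i <= b --> V i = W i) ==> r V = r W" by blast
 then show ?case by (intro exI[of _ "max a b"]) (metis le_max_iff_disj)
qed

lemma sm_measurable:
 assumes "q : sm J" "!!i. i : J ==> (%om. X om i) : bmeas M"
 shows "(%om. q (X om)) : bmeas M" using assms(1)
proof (induction rule: sm.induct)
 case (base i c u d)
 have "(%x :: real^3. x $ u) : bmeas borel" by (intro borel_measurable_continuous_onI continuous_intros)
 from measurable_compose[OF assms(2)[OF base] this]
 have m: "(%om. c * X om i $ u + d) : bmeas M" by simp
 show ?case by (rule measurable_compose[OF m borel_measurable_continuous_onI[OF sE_continuous]])
qed auto

lemma sm_zero: "J ~= {} ==> (%V. 0) : sm J" using sm.base[of _ J 0 _ 0] by (auto simp: sE_def)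

section \<open>Events approximable in L1 by smooth functions of the particles\<close>

definition appr :: "'a measure => ('a => velocities) => nat set => 'a set => bool" where
 "appr M X J E \<longleftrightarrow> E : sets M \<and>
  (\<forall>e>0. \<exists>q\<in>sm J. (\<integral>om. \<bar>indicator E om - q (X om)\<bar> \<partial>M) < e)"

locale appr_space = finite_measure M for M :: "'a measure" +
 fixes X :: "'a => velocities" and J :: "nat set"
 assumes X_meas: "!!i. i : J ==> (%om. X om i) : bmeas M" and J_ne: "J ~= {}"
begin

lemma int_q: "E : sets M ==> q : sm J ==> integrable M (%om. \<bar>indicator E om - q (X om)\<bar>)"
proof (intro integrable_const_bound[where B=1] AE_I2)
 assume E: "E : sets M" and q: "q : sm J"
 show "norm \<bar>indicator E om - q (X om)\<bar> <= 1" for om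
  using sm_range[OF q, of "X om"] by (auto simp: indicator_def)
 note [measurable] = E sm_measurable[OF q X_meas]
 show "(%om. \<bar>indicator E om - q (X om)\<bar>) : bmeas M" by measurable
qed

text \<open>Approximability is closed in the pseudometric given by the measure of the symmetric
  difference. Countable unions and the law of large numbers both enter through this closure
  property.\<close>

lemma appr_limit:
 assumes "E : sets M" "!!e. e > 0 ==> \<exists>F. appr M X J F & measure M ((E - F) \<union> (F - E)) < e"
 shows "appr M X J E" unfolding appr_def
proof (intro conjI allI impI assms(1))
 fix e :: real assume "e > 0"
 then obtain F where F: "appr M X J F" "measure M ((E - F) \<union> (F - E)) < e / 2" using assms(2)[of "e/2"] by auto
 then obtain q where q: "q : sm J" "(\<integral>om. \<bar>indicator F om - q (X om)\<bar> \<partial>M) < e / 2"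
  unfolding appr_def using \<open>e > 0\<close> by (meson half_gt_zero)
 have [measurable]: "F : sets M" "E : sets M" using F assms by (auto simp: appr_def)
 have i: "integrable M (indicator ((E - F) \<union> (F - E)) :: 'a => real)"
  by (rule integrable_real_indicator) (auto simp: less_top[symmetric])
 have "(\<integral>om. \<bar>indicator E om - q (X om)\<bar> \<partial>M) \<le>
   (\<integral>om. indicator ((E - F) \<union> (F - E)) om + \<bar>indicator F om - q (X om)\<bar> \<partial>M)"
  by (rule integral_mono[OF int_q Bintegrable_add[OF i int_q]])
   (auto simp: q(1) indicator_def)
 also have "... = measure M ((E - F) \<union> (F - E)) + (\<integral>om. \<bar>indicator F om - q (X om)\<bar> \<partial>M)"
  by (subst Bintegral_add[OF i int_q]) (auto simp: q(1))
 finally show "\<exists>q\<in>sm J. (\<integral>om. \<bar>indicator E om - q (X om)\<bar> \<partial>M) < e"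
  using q F by (intro bexI[of _ q]) auto
qed

lemma appr_compl: "appr M X J E ==> appr M X J (space M - E)" unfolding appr_def
proof (intro conjI allI impI)
 fix e :: real assume E: "E : sets M & (\<forall>e>0. \<exists>q\<in>sm J. (\<integral>om. \<bar>indicator E om - q (X om)\<bar> \<partial>M) < e)"
  and "e > 0"
 then obtain q where q: "q : sm J" "(\<integral>om. \<bar>indicator E om - q (X om)\<bar> \<partial>M) < e" by blast
 have "(\<integral>om. \<bar>indicator (space M - E) om - (1 - q (X om))\<bar> \<partial>M) =
   (\<integral>om. \<bar>indicator E om - q (X om)\<bar> \<partial>M)"
  by (rule Bintegral_cong) (auto simp: indicator_def)
 then show "\<exists>q\<in>sm J. (\<integral>om. \<bar>indicator (space M - E) om - q (X om)\<bar> \<partial>M) < e"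
  using q sm.compl[OF q(1)] by (intro bexI[of _ "%V. 1 - q V"]) auto
qed auto

lemma appr_int:
 assumes "appr M X J E" "appr M X J F"
 shows "appr M X J (E \<inter> F)" unfolding appr_def
proof (intro conjI allI impI)
 have [measurable]: "F : sets M" "E : sets M" using assms by (auto simp: appr_def)
 then show "E \<inter> F : sets M" by auto
 fix e :: real assume "e > 0"
 then obtain q r where q: "q : sm J" "(\<integral>om. \<bar>indicator E om - q (X om)\<bar> \<partial>M) < e / 2"
  and r: "r : sm J" "(\<integral>om. \<bar>indicator F om - r (X om)\<bar> \<partial>M) < e / 2"
  using assms unfolding appr_def by (meson half_gt_zero)
 have qr: "(%V. q V * r V) : sm J" using q r sm.mult by auto
 have "(\<integral>om. \<bar>indicator (E \<inter> F) om - q (X om) * r (X om)\<bar> \<partial>M) \<le>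
   (\<integral>om. \<bar>indicator E om - q (X om)\<bar> + \<bar>indicator F om - r (X om)\<bar> \<partial>M)"
 proof (rule integral_mono[OF int_q[OF _ qr] Bintegrable_add[OF int_q int_q]])
  fix om
  have "\<bar>a * b - q (X om) * r (X om)\<bar> <= \<bar>a - q (X om)\<bar> + \<bar>b - r (X om)\<bar>"
   if "a = 0 \<or> a = 1" "b = 0 \<or> b = 1" for a b
  proof -
   \<comment> \<open>As all factors lie in [0,1], the error of a product is at most the sum of the
     errors of its factors.\<close>
   have "a * b - q (X om) * r (X om) = (a - q (X om)) * b + q (X om) * (b - r (X om))"
    by (simp add: algebra_simps)
   also have "\<bar>...\<bar> <= \<bar>a - q (X om)\<bar> * \<bar>b\<bar> + \<bar>q (X om)\<bar> * \<bar>b - r (X om)\<bar>"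
    by (simp add: abs_mult[symmetric] abs_triangle_ineq)
   also have "... <= \<bar>a - q (X om)\<bar> * 1 + 1 * \<bar>b - r (X om)\<bar>"
    using that sm_range[OF q(1), of "X om"] by (intro add_mono mult_mono) auto
   finally show ?thesis by simp
  qed
  from this[of "indicator E om" "indicator F om"]
  show "\<bar>indicator (E \<inter> F) om - q (X om) * r (X om)\<bar> \<le>
   \<bar>indicator E om - q (X om)\<bar> + \<bar>indicator F om - r (X om)\<bar>"
   by (auto simp: indicator_def)
 qed (auto simp: q r)
 also have "... < e" by (subst Bintegral_add[OF int_q int_q]) (use q r in auto)
 finally show "\<exists>q\<in>sm J. (\<integral>om. \<bar>indicator (E \<inter> F) om - q (X om)\<bar> \<partial>M) < e"
  using qr by (intro bexI[of _ "%V. q V * r V"]) auto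
qed

lemma appr_empty: "appr M X J {}" unfolding appr_def using sm_zero[OF J_ne] by (auto intro!: bexI[of _ "%V. 0"])

lemma appr_un:
 assumes "appr M X J E" "appr M X J F"
 shows "appr M X J (E \<union> F)"
proof -
 have "E <= space M" "F <= space M" using assms sets.sets_into_space by (auto simp: appr_def)
 then have "E \<union> F = space M - ((space M - E) \<inter> (space M - F))" by auto
 then show ?thesis using appr_compl[OF appr_int[OF appr_compl[OF assms(1)] appr_compl[OF assms(2)]]] by simp
qed

lemma appr_UN:
 assumes "!!n. appr M X J (E n)"
 shows "appr M X J (\<Union>n::nat. E n)"
proof (rule appr_limit)
 have E[measurable]: "E n : sets M" for n using assms by (auto simp: appr_def)
 then show "(\<Union>n. E n) : sets M" by auto
 have f: "appr M X J (\<Union>i\<in>{..<n}. E i)" for n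
 proof (induction n)
  case (Suc n)
  then show ?case using appr_un[OF Suc assms[of n]] by (simp add: lessThan_Suc Un_commute)
 qed (simp add: appr_empty)
 define F where "F n = (\<Union>i\<in>{..<n}. E i)" for n
 have [measurable]: "F n : sets M" for n unfolding F_def by auto
 have "(%n. measure M (F n)) ----> measure M (\<Union>n. F n)"
  by (rule finite_Lim_measure_incseq) (auto simp: incseq_def F_def intro: less_le_trans)
 moreover have "(\<Union>n. F n) = (\<Union>n. E n)" by (auto simp: F_def)
 ultimately have l: "(%n. measure M (F n)) ----> measure M (\<Union>n. E n)" by simp
 fix e :: real assume "e > 0"
 then obtain n where n: "\<bar>measure M (F n) - measure M (\<Union>n. E n)\<bar> < e"
  using LIMSEQ_D[OF l] by (auto simp: dist_real_def)
 have sub: "F n <= (\<Union>n. E n)" by (auto simp: F_def)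
 have "measure M ((\<Union>n. E n) - F n) = measure M (\<Union>n. E n) - measure M (F n)"
  by (rule finite_measure_Diff) (use sub in auto)
 moreover have "((\<Union>n. E n) - F n) \<union> (F n - (\<Union>n. E n)) = (\<Union>n. E n) - F n" using sub by auto
 ultimately show "\<exists>F. appr M X J F & measure M (((\<Union>n. E n) - F) \<union> (F - (\<Union>n. E n))) < e"
  using n f[of n] by (intro exI[of _ "F n"]) (auto simp: F_def[symmetric])
qed

text \<open>Turning the approximable events into a sigma-algebra of their own makes approximability
  a case of measurability: a map that is measurable from \<open>apprM\<close> has approximable
  preimages, and the usual measurability rules apply.\<close>

definition "apprM = sigma (space M) {E. appr M X J E}"

lemma sets_apprM: "sets apprM = {E. appr M X J E}" and space_apprM: "space apprM = space M"
proof -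
 have sub: "{E. appr M X J E} <= Pow (space M)" using sets.sets_into_space by (auto simp: appr_def)
 have "sigma_algebra (space M) {E. appr M X J E}"
 proof (intro sigma_algebra_iff2[THEN iffD2] conjI)
  show "{E. appr M X J E} <= Pow (space M)" using sets.sets_into_space by (auto simp: appr_def)
 qed (auto intro: appr_empty appr_compl appr_UN)
 then show "sets apprM = {E. appr M X J E}" "space apprM = space M" unfolding apprM_def using sub
  by (simp_all add: sigma_algebra.sigma_sets_eq)
qed

text \<open>Smoothed half-space functions with slope \<open>p\<close> converge pointwise to the
  indicator of the open half-space by \<open>sE_limit\<close>; boundedness gives convergence in
  L1.\<close>

lemma appr_half:
 assumes "i : J"
 shows "appr M X J {om\<in>space M. a < X om i $ u}" unfolding appr_def
proof (intro conjI allI impI)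
 have "(%x :: real^3. x $ u) : bmeas borel" by (intro borel_measurable_continuous_onI continuous_intros)
 from measurable_compose[OF X_meas[OF assms] this]
 have m[measurable]: "(%om. X om i $ u) : bmeas M" by simp
 show s[measurable]: "{om\<in>space M. a < X om i $ u} : sets M" by measurable
 define q where "q p = (%V :: velocities. sE 0 (real p * V i $ u + (- real p * a)))" for p
 have q: "q p : sm J" for p unfolding q_def by (rule sm.base[OF assms])
 let ?E = "{om\<in>space M. a < X om i $ u}"
 have "(%p. \<integral>om. \<bar>indicator ?E om - q p (X om)\<bar> \<partial>M) ----> (\<integral>om. 0 \<partial>M)"
 proof (rule integral_dominated_convergence[where w="%_. 1"])
  show "AE om in M. (%p. \<bar>indicator ?E om - q p (X om)\<bar>) ----> 0"
  proof (rule AE_I2)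
   fix om assume "om : space M"
   have "(%p. q p (X om)) ----> indicator ?E om"
    using sE_limit[of "X om i $ u - a"] \<open>om : space M\<close>
    by (auto simp: q_def algebra_simps indicator_def)
   from tendsto_rabs[OF tendsto_diff[OF tendsto_const[of "indicator ?E om"] this]]
   show "(%p. \<bar>indicator ?E om - q p (X om)\<bar>) ----> 0" by simp
  qed
  show "AE om in M. norm \<bar>indicator ?E om - q p (X om)\<bar> <= 1" for p
  proof (rule AE_I2)
   show "norm \<bar>indicator ?E om - q p (X om)\<bar> <= 1" for om
    using sm_range[OF q[of p], of "X om"] by (simp add: indicator_def)
  qed
  show "(%om. \<bar>indicator ?E om - q p (X om)\<bar>) : bmeas M" for p
   using borel_measurable_integrable[OF int_q[OF s q[of p]]] .
 qed auto
 then have l: "(%p. \<integral>om. \<bar>indicator ?E om - q p (X om)\<bar> \<partial>M) ----> 0" by simp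
 fix e :: real assume "e > 0"
 then have "eventually (%p. (\<integral>om. \<bar>indicator ?E om - q p (X om)\<bar> \<partial>M) < e) sequentially"
  by (rule order_tendstoD(2)[OF l])
 then show "\<exists>q\<in>sm J. (\<integral>om. \<bar>indicator ?E om - q (X om)\<bar> \<partial>M) < e"
  using q eventually_happens'[OF sequentially_bot] by blast
qed

lemma X_apprM: "i : J ==> (%om. X om i) : apprM \<rightarrow>\<^sub>M borel"
proof (subst borel_measurable_euclidean_space, intro ballI)
 fix b :: "real^3" assume i: "i : J" and "b : Basis"
 then obtain u where b: "b = axis u 1" by (auto simp: Basis_vec_def)
 show "(%om. X om i \<bullet> b) : bmeas apprM" unfolding b borel_measurable_iff_greater
  using appr_half[OF i] by (simp add: cart_eq_inner_axis[symmetric] space_apprM sets_apprM)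
qed

end

text \<open>Half-spaces in single coordinates generate the product sigma-algebra, so the identity is
  measurable from \<open>apprM\<close> to \<open>velM {1..n}\<close> and every measurable set is
  approximable.\<close>

lemma smooth_approx:
 assumes "finite_measure mu" "sets mu = sets (velM {1..n})" "n >= 1" "C : sets mu" "e > 0"
 obtains q where "q : sm {1..n}" "(\<integral>V. \<bar>indicator C V - q V\<bar> \<partial>mu) < e"
proof -
 interpret appr_space mu "%V. V" "{1..n}" unfolding appr_space_def appr_space_axioms_def
  using assms(1,3) by (auto simp: measurable_cong_sets[OF assms(2) refl])
 have "(%V. V) : apprM \<rightarrow>\<^sub>M velM {1..n}"
 proof (rule measurable_PiM_single')
  show "(%V. V) : space apprM \<rightarrow> (\<Pi>\<^sub>E i\<in>{1..n}. space borel)"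
   using sets_eq_imp_space_eq[OF assms(2)] unfolding space_apprM by (auto simp: space_PiM)
 qed (use X_apprM in blast)
 from measurable_sets[OF this, of C] assms(4) have "C \<inter> space mu : sets apprM"
  unfolding space_apprM assms(2) by (simp add: vimage_def)
 then have "appr mu (%V. V) {1..n} C"
  unfolding sets_apprM using sets.sets_into_space[OF assms(4)] by (simp add: Int_absorb2)
 then show ?thesis using that assms(5) unfolding appr_def by blast
qed

text \<open>The arguments are p(p + x) and p(p - x) for each coordinate x. Both are positive only if
  |x| < p, which bounds the support; for fixed x both tend to infinity with p, which gives the limit
  1.\<close>

definition cut :: "nat set => nat => velocities => real" where
 "cut I p V = (\<Prod>i\<in>I. \<Prod>u\<in>UNIV. sE 0 (real p * V i $ u + real p * real p) *
  sE 0 (real p * real p - real p * V i $ u))"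

lemma cut_range: "0 <= cut I p V" "cut I p V <= 1"
 unfolding cut_def by (auto intro!: prod_nonneg prod_le_1 mult_le_one simp: sE_range)

lemma C_diff_cut: "C_diff n k (cut I p)" unfolding cut_def
 by (intro C_diff_prod C_diff_mult C_diff_sE C_diff_add C_diff_diff C_diff_const C_diff_coord)

lemma cut_limit: "(%p. cut I p V) ----> 1"
proof -
 have 1: "(%p. sE 0 (real p * x + real p * real p)) ----> 1" for x
 proof (rule Lim_transform_eventually)
  show "(%p. exp (- 1 / (real p * x + real p * real p))) ----> 1" by real_asymp
  have "eventually (%p. real p * x + real p * real p > 0) sequentially" by real_asymp
  then show "\<forall>\<^sub>F p in sequentially. exp (- 1 / (real p * x + real p * real p)) =
    sE 0 (real p * x + real p * real p)" by eventually_elim (simp add: sE_def)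
 qed
 have 2: "(%p. sE 0 (real p * real p - real p * x)) ----> 1" for x using 1[of "- x"] by simp
 have "(%p. cut I p V) ----> (\<Prod>i\<in>I. \<Prod>u\<in>(UNIV :: 3 set). 1 * 1)"
  unfolding cut_def by (intro tendsto_prod tendsto_mult 1 2)
 then show ?thesis by simp
qed

lemma cut_zero:
 assumes "i : I" "norm (V i) > 3 * real p" "finite I"
 shows "cut I p V = 0"
proof -
 \<comment> \<open>Origin of the factor 3 in the radius: a vector whose three coordinates are at
   most \<open>p\<close> in absolute value has norm at most \<open>3 * p\<close>.\<close>
 have "norm (V i) <= (\<Sum>u\<in>UNIV. \<bar>V i $ u\<bar>)" by (rule norm_le_l1_cart)
 then have "3 * real p < \<bar>V i $ 1\<bar> + \<bar>V i $ 2\<bar> + \<bar>V i $ 3\<bar>" using assms(2) by (simp add: sum_3)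
 then have "\<bar>V i $ 1\<bar> > real p \<or> \<bar>V i $ 2\<bar> > real p \<or> \<bar>V i $ 3\<bar> > real p" by argo
 then obtain u where u: "\<bar>V i $ u\<bar> > real p" by blast
 have "real p * (V i $ u + real p) <= 0 \<or> real p * (real p - V i $ u) <= 0" using u by (auto simp: mult_le_0_iff)
 then have "sE 0 (real p * V i $ u + real p * real p) *
   sE 0 (real p * real p - real p * V i $ u) = 0" by (auto simp: sE_def algebra_simps)
 then have "(\<Prod>u\<in>UNIV. sE 0 (real p * V i $ u + real p * real p) *
  sE 0 (real p * real p - real p * V i $ u)) = 0" by (intro prod_zero) auto
 then show ?thesis unfolding cut_def using assms by (intro prod_zero) auto
qed

lemma cut_cong: "(!!i. i : I ==> V i = W i) ==> cut I p V = cut I p W"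
 unfolding cut_def by (auto intro!: prod.cong)

lemma cut_Cg: "cut {1..n} p : Cg n K"
 by (auto simp: Cg_def compact_supp_def C_diff_cut intro!: exI[of _ "3 * real p"] cut_zero)

section \<open>Mixtures of product measures\<close>

declare One_nat_def [simp del]

definition Pinf :: "(real^3) measure => velocities measure" where
 "Pinf \<rho> = PiM UNIV (%_. \<rho>)"

text \<open>Multipliers that see the particles m+1..j only, hence are constants for every operator
  on the first \<open>m\<close>. Compact support in these particles makes their product with a
  compactly supported test of \<open>m\<close> particles compactly supported on
  \<open>phase j\<close>.\<close>

definition Qc :: "nat => nat => (velocities => real) set" where
 "Qc m j = {q. (\<forall>V. 0 <= q V & q V <= 1) & (\<forall>k. C_diff j k q) \<and>
  (\<forall>V W. (\<forall>i\<in>{m+1..j}. V i = W i) --> q V = q W) \<and>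
  (\<exists>R. \<forall>V. (\<exists>i\<in>{m+1..j}. norm (V i) > R) --> q V = 0)}"

locale random_measure =
 fixes \<nu> :: "(real^3) measure measure"
 assumes idm: "(%\<rho>. \<rho>) : \<nu> \<rightarrow>\<^sub>M prob_algebra borel"
begin

lemma rho: "\<rho> : space \<nu> ==> prob_space \<rho>" "\<rho> : space \<nu> ==> sets \<rho> = sets borel"
 using measurable_space[OF idm] by (auto simp: space_prob_algebra)

lemma sets_PiM_rho: "\<rho> : space \<nu> ==> sets (PiM I (%_. \<rho>)) = sets (velM I)"
 using rho(2) by (intro sets_PiM_cong) auto

lemma sets_tensor: "\<rho> : space \<nu> ==> sets (tensor n \<rho>) = sets (velM {1..n})"
 unfolding tensor_def by (rule sets_PiM_rho)

lemma prob_PiM_rho: "\<rho> : space \<nu> ==> prob_space (PiM I (%_. \<rho>))"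
 using rho(1) by (intro prob_space_PiM)

text \<open>Cylinders over finite boxes form an intersection-stable generator, and their
  probabilities are finite products of the measurable functions
  \<open>emeasure \<rho> (E i)\<close>.\<close>

lemma Pinf_meas: "Pinf : \<nu> \<rightarrow>\<^sub>M prob_algebra (velM UNIV)"
proof (rule measurable_prob_algebra_generated[OF sets_PiM Int_stable_prod_algebra])
 show "prod_algebra UNIV (%_. borel) <= Pow (\<Pi>\<^sub>E i\<in>UNIV. space borel)"
  by (rule prod_algebra_sets_into_space)
 fix A :: "velocities set" assume "A : prod_algebra UNIV (%_. borel)"
 from prod_algebraE[OF this] obtain J E where
  A: "A = prod_emb UNIV (%_. borel) J (Pi\<^sub>E J E)" "finite J" "!!i. i : J ==> E i : sets borel"
  by metis
 have "emeasure (Pinf \<rho>) A = (\<Prod>i\<in>J. emeasure \<rho> (E i))" if \<rho>: "\<rho> : space \<nu>" for \<rho>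
 proof -
  have "prod_emb UNIV (%_. borel) J (Pi\<^sub>E J E) = prod_emb UNIV (%_. \<rho>) J (Pi\<^sub>E J E)"
   using sets_eq_imp_space_eq[OF rho(2)[OF \<rho>]] by (simp add: prod_emb_def)
  then show ?thesis unfolding A(1) Pinf_def by (simp, intro emeasure_PiM_emb) (use rho \<rho> A in auto)
 qed
 moreover have "(%\<rho>. \<Prod>i\<in>J. emeasure \<rho> (E i)) : bmeas \<nu>"
 proof (intro borel_measurable_prod_ennreal)
  fix i assume "i : J"
  show "(%\<rho>. emeasure \<rho> (E i)) : bmeas \<nu>"
   using measurable_compose[OF measurable_prob_algebraD[OF idm] measurable_emeasure_subprob_algebra[OF A(3)[OF \<open>i : J\<close>]]] .
 qed
 ultimately show "(%\<rho>. emeasure (Pinf \<rho>) A) : bmeas \<nu>" by (subst measurable_cong) auto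
qed (auto simp: Pinf_def prob_PiM_rho sets_PiM_rho)

lemma tensor_Pinf:
 assumes \<rho>: "\<rho> : space \<nu>"
 shows "tensor n \<rho> = distr (Pinf \<rho>) (velM {1..n}) (%X. restrict X {1..n})"
proof -
 interpret product_prob_space "%_::nat. \<rho>" UNIV
  using rho(1)[OF \<rho>] by (simp add: product_prob_space_def product_prob_space_axioms_def
   product_sigma_finite_def prob_space_imp_sigma_finite)
 have "tensor n \<rho> = distr (PiM UNIV (%_. \<rho>)) (PiM {1..n} (%_. \<rho>)) (%X. restrict X {1..n})"
  unfolding tensor_def by (rule distr_PiM_restrict_finite[symmetric]) auto
 also have "... = distr (Pinf \<rho>) (velM {1..n}) (%X. restrict X {1..n})"
  unfolding Pinf_def by (rule distr_cong) (auto simp: sets_PiM_rho \<rho>)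
 finally show ?thesis .
qed

lemma restr_meas: "(%X. restrict X {1..n}) : velM UNIV \<rightarrow>\<^sub>M velM {1..n}"
 by (rule measurable_restrict_subset) auto

lemma tensor_meas: "tensor n : \<nu> \<rightarrow>\<^sub>M prob_algebra (velM {1..n})"
 by (subst measurable_cong[OF tensor_Pinf], assumption)
  (rule measurable_compose[OF Pinf_meas measurable_distr_prob_space[OF restr_meas]])

lemmas tensor_meas' = measurable_prob_algebraD[OF tensor_meas]

lemma prob_tensor: "\<rho> : space \<nu> ==> prob_space (tensor n \<rho>)"
 unfolding tensor_def by (rule prob_PiM_rho)

lemma integral_tensor_meas:
 fixes f :: "velocities => real"
 assumes "f : bmeas (velM {1..n})"
 shows "(%\<rho>. \<integral>V. f V \<partial>tensor n \<rho>) : bmeas \<nu>"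
 using measurable_compose[OF tensor_meas' integral_measurable_subprob_algebra[OF assms]] .

end

text \<open>Here \<open>prob_algebra borel\<close> acts as a bare measurable space. Integrals
  against \<open>tensor n \<rho>\<close> become measurable on the set of all laws, so selection sets
  can be found in \<open>prob_algebra borel\<close> itself, whatever sigma-algebra
  \<open>\<nu>\<close> carries.\<close>

interpretation RM: random_measure "prob_algebra borel" by unfold_locales auto

section \<open>Mixtures and the joint law of the random measure and its particles\<close>

locale mixing = prob_space \<nu> + random_measure \<nu> for \<nu> :: "(real^3) measure measure"
begin

lemma sets_mixture: "sets (mixture n \<nu>) = sets (velM {1..n})"
 unfolding mixture_def by (rule sets_bind[OF sets_tensor]) (auto simp: not_empty)

lemma prob_mixture: "prob_space (mixture n \<nu>)"
 unfolding mixture_def by (rule prob_space_bind[OF _ tensor_meas']) (auto simp: prob_tensor)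

lemma nn_mixture:
 "f : bmeas (velM {1..n}) ==>
  (\<integral>\<^sup>+V. f V \<partial>mixture n \<nu>) = (\<integral>\<^sup>+\<rho>. (\<integral>\<^sup>+V. f V \<partial>tensor n \<rho>) \<partial>\<nu>)"
 unfolding mixture_def by (rule nn_integral_bind[OF _ tensor_meas'])

lemma integral_mixture:
 fixes f :: "velocities => real"
 assumes "f : bmeas (velM {1..n})" "!!V. V : phase n ==> \<bar>f V\<bar> <= B"
 shows "(\<integral>V. f V \<partial>mixture n \<nu>) = (\<integral>\<rho>. (\<integral>V. f V \<partial>tensor n \<rho>) \<partial>\<nu>)"
 unfolding mixture_def by (rule integral_bind[where B=B and B'=1 and K="velM {1..n}"])
  (use assms tensor_meas' in \<open>auto simp: space_velM prob_tensor prob_space.emeasure_space_1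
    intro!: finite_measure_axioms AE_I2\<close>)

text \<open>Measurable space for the pair of the random measure and its particles. On it lives
  \<open>bigM\<close>: draw \<open>\<rho>\<close> from \<open>\<nu>\<close>, then an infinite
  independent sample \<open>X\<close> from \<open>\<rho>\<close>. All mixtures are marginals of this
  one law, so different numbers of particles are compared on one probability space.\<close>

definition "Om = \<nu> \<Otimes>\<^sub>M velM UNIV"
definition "bigM = \<nu> \<bind> (%\<rho>. distr (Pinf \<rho>) Om (%X. (\<rho>, X)))"

lemma ker_meas: "(%\<rho>. distr (Pinf \<rho>) Om (%X. (\<rho>, X))) : \<nu> \<rightarrow>\<^sub>M prob_algebra Om"
 by (rule measurable_distr_prob_space2[OF Pinf_meas]) (simp add: Om_def)

lemma sets_bigM: "sets bigM = sets Om" unfolding bigM_def by (rule sets_bind) (auto simp: not_empty)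

lemma space_bigM: "space bigM = space \<nu> \<times> UNIV"
 using sets_eq_imp_space_eq[OF sets_bigM] by (simp add: Om_def space_pair_measure space_PiM)

lemma prob_bigM: "prob_space bigM" unfolding bigM_def by (rule prob_space_bind[OF _ measurable_prob_algebraD[OF ker_meas]])
  (use measurable_space[OF ker_meas] in \<open>auto simp: space_prob_algebra\<close>)

lemma Pair_meas: "\<rho> : space \<nu> ==> (%X. (\<rho>, X)) : Pinf \<rho> \<rightarrow>\<^sub>M Om"
 using sets_PiM_rho[of \<rho> UNIV] unfolding Om_def Pinf_def by (subst measurable_cong_sets[OF _ refl, of _ "velM UNIV"]) auto

lemma nn_bigM:
 assumes "f : bmeas Om"
 shows "(\<integral>\<^sup>+om. f om \<partial>bigM) = (\<integral>\<^sup>+\<rho>. (\<integral>\<^sup>+X. f (\<rho>, X) \<partial>Pinf \<rho>) \<partial>\<nu>)"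
 unfolding bigM_def nn_integral_bind[OF assms measurable_prob_algebraD[OF ker_meas]]
 by (intro nn_integral_cong nn_integral_distr Pair_meas)
  (simp_all add: assms)

lemma integral_bigM:
 fixes f :: "(real^3) measure \<times> velocities => real"
 assumes "f : bmeas Om" "!!om. om : space Om ==> \<bar>f om\<bar> <= B"
 shows "(\<integral>om. f om \<partial>bigM) = (\<integral>\<rho>. (\<integral>X. f (\<rho>, X) \<partial>Pinf \<rho>) \<partial>\<nu>)"
proof -
 have "(\<integral>om. f om \<partial>bigM) = (\<integral>\<rho>. (\<integral>om. f om \<partial>distr (Pinf \<rho>) Om (%X. (\<rho>, X))) \<partial>\<nu>)"
  unfolding bigM_def by (rule integral_bind[where B=B and B'=1 and K=Om])
   (use assms measurable_prob_algebraD[OF ker_meas] measurable_space[OF ker_meas]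
    in \<open>auto simp: space_prob_algebra intro!: finite_measure_axioms AE_I2
     subprob_space.subprob_emeasure_le_1 prob_space_imp_subprob_space\<close>)
 also have "... = (\<integral>\<rho>. (\<integral>X. f (\<rho>, X) \<partial>Pinf \<rho>) \<partial>\<nu>)"
  by (intro Bintegral_cong refl integral_distr Pair_meas assms)
 finally show ?thesis .
qed

lemma fst_meas: "fst : bigM \<rightarrow>\<^sub>M \<nu>" and snd_meas: "snd : bigM \<rightarrow>\<^sub>M velM UNIV"
 using sets_bigM by (auto simp: Om_def cong: measurable_cong_sets)

lemma mixture_distr: "mixture n \<nu> = distr bigM (velM {1..n}) (%om. restrict (snd om) {1..n})"
proof (rule measure_eqI)
 have m: "(%om. restrict (snd om) {1..n}) : bigM \<rightarrow>\<^sub>M velM {1..n}"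
  by (rule measurable_compose[OF snd_meas restr_meas])
 fix A assume "A : sets (mixture n \<nu>)"
 then have A[measurable]: "A : sets (velM {1..n})" by (simp add: sets_mixture)
 have i: "(%om. indicator A (restrict (snd om) {1..n}) :: ennreal) : bmeas Om"
  using measurable_compose[OF m borel_measurable_indicator[OF A]]
  by (simp cong: measurable_cong_sets add: measurable_cong_sets[OF sets_bigM refl])
 have "emeasure (mixture n \<nu>) A = (\<integral>\<^sup>+V. indicator A V \<partial>mixture n \<nu>)"
  by (subst nn_integral_indicator) (auto simp: sets_mixture)
 also have "... = (\<integral>\<^sup>+\<rho>. (\<integral>\<^sup>+V. indicator A V \<partial>tensor n \<rho>) \<partial>\<nu>)"
  by (rule nn_mixture) simp
 also have "... = (\<integral>\<^sup>+\<rho>. (\<integral>\<^sup>+X. indicator A (restrict X {1..n}) \<partial>Pinf \<rho>) \<partial>\<nu>)"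
 proof (rule nn_integral_cong)
  fix \<rho> assume \<rho>: "\<rho> : space \<nu>"
  show "(\<integral>\<^sup>+V. indicator A V \<partial>tensor n \<rho>) = (\<integral>\<^sup>+X. indicator A (restrict X {1..n}) \<partial>Pinf \<rho>)"
   unfolding tensor_Pinf[OF \<rho>] by (rule nn_integral_distr)
    (use restr_meas sets_PiM_rho[OF \<rho>, of UNIV] in \<open>auto simp: Pinf_def cong: measurable_cong_sets\<close>)
 qed
 also have "... = (\<integral>\<^sup>+om. indicator A (restrict (snd om) {1..n}) \<partial>bigM)"
  by (subst nn_bigM[OF i]) simp
 also have "... = (\<integral>\<^sup>+V. indicator A V \<partial>distr bigM (velM {1..n}) (%om. restrict (snd om) {1..n}))"
  by (subst nn_integral_distr[OF m]) auto
 also have "... = emeasure (distr bigM (velM {1..n}) (%om. restrict (snd om) {1..n})) A" by simp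
 finally show "emeasure (mixture n \<nu>) A =
  emeasure (distr bigM (velM {1..n}) (%om. restrict (snd om) {1..n})) A" .
qed (simp add: sets_mixture)

lemma integral_mixture_bigM:
 fixes f :: "velocities => real"
 assumes "f : bmeas (velM {1..n})"
 shows "(\<integral>V. f V \<partial>mixture n \<nu>) = (\<integral>om. f (restrict (snd om) {1..n}) \<partial>bigM)"
 unfolding mixture_distr by (rule integral_distr[OF measurable_compose[OF snd_meas restr_meas] assms])

lemma appr_bigM: "appr_space bigM snd {m<..}"
proof -
 interpret B: prob_space bigM by (rule prob_bigM)
 show ?thesis by unfold_locales (auto intro: measurable_compose[OF snd_meas measurable_component_singleton])
qed

section \<open>Law of large numbers: the particles determine the random measure\<close>

lemma second_moment_Pinf:
 assumes \<rho>: "\<rho> : space \<nu>" and A: "A : sets borel" and I: "finite I"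
 shows "(\<integral>\<^sup>+X. ennreal ((\<Sum>i\<in>I. indicator A (X i) - measure \<rho> A)\<^sup>2) \<partial>Pinf \<rho>) <= ennreal (card I)"
proof -
 interpret product_prob_space "%_::nat. \<rho>" UNIV
  using rho(1)[OF \<rho>] by (simp add: product_prob_space_def product_prob_space_axioms_def
   product_sigma_finite_def prob_space_imp_sigma_finite)
 have A'[measurable]: "A : sets \<rho>" using A rho(2)[OF \<rho>] by simp
 define p where "p = measure \<rho> A"
 define Y where "Y i X = indicator A (X i) - p" for i and X :: velocities
 have [measurable]: "(%X. X i) : Pinf \<rho> \<rightarrow>\<^sub>M \<rho>" for i unfolding Pinf_def by measurable
 have Ym[measurable]: "Y i : bmeas (Pinf \<rho>)" for i unfolding Y_def by measurable
 have p: "0 <= p" "p <= 1" by (auto simp: p_def)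
 have Y1: "\<bar>Y i X\<bar> <= 1" for i X using p by (auto simp: Y_def indicator_def)
 have PP: "prob_space (Pinf \<rho>)" unfolding Pinf_def by (rule P.prob_space_axioms)
 interpret PP: prob_space "Pinf \<rho>" by (rule PP)
 have YY: "\<bar>Y i X * Y k X\<bar> <= 1" for i k X using mult_mono[OF Y1[of i X] Y1[of k X]] by (simp add: abs_mult)
 have intYY: "integrable (Pinf \<rho>) (%X. Y i X * Y k X)" for i k
  by (rule PP.integrable_const_bound[where B=1]) (use YY in auto)
 have ii: "integrable (Pinf \<rho>) (%X. indicator A (X i) :: real)" for i
  by (rule PP.integrable_const_bound[where B=1]) (auto simp: indicator_def)
 have ii2: "integrable (Pinf \<rho>) (%X. indicator A (X i) * indicator A (X k) :: real)" for i k
  by (rule PP.integrable_const_bound[where B=1]) (auto simp: indicator_def)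
 have e1: "(\<integral>X. indicator A (X i) \<partial>Pinf \<rho>) = p" for i
 proof -
  have "(\<integral>X. indicat_real A (X i) \<partial>Pinf \<rho>) = (\<integral>x. indicator A x \<partial>distr (Pinf \<rho>) \<rho> (%X. X i))"
   by (rule integral_distr[of "%X. X i" "Pinf \<rho>" \<rho> "indicat_real A", symmetric]) auto
  also have "distr (Pinf \<rho>) \<rho> (%X. X i) = \<rho>" unfolding Pinf_def by (rule PiM_component) simp
  finally show ?thesis by (simp add: p_def)
 qed
 have e2: "(\<integral>X. indicator A (X i) * indicator A (X k) \<partial>Pinf \<rho>) = p * p" if "i ~= k" for i k
 proof -
  have "(\<integral>X. indicat_real A (X i) * indicator A (X k) \<partial>Pinf \<rho>) =
    (\<integral>X. indicator {X : space (PiM UNIV (%_. \<rho>)). \<forall>l\<in>{i, k}. X l : A} X \<partial>Pinf \<rho>)"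
   by (rule Bintegral_cong) (auto simp: indicator_def Pinf_def)
  also have "... = measure (Pinf \<rho>) {X : space (PiM UNIV (%_. \<rho>)). \<forall>l\<in>{i, k}. X l : A}"
   by (auto simp: Pinf_def intro!: arg_cong[where f="measure _"])
  also have "... = (\<Prod>l\<in>{i, k}. measure \<rho> A)" using emeasure_PiM_Collect[of "{i,k}" "%_. A"] A' that
   by (simp add: Pinf_def P.emeasure_eq_measure finite_measure.emeasure_eq_measure[of \<rho>]
     prob_space.finite_measure[OF rho(1)[OF \<rho>]] ennreal_mult''[symmetric])
  also have "... = p * p" using that by (simp add: p_def)
  finally show ?thesis .
 qed
 \<comment> \<open>Distinct particles are independent, so centred indicators are uncorrelated. In
   the double sum only the diagonal survives, with entries at most 1, which is where
   \<open>card I\<close> comes from.\<close>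
 have cross: "(\<integral>X. Y i X * Y k X \<partial>Pinf \<rho>) = 0" if "i ~= k" for i k
 proof -
  have "(\<integral>X. Y i X * Y k X \<partial>Pinf \<rho>) =
   (\<integral>X. indicator A (X i) * indicator A (X k) - p * indicator A (X i) - p * indicator A (X k) + p * p \<partial>Pinf \<rho>)"
   by (rule Bintegral_cong) (auto simp: Y_def algebra_simps)
  also have "... = p * p - p * p - p * p + p * p" using ii ii2 e1 e2[OF that] by (simp add: PP.prob_space)
  finally show ?thesis by simp
 qed
 have sq: "(\<Sum>i\<in>I. Y i X)\<^sup>2 = (\<Sum>i\<in>I. \<Sum>k\<in>I. Y i X * Y k X)" for X
  by (simp add: power2_eq_square sum_product)
 have int: "integrable (Pinf \<rho>) (%X. (\<Sum>i\<in>I. Y i X)\<^sup>2)"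
  unfolding sq by (intro Bintegrable_sum intYY)
 have "(\<integral>X. (\<Sum>i\<in>I. Y i X)\<^sup>2 \<partial>Pinf \<rho>) = (\<Sum>i\<in>I. \<Sum>k\<in>I. \<integral>X. Y i X * Y k X \<partial>Pinf \<rho>)"
  unfolding sq by (simp add: intYY)
 also have "... <= (\<Sum>i\<in>I. \<Sum>k\<in>I. if i = k then 1 else 0)"
 proof (intro sum_mono)
  fix i k
  have "(\<integral>X. Y i X * Y k X \<partial>Pinf \<rho>) <= (\<integral>X. 1 \<partial>Pinf \<rho>)"
   by (rule integral_mono[OF intYY]) (use YY in \<open>auto simp: abs_le_iff\<close>)
  then show "(\<integral>X. Y i X * Y k X \<partial>Pinf \<rho>) <= (if i = k then 1 else 0)"
   using cross by (auto simp: PP.prob_space)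
 qed
 also have "... = card I" using I by simp
 finally have "(\<integral>X. (\<Sum>i\<in>I. Y i X)\<^sup>2 \<partial>Pinf \<rho>) <= card I" .
 moreover have "(\<integral>\<^sup>+X. ennreal ((\<Sum>i\<in>I. Y i X)\<^sup>2) \<partial>Pinf \<rho>) = ennreal (\<integral>X. (\<Sum>i\<in>I. Y i X)\<^sup>2 \<partial>Pinf \<rho>)"
  by (rule nn_integral_eq_integral[OF int]) auto
 ultimately show ?thesis by (simp add: Y_def p_def ennreal_leI)
qed

lemma measure_meas: "A : sets borel ==> (%om. measure (fst om) A) : bmeas bigM"
 using measurable_compose[OF fst_meas measurable_compose[OF idm measurable_measure_prob_algebra]] .

text \<open>Chebyshev's inequality. The second moment bound holds for every \<open>\<rho>\<close>
  with the same constant, so it survives averaging over \<open>\<nu>\<close>.\<close>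

lemma lln_deviation:
 assumes A: "A : sets borel" and dl: "dl > 0" and N: "N > 0"
 shows "measure bigM {om\<in>space bigM.
   \<bar>(\<Sum>i\<in>{m<..m+N}. indicator A (snd om i)) / real N - measure (fst om) A\<bar> >= dl} <= 1 / (real N * dl\<^sup>2)"
proof -
 interpret B: prob_space bigM by (rule prob_bigM)
 note [measurable] = measure_meas[OF A] A
 have [measurable]: "(%om. snd om i) : bmeas bigM" for i
  by (rule measurable_compose[OF snd_meas measurable_component_singleton]) auto
 let ?I = "{m<..m+N}"
 let ?S = "%om. (\<Sum>i\<in>?I. indicator A (snd om i) - measure (fst om) A) :: real"
 have m: "(%om. ennreal ((?S om)\<^sup>2)) : bmeas bigM" by measurable
 then have m': "(%om. ennreal ((?S om)\<^sup>2)) : bmeas Om"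
  by (simp add: measurable_cong_sets[OF sets_bigM refl])
 have S: "(\<integral>\<^sup>+om. ennreal ((?S om)\<^sup>2) \<partial>bigM) <= ennreal N"
 proof -
  have "(\<integral>\<^sup>+om. ennreal ((?S om)\<^sup>2) \<partial>bigM) <= (\<integral>\<^sup>+\<rho>. ennreal N \<partial>\<nu>)"
   unfolding nn_bigM[OF m'] by (rule nn_integral_mono) (use second_moment_Pinf[OF _ A, of _ ?I] in simp)
  then show ?thesis by (simp add: emeasure_space_1)
 qed
 let ?E = "{om\<in>space bigM. \<bar>(\<Sum>i\<in>?I. indicator A (snd om i)) / real N - measure (fst om) A\<bar> >= dl}"
 have [measurable]: "?E : sets bigM" by measurable
 have "ennreal (real N ^ 2 * dl\<^sup>2) * emeasure bigM ?E = (\<integral>\<^sup>+om. ennreal (real N ^ 2 * dl\<^sup>2) * indicator ?E om \<partial>bigM)"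
  by (simp add: nn_integral_cmult_indicator)
 also have "... <= (\<integral>\<^sup>+om. ennreal ((?S om)\<^sup>2) \<partial>bigM)"
 proof (intro nn_integral_mono)
  fix om
  have e: "?S om = real N * ((\<Sum>i\<in>?I. indicator A (snd om i)) / real N - measure (fst om) A)"
   using N by (simp add: sum_subtractf right_diff_distrib)
  show "ennreal (real N ^ 2 * dl\<^sup>2) * indicator ?E om <= ennreal ((?S om)\<^sup>2)"
  proof (cases "om : ?E")
   case True
   then have "dl\<^sup>2 <= ((\<Sum>i\<in>?I. indicator A (snd om i)) / real N - measure (fst om) A)\<^sup>2"
    using dl by (simp add: abs_le_square_iff[symmetric])
   then show ?thesis unfolding e power_mult_distrib using True by (simp add: mult_left_mono ennreal_leI)
  qed simp
 qed
 also note S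
 finally have "real N ^ 2 * dl\<^sup>2 * measure bigM ?E <= real N"
  by (simp add: B.emeasure_eq_measure ennreal_mult''[symmetric])
 then show ?thesis using N dl by (simp add: field_simps power2_eq_square)
qed

text \<open>The event is compared with the event that the empirical frequency of \<open>A\<close>
  exceeds \<open>c + dl\<close>. The two can differ only if the random measure of \<open>A\<close>
  lies in the band (c, c + 2 dl] or the frequency deviates from it by at least
  \<open>dl\<close>.\<close>

lemma appr_measure_gt:
 assumes A: "A : sets borel"
 shows "appr bigM snd {m<..} {om\<in>space bigM. measure (fst om) A > c}"
proof -
 interpret B: prob_space bigM by (rule prob_bigM)
 interpret Ap: appr_space bigM snd "{m<..}" by (rule appr_bigM)
 note [measurable] = measure_meas[OF A] A
 let ?E = "{om\<in>space bigM. measure (fst om) A > c}"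
 show ?thesis
 proof (rule Ap.appr_limit)
  show "?E : sets bigM" by measurable
  fix e :: real assume e: "e > 0"
  \<comment> \<open>The band above \<open>c\<close> of width \<open>2 / Suc n\<close> decreases to
    the empty set, so it has small probability for some \<open>n\<close>; this \<open>n\<close>
    fixes \<open>dl\<close> as half the width.\<close>
  define G where "G n = {om\<in>space bigM. c < measure (fst om) A & measure (fst om) A <= c + 2 / real (Suc n)}" for n
  have [measurable]: "G n : sets bigM" for n unfolding G_def by measurable
  have "(%n. measure bigM (G n)) ----> measure bigM (\<Inter>n. G n)"
  proof (rule B.finite_Lim_measure_decseq)
   show "decseq G"
   proof (rule decseq_SucI)
    fix a
    have "2 / real (Suc (Suc a)) <= 2 / real (Suc a)" by (simp add: frac_le)
    then show "G (Suc a) <= G a" unfolding G_def by force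
   qed
  qed auto
  moreover have "(\<Inter>n. G n) = {}"
  proof (rule ccontr)
   assume "(\<Inter>n. G n) ~= {}"
   then obtain om where om: "!!n. om : G n" by blast
   then have "measure (fst om) A - c > 0" by (auto simp: G_def)
   moreover have "(%n. 2 / real (Suc n)) ----> 0" by real_asymp
   then have "measure (fst om) A - c <= 0"
    by (rule LIMSEQ_le_const) (use om in \<open>auto simp: G_def algebra_simps\<close>)
   ultimately show False by simp
  qed
  ultimately have "(%n. measure bigM (G n)) ----> 0" by simp
  from order_tendstoD(2)[OF this, of "e/2"] e obtain n where n: "measure bigM (G n) < e / 2"
   using eventually_happens'[OF sequentially_bot] by fastforce
  define dl where "dl = 1 / real (Suc n)"
  have dl: "dl > 0" by (simp add: dl_def)
  obtain N where N: "real N > 2 / (e * dl\<^sup>2)" using reals_Archimedean2 by blast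
  have Npos: "N > 0" using N e dl by (metis divide_pos_pos less_trans mult_pos_pos of_nat_0_less_iff
     zero_less_numeral zero_less_power)
  have Ne: "1 / (real N * dl\<^sup>2) < e / 2" using N Npos e dl by (simp add: field_simps)
  let ?m = "%om. (\<Sum>i\<in>{m<..m+N}. indicator A (snd om i)) / real N :: real"
  define F where "F = {om\<in>space bigM. ?m om > c + dl}"
  have apF: "appr bigM snd {m<..} F"
  proof -
   have [measurable]: "(%om. snd om i) : Ap.apprM \<rightarrow>\<^sub>M borel" if "i : {m<..m+N}" for i
    using Ap.X_apprM[of i] that by auto
   have "(%om. indicator A (snd om i) :: real) : bmeas Ap.apprM" if "i : {m<..m+N}" for i
    using that by measurable
   then have [measurable]: "?m : bmeas Ap.apprM" by (intro borel_measurable_divide borel_measurable_sum) auto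
   have "{om\<in>space Ap.apprM. ?m om > c + dl} : sets Ap.apprM" by measurable
   then show ?thesis by (simp add: F_def Ap.space_apprM Ap.sets_apprM)
  qed
  let ?D = "{om\<in>space bigM. \<bar>?m om - measure (fst om) A\<bar> >= dl}"
  have [measurable]: "(%om. snd om i) : bmeas bigM" for i
   by (rule measurable_compose[OF snd_meas measurable_component_singleton]) auto
  have [measurable]: "?D : sets bigM" by measurable
  have "measure bigM ((?E - F) \<union> (F - ?E)) <= measure bigM (G n \<union> ?D)"
  proof (rule B.finite_measure_mono)
   have "om : G n \<union> ?D" if "om : (?E - F) \<union> (F - ?E)" for om
    using that dl by (auto simp: G_def F_def dl_def abs_if)
   then show "(?E - F) \<union> (F - ?E) <= G n \<union> ?D" by blast
  qed measurable
  also have "... <= measure bigM (G n) + measure bigM ?D" by (rule measure_Un_le) measurable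
  also have "... < e" using n lln_deviation[OF A dl Npos, of m] Ne by linarith
  finally have "measure bigM ((?E - F) \<union> (F - ?E)) < e" .
  with apF show "\<exists>F. appr bigM snd {m<..} F & measure bigM ((?E - F) \<union> (F - ?E)) < e" by blast
 qed
qed

text \<open>The sigma-algebra of \<open>prob_algebra\<close> is generated by evaluation at Borel
  sets, whose super-level events are approximable. Hence every measurable property of
  \<open>\<rho>\<close> can be read off from the particles beyond \<open>m\<close>, up to a small
  error in L1.\<close>

lemma appr_fst:
 assumes B: "B : sets (prob_algebra borel)"
 shows "appr bigM snd {m<..} {om\<in>space bigM. fst om : B}"
proof -
 interpret Ap: appr_space bigM snd "{m<..}" by (rule appr_bigM)
 have "fst : Ap.apprM \<rightarrow>\<^sub>M prob_algebra (borel :: (real^3) measure)"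
 proof (rule measurable_prob_algebra_generated[where G="sets borel" and \<Omega>=UNIV])
  show "sets borel = sigma_sets UNIV (sets (borel :: (real^3) measure))" by (metis sets.sigma_sets_eq space_borel)
  show "Int_stable (sets (borel :: (real^3) measure))" by (auto simp: Int_stable_def)
  fix A :: "(real^3) set" assume A: "A : sets borel"
  have "(%om. measure (fst om) A) : bmeas Ap.apprM" unfolding borel_measurable_iff_greater
   using appr_measure_gt[OF A] by (auto simp: Ap.space_apprM Ap.sets_apprM)
  then have "(%om. ennreal (measure (fst om) A)) : bmeas Ap.apprM" by measurable
  then show "(%om. emeasure (fst om) A) : bmeas Ap.apprM"
   by (subst measurable_cong[of _ _ "%om. ennreal (measure (fst om) A)"])
    (use rho(1) in \<open>auto simp: Ap.space_apprM space_bigM finite_measure.emeasure_eq_measure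
     prob_space_def\<close>)
 qed (use rho in \<open>auto simp: Ap.space_apprM space_bigM\<close>)
 from measurable_sets[OF this B] show ?thesis by (simp add: Ap.space_apprM Ap.sets_apprM vimage_def Int_def conj_commute)
qed

lemma cut_sm: "finite I ==> I <= J ==> J ~= {} ==> cut I p : sm J"
proof (induction I rule: finite_induct)
 case empty
 have "(%V. 1 - 0) : sm J" using empty by (intro sm.compl sm_zero) auto
 then show ?case by (simp add: cut_def[abs_def])
next
 case (insert i I)
 have one: "(%V. 1) : sm J" using sm.compl[OF sm_zero[of J]] insert by auto
 have b: "(%V. sE 0 (real p * V i $ u + real p * real p) *
  sE 0 (real p * real p - real p * V i $ u)) : sm J" for u
  using insert sm.mult[OF sm.base[of i J "real p" u "real p * real p"]
    sm.base[of i J "- real p" u "real p * real p"]] by (simp add: algebra_simps)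
 have "(%V. \<Prod>u\<in>U. sE 0 (real p * V i $ u + real p * real p) *
  sE 0 (real p * real p - real p * V i $ u)) : sm J" for U
  by (induction U rule: infinite_finite_induct) (auto intro!: sm.mult[OF b] one)
 from sm.mult[OF this[of UNIV] insert.IH] insert.hyps insert.prems show ?case by (simp add: cut_def[abs_def])
qed

text \<open>An approximant depends on finitely many particles, hence on m+1..j as soon as
  \<open>j\<close> is large. A wide cutoff in these particles, chosen anew for each
  \<open>j\<close>, brings it into \<open>Qc m j\<close>.\<close>

lemma tail_approx:
 assumes B: "B : sets (prob_algebra borel)" and e: "e > 0"
 shows "\<exists>j0. \<forall>j\<ge>j0.
  \<exists>q\<in>Qc m j. (\<integral>om. \<bar>indicator B (fst om) - q (snd om)\<bar> \<partial>bigM) < e"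
proof -
 interpret BM: prob_space bigM by (rule prob_bigM)
 interpret Ap: appr_space bigM snd "{m<..}" by (rule appr_bigM)
 let ?E = "{om\<in>space bigM. fst om : B}"
 have E: "?E : sets bigM" using appr_fst[OF B] by (simp add: appr_def)
 obtain q where q: "q : sm {m<..}" "(\<integral>om. \<bar>indicator ?E om - q (snd om)\<bar> \<partial>bigM) < e / 2"
  using appr_fst[OF B, of m] e unfolding appr_def by (meson half_gt_zero)
 obtain j0 where j0: "!!V W. (\<forall>i\<in>{m<..}. i <= j0 --> V i = W i) ==> q V = q W"
  using sm_fin[OF q(1)] by blast
 show ?thesis
 proof (intro exI[of _ "max (Suc m) j0"] allI impI)
  fix j assume j: "j >= max (Suc m) j0"
  let ?I = "{m+1..j}"
  have cs: "cut ?I p : sm {m<..}" for p by (rule cut_sm) auto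
  have qc: "(%V. q V * cut ?I p V) : sm {m<..}" for p by (rule sm.mult[OF q(1) cs])
  have ic: "integrable bigM (%om. 1 - cut ?I p (snd om))" for p
   using Ap.int_q[OF sets.top cs[of p]] cut_range[of ?I p]
   by (elim Bintegrable_cong[THEN iffD1, rotated -1]) auto
  have "(%p. \<integral>om. 1 - cut ?I p (snd om) \<partial>bigM) ----> (\<integral>om. 0 \<partial>bigM)"
  proof (rule integral_dominated_convergence[where w="%_. 1"])
   show "AE om in bigM. (%p. 1 - cut ?I p (snd om)) ----> 0"
    using tendsto_diff[OF tendsto_const[of 1] cut_limit[of ?I]] by (auto intro!: AE_I2)
   show "AE om in bigM. norm (1 - cut ?I p (snd om)) <= 1" for p
    using cut_range[of ?I p] by (auto intro!: AE_I2 simp: abs_le_iff)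
  qed (use ic in \<open>auto intro: borel_measurable_integrable\<close>)
  then have l: "(%p. \<integral>om. 1 - cut ?I p (snd om) \<partial>bigM) ----> 0" by simp
  from order_tendstoD(2)[OF l, of "e/2"] e obtain p where p: "(\<integral>om. 1 - cut ?I p (snd om) \<partial>bigM) < e / 2"
   using eventually_happens'[OF sequentially_bot] by fastforce
  let ?q = "%V. q V * cut ?I p V"
  have "(\<integral>om. \<bar>indicator B (fst om) - ?q (snd om)\<bar> \<partial>bigM) = (\<integral>om. \<bar>indicator ?E om - ?q (snd om)\<bar> \<partial>bigM)"
   by (rule Bintegral_cong) (auto simp: indicator_def)
  also have "... <= (\<integral>om. \<bar>indicator ?E om - q (snd om)\<bar> + (1 - cut ?I p (snd om)) \<partial>bigM)"
  proof (rule integral_mono[OF Ap.int_q[OF E qc] Bintegrable_add[OF Ap.int_q[OF E q(1)] ic]])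
   fix om :: "(real^3) measure \<times> velocities"
   have "q (snd om) * (1 - cut ?I p (snd om)) <= 1 * (1 - cut ?I p (snd om))"
    "q (snd om) * (1 - cut ?I p (snd om)) >= 0"
    using sm_range[OF q(1), of "snd om"] cut_range[of ?I p "snd om"]
    by (auto intro!: mult_left_le_one_le mult_nonneg_nonneg)
   then show "\<bar>indicator ?E om - ?q (snd om)\<bar> <= \<bar>indicator ?E om - q (snd om)\<bar> + (1 - cut ?I p (snd om))"
    by (simp add: algebra_simps)
  qed
  also have "... < e" using q p by (subst Bintegral_add[OF Ap.int_q[OF E q(1)] ic]) auto
  finally have "(\<integral>om. \<bar>indicator B (fst om) - ?q (snd om)\<bar> \<partial>bigM) < e" .
  moreover have "?q : Qc m j" unfolding Qc_def
  proof (intro CollectI conjI allI impI)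
   show "0 <= ?q V" "?q V <= 1" "C_diff j k ?q" for V k using sm_range[OF qc] sm_C_diff[OF qc] by auto
   show "?q V = ?q W" if "\<forall>i\<in>{m+1..j}. V i = W i" for V W using j0[of V W] cut_cong[of ?I V W p] that j by auto
   show "\<exists>R. \<forall>V. (\<exists>i\<in>{m+1..j}. norm (V i) > R) --> ?q V = 0"
    using cut_zero[of _ ?I p] by (intro exI[of _ "3 * real p"]) auto
  qed
  ultimately show "\<exists>q\<in>Qc m j. (\<integral>om. \<bar>indicator B (fst om) - q (snd om)\<bar> \<partial>bigM) < e"
   by (intro bexI[of _ ?q])
 qed
qed

end

section \<open>Monotone limits along a mixture\<close>

lemma ennreal_integral_le:
 fixes f :: "'a => real"
 assumes "integrable M f"
 shows "ennreal (\<integral>x. f x \<partial>M) <= (\<integral>\<^sup>+x. ennreal (f x) \<partial>M)"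
proof -
 have i: "integrable M (%x. max 0 (f x))" using assms by simp
 have "(\<integral>x. f x \<partial>M) <= (\<integral>x. max 0 (f x) \<partial>M)" by (rule integral_mono[OF assms i]) auto
 then have "ennreal (\<integral>x. f x \<partial>M) <= ennreal (\<integral>x. max 0 (f x) \<partial>M)" by (rule ennreal_leI)
 also have "... = (\<integral>\<^sup>+x. ennreal (max 0 (f x)) \<partial>M)"
  by (rule nn_integral_eq_integral[symmetric, OF i]) auto
 also have "... = (\<integral>\<^sup>+x. ennreal (f x) \<partial>M)"
  by (rule nn_integral_cong) (auto simp: max_def ennreal_neg)
 finally show ?thesis .
qed

lemma (in prob_space) ennreal_integral_bounded_le:
 fixes f :: "'a => real"
 assumes "integrable M f" "!!x. x : space M ==> ennreal (f x) <= S"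
 shows "ennreal (\<integral>x. f x \<partial>M) <= S"
proof -
 have "ennreal (\<integral>x. f x \<partial>M) <= (\<integral>\<^sup>+x. ennreal (f x) \<partial>M)" by (rule ennreal_integral_le[OF assms(1)])
 also have "... <= (\<integral>\<^sup>+x. S \<partial>M)" by (rule nn_integral_mono) (use assms in auto)
 finally show ?thesis by (simp add: emeasure_space_1)
qed

lemma (in prob_space) integrable_bounded:
 fixes f :: "'a => real"
 shows "f : bmeas M ==> (!!x. x : space M ==> \<bar>f x\<bar> <= B) ==> integrable M f"
 by (rule integrable_const_bound[where B=B]) auto

lemma (in random_measure) integral_tensor_fold:
 fixes g :: "velocities => real"
 assumes \<rho>: "\<rho> : space \<nu>" and m: "m <= j" and g: "g : bmeas (velM {1..j})"
  and bd: "\<forall>V\<in>phase j. \<bar>g V\<bar> <= B"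
 shows "(\<integral>V. g V \<partial>tensor j \<rho>) =
   (\<integral>x'. (\<integral>x. g (frz m j x' x) \<partial>tensor m \<rho>) \<partial>PiM {m+1..j} (%_. \<rho>))"
  and "(%x. g (frz m j x' x)) : bmeas (tensor m \<rho>)"
  and "integrable (PiM {m+1..j} (%_. \<rho>)) (%x'. (\<integral>x. g (frz m j x' x) \<partial>tensor m \<rho>))"
proof -
 interpret product_sigma_finite "%_::nat. \<rho>"
  using rho(1)[OF \<rho>] by (simp add: product_sigma_finite_def prob_space_imp_sigma_finite)
 interpret Tm: prob_space "tensor m \<rho>" by (rule prob_tensor[OF \<rho>])
 interpret Tj: prob_space "tensor j \<rho>" by (rule prob_tensor[OF \<rho>])
 interpret Ti: prob_space "PiM {m+1..j} (%_. \<rho>)" by (rule prob_PiM_rho[OF \<rho>])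
 have B: "!!V. V : phase j ==> \<bar>g V\<bar> <= B" using bd by blast
 have B0: "0 <= B" using B[OF frz_phase[OF m]] by (meson abs_ge_zero order_trans)
 have u: "{m+1..j} \<union> {1..m} = {1..j}" using m by auto
 have mc: "merge {m+1..j} {1..m} (x', x) = frz m j x' x" for x x' :: velocities
  unfolding frz_def by (rule ext) (auto simp: merge_def)
 have gt: "g : bmeas (tensor j \<rho>)"
  using g by (simp add: measurable_cong_sets[OF sets_tensor[OF \<rho>] refl])
 have ig: "integrable (tensor j \<rho>) g" by (rule Tj.integrable_bounded[OF gt, of B])
   (use B sets_eq_imp_space_eq[OF sets_tensor[OF \<rho>]] in \<open>auto simp: space_velM\<close>)
 show "(\<integral>V. g V \<partial>tensor j \<rho>) =
   (\<integral>x'. (\<integral>x. g (frz m j x' x) \<partial>tensor m \<rho>) \<partial>PiM {m+1..j} (%_. \<rho>))"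
  using product_integral_fold[of "{m+1..j}" "{1..m}" g] ig by (simp add: u mc tensor_def)
 have mm: "case_prod (frz m j) : (PiM {m+1..j} (%_. \<rho>)) \<Otimes>\<^sub>M tensor m \<rho> \<rightarrow>\<^sub>M tensor j \<rho>"
  using measurable_merge[of "{m+1..j}" "{1..m}" "%_. \<rho>"] by (simp add: u mc[symmetric] tensor_def case_prod_beta')
 have gm: "(%(x', x). g (frz m j x' x)) : bmeas ((PiM {m+1..j} (%_. \<rho>)) \<Otimes>\<^sub>M tensor m \<rho>)"
  using measurable_compose[OF mm gt] by (simp add: case_prod_beta')
 have frzm: "frz m j x' : velM {1..m} \<rightarrow>\<^sub>M velM {1..j}" for x'
 proof (rule measurable_PiM_single')
  show "frz m j x' : space (velM {1..m}) \<rightarrow> (\<Pi>\<^sub>E i\<in>{1..j}. space borel)"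
   using frz_phase[OF m, of x'] by (auto simp: phase_def)
  show "(%om. frz m j x' om i) : bmeas (velM {1..m})" if "i : {1..j}" for i
   unfolding frz_apply using that by (cases "i : {1..m}") auto
 qed
 show "(%x. g (frz m j x' x)) : bmeas (tensor m \<rho>)" for x' using measurable_compose[OF frzm g]
  by (simp add: measurable_cong_sets[OF sets_tensor[OF \<rho>] refl])
 show "integrable (PiM {m+1..j} (%_. \<rho>)) (%x'. (\<integral>x. g (frz m j x' x) \<partial>tensor m \<rho>))"
 proof (rule Ti.integrable_bounded[of _ B])
  show "(%x'. \<integral>x. g (frz m j x' x) \<partial>tensor m \<rho>) : bmeas (Pi\<^sub>M {m + 1..j} (%_. \<rho>))"
   using Tm.borel_measurable_lebesgue_integral[OF gm] by simp
  fix x'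
  have "\<bar>\<integral>x. g (frz m j x' x) \<partial>tensor m \<rho>\<bar> <= (\<integral>x. \<bar>g (frz m j x' x)\<bar> \<partial>tensor m \<rho>)"
   by (rule integral_abs_bound)
  also have "... <= (\<integral>x. B \<partial>tensor m \<rho>)"
  proof (rule integral_mono_AE')
   show "AE x in tensor m \<rho>. \<bar>g (frz m j x' x)\<bar> <= B" using B[OF frz_phase[OF m]] by simp
  qed (use B0 in auto)
  finally show "\<bar>\<integral>x. g (frz m j x' x) \<partial>tensor m \<rho>\<bar> <= B" by (simp add: Tm.prob_space)
 qed
qed

section \<open>Finite measurable selection of near-optimal tests\<close>

context mixing begin

text \<open>Monotone convergence reduces the supremum to the tests 0..n. The cell \<open>B l\<close>
  collects the laws for which \<open>l\<close> is the first index that attains the maximum, and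
  these cells form a measurable partition.\<close>

lemma selection:
 fixes G :: "nat => velocities => real"
 assumes Gm: "!!l. G l : bmeas (velM {1..m})"
  and Gb: "!!l. \<forall>V\<in>phase m. \<bar>G l V\<bar> <= Bd l"
  and G0: "\<forall>V\<in>phase m. G 0 V = 0"
  and c: "c < (\<integral>\<^sup>+\<rho>. (SUP l. ennreal (\<integral>V. G l V \<partial>tensor m \<rho>)) \<partial>\<nu>)"
 obtains n B where "!!l. l <= n ==> B l : sets (prob_algebra borel)"
  "!!\<rho>. \<rho> : space \<nu> ==> \<exists>l0\<le>n. \<forall>l\<le>n. \<rho> : B l \<longleftrightarrow> l = l0"
  "c < ennreal (\<integral>\<rho>. (\<Sum>l\<le>n. indicator (B l) \<rho> * (\<integral>V. G l V \<partial>tensor m \<rho>)) \<partial>\<nu>)"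
proof -
 define t where "t l \<rho> = (\<integral>V. G l V \<partial>tensor m \<rho>)" for l \<rho>
 have tm[measurable]: "t l : bmeas (prob_algebra borel)" for l
  unfolding t_def by (rule RM.integral_tensor_meas[OF Gm])
 have tm'[measurable]: "t l : bmeas \<nu>" for l unfolding t_def by (rule integral_tensor_meas[OF Gm])
 have sp: "\<rho> : space \<nu> ==> \<rho> : space (prob_algebra borel)" for \<rho>
  using measurable_space[OF idm] .
 have t0: "t 0 \<rho> = 0" if "\<rho> : space \<nu>" for \<rho>
 proof -
  have "t 0 \<rho> = (\<integral>V. 0 \<partial>tensor m \<rho>)" unfolding t_def by (rule Bintegral_cong)
    (use G0 sets_eq_imp_space_eq[OF sets_tensor[OF that]] in \<open>auto simp: space_velM\<close>)
  then show ?thesis by simp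
 qed
 have tb: "\<bar>t l \<rho>\<bar> <= Bd l" if "\<rho> : space \<nu>" for l \<rho>
 proof -
  interpret T: prob_space "tensor m \<rho>" by (rule prob_tensor[OF that])
  have sp: "space (tensor m \<rho>) = phase m" using sets_eq_imp_space_eq[OF sets_tensor[OF that]] by (simp add: space_velM)
  have "\<bar>t l \<rho>\<bar> <= (\<integral>V. \<bar>G l V\<bar> \<partial>tensor m \<rho>)" unfolding t_def by (rule integral_abs_bound)
  also have "... <= (\<integral>V. Bd l \<partial>tensor m \<rho>)"
  proof (rule integral_mono)
   have "G l : bmeas (tensor m \<rho>)"
    using Gm by (simp add: measurable_cong_sets[OF sets_tensor[OF that] refl])
   then show "integrable (tensor m \<rho>) (%V. \<bar>G l V\<bar>)"
    by (intro T.integrable_bounded[of _ "Bd l"]) (auto simp: sp Gb)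
  qed (auto simp: sp Gb)
  finally show ?thesis by (simp add: T.prob_space)
 qed
 define F where "F n \<rho> = (SUP l\<in>{..n}. ennreal (t l \<rho>))" for n \<rho>
 have Fm[measurable]: "F n : bmeas \<nu>" for n unfolding F_def by (rule borel_measurable_SUP) auto
 have inc: "incseq F" unfolding incseq_def F_def le_fun_def by (auto intro: SUP_subset_mono)
 have FS: "(SUP n. F n \<rho>) = (SUP l. ennreal (t l \<rho>))" for \<rho>
 proof (rule antisym)
  show "(SUP n. F n \<rho>) <= (SUP l. ennreal (t l \<rho>))"
   unfolding F_def by (rule SUP_least) (auto intro: SUP_subset_mono)
  show "(SUP l. ennreal (t l \<rho>)) <= (SUP n. F n \<rho>)"
  proof (rule SUP_least)
   fix l show "ennreal (t l \<rho>) <= (SUP n. F n \<rho>)"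
    by (rule order_trans[OF _ SUP_upper[of l]]) (auto simp: F_def intro!: SUP_upper)
  qed
 qed
 have "(\<integral>\<^sup>+\<rho>. (SUP n. F n \<rho>) \<partial>\<nu>) = (SUP n. \<integral>\<^sup>+\<rho>. F n \<rho> \<partial>\<nu>)"
  by (rule nn_integral_monotone_convergence_SUP[OF inc]) auto
 with c have "c < (SUP n. \<integral>\<^sup>+\<rho>. F n \<rho> \<partial>\<nu>)" by (simp add: FS t_def)
 then obtain n where n: "c < (\<integral>\<^sup>+\<rho>. F n \<rho> \<partial>\<nu>)" by (auto simp: less_SUP_iff)
 \<comment> \<open>The strict inequalities against smaller indices break ties, so that each law lies
   in exactly one of the sets \<open>B 0\<close>, ..., \<open>B n\<close>.\<close>
 define B where "B l = {\<rho> : space (prob_algebra borel).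
   (\<forall>i\<in>{..n}. t i \<rho> <= t l \<rho>) & (\<forall>i\<in>{..<l}. t i \<rho> < t l \<rho>)}" for l
 have B: "B l : sets (prob_algebra borel)" for l unfolding B_def by measurable
 have ex: "\<exists>l0\<le>n. (\<forall>l\<le>n. \<rho> : B l \<longleftrightarrow> l = l0)" if "\<rho> : space \<nu>" for \<rho>
 proof -
  have "Max ((%i. t i \<rho>) ` {..n}) : (%i. t i \<rho>) ` {..n}" by (rule Max_in) auto
  then obtain l where l: "l <= n" "Max ((%i. t i \<rho>) ` {..n}) = t l \<rho>"
   by (metis (no_types, lifting) imageE atMost_iff)
  have "t i \<rho> <= t l \<rho>" if "i <= n" for i unfolding l(2)[symmetric] by (rule Max_ge) (use that in auto)
  then have "\<exists>l\<le>n. \<forall>i\<le>n. t i \<rho> <= t l \<rho>" using l(1) by blast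
  then obtain l0 where l0: "l0 <= n" "\<forall>i\<le>n. t i \<rho> <= t l0 \<rho>"
   and least: "!!k. k < l0 ==> ~ (k <= n & (\<forall>i\<le>n. t i \<rho> <= t k \<rho>))"
   using exists_least_iff[of "%l. l <= n & (\<forall>i\<le>n. t i \<rho> <= t l \<rho>)"] by auto
  have lt: "t k \<rho> < t l0 \<rho>" if kl: "k < l0" for k
  proof -
   obtain i where "i <= n" "t k \<rho> < t i \<rho>" using least[OF kl] l0(1) kl by (auto simp: not_le)
   then show ?thesis using l0(2) by fastforce
  qed
  have "\<rho> : B l \<longleftrightarrow> l = l0" if "l <= n" for l
  proof
   assume "\<rho> : B l"
   then have b: "t l0 \<rho> <= t l \<rho>" "l0 < l ==> t l0 \<rho> < t l \<rho>"
    using l0(1) by (auto simp: B_def)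
   have "t l \<rho> <= t l0 \<rho>" using l0(2) that by blast
   then show "l = l0" using b lt[of l] by (cases l l0 rule: linorder_cases) simp_all
  next
   assume "l = l0"
   then show "\<rho> : B l" using l0 lt sp[OF \<open>\<rho> : space \<nu>\<close>] by (auto simp: B_def)
  qed
  then show ?thesis using l0 by blast
 qed
 have Fsum: "F n \<rho> = ennreal (\<Sum>l\<le>n. indicator (B l) \<rho> * t l \<rho>)"
   "(\<Sum>l\<le>n. indicator (B l) \<rho> * t l \<rho>) >= 0" if \<rho>: "\<rho> : space \<nu>" for \<rho>
 proof -
  obtain l0 where l0: "l0 <= n" "!!l. l <= n ==> \<rho> : B l \<longleftrightarrow> l = l0" using ex[OF \<rho>] by blast
  have "(\<Sum>l\<le>n. indicator (B l) \<rho> * t l \<rho>) = (\<Sum>l\<le>n. if l = l0 then t l0 \<rho> else 0)"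
   by (rule sum.cong) (use l0 in \<open>auto simp: indicator_def\<close>)
  also have "... = t l0 \<rho>" using l0 by simp
  finally have s: "(\<Sum>l\<le>n. indicator (B l) \<rho> * t l \<rho>) = t l0 \<rho>" .
  have mx: "t i \<rho> <= t l0 \<rho>" if "i <= n" for i using l0(2)[OF l0(1)] that by (simp add: B_def)
  \<comment> \<open>Test 0 has value 0, so the maximum is nonnegative and the truncation in
    \<open>ennreal\<close> loses nothing.\<close>
  show "(\<Sum>l\<le>n. indicator (B l) \<rho> * t l \<rho>) >= 0" using mx[of 0] t0[OF \<rho>] s by simp
  show "F n \<rho> = ennreal (\<Sum>l\<le>n. indicator (B l) \<rho> * t l \<rho>)" unfolding s F_def
   by (rule antisym) (use l0 mx in \<open>auto intro!: SUP_least SUP_upper ennreal_leI\<close>)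
 qed
 have [measurable]: "B l \<inter> space \<nu> : sets \<nu>" for l
  using measurable_sets[OF idm B[of l]] by (simp add: vimage_def Int_def)
 have indm: "(%\<rho>. indicator (B l) \<rho> * t l \<rho> :: real) : bmeas \<nu>" for l
 proof -
  have "(%\<rho>. indicator (B l \<inter> space \<nu>) \<rho> * t l \<rho> :: real) : bmeas \<nu>" by measurable
  then show ?thesis by (rule measurable_cong[THEN iffD1, rotated]) (auto simp: indicator_def)
 qed
 have "integrable \<nu> (%\<rho>. indicator (B l) \<rho> * t l \<rho>)" for l
 proof (rule integrable_bounded[where B="Bd l", OF indm])
  fix \<rho> assume \<rho>: "\<rho> : space \<nu>"
  show "\<bar>indicator (B l) \<rho> * t l \<rho>\<bar> <= Bd l"
   using tb[OF \<rho>, of l] order_trans[OF abs_ge_zero tb[OF \<rho>, of l]] by (simp add: indicator_def)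
 qed
 then have "integrable \<nu> (%\<rho>. \<Sum>l\<le>n. indicator (B l) \<rho> * t l \<rho>)"
  by (intro Bintegrable_sum)
 then have "(\<integral>\<^sup>+\<rho>. ennreal (\<Sum>l\<le>n. indicator (B l) \<rho> * t l \<rho>) \<partial>\<nu>) =
   ennreal (\<integral>\<rho>. (\<Sum>l\<le>n. indicator (B l) \<rho> * t l \<rho>) \<partial>\<nu>)"
  by (rule nn_integral_eq_integral) (use Fsum(2) in auto)
 moreover have "(\<integral>\<^sup>+\<rho>. F n \<rho> \<partial>\<nu>) = (\<integral>\<^sup>+\<rho>. ennreal (\<Sum>l\<le>n. indicator (B l) \<rho> * t l \<rho>) \<partial>\<nu>)"
  by (rule nn_integral_cong) (rule Fsum(1))
 ultimately have "c < ennreal (\<integral>\<rho>. (\<Sum>l\<le>n. indicator (B l) \<rho> * t l \<rho>) \<partial>\<nu>)" using n by simp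
 then show ?thesis using that[of n B] B ex by (simp add: t_def)
qed

end

text \<open>An abstraction of the variational formulas: \<open>T j\<close> collects the integrands obtained from test
 functions on \<open>phase j\<close> when only the first \<open>m\<close> particles are acted on, and \<open>G\<close> is a countable
 subfamily of \<open>T m\<close> that suffices for the suprema. Test functions may be multiplied by functions of
 the remaining particles, which by the law of large numbers can play the role of functions of the
 random measure.\<close>

locale test_family = mixing +
 fixes T :: "nat => (velocities => real) set" and m :: nat and G :: "nat => velocities => real"
 assumes T_meas: "!!j g. m <= j ==> g : T j ==> g : bmeas (velM {1..j})"
  and T_bdd: "!!j g. m <= j ==> g : T j ==> \<exists>B. \<forall>V\<in>phase j. \<bar>g V\<bar> <= B"
  and G_T: "!!l. G l : T m" and G0: "\<forall>V\<in>phase m. G 0 V = 0"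
  and G_dense: "!!\<rho> g. \<rho> : space \<nu> ==> g : T m ==>
   ennreal (\<integral>V. g V \<partial>tensor m \<rho>) <= (SUP l. ennreal (\<integral>V. G l V \<partial>tensor m \<rho>))"
  and combine: "!!n. \<exists>C\<ge>0. \<forall>j\<ge>m. \<forall>q. (\<forall>l\<le>n. q l : Qc m j) -->
   (\<exists>g\<in>T j. \<forall>V\<in>phase j. \<forall>l0\<le>n. \<bar>g V - G l0 (restrict V {1..m})\<bar> \<le>
    C * (\<Sum>l\<le>n. \<bar>q l V - (if l = l0 then 1 else 0)\<bar>))"
  and slice_T: "!!j g x'. m <= j ==> g : T j ==> \<exists>h\<in>T m. \<forall>x\<in>phase m. h x = g (frz m j x' x)"
  and extend_T: "!!j g. m <= j ==> g : T j ==> \<exists>h B. \<forall>p::nat. h p : T (Suc j) \<and>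
   (\<forall>V\<in>phase (Suc j). \<bar>h p V\<bar> <= B & (%p. h p V) ----> g (restrict V {1..j}))"
begin

definition "S j F = (SUP g\<in>T j. ennreal (\<integral>V. g V \<partial>F))"

lemma S_countable: "\<rho> : space \<nu> ==> S m (tensor m \<rho>) = (SUP l. ennreal (\<integral>V. G l V \<partial>tensor m \<rho>))"
 unfolding S_def by (rule antisym) (auto intro!: SUP_least G_dense intro: SUP_upper2[OF G_T])

lemma S_meas: "(%\<rho>. S m (tensor m \<rho>)) : bmeas \<nu>"
proof -
 have "(%\<rho>. SUP l. ennreal (\<integral>V. G l V \<partial>tensor m \<rho>)) : bmeas \<nu>"
  by (intro borel_measurable_SUP measurable_compose[OF integral_tensor_meas measurable_ennreal]
    T_meas[OF order_refl G_T]) auto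
 then show ?thesis by (subst measurable_cong[OF S_countable])
qed

text \<open>With the other particles frozen, a test of \<open>j\<close> particles is a test of
  \<open>m\<close> particles. By Fubini its integral against \<open>tensor j \<rho>\<close> is an
  average of values that are at most \<open>S m (tensor m \<rho>)\<close>.\<close>

lemma S_le:
 assumes j: "m <= j"
 shows "S j (mixture j \<nu>) <= (\<integral>\<^sup>+\<rho>. S m (tensor m \<rho>) \<partial>\<nu>)" unfolding S_def[of j]
proof (rule SUP_least)
 fix g assume g: "g : T j"
 obtain B where bd: "\<forall>V\<in>phase j. \<bar>g V\<bar> <= B" using T_bdd[OF j g] by auto
 then have B: "!!V. V : phase j ==> \<bar>g V\<bar> <= B" by auto
 note gm = T_meas[OF j g]
 have le: "ennreal (\<integral>V. g V \<partial>tensor j \<rho>) <= S m (tensor m \<rho>)" if \<rho>: "\<rho> : space \<nu>" for \<rho>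
 proof -
  interpret Ti: prob_space "PiM {m+1..j} (%_. \<rho>)" by (rule prob_PiM_rho[OF \<rho>])
  have sp: "space (tensor m \<rho>) = phase m" using sets_eq_imp_space_eq[OF sets_tensor[OF \<rho>]] by (simp add: space_velM)
  show ?thesis unfolding integral_tensor_fold(1)[OF \<rho> j gm bd]
  proof (rule Ti.ennreal_integral_bounded_le[OF integral_tensor_fold(3)[OF \<rho> j gm bd]])
   fix x'
   obtain h where h: "h : T m" "!!x. x : phase m ==> h x = g (frz m j x' x)"
    using slice_T[OF j g] by blast
   have "(\<integral>x. g (frz m j x' x) \<partial>tensor m \<rho>) = (\<integral>x. h x \<partial>tensor m \<rho>)"
    by (rule Bintegral_cong) (auto simp: sp h(2))
   then show "ennreal (\<integral>x. g (frz m j x' x) \<partial>tensor m \<rho>) <= S m (tensor m \<rho>)"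
    unfolding S_def using h(1) by (auto intro: SUP_upper)
  qed
 qed
 have bt: "\<bar>\<integral>V. g V \<partial>tensor j \<rho>\<bar> <= max B 0" if \<rho>: "\<rho> : space \<nu>" for \<rho>
 proof -
  interpret T: prob_space "tensor j \<rho>" by (rule prob_tensor[OF \<rho>])
  have sp: "space (tensor j \<rho>) = phase j" using sets_eq_imp_space_eq[OF sets_tensor[OF \<rho>]] by (simp add: space_velM)
  have "\<bar>\<integral>V. g V \<partial>tensor j \<rho>\<bar> <= (\<integral>V. \<bar>g V\<bar> \<partial>tensor j \<rho>)" by (rule integral_abs_bound)
  also have "... <= (\<integral>V. max B 0 \<partial>tensor j \<rho>)"
   by (rule integral_mono_AE') (use B in \<open>auto simp: sp intro!: AE_I2 max.coboundedI1\<close>)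
  finally show ?thesis by (simp add: T.prob_space)
 qed
 have "ennreal (\<integral>V. g V \<partial>mixture j \<nu>) = ennreal (\<integral>\<rho>. (\<integral>V. g V \<partial>tensor j \<rho>) \<partial>\<nu>)"
  by (subst integral_mixture[OF gm B]) auto
 also have "... <= (\<integral>\<^sup>+\<rho>. ennreal (\<integral>V. g V \<partial>tensor j \<rho>) \<partial>\<nu>)"
  by (rule ennreal_integral_le[OF integrable_bounded[OF integral_tensor_meas[OF gm] bt]])
 also have "... <= (\<integral>\<^sup>+\<rho>. S m (tensor m \<rho>) \<partial>\<nu>)" by (rule nn_integral_mono) (rule le)
 finally show "ennreal (\<integral>V. g V \<partial>mixture j \<nu>) <= (\<integral>\<^sup>+\<rho>. S m (tensor m \<rho>) \<partial>\<nu>)" .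
qed

text \<open>A test of \<open>j\<close> particles is a bounded pointwise limit of tests of
  \<open>Suc j\<close> particles, and the first \<open>j\<close> particles of the larger mixture
  have the law of the smaller one.\<close>

lemma S_Suc:
 assumes j: "m <= j"
 shows "S j (mixture j \<nu>) <= S (Suc j) (mixture (Suc j) \<nu>)" unfolding S_def[of j]
proof (rule SUP_least)
 interpret BM: prob_space bigM by (rule prob_bigM)
 fix g assume g: "g : T j"
 have j': "m <= Suc j" using j by simp
 obtain h B where h: "!!p::nat. h p : T (Suc j)"
  "!!p V. V : phase (Suc j) ==> \<bar>h p V\<bar> <= B"
  "!!V. V : phase (Suc j) ==> (%p. h p V) ----> g (restrict V {1..j})"
  using extend_T[OF j g] by blast
 have rr: "restrict (restrict X {1..Suc j}) {1..j} = restrict X {1..j}" for X :: velocities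
  by (auto simp: restrict_def fun_eq_iff)
 have rm: "(%om. restrict (snd om) {1..n}) : bigM \<rightarrow>\<^sub>M velM {1..n}" for n
  by (rule measurable_compose[OF snd_meas restr_meas])
 have "(%p. \<integral>om. h p (restrict (snd om) {1..Suc j}) \<partial>bigM) ----> (\<integral>om. g (restrict (snd om) {1..j}) \<partial>bigM)"
 proof (rule integral_dominated_convergence[where w="%_. B"])
  show "(%om. g (restrict (snd om) {1..j})) : bmeas bigM"
   by (rule measurable_compose[OF rm T_meas[OF j g]])
  show "(%om. h p (restrict (snd om) {1..Suc j})) : bmeas bigM" for p
   by (rule measurable_compose[OF rm T_meas[OF j' h(1)]])
  show "AE om in bigM. (%p. h p (restrict (snd om) {1..Suc j})) ----> g (restrict (snd om) {1..j})"
   using h(3)[OF restrict_phase] by (auto simp: rr)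
  show "AE om in bigM. norm (h p (restrict (snd om) {1..Suc j})) <= B" for p
   using h(2)[OF restrict_phase] by auto
 qed auto
 then have "(%p. ennreal (\<integral>V. h p V \<partial>mixture (Suc j) \<nu>)) ----> ennreal (\<integral>V. g V \<partial>mixture j \<nu>)"
  by (intro tendsto_ennrealI)
   (simp add: integral_mixture_bigM[OF T_meas[OF j g]] integral_mixture_bigM[OF T_meas[OF j' h(1)]])
 then show "ennreal (\<integral>V. g V \<partial>mixture j \<nu>) <= S (Suc j) (mixture (Suc j) \<nu>)"
  by (rule LIMSEQ_le_const2) (auto simp: S_def intro!: exI[of _ 0] SUP_upper h(1))
qed

lemma S_mono:
 assumes "m <= i" "i <= j"
 shows "S i (mixture i \<nu>) <= S j (mixture j \<nu>)" using assms(2)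
 by (induction rule: dec_induct) (use assms(1) in \<open>auto intro: order_trans[OF _ S_Suc]\<close>)

text \<open>The ideal test uses \<open>G l\<close> whenever \<open>\<rho>\<close> lies in the cell
  \<open>B l\<close>, and its value exceeds \<open>c\<close>. Replacing the cells by approximants
  \<open>q l\<close> in \<open>Qc m j\<close> and applying \<open>combine\<close> costs at most
  \<open>C\<close> times the sum of the L1 errors.\<close>

lemma S_gt:
 assumes "c < (\<integral>\<^sup>+\<rho>. S m (tensor m \<rho>) \<partial>\<nu>)"
 shows "\<exists>j\<ge>m. c < S j (mixture j \<nu>)"
proof -
 interpret BM: prob_space bigM by (rule prob_bigM)
 note Gm = T_meas[OF order_refl G_T]
 obtain Bd where bd: "!!l. \<forall>V\<in>phase m. \<bar>G l V\<bar> <= Bd l" using T_bdd[OF order_refl G_T] by metis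
 then have Bd: "!!l V. V : phase m ==> \<bar>G l V\<bar> <= Bd l" by auto
 have "c < (\<integral>\<^sup>+\<rho>. (SUP l. ennreal (\<integral>V. G l V \<partial>tensor m \<rho>)) \<partial>\<nu>)"
  using assms by (simp add: S_countable cong: nn_integral_cong)
 note c_less = this
 obtain n B where B: "!!l. l <= n ==> B l : sets (prob_algebra borel)"
  and part: "!!\<rho>. \<rho> : space \<nu> ==> \<exists>l0\<le>n. \<forall>l\<le>n. \<rho> : B l \<longleftrightarrow> l = l0"
  and gt: "c < ennreal (\<integral>\<rho>. (\<Sum>l\<le>n. indicator (B l) \<rho> * (\<integral>V. G l V \<partial>tensor m \<rho>)) \<partial>\<nu>)"
  by (rule selection[OF Gm bd G0 c_less]) (rule that)
 define val where "val = (\<integral>\<rho>. (\<Sum>l\<le>n. indicator (B l) \<rho> * (\<integral>V. G l V \<partial>tensor m \<rho>)) \<partial>\<nu>)"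
 obtain c' where c': "c = ennreal c'" "c' >= 0" using gt by (cases c) auto
 then have d: "val - c' > 0" using gt by (simp add: val_def ennreal_less_iff)
 obtain C where C: "C >= 0" and comb: "\<forall>j\<ge>m. \<forall>q. (\<forall>l\<le>n. q l : Qc m j) -->
   (\<exists>g\<in>T j. \<forall>V\<in>phase j. \<forall>l0\<le>n. \<bar>g V - G l0 (restrict V {1..m})\<bar> \<le>
    C * (\<Sum>l\<le>n. \<bar>q l V - (if l = l0 then 1 else 0)\<bar>))" using combine[of n] by (elim exE conjE)
 \<comment> \<open>With this \<open>e\<close> the total error \<open>C * real (n + 1) * e\<close> is
   at most half of the gap \<open>val - c'\<close>; \<open>C + 1\<close> instead of \<open>C\<close>
   avoids a division by zero.\<close>
 define e where "e = (val - c') / (2 * (C + 1) * real (n + 1))"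
 have e: "e > 0" using d C by (simp add: e_def)
 have "\<forall>l. \<exists>j0. l <= n --> (\<forall>j\<ge>j0. \<exists>q\<in>Qc m j.
   (\<integral>om. \<bar>indicator (B l) (fst om) - q (snd om)\<bar> \<partial>bigM) < e)"
  using tail_approx[OF B e, of _ m] by blast
 from choice[OF this] obtain j0 where j0: "\<forall>l. l <= n --> (\<forall>j\<ge>j0 l. \<exists>q\<in>Qc m j.
   (\<integral>om. \<bar>indicator (B l) (fst om) - q (snd om)\<bar> \<partial>bigM) < e)" by (elim exE)
 \<comment> \<open>The sum is a convenient index above \<open>m\<close> and above all thresholds
   \<open>j0 l\<close> with \<open>l \<le> n\<close>.\<close>
 define j where "j = m + (\<Sum>l\<le>n. j0 l)"
 have jm: "m <= j" by (simp add: j_def)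
 have "j0 l <= j" if "l <= n" for l using member_le_sum[of l "{..n}" j0] that by (simp add: j_def)
 then have "\<forall>l. \<exists>q. l <= n --> q : Qc m j \<and>
   (\<integral>om. \<bar>indicator (B l) (fst om) - q (snd om)\<bar> \<partial>bigM) < e" using j0 by blast
 from choice[OF this] obtain q where qq: "\<forall>l. l <= n --> q l : Qc m j \<and>
   (\<integral>om. \<bar>indicator (B l) (fst om) - q l (snd om)\<bar> \<partial>bigM) < e" by (elim exE)
 then have q: "!!l. l <= n ==> q l : Qc m j"
   "!!l. l <= n ==> (\<integral>om. \<bar>indicator (B l) (fst om) - q l (snd om)\<bar> \<partial>bigM) < e" by auto
 obtain g where g: "g : T j" and gG: "!!V l0. V : phase j ==> l0 <= n ==>
   \<bar>g V - G l0 (restrict V {1..m})\<bar> <= C * (\<Sum>l\<le>n. \<bar>q l V - (if l = l0 then 1 else 0)\<bar>)"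
  using comb[rule_format, OF jm, of q] q(1) by blast
 obtain Bg where Bg: "!!V. V : phase j ==> \<bar>g V\<bar> <= Bg" using T_bdd[OF jm g] by auto
 have rm: "(%om. restrict (snd om) {1..k}) : bigM \<rightarrow>\<^sub>M velM {1..k}" for k
  by (rule measurable_compose[OF snd_meas restr_meas])
 have ig: "integrable bigM (%om. g (restrict (snd om) {1..j}))"
  by (rule BM.integrable_bounded[OF measurable_compose[OF rm T_meas[OF jm g]], of Bg])
   (rule Bg[OF restrict_phase])
 have Bm: "(%om. indicator (B l) (fst om) :: real) : bmeas bigM" if "l <= n" for l
  using measurable_compose[OF fst_meas measurable_compose[OF idm borel_measurable_indicator[OF B[OF that]]]] .
 have GBm: "(%om. indicator (B l) (fst om) * G l (restrict (snd om) {1..m})) : bmeas bigM"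
  if "l <= n" for l using Bm[OF that] measurable_compose[OF rm Gm[of l]] by measurable
 have GBb: "\<bar>indicator (B l) \<rho> * G l (restrict X {1..m})\<bar> <= Bd l" for l \<rho> and X :: velocities
  using Bd[OF restrict_phase[of X m], of l] by (auto simp: indicator_def)
 have iGB: "integrable bigM (%om. \<Sum>l\<le>n. indicator (B l) (fst om) * G l (restrict (snd om) {1..m}))"
  by (intro Bintegrable_sum BM.integrable_bounded[OF GBm])
   (use GBb in auto)
 have qr: "q l (restrict X {1..j}) = q l X" if "l <= n" for l X using q(1)[OF that] unfolding Qc_def by auto
 have iq: "integrable bigM (%om. \<bar>indicator (B l) (fst om) - q l (snd om)\<bar>)" if "l <= n" for l
 proof (rule BM.integrable_bounded[of _ 1])
  have "C_diff j 0 (q l)" using q(1)[OF that] by (simp add: Qc_def del: C_diff.simps)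
  from measurable_compose[OF rm C_diff_measurable[OF this]]
  have "(%om. q l (snd om)) : bmeas bigM" by (simp add: qr[OF that])
  then show "(%om. \<bar>indicator (B l) (fst om) - q l (snd om)\<bar>) : bmeas bigM"
   using Bm[OF that] by measurable
  show "\<bar>\<bar>indicator (B l) (fst om) - q l (snd om)\<bar>\<bar> <= 1" for om :: "(real^3) measure \<times> velocities"
   using q(1)[OF that] by (auto simp: Qc_def indicator_def)
 qed
 have veq: "val = (\<integral>om. (\<Sum>l\<le>n. indicator (B l) (fst om) * G l (restrict (snd om) {1..m})) \<partial>bigM)"
 proof -
  have "(\<integral>om. (\<Sum>l\<le>n. indicator (B l) (fst om) * G l (restrict (snd om) {1..m})) \<partial>bigM) =
   (\<integral>\<rho>. (\<integral>X. (\<Sum>l\<le>n. indicator (B l) \<rho> * G l (restrict X {1..m})) \<partial>Pinf \<rho>) \<partial>\<nu>)"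
  proof -
   have "\<bar>\<Sum>l\<le>n. indicator (B l) (fst om) * G l (restrict (snd om) {1..m})\<bar> <= (\<Sum>l\<le>n. Bd l)"
    for om :: "(real^3) measure \<times> velocities" by (rule order_trans[OF sum_abs sum_mono]) (rule GBb)
   from integral_bigM[OF _ this] borel_measurable_integrable[OF iGB] show ?thesis
    by (simp only: measurable_cong_sets[OF sets_bigM refl] fst_conv snd_conv)
  qed
  also have "... = val" unfolding val_def
  proof (rule Bintegral_cong[OF refl])
   fix \<rho> assume \<rho>: "\<rho> : space \<nu>"
   interpret Pi: prob_space "Pinf \<rho>" unfolding Pinf_def by (rule prob_PiM_rho[OF \<rho>])
   have rP: "(%X. restrict X {1..m}) : Pinf \<rho> \<rightarrow>\<^sub>M velM {1..m}"
    using restr_meas sets_PiM_rho[OF \<rho>, of UNIV] unfolding Pinf_def by (auto cong: measurable_cong_sets)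
   have i: "integrable (Pinf \<rho>) (%X. G l (restrict X {1..m}))" for l
    by (rule Pi.integrable_bounded[OF measurable_compose[OF rP Gm], of _ "Bd l"])
     (rule Bd[OF restrict_phase])
   show "(\<integral>X. (\<Sum>l\<le>n. indicator (B l) \<rho> * G l (restrict X {1..m})) \<partial>Pinf \<rho>) =
     (\<Sum>l\<le>n. indicator (B l) \<rho> * (\<integral>V. G l V \<partial>tensor m \<rho>))"
    unfolding tensor_Pinf[OF \<rho>] by (simp add: integral_distr[OF rP Gm] i)
  qed
  finally show ?thesis by simp
 qed
 have "val - (\<integral>om. g (restrict (snd om) {1..j}) \<partial>bigM) =
   (\<integral>om. (\<Sum>l\<le>n. indicator (B l) (fst om) * G l (restrict (snd om) {1..m})) - g (restrict (snd om) {1..j}) \<partial>bigM)"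
  unfolding veq by (rule Bintegral_diff[OF iGB ig, symmetric])
 also have "... <= (\<integral>om. C * (\<Sum>l\<le>n. \<bar>indicator (B l) (fst om) - q l (snd om)\<bar>) \<partial>bigM)"
 proof (rule integral_mono)
  fix om assume "om : space bigM"
  then have "fst om : space \<nu>" by (auto simp: space_bigM)
  from part[OF this] obtain l0 where l0: "l0 <= n" "!!l. l <= n ==> fst om : B l \<longleftrightarrow> l = l0" by blast
  have "(\<Sum>l\<le>n. indicator (B l) (fst om) * G l (restrict (snd om) {1..m})) =
    (\<Sum>l\<le>n. if l = l0 then G l0 (restrict (snd om) {1..m}) else 0)"
   by (rule sum.cong) (use l0 in \<open>auto simp: indicator_def\<close>)
  also have "... = G l0 (restrict (snd om) {1..m})" using l0 by simp
  finally have s: "(\<Sum>l\<le>n. indicator (B l) (fst om) * G l (restrict (snd om) {1..m})) = G l0 (restrict (snd om) {1..m})" .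
  have rr: "restrict (restrict (snd om) {1..j}) {1..m} = restrict (snd om) {1..m}"
   using jm by (auto simp: restrict_def fun_eq_iff)
  have "(\<Sum>l\<le>n. \<bar>q l (restrict (snd om) {1..j}) - (if l = l0 then 1 else 0)\<bar>) =
    (\<Sum>l\<le>n. \<bar>indicator (B l) (fst om) - q l (snd om)\<bar>)"
   by (rule sum.cong) (use l0 in \<open>auto simp: indicator_def qr abs_minus_commute\<close>)
  with gG[OF restrict_phase[of "snd om" j] l0(1)] s rr
  show "(\<Sum>l\<le>n. indicator (B l) (fst om) * G l (restrict (snd om) {1..m})) - g (restrict (snd om) {1..j}) \<le>
    C * (\<Sum>l\<le>n. \<bar>indicator (B l) (fst om) - q l (snd om)\<bar>)" by (simp add: abs_le_iff)
 qed (use iGB ig iq in \<open>auto intro!: Bintegrable_diff integrable_mult_right Bintegrable_sum\<close>)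
 also have "... = C * (\<Sum>l\<le>n. \<integral>om. \<bar>indicator (B l) (fst om) - q l (snd om)\<bar> \<partial>bigM)"
  by (simp add: Bintegral_sum iq)
 also have "... <= C * (\<Sum>l\<le>n. e)"
  by (intro mult_left_mono sum_mono C) (use q(2) in \<open>auto intro: less_imp_le\<close>)
 also have "... = (C / (C + 1)) * ((val - c') / 2)"
 proof -
  have alg: "C * (N * (D / (2 * (C + 1) * N))) = C / (C + 1) * (D / 2)" if "N > 0" for N D :: real
   using that C by (simp add: divide_simps)
  have s: "(\<Sum>l\<le>n. e) = real (n + 1) * e" by simp
  show ?thesis unfolding s unfolding e_def by (rule alg) simp
 qed
 also have "... <= 1 * ((val - c') / 2)" using C d by (intro mult_right_mono) auto
 also have "... < val - c'" using d by simp
 finally have "c' < (\<integral>V. g V \<partial>mixture j \<nu>)" by (simp add: integral_mixture_bigM[OF T_meas[OF jm g]])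
 then have "c < ennreal (\<integral>V. g V \<partial>mixture j \<nu>)" using c' by (simp add: ennreal_less_iff)
 also have "... <= S j (mixture j \<nu>)" unfolding S_def using g by (auto intro: SUP_upper)
 finally show ?thesis using jm by blast
qed

theorem S_limit: "(%j. S j (mixture j \<nu>)) ----> (\<integral>\<^sup>+\<rho>. S m (tensor m \<rho>) \<partial>\<nu>)"
proof (rule order_tendstoI)
 fix c assume "c < (\<integral>\<^sup>+\<rho>. S m (tensor m \<rho>) \<partial>\<nu>)"
 from S_gt[OF this] obtain j where "m <= j" "c < S j (mixture j \<nu>)" by blast
 then show "eventually (%j. c < S j (mixture j \<nu>)) sequentially"
  using S_mono by (auto simp: eventually_sequentially intro!: exI[of _ j] intro: less_le_trans)
next
 fix c assume "(\<integral>\<^sup>+\<rho>. S m (tensor m \<rho>) \<partial>\<nu>) < c"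
 then show "eventually (%j. S j (mixture j \<nu>) < c) sequentially"
  using S_le by (auto simp: eventually_sequentially intro!: exI[of _ m] intro: le_less_trans)
qed

end

section \<open>Differential operators and countable families of test functions\<close>

declare C_diff.simps [simp del]

text \<open>Separability inside C(K), with the dense functions taken from the family
  \<open>Y\<close> itself. A function is coded by a modulus of continuity \<open>p\<close> at
  precision \<open>n\<close> and by approximate values \<open>ds\<close> from a countable dense set
  on a finite net; one function is picked from every nonempty code class.\<close>

lemma countable_dense_subfamily:
 fixes Y :: "('a::metric_space => 'e::{metric_space,second_countable_topology}) set"
 assumes K: "compact K" and Y: "!!y. y : Y ==> continuous_on K y"
 shows "\<exists>Q. countable Q & Q <= Y & (\<forall>y\<in>Y. \<forall>e>0. \<exists>q\<in>Q. \<forall>x\<in>K. dist (y x) (q x) < e)"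
proof -
 obtain D :: "'e set" where D: "countable D" "!!X. open X ==> X ~= {} ==> \<exists>d\<in>D. d : X"
  using countable_dense_exists by blast
 have "\<exists>cs. set cs <= K & K <= (\<Union>c\<in>set cs. ball c (1 / real (Suc p)))" for p
 proof -
  have "K <= (\<Union>c\<in>K. ball c (1 / real (Suc p)))" by auto
  then obtain C where "C <= K" "finite C" "K <= (\<Union>c\<in>C. ball c (1 / real (Suc p)))"
   using compactE_image[OF K, of K "%c. ball c (1 / real (Suc p))"] by auto
  then show ?thesis using finite_list[of C] by auto
 qed
 then obtain cs where cs: "!!p. set (cs p) <= K" "!!p. K <= (\<Union>c\<in>set (cs p). ball c (1 / real (Suc p)))"
  by metis
 define Z where "Z = (%(p, n, ds). {y\<in>Y.
   (\<forall>x\<in>K. \<forall>x'\<in>K. dist x x' < 1 / real (Suc p) --> dist (y x) (y x') < 1 / real (Suc n)) \<and>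
   list_all2 (%c d. dist (y c) d < 1 / real (Suc n)) (cs p) ds})"
 define pick where "pick z = (SOME y. y : Z z)" for z
 define I where "I = {z : UNIV \<times> UNIV \<times> lists D. Z z ~= {}}"
 have pick: "pick z : Z z" if "z : I" for z
 proof -
  have "\<exists>y. y : Z z" using that by (auto simp: I_def)
  then show ?thesis unfolding pick_def by (rule someI_ex)
 qed
 have ZY: "Z z <= Y" for z by (cases z) (auto simp: Z_def)
 have "countable I" unfolding I_def by (rule countable_subset[of _ "UNIV \<times> UNIV \<times> lists D"]) (auto intro: D(1))
 then have "countable (pick ` I)" by simp
 moreover have "pick ` I <= Y" using pick ZY by blast
 moreover have "\<exists>q\<in>pick ` I. \<forall>x\<in>K. dist (y x) (q x) < e" if y: "y : Y" and e: "e > 0" for y e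
 proof -
  obtain n where n: "4 / real (Suc n) < e"
  proof -
   have "(%n. 4 / real (Suc n)) ----> 0" by real_asymp
   from order_tendstoD(2)[OF this e] show ?thesis using that eventually_happens'[OF sequentially_bot] by fastforce
  qed
  have "uniformly_continuous_on K y" by (rule compact_uniformly_continuous[OF Y[OF y] K])
  then have "\<forall>e>0. \<exists>d>0. \<forall>x\<in>K. \<forall>x'\<in>K. dist x' x < d --> dist (y x') (y x) < e"
   unfolding uniformly_continuous_on_def .
  moreover have "1 / real (Suc n) > 0" by simp
  ultimately obtain dl where dl: "dl > 0"
   "\<forall>x\<in>K. \<forall>x'\<in>K. dist x' x < dl --> dist (y x') (y x) < 1 / real (Suc n)" by blast
  obtain p where p: "1 / real (Suc p) < dl" using nat_approx_posE[OF dl(1)] by blast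
  have "\<forall>c. \<exists>d\<in>D. dist (y c) d < 1 / real (Suc n)"
   using D(2)[of "ball (y _) (1 / real (Suc n))"] by (auto simp: mem_ball)
  then obtain f where f: "!!c. f c : D" "!!c. dist (y c) (f c) < 1 / real (Suc n)" by metis
  define z where "z = (p, n, map f (cs p))"
  have yz: "y : Z z" unfolding Z_def z_def using y f dl p by (auto simp: list_all2_conv_all_nth dist_commute)
  then have "z : I" using f(1) by (auto simp: I_def z_def)
  have "dist (y x) (pick z x) < e" if x: "x : K" for x
  proof -
   obtain c where c: "c : set (cs p)" "dist c x < 1 / real (Suc p)" using cs(2)[of p] x by auto
   then have cK: "c : K" using cs(1) by blast
   obtain i where i: "i < length (cs p)" "cs p ! i = c" using c(1) by (auto simp: in_set_conv_nth)
   have ex: "dist (w c) (w x) < 1 / real (Suc n)" "dist (w c) (f c) < 1 / real (Suc n)" if "w : Z z" for w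
    using that c(2) cK x i by (auto simp: Z_def z_def list_all2_conv_all_nth)
   \<comment> \<open>Two functions with the same code differ at \<open>x\<close> by at most four
     errors of size \<open>1 / Suc n\<close>: two from continuity between \<open>x\<close> and the
     net point \<open>c\<close>, two from the recorded value at \<open>c\<close>.\<close>
   have "dist (y x) (pick z x) <= dist (y c) (y x) + dist (y c) (f c) + dist (pick z c) (f c) + dist (pick z c) (pick z x)"
    by metric
   also have "... < 4 / real (Suc n)" using ex[OF yz] ex[OF pick[OF \<open>z : I\<close>]] by simp
   finally show ?thesis using n by simp
  qed
  then show ?thesis using \<open>z : I\<close> by blast
 qed
 ultimately show ?thesis by (intro exI[of _ "pick ` I"] conjI ballI allI impI)
qed

text \<open>Differential operators of order at most \<open>d\<close> acting on the first
  \<open>m\<close> particles, with coefficients that depend on these particles only. Locality,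
  additivity and lifting are proved once by induction and then serve the Fisher information and both
  dissipations.\<close>

inductive dop :: "nat => nat => ((velocities => real) => velocities => real) => bool" for m where
 partial: "i : {1..m} ==> dop m 1 (partial i u)"
| mult: "(!!n k. m <= n ==> C_diff n k c) ==>
  (!!V W. (!!i. i : {1..m} ==> V i = W i) ==> c V = c W) ==> dop m 0 (%psi V. c V * psi V)"
| add: "dop m d L ==> dop m d L' ==> dop m d (%psi V. L psi V + L' psi V)"
| comp: "dop m d L ==> dop m d' L' ==> dop m (d + d') (%psi. L (L' psi))"

lemma dop_C_diff: "dop m d L ==> m <= n ==> C_diff n (k + d) psi ==> C_diff n k (L psi)"
proof (induction arbitrary: k psi rule: dop.induct)
 case (partial i u)
 then show ?case using C_diff_partial[of n k psi i u] by (simp add: One_nat_def)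
next
 case (mult c)
 show ?case by (rule C_diff_mult[OF mult.hyps(1)[OF mult.prems(1)]]) (use mult.prems(2) in simp)
next
 case (add d L L')
 show ?case by (rule C_diff_add[OF add.IH(1)[OF add.prems] add.IH(2)[OF add.prems]])
next
 case (comp d L d' L')
 show ?case by (intro comp.IH comp.prems(1)) (use comp.prems in \<open>simp add: add.assoc\<close>)
qed

lemma dop_cong_all:
 "dop m d L ==> m <= n ==> \<forall>V\<in>phase n. f V = g V ==> \<forall>V\<in>phase n. L f V = L g V"
proof (induction arbitrary: f g rule: dop.induct)
 case (partial i u)
 then show ?case by (intro ballI partial_cong[of n]) auto
next
 case (add d L L')
 show ?case using add.IH(1)[OF add.prems] add.IH(2)[OF add.prems] by simp
next
 case (comp d L d' L')
 show ?case by (rule comp.IH(1)[OF comp.prems(1) comp.IH(2)[OF comp.prems]])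
next
 case (mult c)
 show ?case using mult.prems(2) by simp
qed

lemma dop_cong:
 "dop m d L ==> m <= n ==> (!!V. V : phase n ==> f V = g V) ==> V : phase n ==> L f V = L g V"
 using dop_cong_all[of m d L n f g] by blast

text \<open>The condition that some particle has norm above \<open>R\<close> is open: it persists
  under small moves, so \<open>psi\<close> vanishes along the slice near 0 and its partial is 0
  there.\<close>

lemma dop_supp: "dop m d L ==> m <= n ==> supp_in n R psi ==> supp_in n R (L psi)"
proof (induction arbitrary: psi rule: dop.induct)
 case (partial i u)
 show ?case unfolding supp_in_def
 proof (intro ballI impI)
  fix V assume V: "V : phase n" "\<exists>j\<in>{1..n}. R < norm (V j)"
  then obtain j where j: "j : {1..n}" "R < norm (V j)" by blast
  have i: "i : {1..n}" using partial by auto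
  have "((%t. norm (mv V i u t j)) \<longlongrightarrow> norm (mv V i u 0 j)) (nhds 0)"
  proof -
   have "isCont (%t. norm (mv V i u t j)) 0" unfolding mv_def by (cases "i = j") (auto intro!: continuous_intros)
   then show ?thesis unfolding continuous_at by (simp add: tendsto_nhds_iff)
  qed
  from order_tendstoD(1)[OF this, of R] j
  have ev: "eventually (%t. norm (mv V i u t j) > R) (nhds 0)" by simp
  have "((%t. psi (mv V i u t)) has_real_derivative 0) (at 0)"
  proof (rule DERIV_cong_ev[THEN iffD2, OF refl _ refl DERIV_const[of 0]])
   show "eventually (%t. psi (mv V i u t) = 0) (nhds 0)" using ev
   proof eventually_elim
    case (elim t)
    then show ?case using partial.prems(2) mv_phase[OF V(1) i, of u t] j(1) unfolding supp_in_def by blast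
   qed
  qed
  then show "partial i u psi V = 0" by (rule partialI)
 qed
next
 case (add d L L')
 show ?case using add.IH(1)[OF add.prems] add.IH(2)[OF add.prems] by (simp add: supp_in_def)
next
 case (mult c)
 show ?case using mult.prems(2) by (simp add: supp_in_def)
next
 case (comp d L d' L')
 show ?case by (rule comp.IH(1)[OF comp.prems(1) comp.IH(2)[OF comp.prems]])
qed

lemma dop_add:
 "dop m d L ==> m <= n ==> C_diff n d f ==> C_diff n d g ==> V : phase n ==>
  L (%V. f V + g V) V = L f V + L g V"
proof (induction arbitrary: f g V rule: dop.induct)
 case (partial i u)
 have i: "i : {1..n}" using partial by auto
 have "((%t. f (mv V i u t) + g (mv V i u t)) has_real_derivative partial i u f V + partial i u g V) (at 0)"
  by (intro DERIV_add slice_has_derivative0[where k=0 and n=n] i)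
   (use partial in \<open>auto simp: One_nat_def\<close>)
 then show ?case by (rule partialI)
next
 case (comp d L d' L')
 have 1: "C_diff n d (L' f)" "C_diff n d (L' g)" by (rule dop_C_diff[OF comp.hyps(2) comp.prems(1)], use comp.prems in simp)+
 have 2: "C_diff n d' f" "C_diff n d' g" using comp.prems(2,3) by (auto elim: C_diff_mono)
 have "L (L' (%V. f V + g V)) V = L (%V. L' f V + L' g V) V"
  by (rule dop_cong[OF comp.hyps(1) comp.prems(1) _ comp.prems(4)])
   (rule comp.IH(2)[OF comp.prems(1) 2])
 also have "... = L (L' f) V + L (L' g) V" by (rule comp.IH(1)[OF comp.prems(1) 1 comp.prems(4)])
 finally show ?case .
next
 case (mult c)
 show ?case by (simp add: algebra_simps)
next
 case (add d L L')
 show ?case using add.IH(1)[OF add.prems] add.IH(2)[OF add.prems] by simp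
qed

text \<open>A multiplier that depends on the particles after \<open>m\<close> only is constant along
  every slice used by \<open>L\<close>. This is the mechanism that lets the remaining particles
  select a test function.\<close>

lemma dop_mult:
 assumes p: "!!V W. (!!i. i : {m+1..n} ==> V i = W i) ==> p V = p W"
 shows "dop m d L ==> m <= n ==> C_diff n d f ==> V : phase n ==>
  L (%V. p V * f V) V = p V * L f V"
proof (induction arbitrary: f V rule: dop.induct)
 case (partial i u)
 have i: "i : {1..n}" using partial by auto
 have pc: "p (mv V i u t) = p V" for t by (rule p) (use partial in \<open>auto simp: mv_def\<close>)
 have "((%t. p V * f (mv V i u t)) has_real_derivative p V * partial i u f V) (at 0)"
  by (intro DERIV_cmult slice_has_derivative0[where k=0 and n=n] i)
   (use partial in \<open>auto simp: One_nat_def\<close>)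
 then show ?case by (intro partialI) (simp add: pc)
next
 case (add d L L')
 show ?case using add.IH(1)[OF add.prems] add.IH(2)[OF add.prems] by (simp add: algebra_simps)
next
 case (comp d L d' L')
 have 1: "C_diff n d (L' f)" by (rule dop_C_diff[OF comp.hyps(2) comp.prems(1)], use comp.prems in simp)
 have 2: "C_diff n d' f" using comp.prems(2) by (auto elim: C_diff_mono)
 have "L (L' (%V. p V * f V)) V = L (%V. p V * L' f V) V"
  by (rule dop_cong[OF comp.hyps(1) comp.prems(1) _ comp.prems(3)])
   (rule comp.IH(2)[OF comp.prems(1) 2])
 also have "... = p V * L (L' f) V" by (rule comp.IH(1)[OF comp.prems(1) 1 comp.prems(3)])
 finally show ?case .
next
 case (mult c)
 show ?case by (simp add: algebra_simps)
qed

lemma dop_zero: "dop m d L ==> m <= n ==> V : phase n ==> L (%V. 0) V = 0"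
 using dop_mult[of m n "%_. 0" d L "%_. 0" V] C_diff_const by simp

lemma dop_sum:
 assumes "dop m d L" "m <= n" "V : phase n" "!!l. l : I ==> C_diff n d (f l)"
 shows "L (%V. \<Sum>l\<in>I. f l V) V = (\<Sum>l\<in>I. L (f l) V)" using assms(4)
proof (induction I rule: infinite_finite_induct)
 case (insert l I)
 then show ?case using dop_add[OF assms(1,2) _ _ assms(3), of "f l" "%V. \<Sum>l\<in>I. f l V"] by (simp add: C_diff_sum)
qed (use dop_zero[OF assms(1-3)] in auto)

lemma dop_lift:
 "dop m d L ==> m <= j ==> j <= n ==> V : phase n ==>
  L (%V. f (restrict V {1..j})) V = L f (restrict V {1..j})"
proof (induction arbitrary: f V rule: dop.induct)
 case (partial i u)
 then show ?case by (intro partial_lift) auto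
next
 case (mult c)
 have "c V = c (restrict V {1..j})" by (rule mult.hyps(2)) (use mult.prems in auto)
 then show ?case by (simp only:)
next
 case (comp d L d' L')
 have mn: "m <= n" using comp.prems by simp
 have "L (L' (%V. f (restrict V {1..j}))) V = L (%V. L' f (restrict V {1..j})) V"
  by (rule dop_cong[OF comp.hyps(1) mn _ comp.prems(3)])
   (rule comp.IH(2)[OF comp.prems(1,2)])
 also have "... = L (L' f) (restrict V {1..j})" by (rule comp.IH(1)[OF comp.prems])
 finally show ?case .
next
 case (add d L L')
 show ?case using add.IH(1)[OF add.prems] add.IH(2)[OF add.prems] by simp
qed

lemma dop_frz:
 "dop m d L ==> m <= n ==> x : phase m ==> L (%x. f (frz m n x' x)) x = L f (frz m n x' x)"
proof (induction arbitrary: f x rule: dop.induct)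
 case (partial i u)
 then show ?case by (intro partial_frz) auto
next
 case (mult c)
 have "c x = c (frz m n x' x)" by (rule mult.hyps(2)) (auto simp: frz_apply)
 then show ?case by simp
next
 case (comp d L d' L')
 have "L (L' (%x. f (frz m n x' x))) x = L (%x. L' f (frz m n x' x)) x"
  by (rule dop_cong[OF comp.hyps(1) order_refl _ comp.prems(2)])
   (rule comp.IH(2)[OF comp.prems(1)])
 also have "... = L (L' f) (frz m n x' x)" by (rule comp.IH(1)[OF comp.prems])
 finally show ?case .
next
 case (add d L L')
 show ?case using add.IH(1)[OF add.prems] add.IH(2)[OF add.prems] by simp
qed

lemma Cg_lift_mult:
 assumes "psi : Cg m K" "m <= j" "!!k. k : K ==> C_diff j k q"
  "!!V. V : phase j ==> (\<exists>i\<in>{m+1..j}. norm (V i) > R) ==> q V = 0"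
 shows "(%V. q V * psi (restrict V {1..m})) : Cg j K"
proof -
 obtain R' where R': "supp_in m R' psi" using Cg_supp[OF assms(1)] by blast
 have "supp_in j (max R R') (%V. q V * psi (restrict V {1..m}))" unfolding supp_in_def
 proof (intro ballI impI)
  fix V assume V: "V : phase j" "\<exists>i\<in>{1..j}. max R R' < norm (V i)"
  then obtain i where i: "i : {1..j}" "max R R' < norm (V i)" by blast
  show "q V * psi (restrict V {1..m}) = 0"
  proof (cases "i <= m")
   case True
   then have "\<exists>i\<in>{1..m}. R' < norm (restrict V {1..m} i)" using i by (intro bexI[of _ i]) auto
   then have "psi (restrict V {1..m}) = 0" using R' restrict_phase[of V m] unfolding supp_in_def by blast
   then show ?thesis by simp
  next
   case False
   then have "q V = 0" using assms(4)[OF V(1)] i by (metis One_nat_def Suc_eq_plus1 Suc_leI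
      atLeastAtMost_iff max_less_iff_conj not_le)
   then show ?thesis by simp
  qed
 qed
 then show ?thesis using assms by (auto simp: Cg_def compact_supp_iff intro!: C_diff_mult C_diff_lift)
qed

lemma Cg_frz:
 assumes "psi : Cg n K" "m <= n"
 shows "(%x. psi (frz m n x' x)) : Cg m K"
proof -
 obtain R where R: "supp_in n R psi" using Cg_supp[OF assms(1)] by blast
 have "supp_in m R (%x. psi (frz m n x' x))" unfolding supp_in_def
 proof (intro ballI impI)
  fix x :: velocities assume "\<exists>i\<in>{1..m}. R < norm (x i)"
  then obtain i where "i : {1..m}" "R < norm (x i)" by blast
  then have "\<exists>i\<in>{1..n}. R < norm (frz m n x' x i)" using assms(2) by (intro bexI[of _ i]) (auto simp: frz_apply)
  then show "psi (frz m n x' x) = 0" using R frz_phase[OF assms(2)] by (auto simp: supp_in_def)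
 qed
 then show ?thesis using assms by (auto simp: Cg_def compact_supp_iff intro!: C_diff_frz)
qed

section \<open>Quadratic test integrands and their countable families\<close>

definition quadL :: "((velocities => real) => velocities => real) => (velocities => real) => velocities => real" where
 "quadL L psi V = L psi V - (psi V)\<^sup>2 / 4"

locale diff_op =
 fixes m d :: nat and L :: "(velocities => real) => velocities => real" and K :: "nat set" and k0 :: nat
 assumes dop: "dop m d L" and k0: "k0 : K" "d <= k0"
begin

lemma Cg_d: "psi : Cg n K ==> C_diff n d psi" using Cg_C_diff k0 by blast

lemma L_cont: "psi : Cg n K ==> m <= n ==> C_diff n 0 (L psi)"
 using dop_C_diff[OF dop, of n 0 psi] Cg_d by simp

lemma quadL_meas: "psi : Cg n K ==> m <= n ==> quadL L psi : bmeas (velM {1..n})"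
 using C_diff_measurable[OF L_cont, of psi n] C_diff_measurable[OF Cg_d, of psi n]
 unfolding quadL_def[abs_def] by measurable

lemma Cg_bounds:
 assumes "psi : Cg n K" "m <= n"
 shows "\<exists>B\<ge>0. \<forall>V\<in>phase n. \<bar>psi V\<bar> <= B & \<bar>L psi V\<bar> <= B"
proof -
 obtain R where R: "supp_in n R psi" using Cg_supp[OF assms(1)] by blast
 obtain B where B: "B >= 0" "!!V. V : phase n ==> \<bar>psi V\<bar> <= B"
  by (rule supp_in_bounded[OF C_diff_continuous[OF Cg_d[OF assms(1)]] R]) (rule that)
 obtain B' where B': "B' >= 0" "!!V. V : phase n ==> \<bar>L psi V\<bar> <= B'"
  by (rule supp_in_bounded[OF C_diff_continuous[OF L_cont[OF assms]] dop_supp[OF dop assms(2) R]]) (rule that)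
 show ?thesis using B B' by (intro exI[of _ "max B B'"]) (auto simp: le_max_iff_disj)
qed

lemma quadL_bound:
 assumes "\<bar>psi V\<bar> <= B" "\<bar>L psi V\<bar> <= B"
 shows "\<bar>quadL L psi V\<bar> <= B + B\<^sup>2 / 4"
proof -
 have "(psi V)\<^sup>2 <= B\<^sup>2" using assms(1) by (metis abs_ge_zero abs_le_square_iff abs_of_nonneg order_trans)
 then show ?thesis using assms(2) zero_le_power2[of "psi V"] unfolding quadL_def abs_le_iff by linarith
qed

lemma sq_diff_bound:
 fixes a b :: real
 assumes "\<bar>a - b\<bar> <= e" "\<bar>a + b\<bar> <= B"
 shows "\<bar>a\<^sup>2 - b\<^sup>2\<bar> <= e * B"
proof -
 have "\<bar>a\<^sup>2 - b\<^sup>2\<bar> = \<bar>a - b\<bar> * \<bar>a + b\<bar>" by (simp add: power2_eq_square abs_mult[symmetric] algebra_simps)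
 also have "... <= e * B" using assms by (intro mult_mono) auto
 finally show ?thesis .
qed

lemma countable_tests:
 "\<exists>P. countable P & P <= Cg m K & (\<forall>psi\<in>Cg m K. \<forall>e>0. \<exists>phi\<in>P. \<forall>V\<in>phase m. \<bar>quadL L psi V - quadL L phi V\<bar> <= e)"
proof -
 define C where "C R = {psi\<in>Cg m K. supp_in m (real R) psi}" for R
 \<comment> \<open>Density is needed for the pair, since \<open>quadL\<close> involves
   \<open>psi\<close> and \<open>L psi\<close>. The support radius \<open>R\<close> is fixed first,
   so that only the compact set \<open>kset m (real R)\<close> matters.\<close>
 define h where "h = (%psi V. (psi V, L psi V))"
 have "\<exists>P\<subseteq>C R. countable P & (\<forall>psi\<in>C R. \<forall>e>0. \<exists>phi\<in>P. \<forall>V\<in>kset m (real R). dist (h psi V) (h phi V) < e)" for R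
 proof -
  have hc: "continuous_on (kset m (real R)) y" if yC: "y : h ` C R" for y
  proof -
   obtain psi where psi: "psi : Cg m K" "y = h psi" using yC unfolding C_def by blast
   have "continuous_on (phase m) y" unfolding psi(2) h_def
    by (intro continuous_on_Pair C_diff_continuous[OF Cg_d[OF psi(1)]]
      C_diff_continuous[OF L_cont[OF psi(1) order_refl]])
   then show ?thesis by (rule continuous_on_subset) (auto simp: kset_def)
  qed
  have "\<exists>Q. countable Q & Q <= h ` C R \<and>
    (\<forall>y\<in>h ` C R. \<forall>e>0. \<exists>q\<in>Q. \<forall>x\<in>kset m (real R). dist (y x) (q x) < e)"
   by (rule countable_dense_subfamily[OF compact_kset hc])
  then obtain Q where Q: "countable Q" "Q <= h ` C R"
   "\<forall>y\<in>h ` C R. \<forall>e>0. \<exists>q\<in>Q. \<forall>x\<in>kset m (real R). dist (y x) (q x) < e" by (elim exE conjE)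
  then have "\<exists>P. countable P & P <= C R & Q = h ` P"
   using countable_subset_image[of Q h "C R"] by blast
  then obtain P where P: "P <= C R" "countable P" "Q = h ` P" by (elim exE conjE)
  have "\<exists>phi\<in>P. \<forall>V\<in>kset m (real R). dist (h psi V) (h phi V) < e" if "psi : C R" "e > 0" for psi e
   using Q(3)[rule_format, OF imageI[OF that(1)] that(2)] unfolding P(3) by blast
  then show ?thesis using P(1,2) by (intro exI[of _ P]) simp
 qed
 then have "\<forall>R. \<exists>P. P <= C R & countable P \<and>
   (\<forall>psi\<in>C R. \<forall>e>0. \<exists>phi\<in>P. \<forall>V\<in>kset m (real R). dist (h psi V) (h phi V) < e)" by blast
 from choice[OF this] obtain P where P': "\<forall>R. P R <= C R & countable (P R) \<and>
   (\<forall>psi\<in>C R. \<forall>e>0. \<exists>phi\<in>P R. \<forall>V\<in>kset m (real R). dist (h psi V) (h phi V) < e)" by (elim exE)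
 then have P: "!!R. P R <= C R" "!!R. countable (P R)"
  "!!R psi e. psi : C R ==> e > 0 ==> \<exists>phi\<in>P R. \<forall>V\<in>kset m (real R). dist (h psi V) (h phi V) < e"
  by simp_all
 show ?thesis
 proof (intro exI[of _ "\<Union>R. P R"] conjI ballI allI impI)
  show "countable (\<Union>R. P R)" using P(2) by auto
  show "(\<Union>R. P R) <= Cg m K" using P(1) by (auto simp: C_def)
  fix psi and e :: real assume psi: "psi : Cg m K" and e: "e > 0"
  obtain R0 where "supp_in m R0 psi" using Cg_supp[OF psi] by blast
  then have "supp_in m (real (nat \<lceil>R0\<rceil>)) psi" by (rule supp_in_mono) linarith
  then obtain R where R: "psi : C R" using psi by (auto simp: C_def)
  obtain B where B: "B >= 0" "!!V. V : phase m ==> \<bar>psi V\<bar> <= B" using Cg_bounds[OF psi] by blast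
  \<comment> \<open>The linear term changes by at most \<open>\<epsilon>\<close> and the square by
    at most \<open>\<epsilon> * (2 * B + 1)\<close>, where the 1 bounds \<open>\<epsilon>\<close>
    itself; together this is at most \<open>e\<close>.\<close>
  define \<epsilon> where "\<epsilon> = min 1 (e / (2 + 2 * B))"
  have "\<epsilon> <= e / (2 + 2 * B)" by (simp add: \<epsilon>_def)
  then have "\<epsilon> * (2 + 2 * B) <= e" using B(1) by (subst (asm) pos_le_divide_eq) auto
  then have \<epsilon>: "\<epsilon> > 0" "\<epsilon> <= 1" "\<epsilon> * (2 + 2 * B) <= e"
   using e B(1) by (auto simp: \<epsilon>_def)
  obtain phi where phi: "phi : P R" "!!V. V : kset m (real R) ==> dist (h psi V) (h phi V) < \<epsilon>"
   using P(3)[OF R \<epsilon>(1)] by blast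
  have phiC: "phi : Cg m K" "supp_in m (real R) phi" using phi(1) P(1) by (auto simp: C_def)
  have "\<bar>quadL L psi V - quadL L phi V\<bar> <= e" if V: "V : phase m" for V
  proof (cases "V : kset m (real R)")
   case False
   have "supp_in m (real R) (L psi)" "supp_in m (real R) (L phi)"
    using dop_supp[OF dop order_refl] R phiC(2) by (auto simp: C_def)
   from this[THEN supp_in_0[OF _ V False]]
   have "L psi V = 0" "L phi V = 0" "psi V = 0" "phi V = 0"
    using R phiC(2) supp_in_0[OF _ V False] unfolding C_def by blast+
   then show ?thesis using e by (simp add: quadL_def)
  next
   case True
   have d: "\<bar>psi V - phi V\<bar> <= \<epsilon>" "\<bar>L psi V - L phi V\<bar> <= \<epsilon>"
    using phi(2)[OF True] dist_fst_le[of "h psi V" "h phi V"] dist_snd_le[of "h psi V" "h phi V"]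
    by (auto simp: h_def dist_real_def)
   have "\<bar>psi V + phi V\<bar> <= 2 * B + 1" using d(1) \<epsilon>(2) B(2)[OF V] by linarith
   from sq_diff_bound[OF d(1) this] have "\<bar>(psi V)\<^sup>2 - (phi V)\<^sup>2\<bar> <= \<epsilon> * (2 * B + 1)" .
   then have "\<bar>quadL L psi V - quadL L phi V\<bar> <= \<epsilon> + \<epsilon> * (2 * B + 1)"
    using d(2) unfolding quadL_def by argo
   then show ?thesis using \<epsilon>(3) by (simp add: algebra_simps)
  qed
  then show "\<exists>phi\<in>\<Union> (range P). \<forall>V\<in>phase m. \<bar>quadL L psi V - quadL L phi V\<bar> <= e" using phi(1) by blast
 qed
qed

text \<open>The combined test is the sum of the products of \<open>q l\<close> with
  \<open>psi l\<close>, on which \<open>L\<close> acts term by term. If \<open>q\<close> is close to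
  the unit vector with index \<open>l0\<close>, the sum and its image under \<open>L\<close> are
  close to those of \<open>psi l0\<close>; the factor \<open>2 * B\<close> in the constant handles
  the square.\<close>

lemma quadL_combine:
 assumes psi: "!!l. psi l : Cg m K"
 shows "\<exists>C\<ge>0. \<forall>j\<ge>m. \<forall>q. (\<forall>l\<le>(n::nat). q l : Qc m j) -->
   (\<exists>g\<in>quadL L ` Cg j K. \<forall>V\<in>phase j. \<forall>l0\<le>n. \<bar>g V - quadL L (psi l0) (restrict V {1..m})\<bar> \<le>
    C * (\<Sum>l\<le>n. \<bar>q l V - (if l = l0 then 1 else 0)\<bar>))"
proof -
 have "\<forall>l. \<exists>B\<ge>0. \<forall>V\<in>phase m. \<bar>psi l V\<bar> <= B & \<bar>L (psi l) V\<bar> <= B"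
  using Cg_bounds[OF psi order_refl] by blast
 from choice[OF this] obtain b where b: "!!l. b l >= 0"
  "!!l V. V : phase m ==> \<bar>psi l V\<bar> <= b l" "!!l V. V : phase m ==> \<bar>L (psi l) V\<bar> <= b l"
  by blast
 define B where "B = (\<Sum>l\<le>n. b l)"
 have B0: "B >= 0" using b(1) by (simp add: B_def sum_nonneg)
 have bB: "b l <= B" if "l <= n" for l unfolding B_def by (rule member_le_sum) (use that b(1) in auto)
 show ?thesis
 proof (intro exI[of _ "B + B * (2 * B) / 4"] conjI allI impI)
  show "0 <= B + B * (2 * B) / 4" using B0 by simp
  fix j and q :: "nat => velocities => real"
  assume j: "m <= j" and q: "\<forall>l\<le>n. q l : Qc m j"
  define \<Psi> where "\<Psi> = (%V. \<Sum>l\<le>n. q l V * psi l (restrict V {1..m}))"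
  have trm: "(%V. q l V * psi l (restrict V {1..m})) : Cg j K" if "l <= n" for l
  proof -
   have "q l : Qc m j" using q that by blast
   then obtain R where "!!V. \<exists>i\<in>{m+1..j}. norm (V i) > R ==> q l V = 0" "!!k. C_diff j k (q l)"
    unfolding Qc_def by blast
   then show ?thesis by (intro Cg_lift_mult[OF psi j]) auto
  qed
  have \<Psi>: "\<Psi> : Cg j K" unfolding \<Psi>_def by (rule Cg_sum) (use trm in auto)
  have L\<Psi>: "L \<Psi> V = (\<Sum>l\<le>n. q l V * L (psi l) (restrict V {1..m}))" if V: "V : phase j" for V
  proof -
   have "L \<Psi> V = (\<Sum>l\<le>n. L (%V. q l V * psi l (restrict V {1..m})) V)"
    unfolding \<Psi>_def by (rule dop_sum[OF dop j V]) (use Cg_d[OF trm] in auto)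
   also have "... = (\<Sum>l\<le>n. q l V * L (psi l) (restrict V {1..m}))"
   proof (rule sum.cong[OF refl])
    fix l assume "l : {..n}"
    then have ql: "q l : Qc m j" using q by auto
    have "L (%V. q l V * psi l (restrict V {1..m})) V = q l V * L (%V. psi l (restrict V {1..m})) V"
     by (rule dop_mult[OF _ dop j C_diff_lift[OF Cg_d[OF psi] j] V])
      (use ql in \<open>auto simp: Qc_def\<close>)
    then show "L (%V. q l V * psi l (restrict V {1..m})) V = q l V * L (psi l) (restrict V {1..m})"
     using dop_lift[OF dop order_refl j V] by simp
   qed
   finally show ?thesis .
  qed
  show "\<exists>g\<in>quadL L ` Cg j K. \<forall>V\<in>phase j. \<forall>l0\<le>n. \<bar>g V - quadL L (psi l0) (restrict V {1..m})\<bar> \<le>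
    (B + B * (2 * B) / 4) * (\<Sum>l\<le>n. \<bar>q l V - (if l = l0 then 1 else 0)\<bar>)"
  proof (rule bexI[OF _ imageI[OF \<Psi>]], intro ballI allI impI)
   fix V l0 assume V: "V : phase j" and l0: "l0 <= n"
   define \<sigma> where "\<sigma> = (\<Sum>l\<le>n. \<bar>q l V - (if l = l0 then 1 else 0)\<bar>)"
   let ?r = "restrict V {1..m}"
   have key: "\<bar>(\<Sum>l\<le>n. q l V * x l) - x l0\<bar> <= B * \<sigma>" if x: "!!l. l <= n ==> \<bar>x l\<bar> <= b l" for x
   proof -
    have "x l0 = (\<Sum>l\<le>n. if l = l0 then x l0 else 0)" using l0 by simp
    then have "(\<Sum>l\<le>n. q l V * x l) - x l0 = (\<Sum>l\<le>n. q l V * x l - (if l = l0 then x l0 else 0))"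
     by (simp only: sum_subtractf)
    also have "... = (\<Sum>l\<le>n. (q l V - (if l = l0 then 1 else 0)) * x l)"
     by (rule sum.cong) (auto simp: algebra_simps)
    also have "\<bar>...\<bar> <= (\<Sum>l\<le>n. \<bar>q l V - (if l = l0 then 1 else 0)\<bar> * B)"
     by (rule order_trans[OF sum_abs sum_mono])
      (use x bB in \<open>auto simp: abs_mult intro!: mult_left_mono intro: order_trans\<close>)
    finally show ?thesis by (simp add: \<sigma>_def sum_distrib_left mult.commute)
   qed
   have k1: "\<bar>(\<Sum>l\<le>n. q l V * L (psi l) ?r) - L (psi l0) ?r\<bar> <= B * \<sigma>"
    by (rule key) (rule b(3)[OF restrict_phase])
   have k2: "\<bar>\<Psi> V - psi l0 ?r\<bar> <= B * \<sigma>"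
    unfolding \<Psi>_def by (rule key) (rule b(2)[OF restrict_phase])
   have "\<bar>\<Psi> V\<bar> <= (\<Sum>l\<le>n. b l)" unfolding \<Psi>_def
   proof (rule order_trans[OF sum_abs sum_mono])
    fix l assume "l : {..n}"
    then have "0 <= q l V" "q l V <= 1" using q by (auto simp: Qc_def)
    then have "\<bar>q l V * psi l ?r\<bar> <= 1 * \<bar>psi l ?r\<bar>" by (simp add: abs_mult mult_left_le_one_le)
    then show "\<bar>q l V * psi l ?r\<bar> <= b l" using b(2)[OF restrict_phase[of V m], of l] by simp
   qed
   then have "\<bar>\<Psi> V + psi l0 ?r\<bar> <= 2 * B"
    using b(2)[OF restrict_phase[of V m], of l0] bB[OF l0] unfolding B_def by linarith
   from sq_diff_bound[OF k2 this] have "\<bar>(\<Psi> V)\<^sup>2 - (psi l0 ?r)\<^sup>2\<bar> <= B * \<sigma> * (2 * B)" .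
   then have "\<bar>quadL L \<Psi> V - quadL L (psi l0) ?r\<bar> <= B * \<sigma> + B * \<sigma> * (2 * B) / 4"
    using k1 unfolding quadL_def L\<Psi>[OF V] by argo
   also have "... = (B + B * (2 * B) / 4) * \<sigma>" by (simp add: algebra_simps)
   finally show "\<bar>quadL L \<Psi> V - quadL L (psi l0) ?r\<bar> <= (B + B * (2 * B) / 4) *
     (\<Sum>l\<le>n. \<bar>q l V - (if l = l0 then 1 else 0)\<bar>)" by (simp only: \<sigma>_def)
  qed
 qed
qed

text \<open>Regarded as a function of \<open>Suc j\<close> particles, \<open>psi\<close> loses its
  compact support. A cutoff in the last particle restores it, and \<open>L\<close> treats the cutoff
  as a constant because \<open>m \<le> j\<close>.\<close>

lemma quadL_extend:
 assumes psi: "psi : Cg j K" and j: "m <= j"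
 shows "\<exists>h B. \<forall>p::nat. h p : quadL L ` Cg (Suc j) K \<and>
   (\<forall>V\<in>phase (Suc j). \<bar>h p V\<bar> <= B & (%p. h p V) ----> quadL L psi (restrict V {1..j}))"
proof -
 obtain B where B: "B >= 0" "!!V. V : phase j ==> \<bar>psi V\<bar> <= B" "!!V. V : phase j ==> \<bar>L psi V\<bar> <= B"
  using Cg_bounds[OF psi j] by blast
 define c where "c = (%p V. cut {Suc j} p V)"
 define \<Psi> where "\<Psi> p = (%V. c p V * psi (restrict V {1..j}))" for p
 have \<Psi>: "\<Psi> p : Cg (Suc j) K" for p unfolding \<Psi>_def c_def
  by (rule Cg_lift_mult[OF psi _ C_diff_cut, where R="3 * real p"])
   (auto intro!: cut_zero[of "Suc j"] simp: le_Suc_eq)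
 have L\<Psi>: "L (\<Psi> p) V = c p V * L psi (restrict V {1..j})" if V: "V : phase (Suc j)" for p V
 proof -
  have "L (\<Psi> p) V = c p V * L (%V. psi (restrict V {1..j})) V" unfolding \<Psi>_def
   by (rule dop_mult[OF _ dop _ C_diff_lift[OF Cg_d[OF psi]] V]) (use j in \<open>auto simp: c_def intro: cut_cong\<close>)
  then show ?thesis using dop_lift[OF dop j _ V, of psi] by simp
 qed
 have cr: "0 <= c p V" "c p V <= 1" for p V by (auto simp: c_def cut_range)
 have cl: "(%p. c p V) ----> 1" for V by (simp add: c_def cut_limit)
 have mb: "\<bar>c p V * x\<bar> <= B" if "\<bar>x\<bar> <= B" for p V x
  using mult_left_le_one_le[of "\<bar>x\<bar>" "c p V"] cr[of p V] that by (simp add: abs_mult)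
 show ?thesis
 proof (intro exI[of _ "%p. quadL L (\<Psi> p)"] exI[of _ "B + B\<^sup>2 / 4"] allI conjI ballI)
  show "quadL L (\<Psi> p) : quadL L ` Cg (Suc j) K" for p using \<Psi> by blast
  fix p V assume V: "V : phase (Suc j)"
  show "\<bar>quadL L (\<Psi> p) V\<bar> <= B + B\<^sup>2 / 4"
  proof (rule quadL_bound)
   show "\<bar>\<Psi> p V\<bar> <= B" unfolding \<Psi>_def by (rule mb[OF B(2)[OF restrict_phase]])
   show "\<bar>L (\<Psi> p) V\<bar> <= B" unfolding L\<Psi>[OF V] by (rule mb[OF B(3)[OF restrict_phase]])
  qed
  have "(%p. c p V * L psi (restrict V {1..j}) - (c p V * psi (restrict V {1..j}))\<^sup>2 / 4)
   ----> 1 * L psi (restrict V {1..j}) - (1 * psi (restrict V {1..j}))\<^sup>2 / 4"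
   by (intro tendsto_intros cl) simp
  then show "(%p. quadL L (\<Psi> p) V) ----> quadL L psi (restrict V {1..j})"
   unfolding quadL_def L\<Psi>[OF V] unfolding \<Psi>_def by simp
 qed
qed

end

lemma (in mixing) diff_op_family:
 assumes "diff_op m d L K k0"
 shows "\<exists>G. test_family \<nu> (%j. quadL L ` Cg j K) m G"
proof -
 interpret D: diff_op m d L K k0 by fact
 obtain P where P: "countable P" "P <= Cg m K"
  "\<forall>psi\<in>Cg m K. \<forall>e>0. \<exists>phi\<in>P. \<forall>V\<in>phase m. \<bar>quadL L psi V - quadL L phi V\<bar> <= e"
  using D.countable_tests by blast
 have Pne: "P ~= {}" using P(3) Cg_zero[of m K] zero_less_one by blast
 define ps where "ps l = (case l of 0 => (%V. 0) | Suc i => from_nat_into P i)" for l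
 have ps: "ps l : Cg m K" for l using P(2) from_nat_into[OF Pne] by (auto simp: ps_def Cg_zero split: nat.split)
 have psP: "\<exists>l. phi = ps l" if phiP: "phi : P" for phi
 proof -
  obtain i where "phi = from_nat_into P i" using from_nat_into_surj[OF P(1) phiP] by metis
  then show ?thesis by (intro exI[of _ "Suc i"]) (simp add: ps_def)
 qed
 have "test_family \<nu> (%j. quadL L ` Cg j K) m (%l. quadL L (ps l))"
 proof
  fix j g assume j: "m <= j" and "g : quadL L ` Cg j K"
  then obtain psi where psi: "psi : Cg j K" "g = quadL L psi" by blast
  show "g : bmeas (velM {1..j})" using D.quadL_meas[OF psi(1) j] psi(2) by simp
  show "\<exists>B. \<forall>V\<in>phase j. \<bar>g V\<bar> <= B"
   using D.Cg_bounds[OF psi(1) j] D.quadL_bound[of psi] unfolding psi(2) by blast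
  show "\<exists>h B. \<forall>p::nat. h p : quadL L ` Cg (Suc j) K \<and>
   (\<forall>V\<in>phase (Suc j). \<bar>h p V\<bar> <= B & (%p. h p V) ----> g (restrict V {1..j}))"
   unfolding psi(2) by (rule D.quadL_extend[OF psi(1) j])
  show "\<exists>h\<in>quadL L ` Cg m K. \<forall>x\<in>phase m. h x = g (frz m j x' x)" for x'
   using dop_frz[OF D.dop j, of _ psi x']
   by (intro bexI[OF _ imageI[OF Cg_frz[OF psi(1) j, of x']]]) (auto simp: psi(2) quadL_def)
 next
  show "quadL L (ps l) : quadL L ` Cg m K" for l using ps by blast
  show "\<forall>V\<in>phase m. quadL L (ps 0) V = 0" using dop_zero[OF D.dop order_refl] by (simp add: ps_def quadL_def)
  show "\<exists>C\<ge>0. \<forall>j\<ge>m. \<forall>q. (\<forall>l\<le>n. q l : Qc m j) -->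
   (\<exists>g\<in>quadL L ` Cg j K. \<forall>V\<in>phase j. \<forall>l0\<le>n. \<bar>g V - quadL L (ps l0) (restrict V {1..m})\<bar> \<le>
    C * (\<Sum>l\<le>n. \<bar>q l V - (if l = l0 then 1 else 0)\<bar>))" for n by (rule D.quadL_combine[OF ps])
  fix \<rho> g assume \<rho>: "\<rho> : space \<nu>" and "g : quadL L ` Cg m K"
  then obtain psi where psi: "psi : Cg m K" "g = quadL L psi" by blast
  interpret T: prob_space "tensor m \<rho>" by (rule prob_tensor[OF \<rho>])
  have sp: "space (tensor m \<rho>) = phase m" using sets_eq_imp_space_eq[OF sets_tensor[OF \<rho>]] by (simp add: space_velM)
  have int: "integrable (tensor m \<rho>) (quadL L phi)" if phi: "phi : Cg m K" for phi
  proof -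
   obtain B where B: "\<forall>V\<in>phase m. \<bar>phi V\<bar> <= B & \<bar>L phi V\<bar> <= B" using D.Cg_bounds[OF phi] by blast
   show ?thesis
   proof (rule T.integrable_bounded[where B="B + B\<^sup>2 / 4"])
    show "quadL L phi : bmeas (tensor m \<rho>)"
     using D.quadL_meas[OF phi] by (simp add: measurable_cong_sets[OF sets_tensor[OF \<rho>] refl])
    show "\<bar>quadL L phi V\<bar> <= B + B\<^sup>2 / 4" if "V : space (tensor m \<rho>)" for V
     using B that sp by (intro D.quadL_bound) auto
   qed
  qed
  let ?S = "SUP l. ennreal (\<integral>V. quadL L (ps l) V \<partial>tensor m \<rho>)"
  show "ennreal (\<integral>V. g V \<partial>tensor m \<rho>) <= ?S"
  proof (rule ennreal_le_epsilon)
   fix e :: real assume e: "0 < e"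
   obtain phi where phi: "phi : P" "\<forall>V\<in>phase m. \<bar>quadL L psi V - quadL L phi V\<bar> <= e"
    using P(3) psi(1) e by blast
   obtain l where l: "phi = ps l" using psP[OF phi(1)] by blast
   have "(\<integral>V. g V \<partial>tensor m \<rho>) <= (\<integral>V. quadL L (ps l) V + e \<partial>tensor m \<rho>)"
    using phi(2) unfolding psi(2) l
    by (intro integral_mono int[OF psi(1)] Bintegrable_add int[OF ps])
     (auto simp: sp abs_le_iff algebra_simps)
   also have "... = (\<integral>V. quadL L (ps l) V \<partial>tensor m \<rho>) + e"
    by (subst Bintegral_add[OF int[OF ps]]) (auto simp: T.prob_space)
   finally have "ennreal (\<integral>V. g V \<partial>tensor m \<rho>) <= ennreal ((\<integral>V. quadL L (ps l) V \<partial>tensor m \<rho>) + e)"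
    by (rule ennreal_leI)
   also have "... <= ennreal (\<integral>V. quadL L (ps l) V \<partial>tensor m \<rho>) + ennreal e"
    using e by (cases "(\<integral>V. quadL L (ps l) V \<partial>tensor m \<rho>) >= 0") (auto simp: ennreal_neg intro!: ennreal_leI)
   also have "... <= ?S + ennreal e" by (intro add_right_mono SUP_upper) auto
   finally show "ennreal (\<integral>V. g V \<partial>tensor m \<rho>) <= ?S + ennreal e" .
  qed
 qed
 then show ?thesis by blast
qed

text \<open>By duality this is the squared L2 norm with respect to \<open>F\<close> of the function
  that represents the functional sending \<open>psi\<close> to the integral of \<open>L psi\<close>,
  and it is infinite if no such function exists. The factor 1/4 in \<open>quadL\<close> is the
  matching normalisation.\<close>

definition sup_quad :: "((velocities => real) => velocities => real) => nat set => nat => velocities measure => ennreal" where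
 "sup_quad L K n F = (SUP psi\<in>Cg n K. ennreal (\<integral>V. quadL L psi V \<partial>F))"

context mixing begin

lemma sup_quad_mixture:
 assumes "diff_op m d L K k0"
 shows sup_quad_measurable: "(%\<rho>. sup_quad L K m (tensor m \<rho>)) : bmeas \<nu>"
  and sup_quad_limit: "(%j. sup_quad L K j (mixture j \<nu>)) ----> (\<integral>\<^sup>+\<rho>. sup_quad L K m (tensor m \<rho>) \<partial>\<nu>)"
  and sup_quad_mono: "!!i j. m <= i ==> i <= j ==>
   sup_quad L K i (mixture i \<nu>) <= sup_quad L K j (mixture j \<nu>)"
proof -
 obtain G where "test_family \<nu> (%j. quadL L ` Cg j K) m G" using diff_op_family[OF assms] by blast
 then interpret F: test_family \<nu> "%j. quadL L ` Cg j K" m G .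
 have e: "F.S j F = sup_quad L K j F" for j F by (simp add: F.S_def sup_quad_def image_image)
 show "(%\<rho>. sup_quad L K m (tensor m \<rho>)) : bmeas \<nu>" using F.S_meas by (simp add: e)
 show "(%j. sup_quad L K j (mixture j \<nu>)) ----> (\<integral>\<^sup>+\<rho>. sup_quad L K m (tensor m \<rho>) \<partial>\<nu>)"
  using F.S_limit by (simp add: e)
 show "sup_quad L K i (mixture i \<nu>) <= sup_quad L K j (mixture j \<nu>)" if "m <= i" "i <= j" for i j
  using F.S_mono[OF that] by (simp add: e)
qed

end

section \<open>The functionals $D$ and $\mathcal{K}$\<close>

lemma C_diff_b_vec: "C_diff n k (%V. b_vec l V $ u)"
proof -
 have e: "(%V. b_vec l V $ 1) = (%V. axis l 1 $ 2 * (V 1 $ 3 - V 2 $ 3) - (V 1 $ 2 - V 2 $ 2) * axis l 1 $ 3)"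
  "(%V. b_vec l V $ 2) = (%V. axis l 1 $ 3 * (V 1 $ 1 - V 2 $ 1) - (V 1 $ 3 - V 2 $ 3) * axis l 1 $ 1)"
  "(%V. b_vec l V $ 3) = (%V. axis l 1 $ 1 * (V 1 $ 2 - V 2 $ 2) - (V 1 $ 1 - V 2 $ 1) * axis l 1 $ 2)"
  by (auto simp: b_vec_def cross3_def fun_eq_iff)
 have "u = 1 \<or> u = 2 \<or> u = 3" by (rule exhaust_3)
 then show ?thesis by (elim disjE; hypsubst; unfold e; intro C_diff_diff C_diff_mult C_diff_const C_diff_coord)
qed

lemma b_vec_local: "(!!i. i : {1..2} ==> V i = W i) ==> b_vec l V = b_vec l W"
 by (simp add: b_vec_def)

lemma dop_coeff_partial:
 assumes "!!n k. m <= n ==> C_diff n k c" "!!V W. (!!i. i : {1..m} ==> V i = W i) ==> c V = c W"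
  and "i : {1..m}"
 shows "dop m 1 (%psi V. c V * partial i u psi V)"
 using dop.comp[OF dop.mult[of m c, OF assms(1,2)] dop.partial[OF assms(3), of u]] by simp

lemma dop_b_deriv: "dop 2 1 (b_deriv l)"
proof -
 have t1: "dop 2 1 (%psi V. b_vec l V $ u * partial 1 u psi V)" for u
  by (rule dop_coeff_partial) (auto simp: C_diff_b_vec intro: arg_cong[OF b_vec_local, of _ _ "%x. x $ u"])
 have t2: "dop 2 1 (%psi V. (- b_vec l V $ u) * partial 2 u psi V)" for u
 proof (rule dop_coeff_partial)
  show "C_diff n k (%V. - b_vec l V $ u)" for n k by (intro C_diff_minus C_diff_b_vec)
  show "- b_vec l V $ u = - b_vec l W $ u" if "!!i. i : {1..2} ==> V i = W i" for V W
   using b_vec_local[OF that] by simp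
 qed auto
 have e: "b_deriv l = (%psi V.
   ((b_vec l V $ 1 * partial 1 1 psi V + b_vec l V $ 2 * partial 1 2 psi V) + b_vec l V $ 3 * partial 1 3 psi V) +
   (((- b_vec l V $ 1) * partial 2 1 psi V + (- b_vec l V $ 2) * partial 2 2 psi V) + (- b_vec l V $ 3) * partial 2 3 psi V))"
  by (intro ext) (simp add: b_deriv_def grad_def inner_vec_def sum_3)
 show ?thesis unfolding e by (intro dop.add t1 t2)
qed

section \<open>Radial coefficients and the operators of the two dissipations\<close>

definition rad :: "(real => real) => velocities => real" where
 "rad g V = g (norm (V 1 - V 2))"

lemma C_diff_rad: "smooth_radial g ==> 2 <= n ==> C_diff n k (rad g)"
 unfolding rad_def[abs_def] smooth_radial_def by (rule C_diff_rel[where g="%x. g (norm x)"]) auto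

lemma rad_local: "(!!i. i : {1..2} ==> V i = W i) ==> rad g V = rad g W"
 by (simp add: rad_def)

lemma dop_rad: "smooth_radial g ==> dop 2 0 (%psi V. rad g V * psi V)"
 by (rule dop.mult) (auto intro: C_diff_rad rad_local)

lemma smooth_radial_mult: "smooth_radial f ==> smooth_radial g ==> smooth_radial (%r. f r * g r)"
 unfolding smooth_radial_def by (auto intro: C_diff_mult)

lemma smooth_radial_powr: "smooth_radial f ==> (!!r. r >= 0 ==> f r > 0) ==> smooth_radial (%r. f r powr s)"
 unfolding smooth_radial_def by (auto intro!: C_diff_powr)

text \<open>Smoothness is given for a function on \<open>real^3\<close>. Along the first axis
  through a point at distance \<open>r > 0\<close> the norm is \<open>r + t\<close> for small
  \<open>t\<close>, which yields the derivative in one variable.\<close>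

lemma smooth_radial_deriv:
 assumes "smooth_radial g" "r > 0"
 shows "(g has_real_derivative deriv g r) (at r)"
proof -
 define V :: velocities where "V = (\<lambda>i\<in>{1..1}. r *\<^sub>R axis 1 1)"
 have V: "V : phase 1" by (auto simp: V_def phase_def)
 have C: "C_diff 1 (Suc 0) (%V. g (norm (V 1)))" using assms by (auto simp: smooth_radial_def)
 have "((%t. g (norm (mv V 1 1 t 1))) has_real_derivative partial 1 1 (%V. g (norm (V 1))) V) (at 0)" (is "(_ has_real_derivative ?D) _")
  by (rule slice_has_derivative0[OF C V]) simp
 moreover have "norm (mv V 1 1 t 1) = \<bar>r + t\<bar>" for t
 proof -
  have "mv V 1 1 t 1 = (r + t) *\<^sub>R axis 1 1" by (simp add: mv_def V_def scaleR_add_left)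
  then show ?thesis by simp
 qed
 ultimately have "((%t. g \<bar>r + t\<bar>) has_real_derivative ?D) (at 0)" by simp
 then have "((%t. g (r + t)) has_real_derivative ?D) (at 0)"
 proof (rule DERIV_cong_ev[THEN iffD1, OF refl _ refl, rotated])
  have "eventually (%t. - r < t) (nhds 0)"
   using assms(2) by (intro eventually_nhds_in_open[of "{-r<..}", simplified]) auto
  then show "eventually (%t. g \<bar>r + t\<bar> = g (r + t)) (nhds 0)" by eventually_elim simp
 qed
 then have "(g has_real_derivative ?D) (at r)" using DERIV_shift[of g ?D 0 r] by (simp add: add.commute)
 then show ?thesis using DERIV_imp_deriv by metis
qed

lemma norm_axis_deriv:
 fixes w :: "real^3"
 assumes "w ~= 0"
 shows "((%t. norm (w + t *\<^sub>R axis u 1)) has_real_derivative w $ u / norm w) (at 0)"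
proof -
 have e: "norm (w + t *\<^sub>R axis u 1) = sqrt (w \<bullet> w + 2 * t * w $ u + t * t)" for t
  by (simp add: norm_eq_sqrt_inner inner_add_left inner_add_right inner_axis inner_commute[of "axis u 1" w]
    inner_axis_axis algebra_simps)
 have "((%t. sqrt (q + 2 * t * c + t * t)) has_real_derivative c / sqrt q) (at 0)" if "q > 0" for q c :: real
  using that by (auto intro!: derivative_eq_intros simp: field_simps)
 from this[of "w \<bullet> w" "w $ u"] show ?thesis using assms unfolding e unfolding norm_eq_sqrt_inner by simp
qed

lemma rad_slice:
 assumes g: "smooth_radial g" and w: "V 1 ~= V 2"
 shows "((%t. rad g (mv V 1 u t)) has_real_derivative
   deriv g (norm (V 1 - V 2)) * ((V 1 - V 2) $ u / norm (V 1 - V 2))) (at 0)"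
  and "((%t. rad g (mv V 2 u t)) has_real_derivative
   deriv g (norm (V 1 - V 2)) * (- ((V 1 - V 2) $ u / norm (V 1 - V 2)))) (at 0)"
proof -
 have w0: "V 1 - V 2 ~= 0" using w by simp
 have e1: "rad g (mv V 1 u t) = g (norm ((V 1 - V 2) + t *\<^sub>R axis u 1))" for t by (simp add: rad_def mv_def algebra_simps)
 have e2: "rad g (mv V 2 u t) = g (norm ((V 2 - V 1) + t *\<^sub>R axis u 1))" for t
  by (simp add: rad_def mv_def norm_minus_commute[of "V 1"] algebra_simps)
 show "((%t. rad g (mv V 1 u t)) has_real_derivative
   deriv g (norm (V 1 - V 2)) * ((V 1 - V 2) $ u / norm (V 1 - V 2))) (at 0)" unfolding e1
  by (rule DERIV_chain2[OF _ norm_axis_deriv[OF w0]])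
   (use smooth_radial_deriv[OF g, of "norm (V 1 - V 2)"] w in simp)
 have w1: "V 2 - V 1 ~= 0" using w by simp
 have "((%t. rad g (mv V 2 u t)) has_real_derivative
   deriv g (norm (V 2 - V 1)) * ((V 2 - V 1) $ u / norm (V 2 - V 1))) (at 0)" unfolding e2
  by (rule DERIV_chain2[OF _ norm_axis_deriv[OF w1]])
   (use smooth_radial_deriv[OF g, of "norm (V 2 - V 1)"] w in simp)
 moreover have eq: "(V 2 - V 1) $ u / norm (V 2 - V 1) = - ((V 1 - V 2) $ u / norm (V 1 - V 2))"
  by (simp add: norm_minus_commute[of "V 2"] minus_divide_left)
 ultimately show "((%t. rad g (mv V 2 u t)) has_real_derivative
   deriv g (norm (V 1 - V 2)) * (- ((V 1 - V 2) $ u / norm (V 1 - V 2)))) (at 0)"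
  unfolding eq unfolding norm_minus_commute[of "V 2" "V 1"] by blast
qed

text \<open>The rotation fields \<open>b_k\<close> annihilate functions of the relative speed.\<close>

lemma b_deriv_rad:
 assumes g: "smooth_radial g" and n: "2 <= n" and f: "C_diff n 1 f" and V: "V : phase n"
 shows "b_deriv l (%V. rad g V * f V) V = rad g V * b_deriv l f V"
proof (cases "V 1 = V 2")
 \<comment> \<open>On the diagonal the norm is not differentiable, but there \<open>b_vec\<close>
   vanishes, so both sides are 0.\<close>
 case True
 then have "b_vec l V = 0" by (simp add: b_vec_def)
 then show ?thesis by (simp add: b_deriv_def)
next
 case False
 define w where "w = V 1 - V 2"
 define c where "c = deriv g (norm w) / norm w"
 have f': "C_diff n (Suc 0) f" using f by (simp add: One_nat_def)
 have fs: "((%t. f (mv V i u t)) has_real_derivative partial i u f V) (at 0)" if "i : {1, 2}" for i u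
  by (rule slice_has_derivative0[OF f' V]) (use that n in auto)
 have 1: "partial 1 u (%V. rad g V * f V) V = c * f V * w $ u + rad g V * partial 1 u f V" for u
  by (rule partialI, rule DERIV_cong[OF DERIV_mult[OF rad_slice(1)[OF g False] fs]])
   (auto simp: c_def w_def algebra_simps)
 have 2: "partial 2 u (%V. rad g V * f V) V = - (c * f V * w $ u) + rad g V * partial 2 u f V" for u
  by (rule partialI, rule DERIV_cong[OF DERIV_mult[OF rad_slice(2)[OF g False] fs]])
   (auto simp: c_def w_def algebra_simps)
 have g1: "grad 1 (%V. rad g V * f V) V = (c * f V) *\<^sub>R w + rad g V *\<^sub>R grad 1 f V"
  by (simp add: vec_eq_iff grad_def 1)
 have g2: "grad 2 (%V. rad g V * f V) V = - ((c * f V) *\<^sub>R w) + rad g V *\<^sub>R grad 2 f V"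
  by (simp add: vec_eq_iff grad_def 2)
 have "b_vec l V \<bullet> w = 0" unfolding b_vec_def w_def by (simp add: dot_cross_self)
 then show ?thesis unfolding b_deriv_def g1 g2 by (simp add: inner_add_right algebra_simps)
qed

definition Ld :: "(real => real) => 3 => (velocities => real) => velocities => real" where
 "Ld a l psi V = sqrt (a (norm (V 1 - V 2))) * b_deriv l psi V"

definition Lk :: "(real => real) => (real => real) => 3 => (velocities => real) => velocities => real" where
 "Lk a \<theta> l psi = cut_deriv a \<theta> l (cut_deriv a \<theta> l psi)"

lemma D_reg_sup_quad: "D_reg a n F = ennreal (1 / 2) * (\<Sum>l\<in>UNIV. sup_quad (Ld a l) {1} n F)"
 by (simp add: D_reg_def sup_quad_def Cc_eq quadL_def Ld_def)

lemma K_reg_sup_quad: "K_reg a n F = (SUP \<theta>\<in>cutoffs. \<Sum>l\<in>UNIV. sup_quad (Lk a \<theta> l) {2} n F)"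
 by (simp add: K_reg_def sup_quad_def Cc_eq quadL_def Lk_def)

definition pos_radial :: "(real => real) => bool" where
 "pos_radial a \<longleftrightarrow> smooth_radial a & (\<forall>r\<ge>0. a r > 0)"

lemma pos_radial_powr: "pos_radial a ==> smooth_radial (%r. a r powr s)"
 unfolding pos_radial_def by (auto intro: smooth_radial_powr)

lemma Ld_eq: "pos_radial a ==> Ld a l psi V = rad (%r. a r powr (1 / 2)) V * b_deriv l psi V"
 by (auto simp: Ld_def rad_def pos_radial_def powr_half_sqrt less_imp_le)

lemma Ld_diff_op: "pos_radial a ==> diff_op 2 1 (Ld a l) {1} 1"
proof
 assume a: "pos_radial a"
 have "Ld a l = (%psi. (%psi V. rad (%r. a r powr (1 / 2)) V * psi V) (b_deriv l psi))"
  by (intro ext) (simp add: Ld_eq[OF a])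
 then show "dop 2 1 (Ld a l)" using dop.comp[OF dop_rad[OF pos_radial_powr[OF a, of "1/2"]] dop_b_deriv[of l]] by simp
qed auto

text \<open>The radial coefficient of \<open>cut_deriv\<close>. Since \<open>b_deriv\<close> treats
  radial functions as constants, \<open>Lk\<close> equals the square of this coefficient times two
  applications of \<open>b_deriv\<close>.\<close>

definition hk :: "(real => real) => (real => real) => real => real" where
 "hk a \<theta> r = \<theta> r * a r powr (1 / 4)"

lemma smooth_hk: "pos_radial a ==> smooth_radial \<theta> ==> smooth_radial (hk a \<theta>)"
 unfolding hk_def[abs_def] by (intro smooth_radial_mult pos_radial_powr)

lemma cut_deriv_eq: "cut_deriv a \<theta> l psi V = rad (hk a \<theta>) V * b_deriv l psi V"
 by (simp add: cut_deriv_def rad_def hk_def)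

lemma dop_cut_deriv:
 assumes "pos_radial a" "smooth_radial \<theta>"
 shows "dop 2 1 (cut_deriv a \<theta> l)"
proof -
 have "cut_deriv a \<theta> l = (%psi. (%psi V. rad (hk a \<theta>) V * psi V) (b_deriv l psi))"
  by (intro ext) (simp add: cut_deriv_eq)
 then show ?thesis using dop.comp[OF dop_rad[OF smooth_hk[OF assms]] dop_b_deriv[of l]] by simp
qed

lemma Lk_diff_op: "pos_radial a ==> smooth_radial \<theta> ==> diff_op 2 2 (Lk a \<theta> l) {2} 2"
proof
 assume "pos_radial a" "smooth_radial \<theta>"
 from dop.comp[OF dop_cut_deriv[OF this, of l] dop_cut_deriv[OF this, of l]]
 show "dop 2 2 (Lk a \<theta> l)" by (simp add: Lk_def[abs_def])
qed auto

lemma Lk_eq: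
 assumes a: "pos_radial a" "smooth_radial \<theta>" and n: "2 <= n" and f: "C_diff n 2 f" and V: "V : phase n"
 shows "Lk a \<theta> l f V = (rad (hk a \<theta>) V)\<^sup>2 * b_deriv l (b_deriv l f) V"
proof -
 have b: "C_diff n 1 (b_deriv l f)" using dop_C_diff[OF dop_b_deriv n, of 1 f l] f by simp
 have "b_deriv l (cut_deriv a \<theta> l f) V = b_deriv l (%V. rad (hk a \<theta>) V * b_deriv l f V) V"
  by (rule dop_cong[OF dop_b_deriv n _ V]) (rule cut_deriv_eq)
 also have "... = rad (hk a \<theta>) V * b_deriv l (b_deriv l f) V" by (rule b_deriv_rad[OF smooth_hk[OF a] n b V])
 finally show ?thesis unfolding Lk_def cut_deriv_eq[of a \<theta> l "cut_deriv a \<theta> l f"] by (simp add: power2_eq_square)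
qed

lemma bb_rad:
 assumes g: "smooth_radial g" and n: "2 <= n" and f: "C_diff n 2 f" and V: "V : phase n"
 shows "b_deriv l (b_deriv l (%V. rad g V * f V)) V = rad g V * b_deriv l (b_deriv l f) V"
proof -
 have f1: "C_diff n 1 f" using f by (rule C_diff_mono) simp
 have b: "C_diff n 1 (b_deriv l f)" using dop_C_diff[OF dop_b_deriv n, of 1 f l] f by simp
 have "b_deriv l (b_deriv l (%V. rad g V * f V)) V = b_deriv l (%V. rad g V * b_deriv l f V) V"
  by (rule dop_cong[OF dop_b_deriv n _ V]) (rule b_deriv_rad[OF g n f1])
 also have "... = rad g V * b_deriv l (b_deriv l f) V" by (rule b_deriv_rad[OF g n b V])
 finally show ?thesis .
qed

section \<open>Comparison of suprema for different kernels and cutoffs\<close>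

definition law :: "nat => velocities measure => bool" where
 "law n F \<longleftrightarrow> prob_space F & sets F = sets (velM {1..n})"

lemma law_space: "law n F ==> space F = phase n"
 using sets_eq_imp_space_eq[of F "velM {1..n}"] by (simp add: law_def space_velM)

lemma (in diff_op) quadL_integrable:
 assumes "law n F" "psi : Cg n K" "m <= n"
 shows "integrable F (quadL L psi)"
proof -
 interpret F: prob_space F using assms by (simp add: law_def)
 obtain B where B: "\<forall>V\<in>phase n. \<bar>psi V\<bar> <= B & \<bar>L psi V\<bar> <= B" using Cg_bounds[OF assms(2,3)] by blast
 show ?thesis
 proof (rule F.integrable_bounded[where B="B + B\<^sup>2 / 4"])
  show "quadL L psi : bmeas F"
   using quadL_meas[OF assms(2,3)] assms(1) by (simp add: law_def measurable_cong_sets[of F "velM {1..n}"])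
  show "\<bar>quadL L psi V\<bar> <= B + B\<^sup>2 / 4" if "V : space F" for V
   using B that law_space[OF assms(1)] by (intro quadL_bound) auto
 qed
qed

text \<open>Comparison principle: a test for \<open>L\<close> is traded for tests of
  \<open>L' p\<close> whose integrands are pointwise larger up to an error that vanishes as
  \<open>p\<close> grows; integrating against a probability preserves this.\<close>

lemma sup_quad_le:
 assumes L: "diff_op m d L K k0" and L': "!!p. diff_op m d (L' p) K k0" and F: "law n F" and n: "m <= n"
  and c: "!!psi. psi : Cg n K ==> \<exists>psi' e. (\<forall>p::nat. psi' p : Cg n K \<and>
   (\<forall>V\<in>phase n. quadL L psi V <= quadL (L' p) (psi' p) V + e p)) & e ----> 0"
 shows "sup_quad L K n F <= (SUP p. sup_quad (L' p) K n F)" unfolding sup_quad_def[of L]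
proof (rule SUP_least)
 interpret F: prob_space F using F by (simp add: law_def)
 fix psi assume psi: "psi : Cg n K"
 obtain psi' e where c': "!!p. psi' p : Cg n K" "!!p V. V : phase n ==> quadL L psi V <= quadL (L' p) (psi' p) V + e p"
  "e ----> 0" using c[OF psi] by blast
 note i = diff_op.quadL_integrable[OF L F psi n]
 note i' = diff_op.quadL_integrable[OF L' F c'(1) n]
 have le: "(\<integral>V. quadL L psi V \<partial>F) - e p <= (\<integral>V. quadL (L' p) (psi' p) V \<partial>F)" for p
 proof -
  have "(\<integral>V. quadL L psi V \<partial>F) <= (\<integral>V. quadL (L' p) (psi' p) V + e p \<partial>F)"
   by (rule integral_mono[OF i Bintegrable_add[OF i']])
    (use c'(2) law_space[OF F] in auto)
  also have "... = (\<integral>V. quadL (L' p) (psi' p) V \<partial>F) + e p"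
   by (subst Bintegral_add[OF i']) (auto simp: F.prob_space)
  finally show ?thesis by simp
 qed
 let ?S = "SUP p. sup_quad (L' p) K n F"
 have "ennreal ((\<integral>V. quadL L psi V \<partial>F) - e p) <= ?S" for p
 proof -
  have "ennreal ((\<integral>V. quadL L psi V \<partial>F) - e p) <= ennreal (\<integral>V. quadL (L' p) (psi' p) V \<partial>F)"
   by (rule ennreal_leI[OF le])
  also have "... <= sup_quad (L' p) K n F" unfolding sup_quad_def by (rule SUP_upper[OF c'(1)])
  also have "... <= ?S" by (rule SUP_upper) simp
  finally show ?thesis .
 qed
 moreover have "(%p. ennreal ((\<integral>V. quadL L psi V \<partial>F) - e p)) ----> ennreal ((\<integral>V. quadL L psi V \<partial>F) - 0)"
  by (intro tendsto_ennrealI tendsto_diff tendsto_const c'(3))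
 ultimately show "ennreal (\<integral>V. quadL L psi V \<partial>F) <= ?S"
  using LIMSEQ_le_const2[of "%p. ennreal ((\<integral>V. quadL L psi V \<partial>F) - e p)"] by auto
qed

lemma sup_quad_le1:
 assumes L: "diff_op m d L K k0" and L': "diff_op m d L' K k0" and F: "law n F" and n: "m <= n"
  and c: "!!psi. psi : Cg n K ==> \<exists>psi'\<in>Cg n K. \<forall>V\<in>phase n. quadL L psi V <= quadL L' psi' V"
 shows "sup_quad L K n F <= sup_quad L' K n F"
proof -
 have "sup_quad L K n F <= (SUP p::nat. sup_quad L' K n F)"
 proof (rule sup_quad_le[OF L L' F n])
  fix psi assume "psi : Cg n K"
  from c[OF this] obtain psi' where "psi' : Cg n K" "\<forall>V\<in>phase n. quadL L psi V <= quadL L' psi' V" by blast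
  then show "\<exists>psi' e. (\<forall>p::nat. psi' p : Cg n K & (\<forall>V\<in>phase n. quadL L psi V <= quadL L' (psi' p) V + e p)) & e ----> 0"
   by (intro exI[of _ "%_. psi'"] exI[of _ "%_. 0"]) auto
 qed
 then show ?thesis by simp
qed

lemma Cg_rad: "smooth_radial g ==> 2 <= n ==> psi : Cg n K ==> (%V. rad g V * psi V) : Cg n K"
 by (rule Cg_mult) (auto intro: C_diff_rad)

text \<open>The test is multiplied by the square root of a/a'. The linear term is unchanged because
  \<open>b_deriv\<close> ignores radial factors, and the square only decreases because the factor is
  at most 1.\<close>

lemma Ld_mono:
 assumes a: "pos_radial a" "pos_radial a'" and le: "!!r. r >= 0 ==> a r <= a' r" and F: "law n F" "2 <= n"
 shows "sup_quad (Ld a l) {1} n F <= sup_quad (Ld a' l) {1} n F"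
proof (rule sup_quad_le1[OF Ld_diff_op[OF a(1)] Ld_diff_op[OF a(2)] F])
 fix psi assume psi: "psi : Cg n {1}"
 define g where "g r = a r powr (1/2) * a' r powr (- (1/2))" for r
 have g: "smooth_radial g" unfolding g_def[abs_def] by (intro smooth_radial_mult pos_radial_powr a)
 have pos: "a r > 0" "a' r > 0" if "r >= 0" for r using a that by (auto simp: pos_radial_def)
 have g1: "0 <= g r" "g r <= 1" "a' r powr (1/2) * g r = a r powr (1/2)" if "r >= 0" for r
 proof -
  have "a r powr (1/2) <= a' r powr (1/2)" using pos[OF that] le[OF that] by (intro powr_mono2) auto
  moreover have e: "a' r powr (1/2) * a' r powr (- (1/2)) = 1" using pos[OF that] by (simp add: powr_add[symmetric])
  ultimately have "g r <= a' r powr (1/2) * a' r powr (- (1/2))" unfolding g_def by (intro mult_right_mono) auto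
  then show "g r <= 1" using e by simp
  show "a' r powr (1/2) * g r = a r powr (1/2)" using e by (simp add: g_def mult.left_commute)
 qed (simp add: g_def)
 show "\<exists>psi'\<in>Cg n {1}. \<forall>V\<in>phase n. quadL (Ld a l) psi V <= quadL (Ld a' l) psi' V"
 proof (rule bexI[OF _ Cg_rad[OF g F(2) psi]], rule ballI)
  fix V assume V: "V : phase n"
  have psi1: "C_diff n 1 psi" using psi by (auto simp: Cg_def)
  have "rad (%r. a' r powr (1 / 2)) V * rad g V = rad (%r. a r powr (1 / 2)) V"
   using g1(3)[of "norm (V 1 - V 2)"] by (simp add: rad_def)
  then have "Ld a' l (%V. rad g V * psi V) V = Ld a l psi V"
   unfolding Ld_eq[OF a(1)] Ld_eq[OF a(2)] b_deriv_rad[OF g F(2) psi1 V] mult.assoc[symmetric] by simp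
  moreover have "(rad g V * psi V)\<^sup>2 <= (psi V)\<^sup>2" using g1(1,2)[of "norm (V 1 - V 2)"]
   by (simp add: power_mult_distrib rad_def mult_left_le_one_le power_le_one)
  ultimately show "quadL (Ld a l) psi V <= quadL (Ld a' l) (%V. rad g V * psi V) V" by (simp add: quadL_def)
 qed
qed

text \<open>Multiplying a test function by \<open>rad g\<close> transfers a bound from one pair \<open>(a, \<theta>)\<close> to another
 one whenever \<open>hk a \<theta> ^ 2 = g * hk a' \<theta>' ^ 2\<close>.\<close>

lemma Lk_transfer:
 assumes a: "pos_radial a" "pos_radial a'" "smooth_radial \<theta>" "smooth_radial \<theta>'" "smooth_radial g"
  and g: "!!r. r >= 0 ==> (hk a \<theta> r)\<^sup>2 = g r * (hk a' \<theta>' r)\<^sup>2" "!!r. r >= 0 ==> (g r)\<^sup>2 <= 1 + \<epsilon>"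
  and n: "2 <= n" and psi: "psi : Cg n {2}" and V: "V : phase n"
 shows "quadL (Lk a \<theta> l) psi V <= quadL (Lk a' \<theta>' l) (%V. rad g V * psi V) V + \<epsilon> * (psi V)\<^sup>2 / 4"
proof -
 have psi2: "C_diff n 2 psi" using psi by (auto simp: Cg_def)
 have gpsi2: "C_diff n 2 (%V. rad g V * psi V)" by (intro C_diff_mult psi2 C_diff_rad[OF a(5) n])
 have "(rad (hk a \<theta>) V)\<^sup>2 = rad g V * (rad (hk a' \<theta>') V)\<^sup>2"
  using g(1)[of "norm (V 1 - V 2)"] by (simp add: rad_def)
 then have "Lk a' \<theta>' l (%V. rad g V * psi V) V = Lk a \<theta> l psi V"
  unfolding Lk_eq[OF a(1,3) n psi2 V] Lk_eq[OF a(2,4) n gpsi2 V] bb_rad[OF a(5) n psi2 V] by simp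
 moreover have "(rad g V * psi V)\<^sup>2 <= (1 + \<epsilon>) * (psi V)\<^sup>2"
  unfolding power_mult_distrib using g(2)[of "norm (V 1 - V 2)"] by (intro mult_right_mono) (auto simp: rad_def)
 ultimately show ?thesis by (simp add: quadL_def algebra_simps)
qed

lemma Lk_mono:
 assumes a: "pos_radial a" "pos_radial a'" "smooth_radial \<theta>" "smooth_radial \<theta>'" "smooth_radial g"
  and g: "!!r. r >= 0 ==> (hk a \<theta> r)\<^sup>2 = g r * (hk a' \<theta>' r)\<^sup>2" "!!r. r >= 0 ==> (g r)\<^sup>2 <= 1"
  and F: "law n F" "2 <= n"
 shows "sup_quad (Lk a \<theta> l) {2} n F <= sup_quad (Lk a' \<theta>' l) {2} n F"
proof (rule sup_quad_le1[OF Lk_diff_op[OF a(1,3)] Lk_diff_op[OF a(2,4)] F])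
 fix psi assume psi: "psi : Cg n {2}"
 show "\<exists>psi'\<in>Cg n {2}. \<forall>V\<in>phase n. quadL (Lk a \<theta> l) psi V <= quadL (Lk a' \<theta>' l) psi' V"
  using Lk_transfer[OF a g(1) _ F(2) psi, of 0] g(2) by (intro bexI[OF _ Cg_rad[OF a(5) F(2) psi]] ballI) auto
qed

text \<open>Smooth cutoffs that increase with \<open>p\<close> to the extremal profile r^(-1/2), the
  upper bound in \<open>cutoffs\<close>. They will exhaust the supremum over all cutoffs.\<close>

definition th :: "nat => real => real" where
 "th p r = (r\<^sup>2 + 1 / real (Suc p)) powr (- 1 / 4)"

lemma th_arg_pos: "r\<^sup>2 + 1 / real (Suc p) > 0" by (intro add_nonneg_pos) auto

lemma smooth_sq: "smooth_radial (%r. r\<^sup>2 + c)"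
proof -
 have e: "(%V :: velocities. (norm (V 1))\<^sup>2 + c) = (%V. (V 1 $ 1 * V 1 $ 1 + V 1 $ 2 * V 1 $ 2 + V 1 $ 3 * V 1 $ 3) + c)"
  by (intro ext) (simp add: power2_norm_eq_inner inner_vec_def sum_3)
 show ?thesis unfolding smooth_radial_def e by (intro allI C_diff_add C_diff_mult C_diff_coord C_diff_const)
qed

lemma smooth_sq_powr: "smooth_radial (%r. (r\<^sup>2 + 1 / real (Suc p)) powr s)"
 by (rule smooth_radial_powr[OF smooth_sq th_arg_pos])

lemma smooth_th: "smooth_radial (th p)" unfolding th_def[abs_def] by (rule smooth_sq_powr)

lemma th_sq: "(th p r)\<^sup>2 = (r\<^sup>2 + 1 / real (Suc p)) powr (- 1 / 2)"
 unfolding th_def power2_eq_square using th_arg_pos[of r p] by (simp add: powr_add[symmetric])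

lemma th_cutoff: "th p : cutoffs" unfolding cutoffs_def
proof (intro CollectI conjI allI impI)
 show "\<exists>C. \<forall>r\<ge>0. th p r <= C"
 proof (intro exI allI impI)
  fix r :: real assume "0 <= r"
  have "(r\<^sup>2 + 1 / real (Suc p)) powr (- 1 / 4) <= (1 / real (Suc p)) powr (- 1 / 4)" by (rule powr_mono2') auto
  then show "th p r <= (1 / real (Suc p)) powr (- 1 / 4)" by (simp add: th_def)
 qed
 show "0 <= th p r" for r by (simp add: th_def)
 show "th p r <= r powr (- 1 / 2)" if "0 < r" for r
 proof -
  have "th p r <= (r\<^sup>2) powr (- 1 / 4)" unfolding th_def by (rule powr_mono2') (use that in auto)
  also have "r\<^sup>2 = r powr 2" using that by (simp add: powr_numeral)
  finally show ?thesis by (simp add: powr_powr)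
 qed
 show "smooth_radial (th p)" by (rule smooth_th)
qed

lemma Lk_th_mono:
 assumes a: "pos_radial a" and p: "p <= p'" and F: "law n F" "2 <= n"
 shows "sup_quad (Lk a (th p) l) {2} n F <= sup_quad (Lk a (th p') l) {2} n F"
proof (rule Lk_mono[OF a a smooth_th smooth_th _ _ _ F])
 let ?g = "%r. (r\<^sup>2 + 1 / real (Suc p)) powr (- 1 / 2) * (r\<^sup>2 + 1 / real (Suc p')) powr (1 / 2)"
 show "smooth_radial ?g" by (intro smooth_radial_mult smooth_sq_powr)
 fix r :: real
 have pos: "r\<^sup>2 + 1 / real (Suc p) > 0" "r\<^sup>2 + 1 / real (Suc p') > 0" by (rule th_arg_pos)+
 have e: "(r\<^sup>2 + 1 / real (Suc p')) powr (1 / 2) * (r\<^sup>2 + 1 / real (Suc p')) powr (- 1 / 2) = 1"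
  using pos by (simp add: powr_add[symmetric])
 show "(hk a (th p) r)\<^sup>2 = ?g r * (hk a (th p') r)\<^sup>2"
  unfolding hk_def power_mult_distrib th_sq using e by (simp add: mult.assoc)
 have le: "r\<^sup>2 + 1 / real (Suc p') <= r\<^sup>2 + 1 / real (Suc p)" using p by (simp add: frac_le)
 have "?g r <= (r\<^sup>2 + 1 / real (Suc p)) powr (- 1 / 2) * (r\<^sup>2 + 1 / real (Suc p)) powr (1 / 2)"
  by (intro mult_left_mono powr_mono2) (use pos le in auto)
 also have "... = 1" using pos by (simp add: powr_add[symmetric])
 finally show "(?g r)\<^sup>2 <= 1" by (intro power_le_one) auto
qed

text \<open>The transfer factor from \<open>\<theta>\<close> to \<open>th p\<close> is \<theta>^2
  (r^2 + 1/(p+1))^(1/2). It may exceed 1, but its square is \<theta>^4 r^2 + \<theta>^4/(p+1), which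
  is at most 1 + C^4/(p+1) because \<theta> is below r^(-1/2) and below C; the excess vanishes as p
  grows.\<close>

lemma Lk_le_th:
 assumes a: "pos_radial a" and \<theta>: "\<theta> : cutoffs" and F: "law n F" "2 <= n"
 shows "sup_quad (Lk a \<theta> l) {2} n F <= (SUP p. sup_quad (Lk a (th p) l) {2} n F)"
proof (rule sup_quad_le[OF Lk_diff_op[OF a] Lk_diff_op[OF a smooth_th] F])
 show s\<theta>: "smooth_radial \<theta>" using \<theta> by (simp add: cutoffs_def)
 obtain C where C: "!!r. r >= 0 ==> \<theta> r <= C" using \<theta> by (auto simp: cutoffs_def)
 have pos: "\<theta> r >= 0" if "r >= 0" for r using \<theta> that by (auto simp: cutoffs_def)
 have le: "(\<theta> r)^4 * r\<^sup>2 <= 1" if "r >= 0" for r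
 proof (cases "r = 0")
  case False
  then have r: "r > 0" using that by simp
  have "(\<theta> r)^4 <= (r powr (- 1 / 2))^4" using \<theta> r by (intro power_mono pos) (auto simp: cutoffs_def)
  also have "... = r powr (- 2)" using r by (simp add: powr_power)
  finally have "(\<theta> r)^4 * r\<^sup>2 <= r powr (- 2) * r\<^sup>2" by (intro mult_right_mono) auto
  also have "... = 1" using r by (simp add: powr_minus powr_numeral field_simps)
  finally show ?thesis .
 qed simp
 fix psi assume psi: "psi : Cg n {2}"
 obtain B where B: "!!V. V : phase n ==> \<bar>psi V\<bar> <= B"
  using diff_op.Cg_bounds[OF Lk_diff_op[OF a s\<theta>] psi F(2)] by blast
 define g where "g p r = (\<theta> r * \<theta> r) * (r\<^sup>2 + 1 / real (Suc p)) powr (1 / 2)" for p r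
 have g: "smooth_radial (g p)" for p unfolding g_def[abs_def] by (intro smooth_radial_mult smooth_sq_powr s\<theta>)
 have g1: "(hk a \<theta> r)\<^sup>2 = g p r * (hk a (th p) r)\<^sup>2" for p r
 proof -
  have "(r\<^sup>2 + 1 / real (Suc p)) powr (1 / 2) * (r\<^sup>2 + 1 / real (Suc p)) powr (- 1 / 2) = 1"
   using th_arg_pos[of r p] by (simp add: powr_add[symmetric])
  then show ?thesis unfolding hk_def power_mult_distrib th_sq g_def by (simp add: power2_eq_square mult.assoc)
 qed
 have g2: "(g p r)\<^sup>2 <= 1 + C^4 / real (Suc p)" if "r >= 0" for p r
 proof -
  have "(g p r)\<^sup>2 = (\<theta> r)^4 * ((r\<^sup>2 + 1 / real (Suc p)) powr (1 / 2))\<^sup>2"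
   by (simp add: g_def power_mult_distrib power2_eq_square power4_eq_xxxx algebra_simps)
  also have "((r\<^sup>2 + 1 / real (Suc p)) powr (1 / 2))\<^sup>2 = r\<^sup>2 + 1 / real (Suc p)"
   using th_arg_pos[of r p] by (simp add: powr_half_sqrt)
  also have "(\<theta> r)^4 * (r\<^sup>2 + 1 / real (Suc p)) = (\<theta> r)^4 * r\<^sup>2 + (\<theta> r)^4 / real (Suc p)"
   by (simp add: algebra_simps)
  also have "... <= 1 + C^4 / real (Suc p)"
   using le[OF that] C[OF that] pos[OF that] by (intro add_mono divide_right_mono power_mono) auto
  finally show ?thesis .
 qed
 have c0: "C^4 >= 0" by simp
 show "\<exists>psi' e. (\<forall>p. psi' p : Cg n {2} \<and>
   (\<forall>V\<in>phase n. quadL (Lk a \<theta> l) psi V <= quadL (Lk a (th p) l) (psi' p) V + e p)) & e ----> 0"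
 proof (intro exI[of _ "%p V. rad (g p) V * psi V"] exI[of _ "%p. C^4 / real (Suc p) * B\<^sup>2 / 4"] conjI allI ballI)
  show "(%V. rad (g p) V * psi V) : Cg n {2}" for p by (rule Cg_rad[OF g F(2) psi])
  show "(%p. C^4 / real (Suc p) * B\<^sup>2 / 4) ----> 0" by real_asymp
  fix p V assume V: "V : phase n"
  have "(psi V)\<^sup>2 <= B\<^sup>2" using B[OF V] by (metis abs_ge_zero abs_le_square_iff abs_of_nonneg order_trans)
  then have "C^4 / real (Suc p) * (psi V)\<^sup>2 / 4 <= C^4 / real (Suc p) * B\<^sup>2 / 4"
   by (intro divide_right_mono mult_left_mono) auto
  moreover have "quadL (Lk a \<theta> l) psi V <= quadL (Lk a (th p) l) (%V. rad (g p) V * psi V) V + C^4 / real (Suc p) * (psi V)\<^sup>2 / 4"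
   by (rule Lk_transfer[OF a a s\<theta> smooth_th g g1 g2 F(2) psi V])
  ultimately show "quadL (Lk a \<theta> l) psi V <= quadL (Lk a (th p) l) (%V. rad (g p) V * psi V) V + C^4 / real (Suc p) * B\<^sup>2 / 4"
   by linarith
 qed
qed

text \<open>Along the increasing sequence \<open>th p\<close> the supremum commutes with the finite
  sum over \<open>l\<close>. Hence bounding each summand separately by its supremum along the
  sequence is enough, although the supremum over cutoffs stands outside the sum.\<close>

lemma K_reg_th:
 assumes a: "pos_radial a" and F: "law n F" "2 <= n"
 shows "K_reg a n F = (SUP p. \<Sum>l\<in>UNIV. sup_quad (Lk a (th p) l) {2} n F)" unfolding K_reg_sup_quad
proof (rule antisym)
 have inc: "incseq (%p. sup_quad (Lk a (th p) l) {2} n F)" for l by (rule monoI) (rule Lk_th_mono[OF a _ F])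
 have inc2: "incseq (%p. \<Sum>l\<in>UNIV. sup_quad (Lk a (th p) l) {2} n F)"
  by (rule monoI, rule sum_mono, rule Lk_th_mono[OF a _ F])
 have "(%p. \<Sum>l\<in>UNIV. sup_quad (Lk a (th p) l) {2} n F) \<longlonglongrightarrow>
   (\<Sum>l\<in>UNIV. SUP p. sup_quad (Lk a (th p) l) {2} n F)" by (intro tendsto_sum LIMSEQ_SUP inc)
 from LIMSEQ_unique[OF LIMSEQ_SUP[OF inc2] this]
 have s: "(SUP p. \<Sum>l\<in>UNIV. sup_quad (Lk a (th p) l) {2} n F) =
   (\<Sum>l\<in>UNIV. SUP p. sup_quad (Lk a (th p) l) {2} n F)" .
 show "(SUP \<theta>\<in>cutoffs. \<Sum>l\<in>UNIV. sup_quad (Lk a \<theta> l) {2} n F) <= (SUP p. \<Sum>l\<in>UNIV. sup_quad (Lk a (th p) l) {2} n F)"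
  unfolding s by (intro SUP_least sum_mono Lk_le_th[OF a _ F])
 show "(SUP p. \<Sum>l\<in>UNIV. sup_quad (Lk a (th p) l) {2} n F) <= (SUP \<theta>\<in>cutoffs. \<Sum>l\<in>UNIV. sup_quad (Lk a \<theta> l) {2} n F)"
  by (intro SUP_least SUP_upper2[OF th_cutoff]) auto
qed

text \<open>Kernel index and particle number are both \<open>j\<close>. As \<open>s\<close>
  increases in each of them, the diagonal value lies below \<open>I j p\<close> and, as soon as
  \<open>j\<close> is at least \<open>N\<close>, above \<open>s N p j\<close>; so limits with
  \<open>N\<close> fixed determine the diagonal one.\<close>

lemma diagonal_limit:
 fixes s :: "nat => 'p => nat => ennreal"
 assumes sN: "!!N N' p j. 2 <= N ==> N <= N' ==> 2 <= j ==> s N p j <= s N' p j"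
  and sj: "!!N p i j. 2 <= N ==> 2 <= i ==> i <= j ==> s N p i <= s N p j"
  and lim: "!!N p. 2 <= N ==> s N p ----> I N p"
 shows "(%j. SUP p. s j p j) ----> (SUP N\<in>{2..}. SUP p. I N p)"
  and "mono_on {2..} (%j. SUP p. s j p j)"
proof -
 have sI: "s N p j <= I N p" if "2 <= N" "2 <= j" for N p j
  by (rule LIMSEQ_le_const[OF lim[OF that(1)]]) (use sj that in blast)
 show "mono_on {2..} (%j. SUP p. s j p j)"
 proof (rule mono_onI)
  fix i j :: nat assume ij: "i : {2..}" "j : {2..}" "i <= j"
  have "s i p i <= s j p j" for p using sN[of i j i p] sj[of j i j p] ij by (auto intro: order_trans)
  then show "(SUP p. s i p i) <= (SUP p. s j p j)" by (intro SUP_mono) auto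
 qed
 show "(%j. SUP p. s j p j) ----> (SUP N\<in>{2..}. SUP p. I N p)"
 proof (rule order_tendstoI)
  fix c assume "c < (SUP N\<in>{2..}. SUP p. I N p)"
  then obtain N p where N: "2 <= N" "c < I N p" by (auto simp: less_SUP_iff)
  have "eventually (%j. c < s N p j) sequentially" by (rule order_tendstoD(1)[OF lim[OF N(1)] N(2)])
  then have "eventually (%j. c < s N p j & N <= j) sequentially"
   using eventually_ge_at_top[of N] by (rule eventually_conj)
  then show "eventually (%j. c < (SUP p. s j p j)) sequentially"
  proof eventually_elim
   case (elim j)
   then have "c < s j p j" using sN[of N j j p] N by auto
   then show ?case by (meson SUP_upper UNIV_I less_le_trans)
  qed
 next
  fix c assume c: "(SUP N\<in>{2..}. SUP p. I N p) < c"
  show "eventually (%j. (SUP p. s j p j) < c) sequentially" using eventually_ge_at_top[of 2]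
  proof eventually_elim
   case (elim j)
   have "(SUP p. s j p j) <= (SUP p. I j p)" using sI[OF elim elim] by (intro SUP_mono) auto
   also have "... <= (SUP N\<in>{2..}. SUP p. I N p)" by (rule SUP_upper) (use elim in auto)
   finally show ?case using c by simp
  qed
 qed
qed

lemma SUP_from_2: "(SUP N\<in>{2..}. f N) = (SUP i. f (i + 2 :: nat))" for f :: "nat => ennreal"
proof -
 have "x : range (%i::nat. i + 2)" if "2 <= x" for x using that by (intro image_eqI[of _ _ "x - 2"]) auto
 then have "{2..} = range (%i::nat. i + 2)" by auto
 then show ?thesis by (simp add: image_image)
qed

lemma kernel_approxD:
 assumes "kernel_approx \<gamma> A"
 shows "2 <= N ==> pos_radial (A N)"
  and "2 <= N ==> N <= N' ==> r >= 0 ==> A N r <= A N' r"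
proof -
 show "2 <= N ==> pos_radial (A N)" using assms by (auto simp: kernel_approx_def pos_radial_def)
 assume N: "2 <= N" and "N <= N'" and r: "r >= 0"
 from \<open>N <= N'\<close> show "A N r <= A N' r"
 proof (induction rule: dec_induct)
  case (step k)
  then have "A k r <= A (Suc k) r" using assms N r by (auto simp: kernel_approx_def)
  then show ?case using step by simp
 qed simp
qed

section \<open>Limits of the two dissipations\<close>

context mixing begin

lemma law_mixture: "law n (mixture n \<nu>)" using prob_mixture sets_mixture by (simp add: law_def)

lemma law_tensor: "\<rho> : space \<nu> ==> law n (tensor n \<rho>)"
 using prob_tensor sets_tensor by (simp add: law_def)

lemma D_limit:
 assumes A: "kernel_approx \<gamma> A"
 shows "(%j. D_reg (A j) j (mixture j \<nu>)) ----> (\<integral>\<^sup>+\<rho>. D_fun A 2 (tensor 2 \<rho>) \<partial>\<nu>)"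
  and "mono_on {2..} (%j. D_reg (A j) j (mixture j \<nu>))"
proof -
 note pr = kernel_approxD(1)[OF A] and le = kernel_approxD(2)[OF A]
 \<comment> \<open>There is no cutoff parameter in \<open>D_reg\<close>; the unit type fills the
   slot of \<open>p\<close> in \<open>diagonal_limit\<close>.\<close>
 define s where "s N (p::unit) j = D_reg (A N) j (mixture j \<nu>)" for N p j
 define I where "I N (p::unit) = (\<integral>\<^sup>+\<rho>. D_reg (A N) 2 (tensor 2 \<rho>) \<partial>\<nu>)" for N p
 have mN: "D_reg (A N) j F <= D_reg (A N') j F" if "2 <= N" "N <= N'" "2 <= j" "law j F" for N N' j F
  unfolding D_reg_sup_quad by (intro mult_left_mono sum_mono Ld_mono pr le that) (use that in auto)
 have meas: "(%\<rho>. D_reg (A N) 2 (tensor 2 \<rho>)) : bmeas \<nu>" if "2 <= N" for N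
  unfolding D_reg_sup_quad by (intro borel_measurable_times_ennreal borel_measurable_const borel_measurable_sum
    sup_quad_measurable[OF Ld_diff_op[OF pr[OF that]]])
 have lim: "s N p ----> I N p" if "2 <= N" for N p
 proof -
  note L = Ld_diff_op[OF pr[OF that]]
  have "I N p = ennreal (1 / 2) * (\<Sum>l\<in>UNIV. \<integral>\<^sup>+\<rho>. sup_quad (Ld (A N) l) {1} 2 (tensor 2 \<rho>) \<partial>\<nu>)"
   unfolding I_def D_reg_sup_quad by (subst nn_integral_cmult, intro borel_measurable_sum sup_quad_measurable[OF L],
     subst nn_integral_sum, rule sup_quad_measurable[OF L], rule refl)
  moreover have "s N p ----> ennreal (1 / 2) * (\<Sum>l\<in>UNIV. \<integral>\<^sup>+\<rho>. sup_quad (Ld (A N) l) {1} 2 (tensor 2 \<rho>) \<partial>\<nu>)"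
   unfolding s_def[abs_def] D_reg_sup_quad
   by (intro ennreal_tendsto_cmult[OF ennreal_less_top] tendsto_sum sup_quad_limit[OF L])
  ultimately show ?thesis by simp
 qed
 have sj: "s N p i <= s N p j" if "2 <= N" "2 <= i" "i <= j" for N p i j unfolding s_def D_reg_sup_quad
  by (intro mult_left_mono sum_mono sup_quad_mono[OF Ld_diff_op[OF pr[OF that(1)]]] that) auto
 have sN: "s N p j <= s N' p j" if "2 <= N" "N <= N'" "2 <= j" for N N' p j
  unfolding s_def by (rule mN[OF that law_mixture])
 have dl: "(%j. SUP p. s j p j) ----> (SUP N\<in>{2..}. SUP p. I N p)"
  by (rule diagonal_limit(1)[of s I, OF sN sj lim])
 have dm: "mono_on {2..} (%j. SUP p. s j p j)" by (rule diagonal_limit(2)[of s I, OF sN sj lim])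
 show "mono_on {2..} (%j. D_reg (A j) j (mixture j \<nu>))" using dm by (simp add: s_def)
 have "(\<integral>\<^sup>+\<rho>. D_fun A 2 (tensor 2 \<rho>) \<partial>\<nu>) = (\<integral>\<^sup>+\<rho>. (SUP i. D_reg (A (i + 2)) 2 (tensor 2 \<rho>)) \<partial>\<nu>)"
  by (simp add: D_fun_def SUP_from_2)
 also have "... = (SUP i. \<integral>\<^sup>+\<rho>. D_reg (A (i + 2)) 2 (tensor 2 \<rho>) \<partial>\<nu>)"
  by (rule nn_integral_monotone_convergence_SUP_AE)
   (auto intro!: AE_I2 meas mN law_tensor)
 also have "... = (SUP N\<in>{2..}. SUP p. I N p)" by (simp add: I_def SUP_from_2)
 finally show "(%j. D_reg (A j) j (mixture j \<nu>)) ----> (\<integral>\<^sup>+\<rho>. D_fun A 2 (tensor 2 \<rho>) \<partial>\<nu>)"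
  using dl by (simp add: s_def)
qed

lemma K_limit:
 assumes A: "kernel_approx \<gamma> A"
 shows "(%j. K_reg (A j) j (mixture j \<nu>)) ----> (\<integral>\<^sup>+\<rho>. K_fun A 2 (tensor 2 \<rho>) \<partial>\<nu>)"
  and "mono_on {2..} (%j. K_reg (A j) j (mixture j \<nu>))"
proof -
 note pr = kernel_approxD(1)[OF A] and le = kernel_approxD(2)[OF A]
 define t where "t N p j F = (\<Sum>l\<in>UNIV. sup_quad (Lk (A N) (th p) l) {2} j F)" for N p j F
 define s where "s N p j = t N p j (mixture j \<nu>)" for N p j
 define I where "I N p = (\<integral>\<^sup>+\<rho>. t N p 2 (tensor 2 \<rho>) \<partial>\<nu>)" for N p
 have K: "K_reg (A N) j F = (SUP p. t N p j F)" if "2 <= N" "2 <= j" "law j F" for N j F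
  unfolding t_def by (rule K_reg_th[OF pr[OF that(1)] that(3,2)])
 have mN: "t N p j F <= t N' p j F" if N: "2 <= N" "N <= N'" "2 <= j" "law j F" for N N' p j F unfolding t_def
 proof (rule sum_mono)
  fix l
  have N': "2 <= N'" using N by simp
  define g where "g r = A N r powr (1/2) * A N' r powr (- (1/2))" for r
  have pos: "A N r > 0" "A N' r > 0" if "r >= 0" for r using pr[OF N(1)] pr[OF N'] that by (auto simp: pos_radial_def)
  show "sup_quad (Lk (A N) (th p) l) {2} j F <= sup_quad (Lk (A N') (th p) l) {2} j F"
  proof (rule Lk_mono[OF pr[OF N(1)] pr[OF N'] smooth_th smooth_th _ _ _ N(4,3)])
   show "smooth_radial g" unfolding g_def[abs_def] by (intro smooth_radial_mult pos_radial_powr pr N N')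
   fix r :: real assume r: "r >= 0"
   have e: "A N' r powr (1/2) * A N' r powr (- (1/2)) = 1" using pos[OF r] by (simp add: powr_add[symmetric])
   have q: "(x powr (1/4))\<^sup>2 = x powr (1/2)" for x :: real by (simp add: power2_eq_square powr_add[symmetric])
   show "(hk (A N) (th p) r)\<^sup>2 = g r * (hk (A N') (th p) r)\<^sup>2"
    unfolding hk_def power_mult_distrib q g_def using e by (simp add: algebra_simps)
   have "g r <= A N' r powr (1/2) * A N' r powr (- (1/2))" unfolding g_def
    by (intro mult_right_mono powr_mono2) (use pos[OF r] le[OF N(1,2) r] in auto)
   then show "(g r)\<^sup>2 <= 1" using e by (intro power_le_one) (auto simp: g_def)
  qed
 qed
 have mp: "t N p j F <= t N p' j F" if "2 <= N" "p <= p'" "2 <= j" "law j F" for N p p' j F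
  unfolding t_def by (rule sum_mono) (rule Lk_th_mono[OF pr[OF that(1)] that(2,4,3)])
 have meas: "(%\<rho>. t N p 2 (tensor 2 \<rho>)) : bmeas \<nu>" if "2 <= N" for N p unfolding t_def
  by (intro borel_measurable_sum sup_quad_measurable[OF Lk_diff_op[OF pr[OF that] smooth_th]])
 have lim: "s N p ----> I N p" if "2 <= N" for N p
 proof -
  note L = Lk_diff_op[OF pr[OF that] smooth_th]
  have "I N p = (\<Sum>l\<in>UNIV. \<integral>\<^sup>+\<rho>. sup_quad (Lk (A N) (th p) l) {2} 2 (tensor 2 \<rho>) \<partial>\<nu>)"
   unfolding I_def t_def by (simp add: nn_integral_sum sup_quad_measurable[OF L])
  moreover have "s N p ----> (\<Sum>l\<in>UNIV. \<integral>\<^sup>+\<rho>. sup_quad (Lk (A N) (th p) l) {2} 2 (tensor 2 \<rho>) \<partial>\<nu>)"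
   unfolding s_def[abs_def] t_def by (intro tendsto_sum sup_quad_limit[OF L])
  ultimately show ?thesis by simp
 qed
 have sj: "s N p i <= s N p j" if "2 <= N" "2 <= i" "i <= j" for N p i j unfolding s_def t_def
  by (intro sum_mono sup_quad_mono[OF Lk_diff_op[OF pr[OF that(1)] smooth_th]] that)
 have sN: "s N p j <= s N' p j" if "2 <= N" "N <= N'" "2 <= j" for N N' p j
  unfolding s_def by (rule mN[OF that law_mixture])
 have dl: "(%j. SUP p. s j p j) ----> (SUP N\<in>{2..}. SUP p. I N p)"
  by (rule diagonal_limit(1)[of s I, OF sN sj lim])
 have dm: "mono_on {2..} (%j. SUP p. s j p j)" by (rule diagonal_limit(2)[of s I, OF sN sj lim])
 have Kj: "(SUP p. s j p j) = K_reg (A j) j (mixture j \<nu>)" if "2 <= j" for j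
  using K[OF that that law_mixture] by (simp add: s_def)
 show "mono_on {2..} (%j. K_reg (A j) j (mixture j \<nu>))" using dm unfolding mono_on_def by (simp add: Kj)
 have "(\<integral>\<^sup>+\<rho>. K_fun A 2 (tensor 2 \<rho>) \<partial>\<nu>) = (\<integral>\<^sup>+\<rho>. (SUP i. SUP p. t (i + 2) p 2 (tensor 2 \<rho>)) \<partial>\<nu>)"
  by (rule nn_integral_cong) (simp add: K_fun_def SUP_from_2 K law_tensor)
 also have "... = (SUP i. \<integral>\<^sup>+\<rho>. (SUP p. t (i + 2) p 2 (tensor 2 \<rho>)) \<partial>\<nu>)"
  by (rule nn_integral_monotone_convergence_SUP_AE)
   (auto intro!: AE_I2 meas mN law_tensor borel_measurable_SUP SUP_subset_mono[OF order_refl])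
 also have "... = (SUP i. SUP p. \<integral>\<^sup>+\<rho>. t (i + 2) p 2 (tensor 2 \<rho>) \<partial>\<nu>)"
  by (intro SUP_cong refl nn_integral_monotone_convergence_SUP_AE)
   (auto intro!: AE_I2 meas mp law_tensor)
 also have "... = (SUP N\<in>{2..}. SUP p. I N p)" by (simp add: I_def SUP_from_2)
 finally have e: "(\<integral>\<^sup>+\<rho>. K_fun A 2 (tensor 2 \<rho>) \<partial>\<nu>) = (SUP N\<in>{2..}. SUP p. I N p)" .
 show "(%j. K_reg (A j) j (mixture j \<nu>)) ----> (\<integral>\<^sup>+\<rho>. K_fun A 2 (tensor 2 \<rho>) \<partial>\<nu>)"
  unfolding e by (rule Lim_transform_eventually[OF dl])
   (rule eventually_mono[OF eventually_ge_at_top[of 2]], rule Kj)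
qed

end

section \<open>Riesz representation of bounded quadratic problems\<close>

lemma abs_mult_le_squares: "\<bar>x * y\<bar> <= x\<^sup>2 + y\<^sup>2" for x y :: real
proof -
 have "2 * (\<bar>x\<bar> * \<bar>y\<bar>) <= x\<^sup>2 + y\<^sup>2" using sum_squares_bound[of "\<bar>x\<bar>" "\<bar>y\<bar>"] by simp
 moreover have "0 <= \<bar>x\<bar> * \<bar>y\<bar>" by simp
 ultimately show ?thesis unfolding abs_mult by linarith
qed

lemma young_weighted:
 fixes dl :: real
 assumes "dl > 0"
 shows "\<bar>a\<bar> * \<bar>b\<bar> <= dl * a\<^sup>2 + b\<^sup>2 / dl"
proof -
 have "\<bar>dl * a * b\<bar> <= (dl * a)\<^sup>2 + b\<^sup>2" by (rule abs_mult_le_squares)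
 then have "dl * (\<bar>a\<bar> * \<bar>b\<bar>) <= dl\<^sup>2 * a\<^sup>2 + b\<^sup>2"
  using assms by (simp add: abs_mult power_mult_distrib mult.assoc)
 also have "... = dl * (dl * a\<^sup>2 + b\<^sup>2 / dl)" using assms by (simp add: field_simps power2_eq_square)
 finally show ?thesis using assms by (simp only: mult_le_cancel_left_pos)
qed

lemma (in prob_space) integral_abs_less:
 fixes g :: "'a => real"
 assumes g: "integrable M g" and g2: "integrable M (%x. (g x)\<^sup>2)" and e: "e > 0" and l: "(\<integral>x. (g x)\<^sup>2 \<partial>M) < e\<^sup>2"
 shows "(\<integral>x. \<bar>g x\<bar> \<partial>M) < e"
proof -
 have "(\<integral>x. \<bar>g x\<bar> \<partial>M) <= (\<integral>x. e / 2 + (g x)\<^sup>2 / (2 * e) \<partial>M)"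
 proof (rule integral_mono)
  fix x
  have "0 <= (\<bar>g x\<bar> - e)\<^sup>2" by simp
  then have "2 * e * \<bar>g x\<bar> <= e\<^sup>2 + (g x)\<^sup>2" by (simp add: power2_diff algebra_simps)
  then show "\<bar>g x\<bar> <= e / 2 + (g x)\<^sup>2 / (2 * e)" using e by (simp add: field_simps power2_eq_square)
 qed (use g g2 in auto)
 also have "... = e / 2 + (\<integral>x. (g x)\<^sup>2 \<partial>M) / (2 * e)" using g2 by (simp add: prob_space)
 also have "... < e" using l e by (simp add: field_simps power2_eq_square)
 finally show ?thesis .
qed

lemma (in prob_space) integrable_of_square:
 fixes g :: "'a => real"
 assumes g: "g : bmeas M" and g2: "integrable M (%x. (g x)\<^sup>2)"
 shows "integrable M g"
proof (rule Bintegrable_bound[of M "%x. 1 + (g x)\<^sup>2"])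
 show "AE x in M. norm (g x) <= norm (1 + (g x)\<^sup>2)"
 proof (rule AE_I2)
  fix x
  have "0 <= (\<bar>g x\<bar> - 1)\<^sup>2" by simp
  then have "2 * \<bar>g x\<bar> <= 1 + (g x)\<^sup>2" by (simp add: power2_diff)
  then show "norm (g x) <= norm (1 + (g x)\<^sup>2)" by simp
 qed
qed (use g g2 in auto)

text \<open>Completeness of L2 with a rate: the sequence is Cauchy in L1, an almost everywhere
  convergent subsequence defines \<open>g\<close>, and Fatou's lemma carries the bound
  \<open>e p + e q\<close> over to the limit in \<open>q\<close>.\<close>

lemma (in prob_space) L2_cauchy_limit:
 fixes f :: "nat => 'a => real"
 assumes f: "!!p. f p : bmeas M" "!!p. integrable M (%x. (f p x)\<^sup>2)"
  and d: "!!p q. (\<integral>x. (f p x - f q x)\<^sup>2 \<partial>M) <= e p + e q" and e: "e ----> 0" "!!p. e p >= 0"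
 obtains g where "g : bmeas M" "integrable M (%x. (g x)\<^sup>2)"
  "!!p. integrable M (%x. (f p x - g x)\<^sup>2)" "!!p. (\<integral>x. (f p x - g x)\<^sup>2 \<partial>M) <= e p"
proof -
 note [measurable] = f(1)
 have sq2: "(x - y)\<^sup>2 <= 2 * x\<^sup>2 + 2 * y\<^sup>2" for x y :: real
  using zero_le_power2[of "x + y"] by (simp add: power2_eq_square algebra_simps)
 have d2: "integrable M (%x. (f p x - f q x)\<^sup>2)" for p q
  by (rule Bintegrable_bound[of M "%x. 2 * (f p x)\<^sup>2 + 2 * (f q x)\<^sup>2"])
   (use f(2) sq2 in auto)
 have f1: "integrable M (f p)" for p by (rule integrable_of_square[OF f])
 have "\<exists>N. \<forall>i\<ge>N. \<forall>j\<ge>N. (\<integral>x. norm (f i x - f j x) \<partial>M) < \<epsilon>" if \<epsilon>: "\<epsilon> > 0" for \<epsilon>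
 proof -
  have "\<epsilon>\<^sup>2 / 2 > 0" using \<epsilon> by simp
  from order_tendstoD(2)[OF e(1) this] obtain N where N: "!!p. p >= N ==> e p < \<epsilon>\<^sup>2 / 2"
   by (auto simp: eventually_sequentially)
  have "(\<integral>x. \<bar>f i x - f j x\<bar> \<partial>M) < \<epsilon>" if "i >= N" "j >= N" for i j
   by (rule integral_abs_less[OF Bintegrable_diff[OF f1 f1] d2 \<epsilon>])
    (use d[of i j] N[OF that(1)] N[OF that(2)] in linarith)
  then show ?thesis by auto
 qed
 from cauchy_L1_AE_cauchy_subseq[OF f1 this] obtain r where r: "strict_mono r" "AE x in M. Cauchy (%i. f (r i) x)"
  by blast
 define g where "g x = lim (%i. f (r i) x)" for x
 have gm[measurable]: "g : bmeas M" unfolding g_def[abs_def] by measurable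
 have lim: "AE x in M. (%i. f (r i) x) ----> g x"
  using r(2) by eventually_elim (auto simp: g_def convergent_LIMSEQ_iff[symmetric] Cauchy_convergent)
 have le: "(\<integral>\<^sup>+x. ennreal ((f p x - g x)\<^sup>2) \<partial>M) <= ennreal (e p)" for p
 proof -
  have "(\<integral>\<^sup>+x. ennreal ((f p x - g x)\<^sup>2) \<partial>M) = (\<integral>\<^sup>+x. liminf (%i. ennreal ((f p x - f (r i) x)\<^sup>2)) \<partial>M)"
  proof (rule nn_integral_cong_AE)
   show "AE x in M. ennreal ((f p x - g x)\<^sup>2) = liminf (%i. ennreal ((f p x - f (r i) x)\<^sup>2))" using lim
   proof eventually_elim
    case (elim x)
    have "(%i. ennreal ((f p x - f (r i) x)\<^sup>2)) ----> ennreal ((f p x - g x)\<^sup>2)"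
     by (intro tendsto_ennrealI tendsto_intros elim)
    from lim_imp_Liminf[OF _ this] show ?case by simp
   qed
  qed
  also have "... <= liminf (%i. \<integral>\<^sup>+x. ennreal ((f p x - f (r i) x)\<^sup>2) \<partial>M)"
   by (rule nn_integral_liminf) measurable
  also have "... = liminf (%i. ennreal (\<integral>x. (f p x - f (r i) x)\<^sup>2 \<partial>M))"
   by (simp add: nn_integral_eq_integral[OF d2])
  also have "... <= liminf (%i. ennreal (e p + e (r i)))"
   by (intro Liminf_mono always_eventually allI ennreal_leI d)
  also have "... = ennreal (e p + 0)"
  proof (rule lim_imp_Liminf[OF sequentially_bot])
   have "(%i. e (r i)) ----> 0" using LIMSEQ_subseq_LIMSEQ[OF e(1) r(1)] by (simp add: comp_def)
   then show "(%i. ennreal (e p + e (r i))) ----> ennreal (e p + 0)"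
    by (intro tendsto_ennrealI tendsto_intros)
  qed
  finally show ?thesis by simp
 qed
 have dg: "integrable M (%x. (f p x - g x)\<^sup>2)" for p
  by (rule integrableI_bounded) (auto intro: le_less_trans[OF le])
 have "(\<integral>x. (f p x - g x)\<^sup>2 \<partial>M) <= e p" for p
  using le[of p] e(2)[of p] by (simp add: nn_integral_eq_integral[OF dg] ennreal_le_iff)
 moreover have "integrable M (%x. (g x)\<^sup>2)"
 proof (rule Bintegrable_bound[of M "%x. 2 * (f 0 x)\<^sup>2 + 2 * (f 0 x - g x)\<^sup>2"])
  show "AE x in M. norm ((g x)\<^sup>2) <= norm (2 * (f 0 x)\<^sup>2 + 2 * (f 0 x - g x)\<^sup>2)"
  proof (rule AE_I2)
   show "norm ((g x)\<^sup>2) <= norm (2 * (f 0 x)\<^sup>2 + 2 * (f 0 x - g x)\<^sup>2)" for x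
    using sq2[of "f 0 x" "f 0 x - g x"] by simp
  qed
 qed (use f(2) dg in auto)
 ultimately show ?thesis using that[OF gm] dg by blast
qed

text \<open>If \<open>X\<close> were nonzero, a small multiple of \<open>X\<close> taken as
  \<open>t\<close> would make the linear term beat the quadratic one.\<close>

lemma linear_zero_of_quadratic:
 fixes X Y :: real
 assumes "!!t. t * X <= t\<^sup>2 * Y" "Y >= 0"
 shows "X = 0"
proof (rule ccontr)
 assume "X ~= 0"
 define t where "t = X / (2 * (Y + 1))"
 have "t * X <= t\<^sup>2 * Y" by (rule assms)
 also have "... = t * X * (Y / (2 * (Y + 1)))" by (simp add: t_def power2_eq_square)
 also have "... < t * X * 1"
 proof (rule mult_strict_left_mono)
  show "Y / (2 * (Y + 1)) < 1" using assms(2) by (simp add: field_simps)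
  have "t * X = X\<^sup>2 / (2 * (Y + 1))" by (simp add: t_def power2_eq_square)
  then show "0 < t * X" using \<open>X ~= 0\<close> assms(2) by simp
 qed
 finally show False by simp
qed

context diff_op begin

lemma test_integrable:
 assumes F: "law n F" and n: "m <= n" and psi: "psi : Cg n K"
 shows "psi : bmeas F" "L psi : bmeas F"
  "integrable F psi" "integrable F (L psi)" "integrable F (%V. (psi V)\<^sup>2)"
proof -
 interpret F: prob_space F using F by (simp add: law_def)
 obtain B where B: "B >= 0" "\<forall>V\<in>phase n. \<bar>psi V\<bar> <= B & \<bar>L psi V\<bar> <= B" using Cg_bounds[OF psi n] by blast
 have s: "sets F = sets (velM {1..n})" using F by (simp add: law_def)
 show m: "psi : bmeas F" "L psi : bmeas F"
  using C_diff_measurable[OF L_cont[OF psi n]] C_diff_measurable[OF Cg_d[OF psi]]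
  by (simp_all add: measurable_cong_sets[OF s refl])
 show "integrable F psi" "integrable F (L psi)" using B law_space[OF F] by (auto intro!: F.integrable_bounded[where B=B] m)
 show "integrable F (%V. (psi V)\<^sup>2)"
 proof (rule F.integrable_bounded[where B="B\<^sup>2"])
  show "\<bar>(psi V)\<^sup>2\<bar> <= B\<^sup>2" if "V : space F" for V
   using B law_space[OF F] that by (simp add: abs_le_square_iff[symmetric])
 qed (use m in measurable)
qed

lemma L_linear:
 assumes n: "m <= n" and psi: "psi : Cg n K" and phi: "phi : Cg n K"
 shows "(%V. a * psi V + b * phi V) : Cg n K"
  and "V : phase n ==> L (%V. a * psi V + b * phi V) V = a * L psi V + b * L phi V"
proof -
 have c: "(%V. c * \<xi> V) : Cg n K" if "\<xi> : Cg n K" for c \<xi>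
  using that by (rule Cg_mult) (rule C_diff_const)
 show "(%V. a * psi V + b * phi V) : Cg n K" by (rule Cg_add[OF c[OF psi] c[OF phi]])
 assume V: "V : phase n"
 have "L (%V. a * psi V + b * phi V) V = L (%V. a * psi V) V + L (%V. b * phi V) V"
  by (rule dop_add[OF dop n Cg_d[OF c[OF psi]] Cg_d[OF c[OF phi]] V])
 also have "L (%V. a * psi V) V = a * L psi V"
  using dop_mult[of m n "%_. a", OF _ dop n Cg_d[OF psi] V] by simp
 also have "L (%V. b * phi V) V = b * L phi V"
  using dop_mult[of m n "%_. b", OF _ dop n Cg_d[OF phi] V] by simp
 finally show "L (%V. a * psi V + b * phi V) V = a * L psi V + b * L phi V" .
qed

lemma integral_quadL:
 assumes F: "law n F" and n: "m <= n" and psi: "psi : Cg n K"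
 shows "(\<integral>V. quadL L psi V \<partial>F) = (\<integral>V. L psi V \<partial>F) - (\<integral>V. (psi V)\<^sup>2 \<partial>F) / 4"
 using test_integrable[OF assms] by (simp add: quadL_def)

text \<open>The representing function is the limit of a maximizing sequence, which is a Cauchy sequence by
 the parallelogram identity.\<close>

theorem riesz:
 assumes F: "law n F" and n: "m <= n" and fin: "sup_quad L K n F < \<infinity>"
 obtains h where "h : bmeas F" "integrable F (%V. (h V)\<^sup>2)"
  "!!phi. phi : Cg n K ==> (\<integral>V. L phi V \<partial>F) = (\<integral>V. h V * phi V \<partial>F)"
  "sup_quad L K n F = ennreal (\<integral>V. (h V)\<^sup>2 \<partial>F)"
proof -
 interpret F: prob_space F using F by (simp add: law_def)
 note T = test_integrable[OF F n] and Q = integral_quadL[OF F n]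
 define J where "J psi = (\<integral>V. quadL L psi V \<partial>F)" for psi
 define s where "s = enn2real (sup_quad L K n F)"
 have s: "sup_quad L K n F = ennreal s" "s >= 0" using fin by (auto simp: s_def)
 have Js: "J psi <= s" if "psi : Cg n K" for psi
 proof -
  have "ennreal (J psi) <= ennreal s" unfolding s(1)[symmetric] sup_quad_def J_def by (rule SUP_upper[OF that])
  then show ?thesis using s(2) by (cases "J psi >= 0") (auto simp: ennreal_le_iff)
 qed
 define e :: "nat => real" where "e p = 1 / real (Suc p)" for p
 have e0: "e p > 0" for p by (simp add: e_def)
 have elim: "e ----> 0" unfolding e_def[abs_def] by real_asymp
 have "\<exists>psi\<in>Cg n K. J psi > s - e p" for p
 proof (cases "s - e p < 0")
  case True
  have "J (%V. 0) = (\<integral>V. 0 \<partial>F)" unfolding J_def by (rule Bintegral_cong)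
    (use dop_zero[OF dop n] law_space[OF F] in \<open>auto simp: quadL_def\<close>)
  then show ?thesis using True Cg_zero[of n K] by (intro bexI[of _ "%V. 0"]) auto
 next
  case False
  then have "ennreal (s - e p) < sup_quad L K n F" using e0[of p] by (simp add: s(1) ennreal_less_iff)
  then obtain psi where psi: "psi : Cg n K" "ennreal (s - e p) < ennreal (J psi)"
   unfolding sup_quad_def J_def by (auto simp: less_SUP_iff)
  then show ?thesis using False by (intro bexI[OF _ psi(1)]) (auto simp: ennreal_less_iff)
 qed
 then have "\<forall>p. \<exists>psi. psi : Cg n K & J psi > s - e p" by blast
 from choice[OF this] obtain psi where psi: "!!p. psi p : Cg n K" "!!p. J (psi p) > s - e p" by blast
 have int2: "integrable F (%V. \<xi> V * phi V)" if "\<xi> : Cg n K" "phi : Cg n K" for \<xi> phi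
 proof (rule Bintegrable_bound[of F "%V. (\<xi> V)\<^sup>2 + (phi V)\<^sup>2"])
  show "AE V in F. norm (\<xi> V * phi V) <= norm ((\<xi> V)\<^sup>2 + (phi V)\<^sup>2)"
   by (simp add: abs_mult_le_squares)
 qed (use T[OF that(1)] T[OF that(2)] in auto)
 have J_lin: "J (%V. a * \<xi> V + b * phi V) = a * (\<integral>V. L \<xi> V \<partial>F) + b * (\<integral>V. L phi V \<partial>F)
   - (a\<^sup>2 * (\<integral>V. (\<xi> V)\<^sup>2 \<partial>F) + 2 * a * b * (\<integral>V. \<xi> V * phi V \<partial>F) + b\<^sup>2 * (\<integral>V. (phi V)\<^sup>2 \<partial>F)) / 4"
  if c: "\<xi> : Cg n K" and p: "phi : Cg n K" for a b \<xi> phi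
 proof -
  have "(\<integral>V. L (%V. a * \<xi> V + b * phi V) V \<partial>F) = (\<integral>V. a * L \<xi> V + b * L phi V \<partial>F)"
   by (rule Bintegral_cong[OF refl]) (use L_linear(2)[OF n c p] law_space[OF F] in auto)
  also have "... = a * (\<integral>V. L \<xi> V \<partial>F) + b * (\<integral>V. L phi V \<partial>F)" using T[OF c] T[OF p] by simp
  finally have 1: "(\<integral>V. L (%V. a * \<xi> V + b * phi V) V \<partial>F) = a * (\<integral>V. L \<xi> V \<partial>F) + b * (\<integral>V. L phi V \<partial>F)" .
  have "(\<integral>V. (a * \<xi> V + b * phi V)\<^sup>2 \<partial>F) = (\<integral>V. a\<^sup>2 * (\<xi> V)\<^sup>2 + 2 * a * b * (\<xi> V * phi V) + b\<^sup>2 * (phi V)\<^sup>2 \<partial>F)"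
   by (rule Bintegral_cong) (auto simp: power2_eq_square algebra_simps)
  also have "... = a\<^sup>2 * (\<integral>V. (\<xi> V)\<^sup>2 \<partial>F) + 2 * a * b * (\<integral>V. \<xi> V * phi V \<partial>F) + b\<^sup>2 * (\<integral>V. (phi V)\<^sup>2 \<partial>F)"
   using T(5)[OF c] T(5)[OF p] int2[OF c p] by (simp add: Bintegral_add Bintegrable_add)
  finally show ?thesis unfolding J_def Q[OF L_linear(1)[OF n c p]] 1 by simp
 qed
 have Jq: "J \<xi> = (\<integral>V. L \<xi> V \<partial>F) - (\<integral>V. (\<xi> V)\<^sup>2 \<partial>F) / 4" if "\<xi> : Cg n K" for \<xi>
  unfolding J_def by (rule Q[OF that])
 \<comment> \<open>The value of \<open>J\<close> at the midpoint exceeds the mean of the two values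
   by one sixteenth of the squared distance, yet is at most \<open>s\<close>; this gives the factor
   8.\<close>
 have c1: "(\<integral>V. (psi p V - psi q V)\<^sup>2 \<partial>F) <= 8 * e p + 8 * e q" for p q
 proof -
  have "(\<integral>V. (psi p V - psi q V)\<^sup>2 \<partial>F) = (\<integral>V. (psi p V)\<^sup>2 - 2 * (psi p V * psi q V) + (psi q V)\<^sup>2 \<partial>F)"
   by (rule Bintegral_cong) (auto simp: power2_eq_square algebra_simps)
  also have "... = (\<integral>V. (psi p V)\<^sup>2 \<partial>F) - 2 * (\<integral>V. psi p V * psi q V \<partial>F) + (\<integral>V. (psi q V)\<^sup>2 \<partial>F)"
   using T(5)[OF psi(1)] int2[OF psi(1) psi(1)] by simp
  finally have 1: "(\<integral>V. (psi p V - psi q V)\<^sup>2 \<partial>F) = ..." .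
  have "J (%V. (1/2) * psi p V + (1/2) * psi q V) <= s" by (rule Js[OF L_linear(1)[OF n psi(1) psi(1)]])
  note J = this[unfolded J_lin[OF psi(1) psi(1)]] psi(2)[of p, unfolded Jq[OF psi(1)]]
   psi(2)[of q, unfolded Jq[OF psi(1)]]
  have "A - 2 * M + A' <= 8 * a + 8 * b"
   if "1 / 2 * x + 1 / 2 * y - ((1 / 2)\<^sup>2 * A + 2 * (1 / 2) * (1 / 2) * M + (1 / 2)\<^sup>2 * A') / 4 <= s"
    "s - a < x - A / 4" "s - b < y - A' / 4" for A M A' a b x y :: real using that by (simp add: power2_eq_square field_simps)
  from this[OF J] show ?thesis unfolding 1 .
 qed
 have c2: "(%p. 8 * e p) ----> 0" using tendsto_mult_left[OF elim, of 8] by simp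
 have c3: "8 * e p >= 0" for p using e0[of p] by simp
 obtain g where g: "g : bmeas F" "integrable F (%x. (g x)\<^sup>2)"
  "!!p. integrable F (%x. (psi p x - g x)\<^sup>2)" "!!p. (\<integral>x. (psi p x - g x)\<^sup>2 \<partial>F) <= 8 * e p"
  by (rule F.L2_cauchy_limit[of psi "%p. 8 * e p", OF T(1)[OF psi(1)] T(5)[OF psi(1)] c1 c2 c3])
   (rule that)
 note [measurable] = g(1)
 have gphi: "integrable F (%V. g V * phi V)" if "phi : Cg n K" for phi
 proof (rule Bintegrable_bound[of F "%V. (g V)\<^sup>2 + (phi V)\<^sup>2"])
  show "AE V in F. norm (g V * phi V) <= norm ((g V)\<^sup>2 + (phi V)\<^sup>2)" by (simp add: abs_mult_le_squares)
 qed (use T[OF that] g in auto)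
 have dlim: "(%p. \<integral>x. (psi p x - g x)\<^sup>2 \<partial>F) ----> 0"
  by (rule tendsto_sandwich[OF _ _ tendsto_const \<open>(%p. 8 * e p) ----> 0\<close>]) (auto simp: g(4))
 \<comment> \<open>Euler-Lagrange equation: perturbing the near-maximizer \<open>psi p\<close> by
   \<open>t * phi\<close> gains at most \<open>e p\<close>. The 1/2 is the derivative of the square
   over 4, so the representing function is \<open>g / 2\<close>.\<close>
 have weak: "(\<integral>V. L phi V \<partial>F) = (\<integral>V. g V * phi V \<partial>F) / 2" if phi: "phi : Cg n K" for phi
 proof -
  have c: "(%p. \<integral>V. psi p V * phi V \<partial>F) ----> (\<integral>V. g V * phi V \<partial>F)"
  proof -
   have cs: "\<bar>(\<integral>V. psi p V * phi V \<partial>F) - (\<integral>V. g V * phi V \<partial>F)\<bar> <= dl * (\<integral>V. (phi V)\<^sup>2 \<partial>F) + (\<integral>x. (psi p x - g x)\<^sup>2 \<partial>F) / dl"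
    if dl: "dl > 0" for p dl
   proof -
    have "(\<integral>V. psi p V * phi V \<partial>F) - (\<integral>V. g V * phi V \<partial>F) = (\<integral>V. psi p V * phi V - g V * phi V \<partial>F)"
     by (simp add: int2[OF psi(1) phi] gphi[OF phi])
    also have "\<bar>...\<bar> <= (\<integral>V. \<bar>psi p V * phi V - g V * phi V\<bar> \<partial>F)" by (rule integral_abs_bound)
    also have "... <= (\<integral>V. dl * (phi V)\<^sup>2 + (psi p V - g V)\<^sup>2 / dl \<partial>F)"
    proof (rule integral_mono)
     fix V
     have "\<bar>phi V\<bar> * \<bar>psi p V - g V\<bar> <= dl * (phi V)\<^sup>2 + (psi p V - g V)\<^sup>2 / dl"
      by (rule young_weighted[OF dl])
     then show "\<bar>psi p V * phi V - g V * phi V\<bar> <= dl * (phi V)\<^sup>2 + (psi p V - g V)\<^sup>2 / dl"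
      unfolding left_diff_distrib[symmetric] abs_mult by (simp only: mult.commute)
    qed (use int2[OF psi(1) phi] gphi[OF phi] T(5)[OF phi] g(3) in auto)
    also have "... = dl * (\<integral>V. (phi V)\<^sup>2 \<partial>F) + (\<integral>x. (psi p x - g x)\<^sup>2 \<partial>F) / dl"
     using T(5)[OF phi] g(3) by simp
    finally show ?thesis .
   qed
   show ?thesis
   proof (rule LIMSEQ_I)
    fix r :: real assume r: "r > 0"
    define Y where "Y = (\<integral>V. (phi V)\<^sup>2 \<partial>F)"
    have Y: "Y >= 0" by (simp add: Y_def)
    define dl where "dl = r / (2 * (Y + 1))"
    have dl: "dl > 0" using r Y by (simp add: dl_def)
    have dY: "dl * Y < r / 2 + 0 * r" using r Y by (simp add: dl_def field_simps)
    have "r / 2 * dl > 0" using r dl by simp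
    from order_tendstoD(2)[OF dlim this] obtain N where
     N: "!!p. p >= N ==> (\<integral>x. (psi p x - g x)\<^sup>2 \<partial>F) < r / 2 * dl" by (auto simp: eventually_sequentially)
    have "norm ((\<integral>V. psi p V * phi V \<partial>F) - (\<integral>V. g V * phi V \<partial>F)) < r" if "p >= N" for p
    proof -
     have "(\<integral>x. (psi p x - g x)\<^sup>2 \<partial>F) / dl < r / 2" using N[OF that] dl by (simp add: pos_divide_less_eq)
     then show ?thesis using cs[OF dl, of p] dY unfolding Y_def real_norm_def by linarith
    qed
    then show "\<exists>no. \<forall>p\<ge>no. norm ((\<integral>V. psi p V * phi V \<partial>F) - (\<integral>V. g V * phi V \<partial>F)) < r" by blast
   qed
  qed
  define Y where "Y = (\<integral>V. (phi V)\<^sup>2 \<partial>F)"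
  have "t * ((\<integral>V. L phi V \<partial>F) - (\<integral>V. g V * phi V \<partial>F) / 2) <= t\<^sup>2 * (Y / 4)" for t
  proof -
   have le: "t * ((\<integral>V. L phi V \<partial>F) - (\<integral>V. psi p V * phi V \<partial>F) / 2) - t\<^sup>2 * (Y / 4) <= e p" for p
   proof -
    have "J (%V. 1 * psi p V + t * phi V) <= s" by (rule Js[OF L_linear(1)[OF n psi(1) phi]])
    note J = this[unfolded J_lin[OF psi(1) phi]] psi(2)[of p, unfolded Jq[OF psi(1)]]
    have "t * (l - M / 2) - t\<^sup>2 * (Z / 4) <= a"
     if "1 * x + t * l - (1\<^sup>2 * A + 2 * 1 * t * M + t\<^sup>2 * Z) / 4 <= s" "s - a < x - A / 4"
     for A M Z a x l :: real
    proof -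
     have "t * (l - M / 2) - t\<^sup>2 * (Z / 4) = t * l - (2 * 1 * t * M + t\<^sup>2 * Z) / 4"
      by (simp add: right_diff_distrib add_divide_distrib)
     also have "... = (1 * x + t * l - (1\<^sup>2 * A + 2 * 1 * t * M + t\<^sup>2 * Z) / 4) - (x - A / 4)"
      by (simp add: add_divide_distrib)
     finally show ?thesis using that by linarith
    qed
    from this[OF J] show ?thesis unfolding Y_def .
   qed
   have "t * ((\<integral>V. L phi V \<partial>F) - (\<integral>V. g V * phi V \<partial>F) / 2) - t\<^sup>2 * (Y / 4) <= 0"
   proof (rule LIMSEQ_le[OF _ elim])
    show "(%p. t * ((\<integral>V. L phi V \<partial>F) - (\<integral>V. psi p V * phi V \<partial>F) / 2) - t\<^sup>2 * (Y / 4))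
     ----> t * ((\<integral>V. L phi V \<partial>F) - (\<integral>V. g V * phi V \<partial>F) / 2) - t\<^sup>2 * (Y / 4)"
     by (intro tendsto_intros c) auto
   qed (use le in auto)
   then show ?thesis by simp
  qed
  from linear_zero_of_quadratic[OF this] show ?thesis by (simp add: Y_def)
 qed
 \<comment> \<open>By the weak equation \<open>J\<close> becomes a completed square, so its supremum
   is a quarter of the squared norm of \<open>g\<close>.\<close>
 have val: "J (psi p) = (\<integral>V. (g V)\<^sup>2 \<partial>F) / 4 - (\<integral>V. (psi p V - g V)\<^sup>2 \<partial>F) / 4" for p
 proof -
  have "(\<integral>V. (psi p V - g V)\<^sup>2 \<partial>F) = (\<integral>V. (psi p V)\<^sup>2 - 2 * (g V * psi p V) + (g V)\<^sup>2 \<partial>F)"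
   by (rule Bintegral_cong) (auto simp: power2_eq_square algebra_simps)
  also have "... = (\<integral>V. (psi p V)\<^sup>2 \<partial>F) - 2 * (\<integral>V. g V * psi p V \<partial>F) + (\<integral>V. (g V)\<^sup>2 \<partial>F)"
   using T(5)[OF psi(1)] gphi[OF psi(1)] g(2) by simp
  finally show ?thesis unfolding Jq[OF psi(1)] weak[OF psi(1)] by (simp add: field_simps)
 qed
 have "(%p. J (psi p)) ----> (\<integral>V. (g V)\<^sup>2 \<partial>F) / 4 - 0 / 4"
  unfolding val by (intro tendsto_intros dlim) auto
 moreover have "(%p. J (psi p)) ----> s"
 proof (rule tendsto_sandwich[OF _ _ _ tendsto_const])
  show "(%p. s - e p) ----> s" using tendsto_diff[OF tendsto_const[of s] elim] by simp
  show "\<forall>\<^sub>F p in sequentially. s - e p <= J (psi p)" by (intro always_eventually allI less_imp_le psi(2))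
  show "\<forall>\<^sub>F p in sequentially. J (psi p) <= s" by (intro always_eventually allI Js[OF psi(1)])
 qed
 ultimately have sg: "s = (\<integral>V. (g V)\<^sup>2 \<partial>F) / 4" using LIMSEQ_unique by fastforce
 show ?thesis
 proof (rule that[of "%V. g V / 2"])
  show "integrable F (%V. (g V / 2)\<^sup>2)" using g(2) by (simp add: power_divide)
  show "(\<integral>V. L phi V \<partial>F) = (\<integral>V. g V / 2 * phi V \<partial>F)" if "phi : Cg n K" for phi
   using weak[OF that] by simp
  show "sup_quad L K n F = ennreal (\<integral>V. (g V / 2)\<^sup>2 \<partial>F)" using sg s by (simp add: power_divide)
 qed measurable
qed

end

section \<open>Fisher information\<close>

lemma product_sigma_finite_lborel: "product_sigma_finite (%_::nat. lborel :: (real^3) measure)"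
 by (simp add: product_sigma_finite_def lborel.sigma_finite_measure_axioms)

lemma sigma_finite_leb: "sigma_finite_measure (leb n)"
proof -
 interpret product_sigma_finite "%_::nat. lborel :: (real^3) measure" by (rule product_sigma_finite_lborel)
 show ?thesis unfolding leb_def by (rule sigma_finite) simp
qed

lemma meas_leb: "bmeas (leb n) = bmeas (velM {1..n})" by (rule measurable_cong_sets[OF sets_leb refl])

lemma law_sets_leb: "law n F ==> sets F = sets (leb n)" by (simp add: law_def sets_leb)

text \<open>\<open>dens\<close> passes through \<open>enn2real\<close>; the Radon-Nikodym derivative
  of a probability is finite almost everywhere, so this changes the density on a null set
  only.\<close>

lemma dens_density:
 assumes F: "law n F" and d: "has_density n F"
 shows "dens n F : bmeas (leb n)" "F = density (leb n) (%V. ennreal (dens n F V))"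
proof -
 interpret L: sigma_finite_measure "leb n" by (rule sigma_finite_leb)
 interpret F: prob_space F using F by (simp add: law_def)
 obtain f where f: "f : bmeas (leb n)" "density (leb n) f = F" using d by (auto simp: has_density_def)
 have ac: "absolutely_continuous (leb n) F" using f absolutely_continuousI_density by blast
 have s: "sets F = sets (leb n)" by (rule law_sets_leb[OF F])
 show m: "dens n F : bmeas (leb n)" unfolding dens_def[abs_def] by measurable
 have "AE V in leb n. RN_deriv (leb n) F V = ennreal (dens n F V)" using L.RN_deriv_finite[OF F.sigma_finite_measure_axioms ac s]
  by eventually_elim (simp add: dens_def less_top)
 then have "density (leb n) (%V. ennreal (dens n F V)) = density (leb n) (RN_deriv (leb n) F)"
  by (intro density_cong) (use m in auto)
 also have "... = F" by (rule L.density_RN_deriv[OF ac s])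
 finally show "F = density (leb n) (%V. ennreal (dens n F V))" by simp
qed

lemma dens_nonneg: "dens n F V >= 0" by (simp add: dens_def)

lemma law_integral:
 fixes phi :: "velocities => real"
 assumes F: "law n F" and d: "has_density n F" and phi: "phi : bmeas (velM {1..n})"
 shows "(\<integral>V. phi V \<partial>F) = (\<integral>V. dens n F V * phi V \<partial>leb n)"
  and "integrable F phi \<longleftrightarrow> integrable (leb n) (%V. dens n F V * phi V)"
proof -
 note D = dens_density[OF F d]
 have "(\<integral>V. phi V \<partial>density (leb n) (%V. ennreal (dens n F V))) = (\<integral>V. dens n F V *\<^sub>R phi V \<partial>leb n)"
  by (rule integral_density) (use phi D dens_nonneg in \<open>auto simp: meas_leb\<close>)
 then show "(\<integral>V. phi V \<partial>F) = (\<integral>V. dens n F V * phi V \<partial>leb n)" using D(2) by simp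
 have "integrable (density (leb n) (%V. ennreal (dens n F V))) phi = integrable (leb n) (%V. dens n F V *\<^sub>R phi V)"
  by (rule integrable_density) (use phi D dens_nonneg in \<open>auto simp: meas_leb\<close>)
 then show "integrable F phi \<longleftrightarrow> integrable (leb n) (%V. dens n F V * phi V)" using D(2) by simp
qed

lemma partial_diff_op: "i : {1..n} ==> diff_op n 1 (partial i u) UNIV 1"
 by unfold_locales (auto intro: dop.partial)

section \<open>Weak gradients: integrability and uniqueness\<close>

lemma ball_eq_kset: "{V : phase n. \<forall>l\<in>{1..n}. norm (V l) <= R} = kset n R" by (simp add: kset_def)

lemma weak_gradient_integrable:
 assumes w: "weak_gradient n f g" and i: "i : {1..n}" and psi: "continuous_on (phase n) psi" "supp_in n R psi"
 shows "integrable (leb n) (%V. g i V $ u * psi V)"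
proof -
 obtain B where B: "B >= 0" "!!V. V : phase n ==> \<bar>psi V\<bar> <= B" by (rule supp_in_bounded[OF psi]) (rule that)
 have gm: "g i : bmeas (leb n)" using w i by (auto simp: weak_gradient_def)
 have si: "integrable (leb n) (%V. indicator (kset n R) V *\<^sub>R g i V)"
  using w i unfolding weak_gradient_def set_integrable_def ball_eq_kset by blast
 have cm: "(%x :: real^3. x $ u) : bmeas borel"
  by (intro borel_measurable_continuous_onI continuous_intros)
 have psim: "psi : bmeas (leb n)" using continuous_measurable[OF psi(1)] by (simp add: meas_leb)
 show ?thesis
 proof (rule Bintegrable_bound[of _ "%V. B * norm (indicator (kset n R) V *\<^sub>R g i V)"])
  show "integrable (leb n) (%V. B * norm (indicator (kset n R) V *\<^sub>R g i V))"
   by (rule integrable_mult_right[OF integrable_norm[OF si]])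
  show "(%V. g i V $ u * psi V) : bmeas (leb n)"
   using measurable_compose[OF gm cm] psim by measurable
  show "AE V in leb n. norm (g i V $ u * psi V) <= norm (B * norm (indicator (kset n R) V *\<^sub>R g i V))"
  proof (rule AE_I2)
   fix V assume "V : space (leb n)"
   then have V: "V : phase n" by (simp add: space_leb)
   show "norm (g i V $ u * psi V) <= norm (B * norm (indicator (kset n R) V *\<^sub>R g i V))"
   proof (cases "V : kset n R")
    case True
    have "\<bar>g i V $ u\<bar> * \<bar>psi V\<bar> <= norm (g i V) * B"
     by (intro mult_mono component_le_norm_cart B V) auto
    then show ?thesis using True B(1) by (simp add: abs_mult mult.commute)
   next
    case False
    then show ?thesis using supp_in_0[OF psi(2) V False] by simp
   qed
  qed
 qed
qed

text \<open>Fundamental lemma of the calculus of variations. With a cutoff \<open>d\<close> becomes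
  an integrable \<open>w\<close>, and smooth functions approximate indicators in L1 of the measure
  with density |w|. Testing with the sets where \<open>w\<close> is positive or negative forces
  \<open>w\<close> to vanish.\<close>

lemma ae_zero_of_test:
 fixes d :: "velocities => real"
 assumes n: "n >= 1" and dm: "d : bmeas (leb n)"
  and int: "!!psi. psi : Cc_smooth n ==> integrable (leb n) (%V. d V * psi V)"
  and zero: "!!psi. psi : Cc_smooth n ==> (\<integral>V. d V * psi V \<partial>leb n) = 0"
 shows "AE V in leb n. d V = 0"
proof -
 have "AE V in leb n. d V * cut {1..n} p V = 0" for p
 proof -
  define w where "w V = d V * cut {1..n} p V" for V
  have wi: "integrable (leb n) w" unfolding w_def[abs_def] by (rule int) (simp add: Cc_smooth_eq cut_Cg)
  then have wm[measurable]: "w : bmeas (leb n)" by auto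
  define mu where "mu = density (leb n) (%V. ennreal \<bar>w V\<bar>)"
  have fm: "finite_measure mu"
  proof
   have "(\<integral>\<^sup>+V. ennreal \<bar>w V\<bar> \<partial>leb n) < \<infinity>"
    using wi by (simp add: integrable_iff_bounded)
   then show "emeasure mu (space mu) ~= \<infinity>"
    by (auto simp: mu_def emeasure_density cong: nn_integral_cong)
  qed
  have sm: "sets mu = sets (velM {1..n})" by (simp add: mu_def sets_leb)
  have zeroC: "(\<integral>V. indicator C V * w V \<partial>leb n) = 0" if C: "C : sets (leb n)" for C
  proof -
   have C': "C : sets mu" using C by (simp add: mu_def)
   have iC: "integrable (leb n) (%V. indicator C V * w V)"
    using integrable_real_mult_indicator[OF C wi] by (simp add: mult.commute)
   have "\<bar>\<integral>V. indicator C V * w V \<partial>leb n\<bar> < e" if e: "e > 0" for e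
   proof -
    obtain q where q: "q : sm {1..n}" "(\<integral>V. \<bar>indicator C V - q V\<bar> \<partial>mu) < e"
     by (rule smooth_approx[OF fm sm n C' e]) (rule that)
    have qm[measurable]: "q : bmeas (leb n)"
     using C_diff_measurable[OF sm_C_diff[OF q(1)]] by (simp add: meas_leb)
    have qt: "(%V. q V * cut {1..n} p V) : Cc_smooth n"
     unfolding Cc_smooth_eq by (rule Cg_mult[OF cut_Cg sm_C_diff[OF q(1)]])
    have e1: "(%V. d V * (q V * cut {1..n} p V)) = (%V. q V * w V)" by (auto simp: w_def fun_eq_iff)
    have iq: "integrable (leb n) (%V. q V * w V)" and zq: "(\<integral>V. q V * w V \<partial>leb n) = 0"
     using int[OF qt] zero[OF qt] unfolding e1 by auto
    have "(\<integral>V. indicator C V * w V \<partial>leb n) = (\<integral>V. (indicator C V - q V) * w V \<partial>leb n)"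
     using iC iq zq by (simp add: left_diff_distrib)
    also have "\<bar>...\<bar> <= (\<integral>V. \<bar>(indicator C V - q V) * w V\<bar> \<partial>leb n)" by (rule integral_abs_bound)
    also have "... = (\<integral>V. \<bar>indicator C V - q V\<bar> \<partial>mu)"
     unfolding mu_def using C by (subst integral_density) (auto simp: abs_mult mult.commute)
    finally show ?thesis using q(2) by simp
   qed
   from this[of "\<bar>\<integral>V. indicator C V * w V \<partial>leb n\<bar>"] show ?thesis by fastforce
  qed
  have pos: "AE V in leb n. max 0 (w V) = 0"
  proof -
   have "(\<integral>V. max 0 (w V) \<partial>leb n) = (\<integral>V. indicator {V\<in>space (leb n). 0 < w V} V * w V \<partial>leb n)"
    by (rule Bintegral_cong) (auto simp: indicator_def)
   also have "... = 0" by (rule zeroC) measurable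
   finally show ?thesis using integral_nonneg_eq_0_iff_AE[of "leb n" "%V. max 0 (w V)"] wi by auto
  qed
  have neg: "AE V in leb n. max 0 (- w V) = 0"
  proof -
   have "(\<integral>V. max 0 (- w V) \<partial>leb n) = (\<integral>V. - (indicator {V\<in>space (leb n). w V < 0} V * w V) \<partial>leb n)"
    by (rule Bintegral_cong) (auto simp: indicator_def)
   also have "... = 0" by (simp add: zeroC)
   finally show ?thesis using integral_nonneg_eq_0_iff_AE[of "leb n" "%V. max 0 (- w V)"] wi by auto
  qed
  show ?thesis using pos neg by eventually_elim (auto simp: w_def max_def split: if_splits)
 qed
 then have "AE V in leb n. \<forall>p. d V * cut {1..n} p V = 0" unfolding AE_all_countable by blast
 then show ?thesis
 proof eventually_elim
  case (elim V)
  have "eventually (%p. cut {1..n} p V > 0) sequentially" by (rule order_tendstoD(1)[OF cut_limit]) simp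
  then obtain p where "cut {1..n} p V > 0" using eventually_happens'[OF sequentially_bot] by blast
  then show ?case using elim[rule_format, of p] by simp
 qed
qed

lemma weak_gradient_unique:
 assumes n: "n >= 1" and w: "weak_gradient n f g" "weak_gradient n f g'" and i: "i : {1..n}"
 shows "AE V in leb n. g i V = g' i V"
proof -
 have cm: "(%x :: real^3. x $ u) : bmeas borel" for u
  by (intro borel_measurable_continuous_onI continuous_intros)
 have "AE V in leb n. g i V $ u - g' i V $ u = 0" for u
 proof (rule ae_zero_of_test[OF n])
  have "g i : bmeas (leb n)" "g' i : bmeas (leb n)" using w i by (auto simp: weak_gradient_def)
  from measurable_compose[OF this(1) cm] measurable_compose[OF this(2) cm]
  show "(%V. g i V $ u - g' i V $ u) : bmeas (leb n)" by measurable
  fix psi assume psi: "psi : Cc_smooth n"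
  then obtain R where R: "supp_in n R psi" using Cg_supp unfolding Cc_smooth_eq by blast
  have c: "continuous_on (phase n) psi" using psi by (auto simp: Cc_smooth_def intro: C_diff_continuous)
  note I = weak_gradient_integrable[OF w(1) i c R, of u] weak_gradient_integrable[OF w(2) i c R, of u]
  show "integrable (leb n) (%V. (g i V $ u - g' i V $ u) * psi V)" using I by (simp add: left_diff_distrib)
  have "(\<integral>V. g i V $ u * psi V \<partial>leb n) = (\<integral>V. g' i V $ u * psi V \<partial>leb n)"
  proof -
   have "- (\<integral>V. g i V $ u * psi V \<partial>leb n) = - (\<integral>V. g' i V $ u * psi V \<partial>leb n)"
    using w i psi unfolding weak_gradient_def by simp
   then show ?thesis by simp
  qed
  then show "(\<integral>V. (g i V $ u - g' i V $ u) * psi V \<partial>leb n) = 0" using I by (simp add: left_diff_distrib)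
 qed
 then have "AE V in leb n. \<forall>u. g i V $ u - g' i V $ u = 0" unfolding AE_all_countable by blast
 then show ?thesis by eventually_elim (simp add: vec_eq_iff)
qed

section \<open>Fisher information as a supremum of quadratic integrands\<close>

lemma fisher_integrand:
 assumes w: "weak_gradient n f g" and f: "f : bmeas (leb n)" "!!V. f V >= 0"
 shows "(\<integral>\<^sup>+V. ennreal (\<Sum>i\<in>{1..n}. (norm (g i V))\<^sup>2) / ennreal (f V) \<partial>leb n) =
  (\<Sum>i\<in>{1..n}. \<Sum>u\<in>UNIV. \<integral>\<^sup>+V. ennreal ((g i V $ u)\<^sup>2) / ennreal (f V) \<partial>leb n)"
proof -
 have cm: "(%x :: real^3. x $ u) : bmeas borel" for u
  by (intro borel_measurable_continuous_onI continuous_intros)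
 have m: "(%V. g i V $ u) : bmeas (leb n)" if "i : {1..n}" for i u
  using measurable_compose[OF _ cm, of "g i"] w that by (auto simp: weak_gradient_def)
 have m2: "(%V. ennreal ((g i V $ u)\<^sup>2) / ennreal (f V)) : bmeas (leb n)" if "i : {1..n}" for i u
  using m[OF that, of u] f by measurable
 have e: "ennreal (\<Sum>i\<in>{1..n}. (norm (g i V))\<^sup>2) / ennreal (f V) =
   (\<Sum>i\<in>{1..n}. \<Sum>u\<in>UNIV. ennreal ((g i V $ u)\<^sup>2) / ennreal (f V))" for V
 proof -
  have "(norm x)\<^sup>2 = (\<Sum>u\<in>UNIV. (x $ u)\<^sup>2)" for x :: "real^3"
   unfolding power2_norm_eq_inner inner_vec_def by (simp add: power2_eq_square)
  then have "ennreal ((norm (g i V))\<^sup>2) = (\<Sum>u\<in>UNIV. ennreal ((g i V $ u)\<^sup>2))" for i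
   by (subst sum_ennreal) auto
  moreover have "ennreal (\<Sum>i\<in>{1..n}. (norm (g i V))\<^sup>2) = (\<Sum>i\<in>{1..n}. ennreal ((norm (g i V))\<^sup>2))"
   by (subst sum_ennreal) auto
  ultimately show ?thesis by (simp only: divide_ennreal_def sum_distrib_right)
 qed
 show ?thesis unfolding e by (subst nn_integral_sum, intro borel_measurable_sum m2, assumption)
   (intro sum.cong refl nn_integral_sum m2)
qed

lemma fisher_ge:
 assumes F: "law n F" and d: "has_density n F" and w: "weak_gradient n (dens n F) g" and i: "i : {1..n}"
 shows "sup_quad (partial i u) UNIV n F <= (\<integral>\<^sup>+V. ennreal ((g i V $ u)\<^sup>2) / ennreal (dens n F V) \<partial>leb n)"
 unfolding sup_quad_def
proof (rule SUP_least)
 fix psi assume psi: "psi : Cg n UNIV"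
 define f where "f = dens n F"
 have f0: "f V >= 0" for V by (simp add: f_def dens_nonneg)
 interpret D: diff_op n 1 "partial i u" UNIV 1 by (rule partial_diff_op[OF i])
 note T = D.test_integrable[OF F order_refl psi]
 have m: "psi : bmeas (velM {1..n})" "partial i u psi : bmeas (velM {1..n})"
  "(%V. (psi V)\<^sup>2) : bmeas (velM {1..n})"
  using C_diff_measurable[OF D.Cg_d[OF psi]] C_diff_measurable[OF D.L_cont[OF psi order_refl]] by measurable
 obtain R where R: "supp_in n R psi" using Cg_supp[OF psi] by blast
 have c: "continuous_on (phase n) psi" using C_diff_continuous[OF D.Cg_d[OF psi]] .
 have gi: "integrable (leb n) (%V. g i V $ u * psi V)" by (rule weak_gradient_integrable[OF w i c R])
 have sq: "integrable (leb n) (%V. f V * (psi V)\<^sup>2)" using T(5) law_integral(2)[OF F d m(3)] by (simp add: f_def)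
 have "(\<integral>V. quadL (partial i u) psi V \<partial>F) = (\<integral>V. partial i u psi V \<partial>F) - (\<integral>V. (psi V)\<^sup>2 \<partial>F) / 4"
  by (rule D.integral_quadL[OF F order_refl psi])
 also have "... = - (\<integral>V. g i V $ u * psi V \<partial>leb n) - (\<integral>V. f V * (psi V)\<^sup>2 \<partial>leb n) / 4"
  using w i psi unfolding law_integral(1)[OF F d m(2)] law_integral(1)[OF F d m(3)] f_def
  by (simp add: weak_gradient_def Cc_smooth_eq)
 also have "... = (\<integral>V. - (g i V $ u * psi V) - f V * (psi V)\<^sup>2 / 4 \<partial>leb n)" using gi sq by simp
 finally have "ennreal (\<integral>V. quadL (partial i u) psi V \<partial>F) = ennreal (\<integral>V. - (g i V $ u * psi V) - f V * (psi V)\<^sup>2 / 4 \<partial>leb n)"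
  by simp
 also have "... <= (\<integral>\<^sup>+V. ennreal (- (g i V $ u * psi V) - f V * (psi V)\<^sup>2 / 4) \<partial>leb n)"
  by (rule ennreal_integral_le) (use gi sq in simp)
 also have "... <= (\<integral>\<^sup>+V. ennreal ((g i V $ u)\<^sup>2) / ennreal (dens n F V) \<partial>leb n)"
 proof (rule nn_integral_mono)
  fix V
  let ?x = "g i V $ u"
  show "ennreal (- (?x * psi V) - f V * (psi V)\<^sup>2 / 4) <= ennreal (?x\<^sup>2) / ennreal (dens n F V)"
  \<comment> \<open>Where the density vanishes, the quotient is infinite unless the gradient
    component vanishes too, and then the left side is 0. Elsewhere the bound is a completed
    square.\<close>
  proof (cases "f V = 0")
   case True
   show ?thesis
   proof (cases "?x = 0")
    case False
    then have "ennreal (?x\<^sup>2) / ennreal (dens n F V) = top" using True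
     by (simp add: f_def divide_ennreal_def ennreal_mult_top)
    then show ?thesis by simp
   qed (use True in simp)
  next
   case False
   then have f: "f V > 0" using f0[of V] by simp
   have "0 <= (?x + f V * psi V / 2)\<^sup>2 / f V" using f by simp
   also have "... = ?x\<^sup>2 / f V + ?x * psi V + f V * (psi V)\<^sup>2 / 4"
    using f by (simp add: power2_eq_square field_simps)
   finally have "- (?x * psi V) - f V * (psi V)\<^sup>2 / 4 <= ?x\<^sup>2 / f V" by simp
   then have "ennreal (- (?x * psi V) - f V * (psi V)\<^sup>2 / 4) <= ennreal (?x\<^sup>2 / f V)" by (rule ennreal_leI)
   then show ?thesis using f by (simp add: f_def divide_ennreal)
  qed
 qed
 finally show "ennreal (\<integral>V. quadL (partial i u) psi V \<partial>F) <= (\<integral>\<^sup>+V. ennreal ((g i V $ u)\<^sup>2) / ennreal (dens n F V) \<partial>leb n)" .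
qed

lemma fisher_construct:
 assumes F: "law n F" and d: "has_density n F"
  and fin: "!!i u. i : {1..n} ==> sup_quad (partial i u) UNIV n F < \<infinity>"
 obtains g where "weak_gradient n (dens n F) g"
  "!!i u. i : {1..n} ==> (\<integral>\<^sup>+V. ennreal ((g i V $ u)\<^sup>2) / ennreal (dens n F V) \<partial>leb n) = sup_quad (partial i u) UNIV n F"
proof -
 interpret F: prob_space F using F by (simp add: law_def)
 note D = dens_density[OF F d]
 have sF: "sets F = sets (velM {1..n})" using F by (simp add: law_def)
 have "\<exists>h. i : {1..n} --> h : bmeas F & integrable F (%V. (h V)\<^sup>2) \<and>
  (\<forall>phi\<in>Cg n UNIV. (\<integral>V. partial i u phi V \<partial>F) = (\<integral>V. h V * phi V \<partial>F)) \<and>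
  sup_quad (partial i u) UNIV n F = ennreal (\<integral>V. (h V)\<^sup>2 \<partial>F)" for i u
 proof (cases "i : {1..n}")
  case True
  interpret D: diff_op n 1 "partial i u" UNIV 1 by (rule partial_diff_op[OF True])
  show ?thesis by (rule D.riesz[OF F order_refl fin[OF True]]) blast
 qed auto
 then have "\<forall>iu. \<exists>h. fst iu : {1..n} --> h : bmeas F & integrable F (%V. (h V)\<^sup>2) \<and>
  (\<forall>phi\<in>Cg n UNIV. (\<integral>V. partial (fst iu) (snd iu) phi V \<partial>F) = (\<integral>V. h V * phi V \<partial>F)) \<and>
  sup_quad (partial (fst iu) (snd iu)) UNIV n F = ennreal (\<integral>V. (h V)\<^sup>2 \<partial>F)" by blast
 from choice[OF this] obtain h' where h': "\<forall>iu. fst iu : {1..n} --> h' iu : bmeas F & integrable F (%V. (h' iu V)\<^sup>2) \<and>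
  (\<forall>phi\<in>Cg n UNIV. (\<integral>V. partial (fst iu) (snd iu) phi V \<partial>F) = (\<integral>V. h' iu V * phi V \<partial>F)) \<and>
  sup_quad (partial (fst iu) (snd iu)) UNIV n F = ennreal (\<integral>V. (h' iu V)\<^sup>2 \<partial>F)" by (elim exE)
 define h where "h i u = h' (i, u)" for i u
 have h: "h i u : bmeas F" "integrable F (%V. (h i u V)\<^sup>2)"
  "!!phi. phi : Cg n UNIV ==> (\<integral>V. partial i u phi V \<partial>F) = (\<integral>V. h i u V * phi V \<partial>F)"
  "sup_quad (partial i u) UNIV n F = ennreal (\<integral>V. (h i u V)\<^sup>2 \<partial>F)" if "i : {1..n}" for i u
  using h'[rule_format, of "(i, u)"] that by (simp_all add: h_def)
 have hm: "h i u : bmeas (velM {1..n})" if "i : {1..n}" for i u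
  using h(1)[OF that] by (simp add: measurable_cong_sets[OF sF refl])
 \<comment> \<open>Integration by parts explains the sign. The factor \<open>dens\<close> makes
   \<open>g\<close> vanish wherever the density does, so with the convention 0/0 = 0 the quotient
   equals the density times the square of \<open>h\<close> everywhere.\<close>
 define g where "g i V = (\<chi> u. - (h i u V * dens n F V))" for i V
 have g_m: "g i : bmeas (leb n)" if "i : {1..n}" for i
 proof (subst borel_measurable_euclidean_space, intro ballI)
  fix b :: "real^3" assume "b : Basis"
  then obtain u where b: "b = axis u 1" by (auto simp: Basis_vec_def)
  have "(%V. - (h i u V * dens n F V)) : bmeas (leb n)"
   using hm[OF that, of u] D(1) by (simp add: meas_leb)
  then show "(%V. g i V \<bullet> b) : bmeas (leb n)"
   by (simp add: b cart_eq_inner_axis[symmetric] g_def)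
 qed
 have hi: "integrable F (h i u)" if "i : {1..n}" for i u by (rule F.integrable_of_square[OF h(1,2)[OF that]])
 have ghi: "integrable (leb n) (%V. g i V $ u)" if "i : {1..n}" for i u
  using hi[OF that, of u] law_integral(2)[OF F d hm[OF that, of u]] by (simp add: g_def mult.commute)
 have gint: "integrable (leb n) (g i)" if "i : {1..n}" for i
 proof (rule Bintegrable_bound[of _ "%V. \<Sum>u\<in>UNIV. \<bar>g i V $ u\<bar>"])
  show "integrable (leb n) (%V. \<Sum>u\<in>UNIV. \<bar>g i V $ u\<bar>)" using ghi[OF that] by simp
  show "AE V in leb n. norm (g i V) <= norm (\<Sum>u\<in>UNIV. \<bar>g i V $ u\<bar>)"
   using norm_le_l1_cart[of "g i _"] by (auto intro!: AE_I2 intro: order_trans)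
 qed (rule g_m[OF that])
 have "weak_gradient n (dens n F) g" unfolding weak_gradient_def
 proof (intro ballI conjI allI)
  fix i assume i: "i : {1..n}"
  show "g i : bmeas (leb n)" by (rule g_m[OF i])
  show "set_integrable (leb n) {V : phase n. \<forall>l\<in>{1..n}. norm (V l) <= R} (g i)" for R
   unfolding set_integrable_def
  proof (rule integrable_mult_indicator[OF _ gint[OF i]])
   have "{V : space (velM {1..n}). \<forall>l\<in>{1..n}. norm (V l) <= R} : sets (velM {1..n})" by measurable
   then show "{V : phase n. \<forall>l\<in>{1..n}. norm (V l) <= R} : sets (leb n)" by (simp add: space_velM sets_leb)
  qed
  fix psi u assume "psi : Cc_smooth n"
  then have psi: "psi : Cg n UNIV" by (simp add: Cc_smooth_eq)
  interpret D: diff_op n 1 "partial i u" UNIV 1 by (rule partial_diff_op[OF i])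
  have m: "psi : bmeas (velM {1..n})" "partial i u psi : bmeas (velM {1..n})"
   using C_diff_measurable[OF D.Cg_d[OF psi]] C_diff_measurable[OF D.L_cont[OF psi order_refl]] by auto
  have "(\<integral>V. dens n F V * partial i u psi V \<partial>leb n) = (\<integral>V. h i u V * psi V \<partial>F)"
   using law_integral(1)[OF F d m(2)] h(3)[OF i psi, of u] by (simp only:)
  also have "... = (\<integral>V. dens n F V * (h i u V * psi V) \<partial>leb n)"
   by (rule law_integral(1)[OF F d]) (use m hm[OF i] in measurable)
  also have "... = (\<integral>V. - (g i V $ u * psi V) \<partial>leb n)"
   by (rule Bintegral_cong) (auto simp: g_def algebra_simps)
  finally show "(\<integral>V. dens n F V * partial i u psi V \<partial>leb n) = - (\<integral>V. g i V $ u * psi V \<partial>leb n)" by simp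
 qed
 moreover have "(\<integral>\<^sup>+V. ennreal ((g i V $ u)\<^sup>2) / ennreal (dens n F V) \<partial>leb n) = sup_quad (partial i u) UNIV n F"
  if i: "i : {1..n}" for i u
 proof -
  have "(\<integral>\<^sup>+V. ennreal ((g i V $ u)\<^sup>2) / ennreal (dens n F V) \<partial>leb n) =
    (\<integral>\<^sup>+V. ennreal (dens n F V) * ennreal ((h i u V)\<^sup>2) \<partial>leb n)"
  proof (rule nn_integral_cong)
   fix V
   show "ennreal ((g i V $ u)\<^sup>2) / ennreal (dens n F V) = ennreal (dens n F V) * ennreal ((h i u V)\<^sup>2)"
   proof (cases "dens n F V = 0")
    case False
    then have "dens n F V > 0" using dens_nonneg[of n F V] by simp
    then show ?thesis by (simp add: g_def divide_ennreal ennreal_mult[symmetric] power2_eq_square field_simps)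
   qed (simp add: g_def)
  qed
  also have "... = (\<integral>\<^sup>+V. ennreal ((h i u V)\<^sup>2) \<partial>density (leb n) (%V. ennreal (dens n F V)))"
   by (rule nn_integral_density[symmetric]) (use D(1) hm[OF i] in \<open>auto simp: meas_leb\<close>)
  also have "... = (\<integral>\<^sup>+V. ennreal ((h i u V)\<^sup>2) \<partial>F)" using D(2) by simp
  also have "... = ennreal (\<integral>V. (h i u V)\<^sup>2 \<partial>F)"
   by (rule nn_integral_eq_integral[OF h(2)[OF i]]) auto
  finally show ?thesis using h(4)[OF i] by simp
 qed
 ultimately show ?thesis using that by blast
qed

text \<open>If the partial derivatives of a law are bounded functionals, its translates depend continuously on
 the shift in total variation, so the law is absolutely continuous.\<close>

lemma smooth_approx2:
 assumes mu: "prob_space mu1" "prob_space mu2" "sets mu1 = sets (velM {1..n})" "sets mu2 = sets (velM {1..n})"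
  and n: "n >= 1" and C: "C : sets (velM {1..n})" and e: "e > 0"
 obtains q where "q : sm {1..n}" "(\<integral>V. \<bar>indicator C V - q V\<bar> \<partial>mu1) < e" "(\<integral>V. \<bar>indicator C V - q V\<bar> \<partial>mu2) < e"
proof -
 define K where "K b = (if b then mu1 else mu2)" for b
 define mu where "mu = measure_pmf (bernoulli_pmf (1/2)) \<bind> K"
 have Kp: "prob_space (K b)" "sets (K b) = sets (velM {1..n})" for b using mu by (auto simp: K_def)
 have Km: "K : measure_pmf (bernoulli_pmf (1/2)) \<rightarrow>\<^sub>M subprob_algebra (velM {1..n})"
  using Kp by (auto simp: measurable_def space_subprob_algebra prob_space_imp_subprob_space)
 have s: "sets mu = sets (velM {1..n})" unfolding mu_def by (rule sets_bind) (auto simp: Kp)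
 have "prob_space mu" unfolding mu_def
  by (rule prob_space.prob_space_bind[OF measure_pmf.prob_space_axioms _ Km]) (simp add: Kp)
 then interpret P: prob_space mu .
 obtain q where q: "q : sm {1..n}" "(\<integral>V. \<bar>indicator C V - q V\<bar> \<partial>mu) < e / 2"
  using smooth_approx[OF P.finite_measure_axioms s n, of C "e / 2"] C e s by auto
 have qm[measurable]: "q : bmeas (velM {1..n})" by (rule C_diff_measurable[OF sm_C_diff[OF q(1)]])
 note [measurable] = C
 let ?f = "%V. \<bar>indicator C V - q V\<bar> :: real"
 have fm: "?f : bmeas (velM {1..n})" by measurable
 have fb: "\<bar>?f V\<bar> <= 1" for V using sm_range[OF q(1), of V] by (auto simp: indicator_def)
 have "(\<integral>V. ?f V \<partial>mu) = (\<integral>b. (\<integral>V. ?f V \<partial>K b) \<partial>measure_pmf (bernoulli_pmf (1/2)))"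
  unfolding mu_def by (rule integral_bind[where B=1 and B'=1 and K="velM {1..n}", OF fm fb Km])
   (auto simp: Kp measure_pmf.finite_measure_axioms intro!: subprob_space.subprob_emeasure_le_1 prob_space_imp_subprob_space)
 also have "... = (\<integral>V. ?f V \<partial>mu1) / 2 + (\<integral>V. ?f V \<partial>mu2) / 2" by (simp add: K_def)
 finally have "(\<integral>V. ?f V \<partial>mu1) / 2 + (\<integral>V. ?f V \<partial>mu2) / 2 < e / 2" using q(2) by simp
 moreover have "(\<integral>V. ?f V \<partial>mu1) >= 0" "(\<integral>V. ?f V \<partial>mu2) >= 0" by auto
 ultimately show ?thesis using that[OF q(1)] by linarith
qed

text \<open>The way from 0 to \<open>t\<close> is split into \<open>Suc N\<close> equal steps; the
  quadratic errors add up to \<open>B * t^2 / Suc N\<close> and disappear. In the application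
  \<open>B\<close> bounds second derivatives of a test, while \<open>C\<close> is uniform in the
  test.\<close>

lemma lipschitz_of_quadratic:
 fixes \<Phi> :: "real => real"
 assumes l: "!!t s. \<bar>\<Phi> (t + s) - \<Phi> t\<bar> <= C * \<bar>s\<bar> + B * s\<^sup>2"
 shows "\<bar>\<Phi> t - \<Phi> 0\<bar> <= C * \<bar>t\<bar>"
proof -
 have le: "\<bar>\<Phi> t - \<Phi> 0\<bar> <= C * \<bar>t\<bar> + B * t\<^sup>2 / real (Suc N)" for N
 proof -
  define s where "s = t / real (Suc N)"
  have "\<bar>\<Phi> (real k * s) - \<Phi> 0\<bar> <= real k * (C * \<bar>s\<bar> + B * s\<^sup>2)" for k
  proof (induction k)
   case (Suc k)
   have "real (Suc k) * s = real k * s + s" by (simp add: algebra_simps)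
   then have "\<bar>\<Phi> (real (Suc k) * s) - \<Phi> (real k * s)\<bar> <= C * \<bar>s\<bar> + B * s\<^sup>2" using l[of "real k * s" s] by simp
   moreover have "real (Suc k) * (C * \<bar>s\<bar> + B * s\<^sup>2) = real k * (C * \<bar>s\<bar> + B * s\<^sup>2) + (C * \<bar>s\<bar> + B * s\<^sup>2)"
    by (simp add: algebra_simps)
   ultimately show ?case using Suc by linarith
  qed simp
  from this[of "Suc N"] have "\<bar>\<Phi> (real (Suc N) * s) - \<Phi> 0\<bar> <= real (Suc N) * (C * \<bar>s\<bar> + B * s\<^sup>2)" .
  moreover have "real (Suc N) * s = t" by (simp add: s_def)
  moreover have "real (Suc N) * (C * \<bar>s\<bar> + B * s\<^sup>2) = C * \<bar>t\<bar> + B * t\<^sup>2 / real (Suc N)"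
  proof -
   have "x * (C * \<bar>t / x\<bar> + B * (t / x)\<^sup>2) = C * \<bar>t\<bar> + B * t\<^sup>2 / x" if "x > 0" for x :: real
    using that by (simp add: field_simps power2_eq_square)
   then show ?thesis unfolding s_def by simp
  qed
  ultimately show ?thesis by simp
 qed
 have "(%N. C * \<bar>t\<bar> + B * t\<^sup>2 / real (Suc N)) ----> C * \<bar>t\<bar>" by real_asymp
 then show ?thesis by (rule LIMSEQ_le_const) (use le in auto)
qed

lemma partial_functional_bounded:
 assumes F: "law n F" and i: "i : {1..n}" and fin: "sup_quad (partial i u) UNIV n F < \<infinity>"
 shows "\<exists>C\<ge>0. \<forall>psi\<in>Cg n UNIV. (\<forall>V\<in>phase n. \<bar>psi V\<bar> <= 1) --> \<bar>\<integral>V. partial i u psi V \<partial>F\<bar> <= C"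
proof -
 interpret F: prob_space F using F by (simp add: law_def)
 interpret D: diff_op n 1 "partial i u" UNIV 1 by (rule partial_diff_op[OF i])
 show ?thesis
 proof (rule D.riesz[OF F order_refl fin])
  fix h assume h: "h : bmeas F" "integrable F (%V. (h V)\<^sup>2)"
   "!!phi. phi : Cg n UNIV ==> (\<integral>V. partial i u phi V \<partial>F) = (\<integral>V. h V * phi V \<partial>F)"
  have hi: "integrable F h" by (rule F.integrable_of_square[OF h(1,2)])
  show ?thesis
  proof (intro exI[of _ "\<integral>V. \<bar>h V\<bar> \<partial>F"] conjI ballI impI)
   fix psi assume psi: "psi : Cg n UNIV" "\<forall>V\<in>phase n. \<bar>psi V\<bar> <= 1"
   have "\<bar>\<integral>V. h V * psi V \<partial>F\<bar> <= (\<integral>V. \<bar>h V * psi V\<bar> \<partial>F)" by (rule integral_abs_bound)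
   also have "... <= (\<integral>V. \<bar>h V\<bar> \<partial>F)"
   proof (rule integral_mono_AE')
    show "AE V in F. \<bar>h V * psi V\<bar> <= \<bar>h V\<bar>"
     using psi(2) law_space[OF F] by (auto intro!: AE_I2 simp: abs_mult mult_left_le)
   qed (use hi in auto)
   finally show "\<bar>\<integral>V. partial i u psi V \<partial>F\<bar> <= (\<integral>V. \<bar>h V\<bar> \<partial>F)" by (simp add: h(3)[OF psi(1)])
  qed simp
 qed
qed

lemma taylor2:
 fixes f :: "real => real"
 assumes f: "!!r. (f has_real_derivative f' r) (at r)" "!!r. (f' has_real_derivative f'' r) (at r)"
  and B: "!!r. \<bar>f'' r\<bar> <= B"
 shows "\<bar>f (t + s) - f t - s * f' t\<bar> <= B * s\<^sup>2"
proof -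
 have l: "\<bar>f' x - f' y\<bar> <= B * \<bar>x - y\<bar>" for x y
  using field_differentiable_bound[of UNIV f' f'' B x y] f(2) B by auto
 have "norm ((f s' - s' * f' t) - (f t - t * f' t)) <= (B * \<bar>s\<bar>) * norm (s' - t)" if s': "s' = t + s" for s'
 proof (rule field_differentiable_bound[of "closed_segment t s'" _ "%r. f' r - f' t"])
  show "((%r. f r - r * f' t) has_field_derivative f' z - f' t) (at z within closed_segment t s')" for z
   by (rule has_field_derivative_at_within) (auto intro!: derivative_eq_intros f(1))
  show "norm (f' z - f' t) <= B * \<bar>s\<bar>" if "z : closed_segment t s'" for z
  proof -
   have "\<bar>z - t\<bar> <= \<bar>s\<bar>" using that s' by (auto simp: closed_segment_eq_real_ivl split: if_splits)
   moreover have "0 <= B" using B[of 0] by simp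
   ultimately have "B * \<bar>z - t\<bar> <= B * \<bar>s\<bar>" by (rule mult_left_mono)
   then show ?thesis using l[of z t] by simp
  qed
 qed auto
 from this[OF refl] show ?thesis by (simp add: algebra_simps power2_eq_square)
qed

lemma Cg_shift:
 assumes "psi : Cg n K" "i : {1..n}"
 shows "(%V. psi (mv V i u t)) : Cg n K"
proof -
 obtain R where R: "supp_in n R psi" using Cg_supp[OF assms(1)] by blast
 have "supp_in n (R + \<bar>t\<bar>) (%V. psi (mv V i u t))" unfolding supp_in_def
 proof (intro ballI impI)
  fix V assume V: "V : phase n" "\<exists>k\<in>{1..n}. R + \<bar>t\<bar> < norm (V k)"
  then obtain k where k: "k : {1..n}" "R + \<bar>t\<bar> < norm (V k)" by blast
  have "norm (V k) <= norm (mv V i u t k) + \<bar>t\<bar>"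
  proof (cases "k = i")
   case True
   have "norm (V i) = norm ((V i + t *\<^sub>R axis u 1) - t *\<^sub>R axis u 1)" by simp
   also have "... <= norm (V i + t *\<^sub>R axis u 1) + norm (t *\<^sub>R axis u (1::real))" by (rule norm_triangle_ineq4)
   finally show ?thesis using True by (simp add: mv_def)
  qed (simp add: mv_def)
  then have "R < norm (mv V i u t k)" using k(2) by linarith
  then show "psi (mv V i u t) = 0" using R mv_phase[OF V(1) assms(2), of u t] k(1) unfolding supp_in_def by blast
 qed
 moreover have "C_diff n k (%V. psi (mv V i u t))" if "k : K" for k
  unfolding mv_def by (rule C_diff_shift) (use assms that in \<open>auto simp: Cg_def\<close>)
 ultimately show ?thesis by (auto simp: Cg_def compact_supp_iff)
qed

lemma mv_meas: "i : {1..n} ==> (%V. mv V i u t) : velM {1..n} \<rightarrow>\<^sub>M velM {1..n}"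
proof (rule measurable_PiM_single')
 assume i: "i : {1..n}"
 show "(%V. mv V i u t) : space (velM {1..n}) \<rightarrow> (\<Pi>\<^sub>E i\<in>{1..n}. space borel)"
  using mv_phase[OF _ i] by (simp add: space_velM Pi_iff phase_def[symmetric])
 show "(%V. mv V i u t k) : bmeas (velM {1..n})" if "k : {1..n}" for k
  using that i by (cases "k = i") (simp_all add: mv_def)
qed

text \<open>All translates of \<open>psi\<close> are again tests bounded by 1, so the integral of
  the translated test has derivative at most \<open>C\<close> in absolute value at every
  \<open>t\<close>, with the same \<open>C\<close> for all tests.\<close>

lemma translate_test:
 assumes F: "law n F" and i: "i : {1..n}" and psi: "psi : Cg n UNIV" "\<forall>V\<in>phase n. \<bar>psi V\<bar> <= 1"
  and C: "\<forall>psi\<in>Cg n UNIV. (\<forall>V\<in>phase n. \<bar>psi V\<bar> <= 1) --> \<bar>\<integral>V. partial i u psi V \<partial>F\<bar> <= C"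
 shows "\<bar>(\<integral>V. psi (mv V i u t) \<partial>F) - (\<integral>V. psi V \<partial>F)\<bar> <= C * \<bar>t\<bar>"
proof -
 interpret F: prob_space F using F by (simp add: law_def)
 interpret D: diff_op n 1 "partial i u" UNIV 1 by (rule partial_diff_op[OF i])
 have s: "sets F = sets (velM {1..n})" using F by (simp add: law_def)
 obtain R where R: "supp_in n R psi" using Cg_supp[OF psi(1)] by blast
 have c2: "C_diff n (Suc (Suc 0)) psi" using psi(1) by (auto simp: Cg_def)
 note c1 = C_diff_partial[OF c2 i, of u]
 have R2: "supp_in n R (partial i u (partial i u psi))"
  by (rule dop_supp[OF D.dop order_refl dop_supp[OF D.dop order_refl R]])
 obtain B where B: "B >= 0" "!!V. V : phase n ==> \<bar>partial i u (partial i u psi) V\<bar> <= B"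
  by (rule supp_in_bounded[OF C_diff_continuous[OF C_diff_partial[OF c1 i]] R2]) (rule that)
 define \<Phi> where "\<Phi> t = (\<integral>V. psi (mv V i u t) \<partial>F)" for t
 have q: "\<bar>\<Phi> (t + s) - \<Phi> t\<bar> <= C * \<bar>s\<bar> + B * s\<^sup>2" for t s
 proof -
  have it: "integrable F (%V. psi (mv V i u r))" for r by (rule D.test_integrable(3)[OF F order_refl Cg_shift[OF psi(1) i]])
  have pe: "partial i u (%V. psi (mv V i u t)) V = partial i u psi (mv V i u t)" for V
   unfolding mv_def by (rule partial_shift)
  have ip: "integrable F (%V. partial i u psi (mv V i u t))"
   using D.test_integrable(4)[OF F order_refl Cg_shift[OF psi(1) i], of u t] unfolding pe .
  have pb: "\<bar>\<integral>V. partial i u psi (mv V i u t) \<partial>F\<bar> <= C"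
  proof -
   have "\<forall>V\<in>phase n. \<bar>psi (mv V i u t)\<bar> <= 1" using psi(2) mv_phase[OF _ i] by blast
   with bspec[OF C Cg_shift[OF psi(1) i, of u t]] show ?thesis unfolding pe by (rule mp)
  qed
  have "\<Phi> (t + s) - \<Phi> t - s * (\<integral>V. partial i u psi (mv V i u t) \<partial>F) =
    (\<integral>V. psi (mv V i u (t + s)) - psi (mv V i u t) - s * partial i u psi (mv V i u t) \<partial>F)"
   unfolding \<Phi>_def using it ip by simp
  also have "\<bar>...\<bar> <= (\<integral>V. \<bar>psi (mv V i u (t + s)) - psi (mv V i u t) - s * partial i u psi (mv V i u t)\<bar> \<partial>F)"
   by (rule integral_abs_bound)
  also have "... <= (\<integral>V. B * s\<^sup>2 \<partial>F)"
  proof (rule integral_mono_AE')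
   show "AE V in F. \<bar>psi (mv V i u (t + s)) - psi (mv V i u t) - s * partial i u psi (mv V i u t)\<bar> <= B * s\<^sup>2"
   proof (rule AE_I2)
    fix V assume "V : space F"
    then have V: "V : phase n" using law_space[OF F] by simp
    show "\<bar>psi (mv V i u (t + s)) - psi (mv V i u t) - s * partial i u psi (mv V i u t)\<bar> <= B * s\<^sup>2"
     by (rule taylor2[OF slice_has_derivative[OF c2 V i] slice_has_derivative[OF c1 V i] B(2)[OF mv_phase[OF V i]]])
   qed
  qed (use B(1) in auto)
  also have "... = B * s\<^sup>2" by (simp add: F.prob_space)
  finally have "\<bar>\<Phi> (t + s) - \<Phi> t - s * (\<integral>V. partial i u psi (mv V i u t) \<partial>F)\<bar> <= B * s\<^sup>2" .
  moreover have "\<bar>s * (\<integral>V. partial i u psi (mv V i u t) \<partial>F)\<bar> <= C * \<bar>s\<bar>"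
   using mult_left_mono[OF pb abs_ge_zero[of s]] by (simp add: abs_mult mult.commute)
  ultimately show ?thesis by linarith
 qed
 show ?thesis using lipschitz_of_quadratic[of \<Phi> C B t, OF q] by (simp add: \<Phi>_def)
qed

text \<open>The indicator of \<open>N\<close> is approximated by one smooth function in L1 of
  \<open>F\<close> and of the translated law \<open>mu\<close> at the same time; a cutoff sent to
  infinity makes this function an admissible test.\<close>

lemma translate_set:
 assumes F: "law n F" and n: "n >= 1" and i: "i : {1..n}" and N: "N : sets (velM {1..n})"
  and C: "\<forall>psi\<in>Cg n UNIV. (\<forall>V\<in>phase n. \<bar>psi V\<bar> <= 1) --> \<bar>\<integral>V. partial i u psi V \<partial>F\<bar> <= C"
 shows "{V : phase n. mv V i u t : N} : sets (velM {1..n})"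
  and "measure F N <= measure F {V : phase n. mv V i u t : N} + C * \<bar>t\<bar>"
proof -
 interpret F: prob_space F using F by (simp add: law_def)
 have s: "sets F = sets (velM {1..n})" using F by (simp add: law_def)
 have mm: "(%V. mv V i u t) : velM {1..n} \<rightarrow>\<^sub>M velM {1..n}" by (rule mv_meas[OF i])
 have mmF: "(%V. mv V i u t) : F \<rightarrow>\<^sub>M velM {1..n}" using mm by (simp add: measurable_cong_sets[OF s refl])
 show Nt: "{V : phase n. mv V i u t : N} : sets (velM {1..n})"
  using measurable_sets[OF mm N] by (simp add: space_velM vimage_def Int_def conj_commute)
 define mu where "mu = distr F (velM {1..n}) (%V. mv V i u t)"
 have mup: "prob_space mu" unfolding mu_def by (rule F.prob_space_distr[OF mmF])
 have mus: "sets mu = sets (velM {1..n})" by (simp add: mu_def)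
 interpret M: prob_space mu by (rule mup)
 have muN: "measure mu N = measure F {V : phase n. mv V i u t : N}"
  unfolding mu_def using N by (simp add: measure_distr[OF mmF] law_space[OF F] vimage_def Int_def conj_commute)
 show "measure F N <= measure F {V : phase n. mv V i u t : N} + C * \<bar>t\<bar>"
 proof (rule field_le_epsilon)
  fix e :: real assume e: "e > 0"
  have e2: "e / 2 > 0" using e by simp
  obtain q where q: "q : sm {1..n}" "(\<integral>V. \<bar>indicator N V - q V\<bar> \<partial>F) < e / 2" "(\<integral>V. \<bar>indicator N V - q V\<bar> \<partial>mu) < e / 2"
   by (rule smooth_approx2[OF F.prob_space_axioms mup s mus n N e2]) (rule that)
  have qm: "q : bmeas (velM {1..n})" by (rule C_diff_measurable[OF sm_C_diff[OF q(1)]])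
  have cm: "cut {1..n} p : bmeas (velM {1..n})" for p by (rule C_diff_measurable[OF C_diff_cut])
  have b: "\<bar>q V * cut {1..n} p V\<bar> <= 1" for p V
   using sm_range[OF q(1), of V] cut_range[of "{1..n}" p V] by (simp add: abs_mult mult_le_one)
  have lim: "(%p. \<integral>V. q V * cut {1..n} p V \<partial>M) ----> (\<integral>V. q V \<partial>M)" if "prob_space M" "sets M = sets (velM {1..n})" for M
  proof -
   interpret P: prob_space M by fact
   show ?thesis
   proof (rule integral_dominated_convergence[where w="%_. 1"])
    show "AE V in M. (%p. q V * cut {1..n} p V) ----> q V"
     by (rule AE_I2) (rule tendsto_mult[OF tendsto_const cut_limit, simplified])
   qed (use qm cm b in \<open>auto simp: measurable_cong_sets[OF that(2) refl] intro!: borel_measurable_times\<close>)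
  qed
  have qc: "(%V. q V * cut {1..n} p V) : Cg n UNIV" for p by (rule Cg_mult[OF cut_Cg sm_C_diff[OF q(1)]])
  have "\<bar>(\<integral>V. q V * cut {1..n} p V \<partial>mu) - (\<integral>V. q V * cut {1..n} p V \<partial>F)\<bar> <= C * \<bar>t\<bar>" for p
  proof -
   have "(\<integral>V. q V * cut {1..n} p V \<partial>mu) = (\<integral>V. q (mv V i u t) * cut {1..n} p (mv V i u t) \<partial>F)"
    unfolding mu_def by (rule integral_distr[OF mmF]) (use qm cm in measurable)
   then show ?thesis using translate_test[OF F i qc _ C] b by simp
  qed
  moreover have "(%p. \<bar>(\<integral>V. q V * cut {1..n} p V \<partial>mu) - (\<integral>V. q V * cut {1..n} p V \<partial>F)\<bar>)
    ----> \<bar>(\<integral>V. q V \<partial>mu) - (\<integral>V. q V \<partial>F)\<bar>"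
   by (intro tendsto_intros lim mup mus s F.prob_space_axioms)
  ultimately have d: "\<bar>(\<integral>V. q V \<partial>mu) - (\<integral>V. q V \<partial>F)\<bar> <= C * \<bar>t\<bar>"
   by (intro LIMSEQ_le_const2[of "%p. \<bar>(\<integral>V. q V * cut {1..n} p V \<partial>mu) - (\<integral>V. q V * cut {1..n} p V \<partial>F)\<bar>"]) auto
  have app: "\<bar>measure M N - (\<integral>V. q V \<partial>M)\<bar> <= (\<integral>V. \<bar>indicator N V - q V\<bar> \<partial>M)"
   if "prob_space M" "sets M = sets (velM {1..n})" for M
  proof -
   interpret P: prob_space M by fact
   have NM: "N : sets M" using N that by simp
   have qi: "integrable M q"
    using sm_range[OF q(1)] qm by (intro P.integrable_bounded[where B=1]) (auto simp: measurable_cong_sets[OF that(2) refl])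
   have Ni: "integrable M (indicator N :: velocities => real)" using NM by (simp add: P.emeasure_eq_measure)
   have "measure M N - (\<integral>V. q V \<partial>M) = (\<integral>V. indicator N V - q V \<partial>M)"
    using qi Ni NM sets.sets_into_space[OF NM] by (simp add: Int_absorb2)
   then show ?thesis by (simp add: integral_abs_bound)
  qed
  show "measure F N <= measure F {V : phase n. mv V i u t : N} + C * \<bar>t\<bar> + e"
   using app[OF F.prob_space_axioms s] app[OF mup mus] d q(2,3) muN by linarith
 qed
qed

text \<open>For a Lebesgue null set \<open>N\<close>, Fubini shows that \<open>F\<close> gives
  measure 0 to the translates of \<open>N\<close> by almost every \<open>h\<close>. Such
  \<open>h\<close> exist arbitrarily close to 0, and shifting changes the measure by at most a
  constant times \<open>norm h\<close>, so \<open>F\<close> does not charge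
  \<open>N\<close>.\<close>

lemma law1_has_density:
 assumes F: "law 1 F" and fin: "!!u. sup_quad (partial 1 u) UNIV 1 F < \<infinity>"
 shows "has_density 1 F"
proof -
 interpret F: prob_space F using F by (simp add: law_def)
 interpret L: sigma_finite_measure "leb 1" by (rule sigma_finite_leb)
 have s: "sets F = sets (velM {1..1})" using F by (simp add: law_def)
 have "\<forall>u. \<exists>C\<ge>0. \<forall>psi\<in>Cg 1 UNIV. (\<forall>V\<in>phase 1. \<bar>psi V\<bar> <= 1) --> \<bar>\<integral>V. partial 1 u psi V \<partial>F\<bar> <= C"
  using partial_functional_bounded[OF F _ fin] by simp
 from choice[OF this] obtain C where C: "!!u. C u >= 0"
  "!!u. \<forall>psi\<in>Cg 1 UNIV. (\<forall>V\<in>phase 1. \<bar>psi V\<bar> <= 1) --> \<bar>\<integral>V. partial 1 u psi V \<partial>F\<bar> <= C u" by blast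
 have zero: "emeasure F N = 0" if N0: "N : null_sets (leb 1)" for N
 proof -
  have N: "N : sets (velM {1..1})" using N0 by (auto simp: null_sets_def sets_leb)
  define Sh where "Sh h = {V : phase 1. V(1 := V 1 + h) : N}" for h :: "real^3"
  have le: "measure F N <= measure F (Sh h) + (C 1 + C 2 + C 3) * norm h" for h
  proof -
   \<comment> \<open>A general shift is composed of three shifts along the axes, each controlled by
     \<open>translate_set\<close>.\<close>
   define N1 where "N1 = {V : phase 1. mv V 1 1 (h $ 1) : N}"
   define N2 where "N2 = {V : phase 1. mv V 1 2 (h $ 2) : N1}"
   define N3 where "N3 = {V : phase 1. mv V 1 3 (h $ 3) : N2}"
   have i: "1 : {1..1::nat}" by simp
   note t1 = translate_set[OF F order_refl i N C(2), of 1 "h $ 1", folded N1_def]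
   note t2 = translate_set[OF F order_refl i t1(1) C(2), of 2 "h $ 2", folded N2_def]
   note t3 = translate_set[OF F order_refl i t2(1) C(2), of 3 "h $ 3", folded N3_def]
   have hb: "C u * \<bar>h $ u\<bar> <= C u * norm h" for u by (intro mult_left_mono C component_le_norm_cart)
   have h: "h = h $ 1 *\<^sub>R axis 1 1 + h $ 2 *\<^sub>R axis 2 1 + h $ 3 *\<^sub>R axis 3 1"
    by (simp add: vec_eq_iff forall_3 axis_def)
   have "mv (mv (mv V 1 3 (h $ 3)) 1 2 (h $ 2)) 1 1 (h $ 1) = V(1 := V 1 + h)" for V
    by (subst (4) h) (simp add: mv_def algebra_simps)
   then have N3: "N3 = Sh h" unfolding N3_def N2_def N1_def Sh_def using mv_phase[OF _ i] by auto
   show ?thesis using t1(2) t2(2) t3(2)[unfolded N3] hb[of 1] hb[of 2] hb[of 3] unfolding distrib_right by linarith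
  qed
  have trans_m: "(%(h, V). V(1 := V 1 + h)) : lborel \<Otimes>\<^sub>M F \<rightarrow>\<^sub>M velM {1..1}"
  proof (rule measurable_PiM_single')
   show "(%(h, V). V(1 := V 1 + h)) : space (lborel \<Otimes>\<^sub>M F) \<rightarrow> (\<Pi>\<^sub>E i\<in>{1..1}. space borel)"
    using phase_upd[of _ 1 1] law_space[OF F] by (auto simp: space_pair_measure) (auto simp: phase_def)
   fix k :: nat assume "k : {1..1}"
   then have k: "k = 1" by simp
   have "(%V. V 1) : F \<rightarrow>\<^sub>M borel" by (simp add: measurable_cong_sets[OF s refl])
   then have "(%x. snd x 1 + fst x) : bmeas (lborel \<Otimes>\<^sub>M F)" by measurable
   then show "(%x. (case x of (h, V) => V(1 := V 1 + h)) k) : bmeas (lborel \<Otimes>\<^sub>M F)"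
    by (simp add: k case_prod_beta)
  qed
  interpret PF: pair_sigma_finite lborel F by unfold_locales
  define N' where "N' = {x. (\<lambda>i\<in>{1..1}. x) : N}"
  have N'm[measurable]: "N' : sets borel"
  proof -
   have "(%x. \<lambda>i\<in>{1..1::nat}. x) : (borel :: (real^3) measure) \<rightarrow>\<^sub>M velM {1..1}"
    by (rule measurable_restrict) simp
   from measurable_sets[OF this N] show ?thesis by (simp add: N'_def vimage_def)
  qed
  have NN': "V : N \<longleftrightarrow> V 1 : N'" if "V : phase 1" for V
  proof -
   have "(\<lambda>i\<in>{1..1}. V 1) = V" using that by (auto simp: phase_def fun_eq_iff restrict_def PiE_def extensional_def)
   then show ?thesis by (simp add: N'_def)
  qed
  have N'0: "emeasure lborel N' = 0"
  proof -
   interpret product_sigma_finite "%_::nat. lborel :: (real^3) measure" by (rule product_sigma_finite_lborel)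
   have "emeasure lborel N' = (\<integral>\<^sup>+x. indicator N' x \<partial>lborel)" by simp
   also have "... = (\<integral>\<^sup>+V. indicator N' (V 1) \<partial>leb 1)"
    unfolding leb_def using product_nn_integral_singleton[of "indicator N'" 1] by simp
   also have "... = (\<integral>\<^sup>+V. indicator N V \<partial>leb 1)"
    by (rule nn_integral_cong) (simp add: indicator_def NN' space_leb)
   also have "... = 0" using N0 by (simp add: null_sets_def)
   finally show ?thesis .
  qed
  have "(\<integral>\<^sup>+h. emeasure F (Sh h) \<partial>lborel) = (\<integral>\<^sup>+h. (\<integral>\<^sup>+V. indicator N (V(1 := V 1 + h)) \<partial>F) \<partial>lborel)"
  proof (rule nn_integral_cong)
   fix h :: "real^3"
   have "(\<integral>\<^sup>+V. indicator N (V(1 := V 1 + h)) \<partial>F) = (\<integral>\<^sup>+V. indicator (Sh h) V \<partial>F)"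
    by (rule nn_integral_cong) (auto simp: indicator_def Sh_def law_space[OF F])
   moreover have "Sh h : sets F" using measurable_sets[OF measurable_compose[OF measurable_Pair1' trans_m, of h] N]
    by (simp add: Sh_def law_space[OF F] vimage_def Int_def conj_commute)
   ultimately show "emeasure F (Sh h) = (\<integral>\<^sup>+V. indicator N (V(1 := V 1 + h)) \<partial>F)" by simp
  qed
  also have "... = (\<integral>\<^sup>+V. (\<integral>\<^sup>+h. indicator N (V(1 := V 1 + h)) \<partial>lborel) \<partial>F)"
  proof -
   have "(%x. indicator N (case x of (h, V) => V(1 := V 1 + h)) :: ennreal) : bmeas (lborel \<Otimes>\<^sub>M F)"
    by (rule measurable_compose[OF trans_m borel_measurable_indicator[OF N]])
   from PF.Fubini'[of "%h V. indicator N (V(1 := V 1 + h))"] this show ?thesis by (simp add: case_prod_beta')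
  qed
  also have "... = (\<integral>\<^sup>+V. 0 \<partial>F)"
  proof (rule nn_integral_cong)
   fix V assume "V : space F"
   then have V: "V : phase 1" using law_space[OF F] by simp
   have "(\<integral>\<^sup>+h. indicator N (V(1 := V 1 + h)) \<partial>lborel) = (\<integral>\<^sup>+h. indicator N' (V 1 + h) \<partial>lborel)"
    using NN'[OF phase_upd[OF V]] by (intro nn_integral_cong) (simp add: indicator_def)
   also have "... = (\<integral>\<^sup>+h. indicator N' h \<partial>distr lborel borel ((+) (V 1)))"
    by (subst nn_integral_distr) auto
   also have "... = 0" using N'0 by (simp add: lborel_distr_plus)
   finally show "(\<integral>\<^sup>+h. indicator N (V(1 := V 1 + h)) \<partial>lborel) = 0" .
  qed
  finally have int0: "(\<integral>\<^sup>+h. emeasure F (Sh h) \<partial>lborel) = 0" by simp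
  have "(%h. emeasure F (Sh h)) : bmeas lborel"
  proof -
   have T: "{x : space (lborel \<Otimes>\<^sub>M F). (case x of (h, V) => V(1 := V 1 + h)) : N} : sets (lborel \<Otimes>\<^sub>M F)"
    using measurable_sets[OF trans_m N] by (simp add: vimage_def Int_def conj_commute)
   have "Pair h -` {x : space (lborel \<Otimes>\<^sub>M F). (case x of (h, V) => V(1 := V 1 + h)) : N} = Sh h" for h
    by (auto simp: Sh_def space_pair_measure law_space[OF F])
   then show ?thesis using F.measurable_emeasure_Pair[OF T] by simp
  qed
  with int0 have ae: "AE h in lborel. emeasure F (Sh h) = 0" by (simp add: nn_integral_0_iff_AE)
  have "measure F N <= (C 1 + C 2 + C 3) * dl" if dl: "dl > 0" for dl
  proof -
   have "\<exists>h\<in>ball 0 dl. emeasure F (Sh h) = 0"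
   proof (rule ccontr)
    assume "~ ?thesis"
    then have ne: "emeasure F (Sh h) ~= 0" if "h : ball 0 dl" for h using that by blast
    from ae have "AE h in lborel. h \<notin> ball (0 :: real^3) dl" by eventually_elim (use ne in blast)
    then have "ball (0 :: real^3) dl : null_sets lborel" by (subst (asm) AE_iff_null_sets[symmetric]) auto
    then have "emeasure lborel (ball (0 :: real^3) dl) = 0" by auto
    then show False using open_ball[of "0 :: real^3" dl] dl
     content_ball_pos[of dl "0 :: real^3"] by (simp add: measure_def)
   qed
   then obtain h where h: "norm h < dl" "emeasure F (Sh h) = 0" by auto
   then have "measure F (Sh h) = 0" by (simp add: measure_def)
   with le[of h] have "measure F N <= (C 1 + C 2 + C 3) * norm h" by simp
   also have "... <= (C 1 + C 2 + C 3) * dl" using h C(1) by (intro mult_left_mono) (auto simp: add_nonneg_nonneg)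
   finally show ?thesis .
  qed
  from this[of "1 / real (Suc _)"] have "measure F N <= (C 1 + C 2 + C 3) * (1 / real (Suc k))" for k by simp
  moreover have "(%k. (C 1 + C 2 + C 3) * (1 / real (Suc k))) ----> 0" by real_asymp
  ultimately have "measure F N <= 0" by (intro LIMSEQ_le_const[of "%k. (C 1 + C 2 + C 3) * (1 / real (Suc k))"]) auto
  then show ?thesis by (simp add: F.emeasure_eq_measure measure_le_0_iff)
 qed
 have "absolutely_continuous (leb 1) F" unfolding absolutely_continuous_def using zero by (auto simp: null_sets_def s sets_leb)
 from L.Radon_Nikodym[OF this] show ?thesis by (auto simp: has_density_def s sets_leb)
qed

text \<open>If all suprema are finite, Riesz representation supplies a weak gradient for which
  equality holds, and uniqueness makes the choice inside \<open>I_fun\<close> immaterial. Otherwise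
  both sides are infinite. For \<open>n = 1\<close> the density follows from finiteness; for larger
  \<open>n\<close> it is part of the assumption.\<close>

theorem fisher_eq:
 assumes F: "law n F" and n: "n >= 1" and d: "n = 1 \<or> has_density n F"
 shows "I_fun n F = ennreal (1 / real n) * (\<Sum>i\<in>{1..n}. \<Sum>u\<in>UNIV. sup_quad (partial i u) UNIV n F)"
proof (cases "\<forall>i\<in>{1..n}. \<forall>u. sup_quad (partial i u) UNIV n F < \<infinity>")
 case True
 have hd: "has_density n F" using d True F law1_has_density[of F] by auto
 obtain g where g: "weak_gradient n (dens n F) g"
  "!!i u. i : {1..n} ==> (\<integral>\<^sup>+V. ennreal ((g i V $ u)\<^sup>2) / ennreal (dens n F V) \<partial>leb n) = sup_quad (partial i u) UNIV n F"
  by (rule fisher_construct[OF F hd]) (use True in blast, rule that)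
 define g0 where "g0 = (SOME g. weak_gradient n (dens n F) g)"
 have g0: "weak_gradient n (dens n F) g0" unfolding g0_def by (rule someI[of "weak_gradient n (dens n F)", OF g(1)])
 have "AE V in leb n. \<forall>i\<in>{1..n}. g0 i V = g i V"
  using weak_gradient_unique[OF n g0 g(1)] by (intro AE_finite_allI) auto
 then have "(\<integral>\<^sup>+V. ennreal (\<Sum>i\<in>{1..n}. (norm (g0 i V))\<^sup>2) / ennreal (dens n F V) \<partial>leb n) =
   (\<integral>\<^sup>+V. ennreal (\<Sum>i\<in>{1..n}. (norm (g i V))\<^sup>2) / ennreal (dens n F V) \<partial>leb n)"
  by (intro nn_integral_cong_AE) (auto elim!: eventually_mono)
 also have "... = (\<Sum>i\<in>{1..n}. \<Sum>u\<in>UNIV. sup_quad (partial i u) UNIV n F)"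
  using g(2) by (subst fisher_integrand[OF g(1) dens_density(1)[OF F hd] dens_nonneg]) simp
 finally show ?thesis using hd g(1) by (auto simp: I_fun_def g0_def[symmetric] Let_def)
next
 case False
 then obtain i u where iu: "i : {1..n}" "sup_quad (partial i u) UNIV n F = \<infinity>" by (auto simp: not_less top_unique)
 have "(\<Sum>i\<in>{1..n}. \<Sum>u\<in>UNIV. sup_quad (partial i u) UNIV n F) = \<infinity>"
  using iu by (auto simp: ennreal_sum_eq_top intro!: bexI[of _ i] exI[of _ u])
 moreover have nz: "ennreal (1 / real n) * \<infinity> = \<infinity>" using n by (simp add: ennreal_mult_top)
 moreover have "I_fun n F = \<infinity>"
 proof (cases "has_density n F & (\<exists>g. weak_gradient n (dens n F) g)")
  case True
  define g0 where "g0 = (SOME g. weak_gradient n (dens n F) g)"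
  have g0: "weak_gradient n (dens n F) g0" unfolding g0_def
   by (rule someI_ex[of "weak_gradient n (dens n F)"]) (use True in blast)
  have "(\<integral>\<^sup>+V. ennreal ((g0 i V $ u)\<^sup>2) / ennreal (dens n F V) \<partial>leb n) = \<infinity>"
   using fisher_ge[OF F _ g0 iu(1), of u] True iu(2) by (simp add: top_unique)
  then have "(\<Sum>i\<in>{1..n}. \<Sum>u\<in>UNIV. \<integral>\<^sup>+V. ennreal ((g0 i V $ u)\<^sup>2) / ennreal (dens n F V) \<partial>leb n) = \<infinity>"
   using iu(1) by (auto simp: ennreal_sum_eq_top intro!: bexI[of _ i] exI[of _ u])
  then have "(\<integral>\<^sup>+V. ennreal (\<Sum>i\<in>{1..n}. (norm (g0 i V))\<^sup>2) / ennreal (dens n F V) \<partial>leb n) = \<infinity>"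
   using fisher_integrand[OF g0 dens_density(1)[OF F] dens_nonneg] True by simp
  then show ?thesis using True nz by (auto simp: I_fun_def g0_def[symmetric] Let_def)
 qed (auto simp: I_fun_def)
 ultimately show ?thesis by (simp only:)
qed

section \<open>Exchangeability and the limit of the Fisher information\<close>

lemma Cg_swp:
 assumes "psi : Cg n K" "p : {1..n}"
 shows "(%V. psi (swp p V)) : Cg n K"
proof -
 obtain R where R: "supp_in n R psi" using Cg_supp[OF assms(1)] by blast
 have "supp_in n R (%V. psi (swp p V))" unfolding supp_in_def
 proof (intro ballI impI)
  fix V assume V: "V : phase n" "\<exists>k\<in>{1..n}. R < norm (V k)"
  then obtain k where k: "k : {1..n}" "R < norm (V k)" by blast
  have "Transposition.transpose 1 p k : {1..n}" using k assms(2) by (auto simp: Transposition.transpose_def)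
  moreover have "R < norm (swp p V (Transposition.transpose 1 p k))" using k by simp
  ultimately show "psi (swp p V) = 0" using R swp_phase[OF assms(2) V(1)] unfolding supp_in_def by blast
 qed
 then show ?thesis using assms by (auto simp: Cg_def compact_supp_iff intro!: C_diff_swp)
qed

context mixing begin

lemma swp_meas: "p : {1..n} ==> swp p : velM {1..n} \<rightarrow>\<^sub>M velM {1..n}"
proof (rule measurable_PiM_single')
 assume p: "p : {1..n}"
 show "swp p : space (velM {1..n}) \<rightarrow> (\<Pi>\<^sub>E i\<in>{1..n}. space borel)"
  using swp_phase[OF p] by (simp add: space_velM Pi_iff phase_def[symmetric])
 show "(%V. swp p V i) : bmeas (velM {1..n})" if "i : {1..n}" for i
 proof -
  have "Transposition.transpose 1 p i : {1..n}" using p that by (auto simp: Transposition.transpose_def)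
  then show ?thesis by simp
 qed
qed

lemma integral_swp:
 fixes f :: "velocities => real"
 assumes p: "p : {1..n}" and f: "f : bmeas (velM {1..n})" and B: "!!V. V : phase n ==> \<bar>f V\<bar> <= B"
 shows "(\<integral>V. f (swp p V) \<partial>mixture n \<nu>) = (\<integral>V. f V \<partial>mixture n \<nu>)"
proof -
 have "(\<integral>V. f (swp p V) \<partial>mixture n \<nu>) = (\<integral>\<rho>. (\<integral>V. f (swp p V) \<partial>tensor n \<rho>) \<partial>\<nu>)"
  by (rule integral_mixture[where B=B]) (use B swp_phase[OF p] measurable_compose[OF swp_meas[OF p] f] in auto)
 also have "... = (\<integral>\<rho>. (\<integral>V. f V \<partial>tensor n \<rho>) \<partial>\<nu>)"
 proof (rule Bintegral_cong[OF refl])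
  fix \<rho> assume \<rho>: "\<rho> : space \<nu>"
  have sp: "space (tensor n \<rho>) = phase n" using law_space[OF law_tensor[OF \<rho>]] .
  have ti: "Transposition.transpose 1 p i : {1..n} \<longleftrightarrow> i : {1..n}" for i
   using p by (auto simp: Transposition.transpose_def)
  have e: "(\<lambda>i\<in>{1..n}. V (Transposition.transpose 1 p i)) = swp p V" if "V : phase n" for V
  proof
   fix i
   show "(\<lambda>i\<in>{1..n}. V (Transposition.transpose 1 p i)) i = swp p V i"
   proof (cases "i : {1..n}")
    case False
    then have "Transposition.transpose 1 p i \<notin> {1..n}" using ti by blast
    then have "V (Transposition.transpose 1 p i) = undefined" using PiE_arb[OF that[unfolded phase_def]] by blast
    then show ?thesis using False by (simp add: restrict_def)
   qed simp
  qed
  have d: "distr (tensor n \<rho>) (tensor n \<rho>) (%V. \<lambda>i\<in>{1..n}. V (Transposition.transpose 1 p i)) = tensor n \<rho>"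
   unfolding tensor_def
   by (rule distr_PiM_reindex) (use rho(1)[OF \<rho>] ti in \<open>auto intro: inj_on_subset[OF inj_transpose]\<close>)
  have m: "(%V. \<lambda>i\<in>{1..n}. V (Transposition.transpose 1 p i)) : tensor n \<rho> \<rightarrow>\<^sub>M tensor n \<rho>"
   unfolding tensor_def by (rule measurable_restrict) (use ti in auto)
  have "(\<integral>V. f (swp p V) \<partial>tensor n \<rho>) = (\<integral>V. f (\<lambda>i\<in>{1..n}. V (Transposition.transpose 1 p i)) \<partial>tensor n \<rho>)"
   by (rule Bintegral_cong[OF refl]) (simp only: e sp)
  also have "... = (\<integral>V. f V \<partial>distr (tensor n \<rho>) (tensor n \<rho>) (%V. \<lambda>i\<in>{1..n}. V (Transposition.transpose 1 p i)))"
   by (rule integral_distr[symmetric, OF m]) (use f in \<open>simp add: measurable_cong_sets[OF sets_tensor[OF \<rho>] refl]\<close>)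
  finally show "(\<integral>V. f (swp p V) \<partial>tensor n \<rho>) = (\<integral>V. f V \<partial>tensor n \<rho>)" by (simp only: d)
 qed
 also have "... = (\<integral>V. f V \<partial>mixture n \<nu>)" by (rule integral_mixture[symmetric, OF f B])
 finally show ?thesis .
qed

lemma sup_quad_swp_le:
 assumes ij: "i : {1..n}" "j : {1..n}" and p: "p : {1..n}" "Transposition.transpose 1 p j = i"
 shows "sup_quad (partial i u) UNIV n (mixture n \<nu>) <= sup_quad (partial j u) UNIV n (mixture n \<nu>)"
 unfolding sup_quad_def[of "partial i u"]
proof (rule SUP_least)
 fix psi assume psi: "psi : Cg n UNIV"
 interpret D: diff_op n 1 "partial i u" UNIV 1 by (rule partial_diff_op[OF ij(1)])
 obtain B where B: "\<forall>V\<in>phase n. \<bar>psi V\<bar> <= B & \<bar>partial i u psi V\<bar> <= B" using D.Cg_bounds[OF psi] by blast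
 have q: "quadL (partial j u) (%V. psi (swp p V)) V = quadL (partial i u) psi (swp p V)" for V
  unfolding quadL_def partial_swp p(2) ..
 have "(\<integral>V. quadL (partial i u) psi V \<partial>mixture n \<nu>) = (\<integral>V. quadL (partial j u) (%V. psi (swp p V)) V \<partial>mixture n \<nu>)"
  unfolding q by (rule integral_swp[symmetric, OF p(1) D.quadL_meas[OF psi], where B="B + B\<^sup>2 / 4"])
   (use B in \<open>auto intro: D.quadL_bound\<close>)
 moreover have "ennreal (\<integral>V. quadL (partial j u) (%V. psi (swp p V)) V \<partial>mixture n \<nu>)
   <= sup_quad (partial j u) UNIV n (mixture n \<nu>)" unfolding sup_quad_def by (rule SUP_upper[OF Cg_swp[OF psi p(1)]])
 ultimately show "ennreal (\<integral>V. quadL (partial i u) psi V \<partial>mixture n \<nu>) <= sup_quad (partial j u) UNIV n (mixture n \<nu>)"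
  by (rule ord_eq_le_trans[OF arg_cong[where f=ennreal]])
qed

lemma sup_quad_swp:
 assumes i: "i : {1..n}"
 shows "sup_quad (partial i u) UNIV n (mixture n \<nu>) = sup_quad (partial 1 u) UNIV n (mixture n \<nu>)"
proof (rule antisym)
 have 1: "1 : {1..n}" using i by simp
 show "sup_quad (partial i u) UNIV n (mixture n \<nu>) <= sup_quad (partial 1 u) UNIV n (mixture n \<nu>)"
  by (rule sup_quad_swp_le[OF i 1 i]) simp
 show "sup_quad (partial 1 u) UNIV n (mixture n \<nu>) <= sup_quad (partial i u) UNIV n (mixture n \<nu>)"
  by (rule sup_quad_swp_le[OF 1 i i]) simp
qed

text \<open>By exchangeability the \<open>n\<close> particles contribute equally, so the factor 1/n
  leaves the contribution of particle 1, which fits the test families with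
  \<open>m = 1\<close>.\<close>

lemma I_mixture:
 assumes n: "n >= 1" and d: "has_density n (mixture n \<nu>)"
 shows "I_fun n (mixture n \<nu>) = (\<Sum>u\<in>UNIV. sup_quad (partial 1 u) UNIV n (mixture n \<nu>))"
proof -
 let ?s = "\<Sum>u\<in>UNIV. sup_quad (partial 1 u) UNIV n (mixture n \<nu>)"
 have "I_fun n (mixture n \<nu>) = ennreal (1 / real n) * (\<Sum>i\<in>{1..n}. ?s)"
  unfolding fisher_eq[OF law_mixture n disjI2[OF d]] by (intro arg_cong2[where f="(*)"] sum.cong refl sup_quad_swp)
 also have "... = ennreal (1 / real n) * (of_nat n * ?s)" by simp
 also have "... = (ennreal (1 / real n) * of_nat n) * ?s" by (simp add: mult.assoc)
 also have "ennreal (1 / real n) * of_nat n = 1" using n by (simp add: ennreal_of_nat_eq_real_of_nat ennreal_mult[symmetric])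
 finally show ?thesis by simp
qed

lemma I_limit:
 assumes d: "!!j. j >= 1 ==> has_density j (mixture j \<nu>)"
 shows "(%j. I_fun j (mixture j \<nu>)) ----> (\<integral>\<^sup>+\<rho>. I_fun 1 (tensor 1 \<rho>) \<partial>\<nu>)"
  and "mono_on {1..} (%j. I_fun j (mixture j \<nu>))"
proof -
 have L: "diff_op 1 1 (partial 1 u) UNIV 1" for u by (rule partial_diff_op) simp
 have "(\<integral>\<^sup>+\<rho>. I_fun 1 (tensor 1 \<rho>) \<partial>\<nu>) = (\<integral>\<^sup>+\<rho>. (\<Sum>u\<in>UNIV. sup_quad (partial 1 u) UNIV 1 (tensor 1 \<rho>)) \<partial>\<nu>)"
  by (rule nn_integral_cong) (simp add: fisher_eq[OF law_tensor])
 also have "... = (\<Sum>u\<in>UNIV. \<integral>\<^sup>+\<rho>. sup_quad (partial 1 u) UNIV 1 (tensor 1 \<rho>) \<partial>\<nu>)"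
  by (rule nn_integral_sum) (rule sup_quad_measurable[OF L])
 finally have e: "(\<integral>\<^sup>+\<rho>. I_fun 1 (tensor 1 \<rho>) \<partial>\<nu>) = (\<Sum>u\<in>UNIV. \<integral>\<^sup>+\<rho>. sup_quad (partial 1 u) UNIV 1 (tensor 1 \<rho>) \<partial>\<nu>)" .
 have "(%j. \<Sum>u\<in>UNIV. sup_quad (partial 1 u) UNIV j (mixture j \<nu>)) ----> (\<integral>\<^sup>+\<rho>. I_fun 1 (tensor 1 \<rho>) \<partial>\<nu>)"
  unfolding e by (intro tendsto_sum sup_quad_limit[OF L])
 then show "(%j. I_fun j (mixture j \<nu>)) ----> (\<integral>\<^sup>+\<rho>. I_fun 1 (tensor 1 \<rho>) \<partial>\<nu>)"
  by (rule Lim_transform_eventually)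
   (rule eventually_mono[OF eventually_ge_at_top[of 1]], rule I_mixture[symmetric], auto intro: d)
 show "mono_on {1..} (%j. I_fun j (mixture j \<nu>))"
  by (rule mono_onI) (auto simp: I_mixture d intro!: sum_mono sup_quad_mono[OF L])
qed

end

section \<open>The dual formula for the relative entropy\<close>

definition bdd :: "'a measure => ('a => real) set" where
 "bdd M = {phi. phi : bmeas M & (\<exists>B. \<forall>x\<in>space M. \<bar>phi x\<bar> <= B)}"

text \<open>Variational formula for the relative entropy of \<open>P\<close> with respect to
  \<open>Q\<close>, with \<open>exp phi - 1\<close> instead of the logarithm of an exponential
  integral. The \<open>Q\<close> part is then a plain integral, which can be taken conditionally on
  other particles.\<close>

definition dual :: "'a measure => 'a measure => ennreal" where
 "dual P Q = (SUP phi\<in>bdd Q. ennreal ((\<integral>x. phi x \<partial>P) - (\<integral>x. exp (phi x) - 1 \<partial>Q)))"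

text \<open>The integrand of the relative entropy, shifted to be nonnegative with minimum 0 at
  \<open>u = 1\<close>. For the density of one probability with respect to another the added terms
  integrate to 0.\<close>

definition ent :: "real => real" where
 "ent u = u * ln u - u + 1"

lemma ent_nonneg: "u >= 0 ==> ent u >= 0"
proof (cases "u = 0")
 case False
 assume "u >= 0"
 with False have u: "u > 0" by simp
 have "ln (1 / u) <= 1 / u - 1" by (rule ln_le_minus_one) (use u in simp)
 then have "u * - ln u <= u * (1 / u - 1)" using u by (intro mult_left_mono) (auto simp: ln_div)
 then show ?thesis using u by (simp add: ent_def algebra_simps)
qed (simp add: ent_def)

lemma ent_measurable [measurable]: "ent : bmeas borel" unfolding ent_def[abs_def] by measurable

text \<open>Legendre duality between \<open>ent\<close> and \<open>exp x - 1\<close>, with equality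
  at \<open>x = ln u\<close> for positive \<open>u\<close>; it rests on the inequality
  \<open>1 + y \<le> exp y\<close> at \<open>y = x - ln u\<close>.\<close>

lemma young_exp:
 assumes "u >= 0" shows "u * x - (exp x - 1) <= ent u"
proof (cases "u = 0")
 case False
 with assms have u: "u > 0" by simp
 have "x - ln u + 1 <= exp (x - ln u)" using exp_ge_add_one_self[of "x - ln u"] by linarith
 then have "u * (x - ln u + 1) <= u * exp (x - ln u)" using u by (intro mult_left_mono) auto
 also have "u * exp (x - ln u) = exp x" using u by (simp add: exp_diff)
 finally show ?thesis by (simp add: ent_def algebra_simps)
qed (simp add: ent_def)

lemma bddD:
 assumes "phi : bdd M" "sets N = sets M"
 shows "phi : bmeas N" "\<exists>B\<ge>0. \<forall>x\<in>space N. \<bar>phi x\<bar> <= B"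
proof -
 show "phi : bmeas N" using assms by (simp add: bdd_def measurable_cong_sets[OF assms(2) refl])
 obtain B where "\<forall>x\<in>space M. \<bar>phi x\<bar> <= B" using assms(1) by (auto simp: bdd_def)
 then show "\<exists>B\<ge>0. \<forall>x\<in>space N. \<bar>phi x\<bar> <= B"
  using sets_eq_imp_space_eq[OF assms(2)] by (intro exI[of _ "max 0 B"]) (auto simp: le_max_iff_disj)
qed

lemma bdd_integrable:
 assumes "prob_space N" "phi : bdd M" "sets N = sets M"
 shows "integrable N phi" "integrable N (%x. exp (phi x) - 1)"
proof -
 interpret prob_space N by fact
 obtain B where B: "\<forall>x\<in>space N. \<bar>phi x\<bar> <= B" using bddD(2)[OF assms(2,3)] by blast
 note m = bddD(1)[OF assms(2,3)]
 show "integrable N phi" by (rule integrable_bounded[OF m, of B]) (use B in blast)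
 show "integrable N (%x. exp (phi x) - 1)"
 proof (rule integrable_bounded[where B="exp B + 1"])
  show "(%x. exp (phi x) - 1) : bmeas N" using m by measurable
  fix x assume "x : space N"
  then have "phi x <= B" using B by (simp add: abs_le_iff)
  then have "exp (phi x) <= exp B" by simp
  then show "\<bar>exp (phi x) - 1\<bar> <= exp B + 1" using exp_gt_zero[of "phi x"] by linarith
 qed
qed

text \<open>The test that is \<open>n\<close> on a \<open>Q\<close>-null set and 0 elsewhere costs
  nothing under \<open>Q\<close> and earns \<open>n\<close> times the \<open>P\<close>-measure of
  the set.\<close>

lemma dual_ac:
 assumes P: "prob_space P" and Q: "prob_space Q" and s: "sets P = sets Q" and f: "dual P Q < \<infinity>"
 shows "absolutely_continuous Q P" unfolding absolutely_continuous_def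
proof
 interpret P: prob_space P by fact
 interpret Q: prob_space Q by fact
 fix N assume N: "N : null_sets Q"
 then have NQ[measurable]: "N : sets Q" and NP: "N : sets P" by (auto simp: s null_sets_def)
 have le: "ennreal (real n * measure P N) <= dual P Q" for n
 proof -
  have b: "(%x. real n * indicator N x) : bdd Q"
   unfolding bdd_def by (auto intro!: exI[of _ "real n"] simp: indicator_def)
  have "AE x in Q. x \<notin> N" using N by (rule AE_not_in)
  then have "AE x in Q. exp (real n * indicator N x) - 1 = 0" by eventually_elim simp
  then have "(\<integral>x. exp (real n * indicator N x) - 1 \<partial>Q) = 0" by (rule integral_eq_zero_AE)
  then have "(\<integral>x. real n * indicator N x \<partial>P) - (\<integral>x. exp (real n * indicator N x) - 1 \<partial>Q) = real n * measure P N"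
   using NP by simp
  then show ?thesis unfolding dual_def using SUP_upper[OF b, of "%phi. ennreal ((\<integral>x. phi x \<partial>P) - (\<integral>x. exp (phi x) - 1 \<partial>Q))"]
   by simp
 qed
 have "measure P N = 0"
 proof (rule ccontr)
  assume "measure P N ~= 0"
  then have p: "measure P N > 0" by (simp add: zero_less_measure_iff)
  obtain d where d: "dual P Q = ennreal d" "d >= 0" using f by (cases "dual P Q") auto
  obtain n where "d < real n * measure P N" using p reals_Archimedean3[of "measure P N"] by blast
  then show False using le[of n] d by (simp add: ennreal_le_iff)
 qed
 then show "N : null_sets P" using NP by (simp add: null_sets_def P.emeasure_eq_measure)
qed

lemma dual_density:
 assumes P: "prob_space P" and Q: "prob_space Q" and h: "h : bmeas Q" "!!x. h x >= 0"
  and Ph: "P = density Q (%x. ennreal (h x))"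
 shows "dual P Q = (\<integral>\<^sup>+x. ennreal (ent (h x)) \<partial>Q)"
proof (rule antisym)
 interpret P: prob_space P by fact
 interpret Q: prob_space Q by fact
 note [measurable] = h(1)
 have s: "sets P = sets Q" by (simp add: Ph)
 have val: "(\<integral>x. phi x \<partial>P) - (\<integral>x. exp (phi x) - 1 \<partial>Q) = (\<integral>x. h x * phi x - (exp (phi x) - 1) \<partial>Q)"
  "integrable Q (%x. h x * phi x - (exp (phi x) - 1))"
  if phi: "phi : bdd Q" for phi
 proof -
  note m = bddD(1)[OF phi refl]
  have "integrable P phi" by (rule bdd_integrable(1)[OF P phi s])
  then have i: "integrable Q (%x. h x * phi x)" unfolding Ph using integrable_density[OF m h(1)] h(2) by simp
  have e: "(\<integral>x. phi x \<partial>P) = (\<integral>x. h x * phi x \<partial>Q)"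
   unfolding Ph using integral_density[OF m h(1)] h(2) by simp
  note i2 = bdd_integrable(2)[OF Q phi refl]
  show "integrable Q (%x. h x * phi x - (exp (phi x) - 1))" by (rule Bintegrable_diff[OF i i2])
  show "(\<integral>x. phi x \<partial>P) - (\<integral>x. exp (phi x) - 1 \<partial>Q) = (\<integral>x. h x * phi x - (exp (phi x) - 1) \<partial>Q)"
   unfolding e by (rule Bintegral_diff[OF i i2, symmetric])
 qed
 show "dual P Q <= (\<integral>\<^sup>+x. ennreal (ent (h x)) \<partial>Q)" unfolding dual_def
 proof (rule SUP_least)
  fix phi assume phi: "phi : bdd Q"
  have "ennreal ((\<integral>x. phi x \<partial>P) - (\<integral>x. exp (phi x) - 1 \<partial>Q)) <= (\<integral>\<^sup>+x. ennreal (h x * phi x - (exp (phi x) - 1)) \<partial>Q)"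
   unfolding val(1)[OF phi] by (rule ennreal_integral_le[OF val(2)[OF phi]])
  also have "... <= (\<integral>\<^sup>+x. ennreal (ent (h x)) \<partial>Q)"
   by (intro nn_integral_mono ennreal_leI young_exp h(2))
  finally show "ennreal ((\<integral>x. phi x \<partial>P) - (\<integral>x. exp (phi x) - 1 \<partial>Q)) <= (\<integral>\<^sup>+x. ennreal (ent (h x)) \<partial>Q)" .
 qed
 \<comment> \<open>The optimal test \<open>ln (h x)\<close> truncated to [-n, n]. Where
   \<open>h\<close> vanishes the optimum is minus infinity, so \<open>- n\<close> is prescribed
   there in place of the default value \<open>ln 0 = 0\<close>.\<close>
 define c where "c n x = (if h x = 0 then - real n else max (- real n) (min (real n) (ln (h x))))" for n x
 have cb: "c n : bdd Q" for n unfolding bdd_def c_def by (auto intro!: exI[of _ "real n"])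
 \<comment> \<open>Where \<open>h\<close> is positive, the integrand is 0 at test value 0 and grows
   as the value moves from 0 towards \<open>ln (h x)\<close>. Truncation stops on the way, so the
   integrand stays nonnegative, as Fatou's lemma requires.\<close>
 have c0: "0 <= h x * c n x - (exp (c n x) - 1)" for n x
 proof (cases "h x = 0")
  case False
  then have hx: "h x > 0" using h(2)[of x] by simp
  have "0 <= u * t - (exp t - 1)" if "u > 0" "0 <= t & t <= ln u \<or> ln u <= t & t <= 0" for u t :: real
  proof -
   have e: "1 - exp t >= - t * exp t"
    using mult_left_mono[OF exp_ge_add_one_self[of "- t"], of "exp t"] by (simp add: algebra_simps exp_minus)
   have "u * t >= exp t * t" using that(2)
   proof
    assume "0 <= t & t <= ln u"
    then have "exp t <= u" using that(1) by (metis exp_le_cancel_iff exp_ln)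
    then show ?thesis using \<open>0 <= t & t <= ln u\<close> by (intro mult_right_mono) auto
   next
    assume "ln u <= t & t <= 0"
    then have "u <= exp t" using that(1) by (metis exp_le_cancel_iff exp_ln)
    then show ?thesis using \<open>ln u <= t & t <= 0\<close> by (intro mult_right_mono_neg) auto
   qed
   then show ?thesis using e by (simp add: algebra_simps)
  qed
  from this[OF hx, of "c n x"] show ?thesis using False linear[of 0 "ln (h x)"] by (auto simp: c_def max_def min_def)
 qed (simp add: c_def)
 have lim: "(%n. h x * c n x - (exp (c n x) - 1)) ----> ent (h x)" for x
 proof (cases "h x = 0")
  case True
  have "(%n. - (exp (- real n) - 1)) ----> 1" by real_asymp
  then show ?thesis using True by (simp add: c_def ent_def)
 next
  case False
  then have hx: "h x > 0" using h(2)[of x] by simp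
  obtain N where N: "\<bar>ln (h x)\<bar> <= real N" using real_arch_simple by blast
  have "\<forall>\<^sub>F n in sequentially. ent (h x) = h x * c n x - (exp (c n x) - 1)" using eventually_ge_at_top[of N]
  proof eventually_elim
   case (elim n)
   then have "c n x = ln (h x)" using N False unfolding c_def by (simp add: abs_le_iff)
   then show ?case using hx by (simp add: ent_def)
  qed
  then show ?thesis by (rule tendsto_eventually[OF eventually_mono]) simp
 qed
 have "(\<integral>\<^sup>+x. ennreal (ent (h x)) \<partial>Q) = (\<integral>\<^sup>+x. liminf (%n. ennreal (h x * c n x - (exp (c n x) - 1))) \<partial>Q)"
  by (intro nn_integral_cong lim_imp_Liminf[symmetric] tendsto_ennrealI lim) simp
 also have "... <= liminf (%n. \<integral>\<^sup>+x. ennreal (h x * c n x - (exp (c n x) - 1)) \<partial>Q)"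
  by (rule nn_integral_liminf) (use cb bddD(1)[OF cb refl] in measurable)
 also have "... <= dual P Q"
 proof (rule Liminf_le[OF sequentially_bot])
  show "\<forall>\<^sub>F n in sequentially. (\<integral>\<^sup>+x. ennreal (h x * c n x - (exp (c n x) - 1)) \<partial>Q) <= dual P Q"
  proof (rule always_eventually, rule allI)
   fix n
   have "(\<integral>\<^sup>+x. ennreal (h x * c n x - (exp (c n x) - 1)) \<partial>Q) = ennreal (\<integral>x. h x * c n x - (exp (c n x) - 1) \<partial>Q)"
    by (rule nn_integral_eq_integral[OF val(2)[OF cb]]) (rule AE_I2, rule c0)
   also have "... <= dual P Q" unfolding val(1)[OF cb, symmetric] dual_def by (rule SUP_upper[OF cb])
   finally show "(\<integral>\<^sup>+x. ennreal (h x * c n x - (exp (c n x) - 1)) \<partial>Q) <= dual P Q" .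
  qed
 qed
 finally show "(\<integral>\<^sup>+x. ennreal (ent (h x)) \<partial>Q) <= dual P Q" .
qed

lemma density_of_ac:
 assumes P: "prob_space P" and Q: "prob_space Q" and s: "sets P = sets Q" and ac: "absolutely_continuous Q P"
 obtains h where "h : bmeas Q" "!!x. h x >= (0::real)" "P = density Q (%x. ennreal (h x))"
proof -
 interpret P: prob_space P by fact
 interpret Q: prob_space Q by fact
 have "AE x in Q. RN_deriv Q P x = ennreal (enn2real (RN_deriv Q P x))"
  using Q.RN_deriv_finite[OF P.sigma_finite_measure_axioms ac s] by eventually_elim (simp add: less_top)
 then have "density Q (%x. ennreal (enn2real (RN_deriv Q P x))) = density Q (RN_deriv Q P)" by (intro density_cong) auto
 also have "... = P" by (rule Q.density_RN_deriv[OF ac s])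
 finally show ?thesis by (intro that[of "%x. enn2real (RN_deriv Q P x)"]) auto
qed

section \<open>Countable families of test functions\<close>

text \<open>Rational coefficients and finite lists keep the family countable whenever the underlying
  class of sets is.\<close>

definition combo :: "(rat \<times> 'a set) list => 'a => real" where
 "combo L x = (\<Sum>(c, A)\<leftarrow>L. real_of_rat c * indicator A x)"

lemma combo_append: "combo (L @ L') x = combo L x + combo L' x" by (simp add: combo_def)

lemma combo_scale: "combo (map (%(c, A). (d * c, A)) L) x = real_of_rat d * combo L x"
 by (induction L) (auto simp: combo_def of_rat_mult algebra_simps)

lemma combo_meas: "set L <= UNIV \<times> \<A> ==> \<A> <= sets M ==> combo L : bmeas M"
proof (induction L)
 case (Cons a L)
 obtain c A where a: "a = (c, A)" by (cases a)
 have [measurable]: "A : sets M" "combo L : bmeas M" using Cons a by auto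
 have "combo (a # L) = (%x. real_of_rat c * indicator A x + combo L x)" by (auto simp: a combo_def)
 then show ?case by simp
qed (simp add: combo_def[abs_def])

definition combo_dense :: "'a measure => 'a set set => ('a => real) => bool" where
 "combo_dense mu \<A> phi \<longleftrightarrow> (\<forall>e>0. \<exists>L. set L <= UNIV \<times> \<A> & (\<integral>\<^sup>+x. ennreal \<bar>phi x - combo L x\<bar> \<partial>mu) < ennreal e)"

lemma add_ennreal_less: "a < ennreal x ==> b < ennreal y ==> a + b < ennreal (x + y)"
 by (cases a; cases b) (auto simp: ennreal_less_iff ennreal_plus[symmetric] simp del: ennreal_plus)

lemma combo_dense_limit:
 assumes m: "phi : bmeas mu" "\<A> <= sets mu"
  and a: "!!e. e > 0 ==> \<exists>psi. psi : bmeas mu & combo_dense mu \<A> psi & (\<integral>\<^sup>+x. ennreal \<bar>phi x - psi x\<bar> \<partial>mu) < ennreal e"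
 shows "combo_dense mu \<A> phi" unfolding combo_dense_def
proof (intro allI impI)
 fix e :: real assume e: "e > 0"
 obtain psi where psi: "psi : bmeas mu" "combo_dense mu \<A> psi" "(\<integral>\<^sup>+x. ennreal \<bar>phi x - psi x\<bar> \<partial>mu) < ennreal (e / 2)"
  using a[of "e / 2"] e by auto
 obtain L where L: "set L <= UNIV \<times> \<A>" "(\<integral>\<^sup>+x. ennreal \<bar>psi x - combo L x\<bar> \<partial>mu) < ennreal (e / 2)"
  using psi(2) e unfolding combo_dense_def by (meson half_gt_zero)
 have [measurable]: "combo L : bmeas mu" by (rule combo_meas[OF L(1) m(2)])
 note [measurable] = m(1) psi(1)
 have "(\<integral>\<^sup>+x. ennreal \<bar>phi x - combo L x\<bar> \<partial>mu) <= (\<integral>\<^sup>+x. ennreal \<bar>phi x - psi x\<bar> + ennreal \<bar>psi x - combo L x\<bar> \<partial>mu)"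
  by (intro nn_integral_mono) (auto simp: ennreal_plus[symmetric] simp del: ennreal_plus intro!: ennreal_leI)
 also have "... = (\<integral>\<^sup>+x. ennreal \<bar>phi x - psi x\<bar> \<partial>mu) + (\<integral>\<^sup>+x. ennreal \<bar>psi x - combo L x\<bar> \<partial>mu)"
  by (rule nn_integral_add) auto
 also have "... < ennreal (e / 2 + e / 2)" by (rule add_ennreal_less[OF psi(3) L(2)])
 also have "... = ennreal e" by simp
 finally show "\<exists>L. set L <= UNIV \<times> \<A> & (\<integral>\<^sup>+x. ennreal \<bar>phi x - combo L x\<bar> \<partial>mu) < ennreal e"
  using L(1) by blast
qed

lemma combo_dense_add:
 assumes m: "phi : bmeas mu" "psi : bmeas mu" "\<A> <= sets mu"
  and d: "combo_dense mu \<A> phi" "combo_dense mu \<A> psi"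
 shows "combo_dense mu \<A> (%x. phi x + psi x)" unfolding combo_dense_def
proof (intro allI impI)
 fix e :: real assume e: "e > 0"
 obtain L where L: "set L <= UNIV \<times> \<A>" "(\<integral>\<^sup>+x. ennreal \<bar>phi x - combo L x\<bar> \<partial>mu) < ennreal (e / 2)"
  using d(1) e unfolding combo_dense_def by (meson half_gt_zero)
 obtain L' where L': "set L' <= UNIV \<times> \<A>" "(\<integral>\<^sup>+x. ennreal \<bar>psi x - combo L' x\<bar> \<partial>mu) < ennreal (e / 2)"
  using d(2) e unfolding combo_dense_def by (meson half_gt_zero)
 have [measurable]: "combo L : bmeas mu" "combo L' : bmeas mu"
  by (rule combo_meas[OF L(1) m(3)], rule combo_meas[OF L'(1) m(3)])
 note [measurable] = m(1,2)
 have "(\<integral>\<^sup>+x. ennreal \<bar>(phi x + psi x) - combo (L @ L') x\<bar> \<partial>mu) <= (\<integral>\<^sup>+x. ennreal \<bar>phi x - combo L x\<bar> + ennreal \<bar>psi x - combo L' x\<bar> \<partial>mu)"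
  by (intro nn_integral_mono) (auto simp: combo_append ennreal_plus[symmetric] simp del: ennreal_plus intro!: ennreal_leI)
 also have "... = (\<integral>\<^sup>+x. ennreal \<bar>phi x - combo L x\<bar> \<partial>mu) + (\<integral>\<^sup>+x. ennreal \<bar>psi x - combo L' x\<bar> \<partial>mu)"
  by (rule nn_integral_add) auto
 also have "... < ennreal (e / 2 + e / 2)" by (rule add_ennreal_less[OF L(2) L'(2)])
 also have "... = ennreal e" by simp
 finally show "\<exists>L. set L <= UNIV \<times> \<A> & (\<integral>\<^sup>+x. ennreal \<bar>(phi x + psi x) - combo L x\<bar> \<partial>mu) < ennreal e"
  using L(1) L'(1) by (intro exI[of _ "L @ L'"]) auto
qed

lemma combo_dense_cmult:
 assumes mu: "finite_measure mu" and A: "A : sets mu" "\<A> <= sets mu" and d: "combo_dense mu \<A> (indicator A)"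
 shows "combo_dense mu \<A> (%x. c * indicator A x)"
proof -
 interpret finite_measure mu by fact
 note [measurable] = A(1)
 have rat: "combo_dense mu \<A> (%x. real_of_rat d * indicator A x)" for d unfolding combo_dense_def
 proof (intro allI impI)
  fix e :: real assume e: "e > 0"
  define k where "k = \<bar>real_of_rat d\<bar> + 1"
  have k: "k > 0" by (simp add: k_def add_nonneg_pos)
  obtain L where L: "set L <= UNIV \<times> \<A>" "(\<integral>\<^sup>+x. ennreal \<bar>indicator A x - combo L x\<bar> \<partial>mu) < ennreal (e / k)"
   using d e k unfolding combo_dense_def by (meson divide_pos_pos)
  have [measurable]: "combo L : bmeas mu" by (rule combo_meas[OF L(1) A(2)])
  let ?L = "map (%(c, A). (d * c, A)) L"
  have "(\<integral>\<^sup>+x. ennreal \<bar>real_of_rat d * indicator A x - combo ?L x\<bar> \<partial>mu) \<le>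
    (\<integral>\<^sup>+x. ennreal k * ennreal \<bar>indicator A x - combo L x\<bar> \<partial>mu)"
   unfolding combo_scale right_diff_distrib[symmetric] abs_mult by (intro nn_integral_mono, subst ennreal_mult[symmetric])
    (use k in \<open>auto intro!: ennreal_leI mult_right_mono simp: k_def\<close>)
  also have "... = ennreal k * (\<integral>\<^sup>+x. ennreal \<bar>indicator A x - combo L x\<bar> \<partial>mu)" by (rule nn_integral_cmult) simp
  also have "... < ennreal k * ennreal (e / k)" using L(2) k by (intro ennreal_mult_strict_left_mono) auto
  also have "... = ennreal e" using k e by (simp add: ennreal_mult[symmetric])
  finally show "\<exists>L. set L <= UNIV \<times> \<A> & (\<integral>\<^sup>+x. ennreal \<bar>real_of_rat d * indicator A x - combo L x\<bar> \<partial>mu) < ennreal e"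
   using L(1) by (intro exI[of _ ?L]) auto
 qed
 show ?thesis
 proof (rule combo_dense_limit[OF _ A(2)])
  fix e :: real assume e: "e > 0"
  define k where "k = measure mu (space mu) + 1"
  have k: "k > 0" by (simp add: k_def add_nonneg_pos)
  then obtain d where d: "c < real_of_rat d" "real_of_rat d < c + e / k" using of_rat_dense[of c "c + e / k"] e by auto
  have "(\<integral>\<^sup>+x. ennreal \<bar>c * indicator A x - real_of_rat d * indicator A x\<bar> \<partial>mu) <= (\<integral>\<^sup>+x. ennreal (real_of_rat d - c) \<partial>mu)"
   by (intro nn_integral_mono ennreal_leI) (use d in \<open>auto simp: indicator_def\<close>)
  also have "... = ennreal ((real_of_rat d - c) * measure mu (space mu))"
   using d by (simp add: emeasure_eq_measure ennreal_mult)
  also have "... < ennreal e"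
  proof (rule ennreal_lessI[OF e])
   have "(real_of_rat d - c) * measure mu (space mu) <= (real_of_rat d - c) * k"
    using d by (intro mult_left_mono) (auto simp: k_def)
   also have "... < e / k * k" using d k by (intro mult_strict_right_mono) auto
   finally show "(real_of_rat d - c) * measure mu (space mu) < e" using k by simp
  qed
  finally show "\<exists>psi. psi : bmeas mu & combo_dense mu \<A> psi & (\<integral>\<^sup>+x. ennreal \<bar>c * indicator A x - psi x\<bar> \<partial>mu) < ennreal e"
   using rat[of d] by (intro exI[of _ "%x. real_of_rat d * indicator A x"]) simp
 qed simp
qed

text \<open>Dynkin's argument: sets with approximable indicator are closed under complements and
  countable disjoint unions, so they exhaust the sigma-algebra generated by the intersection-stable
  class. Induction over integrable functions does the rest.\<close>

lemma integrable_combo_dense: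
 assumes mu: "finite_measure mu" and \<A>: "sets mu = sigma_sets (space mu) \<A>" "\<A> <= Pow (space mu)" "Int_stable \<A>" "space mu : \<A>"
  and phi: "integrable mu phi"
 shows "combo_dense mu \<A> phi"
proof -
 interpret finite_measure mu by fact
 have sub: "\<A> <= sets mu" unfolding \<A>(1) by auto
 have ind: "combo_dense mu \<A> (indicator A)" if "A : \<A>" for A unfolding combo_dense_def
  by (intro allI impI exI[of _ "[(1, A)]"]) (use that in \<open>simp add: combo_def\<close>)
 have sets: "combo_dense mu \<A> (indicator A)" if "A : sigma_sets (space mu) \<A>" for A using that
 proof (induction rule: sigma_sets_induct_disjoint[OF \<A>(3,2), consumes 1, case_names basic empty compl union])
  case empty
  show ?case unfolding combo_dense_def by (intro allI impI exI[of _ "[]"]) (simp add: combo_def)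
 next
  case (compl A)
  then have A[measurable]: "A : sets mu" by (simp add: \<A>(1))
  have c: "combo_dense mu \<A> (%x. indicator (space mu) x + (- 1) * indicator A x)"
   by (rule combo_dense_add[OF _ _ sub ind[OF \<A>(4)] combo_dense_cmult[OF mu A sub compl(2)]]) auto
  have "(\<integral>\<^sup>+x. ennreal \<bar>indicator (space mu - A) x - combo L x\<bar> \<partial>mu) =
    (\<integral>\<^sup>+x. ennreal \<bar>(indicator (space mu) x + (- 1) * indicator A x) - combo L x\<bar> \<partial>mu)" for L
   by (intro nn_integral_cong) (auto simp: indicator_def)
  then show ?case using c unfolding combo_dense_def by simp
 next
  case (union A)
  then have A[measurable]: "A i : sets mu" for i by (auto simp: \<A>(1))
  have fin: "combo_dense mu \<A> (%x. \<Sum>i<n. indicator (A i) x)" for n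
  proof (induction n)
   case 0
   show ?case unfolding combo_dense_def by (intro allI impI exI[of _ "[]"]) (simp add: combo_def)
  next
   case (Suc n)
   show ?case unfolding sum.lessThan_Suc by (rule combo_dense_add[OF _ _ sub Suc]) (use union in auto)
  qed
  show ?case
  proof (rule combo_dense_limit[OF _ sub])
   show "indicator (\<Union> (range A)) : bmeas mu" by measurable
   fix e :: real assume e: "e > 0"
   have sm: "(%i. measure mu (A i)) sums measure mu (\<Union> (range A))"
    by (rule finite_measure_UNION) (use union A in auto)
   then have "(%n. \<Sum>i<n. measure mu (A i)) ----> measure mu (\<Union> (range A))" by (simp add: sums_def)
   from order_tendstoD(1)[OF this, of "measure mu (\<Union> (range A)) - e"] e
   obtain n where n: "measure mu (\<Union> (range A)) - e < (\<Sum>i<n. measure mu (A i))"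
    by (auto dest: eventually_happens'[OF sequentially_bot])
   have e1: "(\<Sum>i<n. indicat_real (A i) x) = indicator (\<Union>i<n. A i) x" for x
    using union(1) by (intro indicator_UN_disjoint[symmetric]) (auto simp: disjoint_family_on_def)
   have "(\<integral>\<^sup>+x. ennreal \<bar>indicator (\<Union> (range A)) x - (\<Sum>i<n. indicator (A i) x)\<bar> \<partial>mu) =
     (\<integral>\<^sup>+x. indicator (\<Union> (range A) - (\<Union>i<n. A i)) x \<partial>mu)"
    unfolding e1 by (intro nn_integral_cong) (auto simp: indicator_def)
   also have "... = ennreal (measure mu (\<Union> (range A) - (\<Union>i<n. A i)))" by (simp add: emeasure_eq_measure)
   also have "measure mu (\<Union> (range A) - (\<Union>i<n. A i)) = measure mu (\<Union> (range A)) - measure mu (\<Union>i<n. A i)"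
    by (rule finite_measure_Diff) auto
   also have "measure mu (\<Union>i<n. A i) = (\<Sum>i<n. measure mu (A i))"
    by (rule finite_measure_finite_Union) (use union(1) A in \<open>auto simp: disjoint_family_on_def\<close>)
   finally have "(\<integral>\<^sup>+x. ennreal \<bar>indicator (\<Union> (range A)) x - (\<Sum>i<n. indicator (A i) x)\<bar> \<partial>mu) < ennreal e"
    using n e by (simp add: ennreal_lessI)
   then show "\<exists>psi. psi : bmeas mu & combo_dense mu \<A> psi \<and>
     (\<integral>\<^sup>+x. ennreal \<bar>indicator (\<Union> (range A)) x - psi x\<bar> \<partial>mu) < ennreal e"
    using fin[of n] by (intro exI[of _ "%x. \<Sum>i<n. indicator (A i) x"]) auto
  qed
 qed (use ind in blast)
 show ?thesis using phi
 proof (induction rule: integrable_induct)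
  case (base A c)
  then show ?case using combo_dense_cmult[OF mu base(1) sub sets, of c] by (simp add: \<A>(1) mult.commute)
 next
  case (add f g)
  then show ?case by (intro combo_dense_add sub) auto
 next
  case (lim f s)
  have "(%i. \<integral>\<^sup>+x. norm (f x - s i x) \<partial>mu) ----> 0"
   proof (rule nn_integral_dominated_convergence_norm[where w="%x. 2 * norm (f x)"])
    show "(\<integral>\<^sup>+x. ennreal (2 * norm (f x)) \<partial>mu) < \<infinity>"
     using integrableD(2)[OF integrable_mult_right[OF integrable_norm[OF lim(4)], of 2]] by (simp add: abs_mult less_top)
   qed (use lim in auto)
  note l = this
  show ?case
  proof (rule combo_dense_limit[OF _ sub])
   show "f : bmeas mu" using lim by auto
   fix e :: real assume "e > 0"
   then have "ennreal e > 0" by simp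
   from order_tendstoD(2)[OF l this] obtain i where "(\<integral>\<^sup>+x. norm (f x - s i x) \<partial>mu) < ennreal e"
    by (auto dest: eventually_happens'[OF sequentially_bot])
   then show "\<exists>psi. psi : bmeas mu & combo_dense mu \<A> psi & (\<integral>\<^sup>+x. ennreal \<bar>f x - psi x\<bar> \<partial>mu) < ennreal e"
    using lim by (intro exI[of _ "s i"]) auto
  qed
 qed
qed

text \<open>One countable family is dense in L1 of every finite Borel measure at once, since it is
  built from finite intersections of a countable base without reference to a measure. It takes the
  place of uniform density for tests that are merely measurable.\<close>

lemma countable_L1_dense:
 obtains f :: "nat => real^3 => real" where "!!l. f l : bmeas borel"
  "!!mu (phi :: real^3 => real) e. finite_measure mu ==> sets mu = sets borel ==> integrable mu phi ==> e > 0 ==>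
   \<exists>l. (\<integral>\<^sup>+x. ennreal \<bar>phi x - f l x\<bar> \<partial>mu) < ennreal e"
proof -
 obtain B :: "(real^3) set set" where B: "countable B" "topological_basis B" using ex_countable_basis by blast
 define \<A> where "\<A> = {\<Inter>F | F. finite F & F <= B}"
 have co: "countable \<A>"
 proof -
  have "\<A> = Inter ` {F. finite F & F <= B}" by (auto simp: \<A>_def)
  then show ?thesis using countable_Collect_finite_subset[OF B(1)] by simp
 qed
 have Int: "Int_stable \<A>"
 proof (rule Int_stableI)
  fix a b assume "a : \<A>" "b : \<A>"
  then obtain F G where "a = \<Inter>F" "finite F" "F <= B" "b = \<Inter>G" "finite G" "G <= B" by (auto simp: \<A>_def)
  then show "a \<inter> b : \<A>" unfolding \<A>_def by (intro CollectI exI[of _ "F \<union> G"]) auto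
 qed
 have U: "UNIV : \<A>" unfolding \<A>_def by (intro CollectI exI[of _ "{}"]) auto
 have BA: "B <= \<A>" unfolding \<A>_def by (auto intro!: exI[of _ "{_}"])
 have \<A>b: "\<A> <= sets borel"
 proof
  fix a assume "a : \<A>"
  then obtain F where F: "a = \<Inter>F" "finite F" "F <= B" by (auto simp: \<A>_def)
  have "open a" unfolding F(1) using F topological_basis_open[OF B(2)] by (intro open_Inter) auto
  then show "a : sets borel" by simp
 qed
 have sig: "sets borel = sigma_sets UNIV \<A>"
 proof (rule antisym)
  have "sets borel = sigma_sets UNIV B" unfolding borel_eq_countable_basis[OF B] by simp
  also have "... <= sigma_sets UNIV \<A>" by (rule sigma_sets_mono') (rule BA)
  finally show "sets borel <= sigma_sets UNIV \<A>" .
  show "sigma_sets UNIV \<A> <= sets borel" using sets.sigma_sets_subset[OF \<A>b] by simp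
 qed
 define I where "I = lists ((UNIV :: rat set) \<times> \<A>)"
 have cI: "countable I" unfolding I_def using co by (intro countable_lists) auto
 have neI: "I ~= {}" by (auto simp: I_def)
 have inI: "set (from_nat_into I l) <= UNIV \<times> \<A>" for l using from_nat_into[OF neI, of l] by (auto simp: I_def)
 show ?thesis
 proof (rule that[of "%l. combo (from_nat_into I l)"])
  show "combo (from_nat_into I l) : bmeas borel" for l by (rule combo_meas[OF inI \<A>b])
  fix mu :: "(real^3) measure" and phi :: "real^3 => real" and e :: real
  assume mu: "finite_measure mu" "sets mu = sets borel" "integrable mu phi" and e: "e > 0"
  have sp: "space mu = UNIV" using sets_eq_imp_space_eq[OF mu(2)] by simp
  have "combo_dense mu \<A> phi"
   by (rule integrable_combo_dense[OF mu(1) _ _ Int _ mu(3)]) (use mu(2) U sig in \<open>auto simp: sp\<close>)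
  then obtain L where L: "set L <= UNIV \<times> \<A>" "(\<integral>\<^sup>+x. ennreal \<bar>phi x - combo L x\<bar> \<partial>mu) < ennreal e"
   using e unfolding combo_dense_def by blast
  have "L : I" using L(1) by (auto simp: I_def)
  then obtain l where "from_nat_into I l = L" using from_nat_into_surj[OF cI] by blast
  then show "\<exists>l. (\<integral>\<^sup>+x. ennreal \<bar>phi x - combo (from_nat_into I l) x\<bar> \<partial>mu) < ennreal e" using L(2) by blast
 qed
qed

section \<open>Conditional relative entropy\<close>

lemma frz_meas: "m <= j ==> frz m j x' : velM {1..m} \<rightarrow>\<^sub>M velM {1..j}"
proof (rule measurable_PiM_single')
 assume m: "m <= j"
 show "frz m j x' : space (velM {1..m}) \<rightarrow> (\<Pi>\<^sub>E i\<in>{1..j}. space borel)"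
  using frz_phase[OF m, of x'] by (auto simp: phase_def)
 show "(%om. frz m j x' om i) : bmeas (velM {1..m})" if "i : {1..j}" for i
  unfolding frz_apply using that by (cases "i : {1..m}") auto
qed

lemma upd_meas: "i : {1..n} ==> (%x. (fst x)(i := snd x)) : velM {1..n} \<Otimes>\<^sub>M borel \<rightarrow>\<^sub>M velM {1..n}"
proof (rule measurable_PiM_single')
 assume i: "i : {1..n}"
 show "(%x. (fst x)(i := snd x)) : space (velM {1..n} \<Otimes>\<^sub>M (borel :: (real^3) measure)) \<rightarrow> (\<Pi>\<^sub>E i\<in>{1..n}. space borel)"
  using phase_upd[OF _ i] by (simp add: space_pair_measure space_velM Pi_iff phase_def[symmetric])
 show "(%x. ((fst x)(i := snd x)) k) : bmeas (velM {1..n} \<Otimes>\<^sub>M (borel :: (real^3) measure))" if "k : {1..n}" for k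
  using that by (cases "k = i") simp_all
qed

lemma exp_diff_bound:
 fixes x y :: real
 assumes "\<bar>x\<bar> <= B" "\<bar>y\<bar> <= B"
 shows "\<bar>exp x - exp y\<bar> <= exp B * \<bar>x - y\<bar>"
proof -
 have a: "exp x - exp y <= exp B * \<bar>x - y\<bar>" if "\<bar>x\<bar> <= B" for x y :: real
 proof -
  have "exp x * (1 + (y - x)) <= exp x * exp (y - x)" by (intro mult_left_mono exp_ge_add_one_self) simp
  then have "exp x - exp y <= exp x * (x - y)" by (simp add: exp_diff algebra_simps)
  also have "... <= exp x * \<bar>x - y\<bar>" by (intro mult_left_mono) auto
  also have "... <= exp B * \<bar>x - y\<bar>" using that by (intro mult_right_mono) auto
  finally show ?thesis .
 qed
 show ?thesis using a[OF assms(1), of y] a[OF assms(2), of x] by (simp add: abs_le_iff abs_minus_commute)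
qed

definition clip :: "real => real => real" where
 "clip b x = max (- b) (min b x)"

lemma clip_bound: "b >= 0 ==> \<bar>clip b x\<bar> <= b" by (auto simp: clip_def)

lemma clip_close: "\<bar>x\<bar> <= b ==> \<bar>x - clip b y\<bar> <= \<bar>x - y\<bar>"
 by (auto simp: clip_def)

lemma bdd_vel: "phi : bdd (velM {1..n}) \<longleftrightarrow> phi : bmeas (velM {1..n}) & (\<exists>B. \<forall>V\<in>phase n. \<bar>phi V\<bar> <= B)"
 by (simp add: bdd_def space_velM)

locale reference = mixing \<nu> for \<nu> :: "(real^3) measure measure" +
 fixes \<Gamma> :: "(real^3) measure"
 assumes ref_prob: "prob_space \<Gamma>" and ref_sets: "sets \<Gamma> = sets borel"
begin

sublocale G: prob_space \<Gamma> by (rule ref_prob)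

lemma ref_space: "\<Gamma> : space (prob_algebra borel)" using ref_prob ref_sets by (simp add: space_prob_algebra)

lemmas ref_tensor_sets = RM.sets_tensor[OF ref_space] and ref_tensor_prob = RM.prob_tensor[OF ref_space]

lemma ref_law: "law n (tensor n \<Gamma>)" using ref_tensor_sets ref_tensor_prob by (simp add: law_def)

text \<open>Particle \<open>i\<close> is redrawn from \<open>\<Gamma>\<close> while the others are
  kept. Together with \<open>tst\<close> this gives the dual integrand conditionally on the other
  particles; unlike \<open>quadL\<close> it is not local in particle \<open>i\<close>.\<close>

definition resamp :: "nat => (velocities => real) => velocities => real" where
 "resamp i phi V = (\<integral>y. exp (phi (V(i := y))) - 1 \<partial>\<Gamma>)"

definition tst :: "nat => (velocities => real) => velocities => real" where
 "tst i phi V = phi V - resamp i phi V"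

lemma upd_meas2: "i : {1..n} ==> (%x. (fst x)(i := snd x)) : velM {1..n} \<Otimes>\<^sub>M \<Gamma> \<rightarrow>\<^sub>M velM {1..n}"
 using upd_meas[of i n] by (simp add: measurable_cong_sets[OF sets_pair_measure_cong[OF refl ref_sets] refl])

lemma upd_meas1: "i : {1..n} ==> V : phase n ==> (%y. V(i := y)) : \<Gamma> \<rightarrow>\<^sub>M velM {1..n}"
 using measurable_compose[OF measurable_Pair1' upd_meas2, of V n i] by (simp add: space_velM)

lemma resamp_meas:
 assumes i: "i : {1..n}" and m: "phi : bmeas (velM {1..n})"
 shows "resamp i phi : bmeas (velM {1..n})"
proof -
 have "(%x. exp (phi ((fst x)(i := snd x))) - 1) : bmeas (velM {1..n} \<Otimes>\<^sub>M \<Gamma>)"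
  using measurable_compose[OF upd_meas2[OF i] m] by measurable
 then show ?thesis unfolding resamp_def[abs_def] by (intro G.borel_measurable_lebesgue_integral) (simp add: case_prod_beta')
qed

lemma resamp_integrable:
 fixes phi :: "velocities => real"
 assumes i: "i : {1..n}" and m: "phi : bmeas (velM {1..n})" and B: "\<forall>V\<in>phase n. \<bar>phi V\<bar> <= B"
  and V: "V : phase n"
 shows "integrable \<Gamma> (%y. exp (phi (V(i := y))) - 1)"
  and "\<bar>exp (phi (V(i := y))) - 1\<bar> <= exp B + 1"
proof -
 show b: "\<bar>exp (phi (V(i := y))) - 1\<bar> <= exp B + 1" for y
 proof -
  have "exp (phi (V(i := y))) <= exp B" by (rule iffD2[OF exp_le_cancel_iff abs_le_D1[OF bspec[OF B phase_upd[OF V i]]]])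
  then show ?thesis using exp_gt_zero[of "phi (V(i := y))"] by linarith
 qed
 show "integrable \<Gamma> (%y. exp (phi (V(i := y))) - 1)" by (rule G.integrable_bounded[where B="exp B + 1"])
   (use measurable_compose[OF upd_meas1[OF i V] m] b in auto)
qed

lemma resamp_bound:
 assumes i: "i : {1..n}" and m: "phi : bmeas (velM {1..n})" and B: "\<forall>V\<in>phase n. \<bar>phi V\<bar> <= B"
  and V: "V : phase n"
 shows "\<bar>resamp i phi V\<bar> <= exp B + 1"
proof -
 have "\<bar>resamp i phi V\<bar> <= (\<integral>y. \<bar>exp (phi (V(i := y))) - 1\<bar> \<partial>\<Gamma>)" unfolding resamp_def by (rule integral_abs_bound)
 also have "... <= (\<integral>y. exp B + 1 \<partial>\<Gamma>)"
  by (intro integral_mono integrable_abs resamp_integrable[OF assms]) auto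
 finally show ?thesis by (simp add: G.prob_space)
qed

lemma tst_props:
 assumes i: "i : {1..n}" and phi: "phi : bdd (velM {1..n})"
 shows "tst i phi : bmeas (velM {1..n})" "\<exists>B. \<forall>V\<in>phase n. \<bar>tst i phi V\<bar> <= B"
proof -
 obtain B where m: "phi : bmeas (velM {1..n})" and B: "\<forall>V\<in>phase n. \<bar>phi V\<bar> <= B" using phi by (auto simp: bdd_vel)
 show "tst i phi : bmeas (velM {1..n})" unfolding tst_def[abs_def]
  by (intro borel_measurable_diff m resamp_meas[OF i m])
 have "\<bar>tst i phi V\<bar> <= B + (exp B + 1)" if V: "V : phase n" for V
  using B[rule_format, OF V] resamp_bound[OF i m B V] unfolding tst_def by linarith
 then show "\<exists>B. \<forall>V\<in>phase n. \<bar>tst i phi V\<bar> <= B" by blast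
qed

text \<open>Plays the part that linearity of \<open>L\<close> plays for quadratic integrands: on
  tests bounded by \<open>B\<close>, \<open>tst i\<close> is Lipschitz with constant
  \<open>1 + exp B\<close>, provided the tests are compared for all values of particle
  \<open>i\<close>.\<close>

lemma tst_close:
 assumes i: "i : {1..n}" "i : {1..n'}" and m: "phi : bmeas (velM {1..n})" "psi : bmeas (velM {1..n'})"
  and B: "\<forall>V\<in>phase n. \<bar>phi V\<bar> <= B" "\<forall>V\<in>phase n'. \<bar>psi V\<bar> <= B" and V: "V : phase n" "W : phase n'"
  and d: "\<bar>phi V - psi W\<bar> <= d" "!!y. \<bar>phi (V(i := y)) - psi (W(i := y))\<bar> <= d"
 shows "\<bar>tst i phi V - tst i psi W\<bar> <= (1 + exp B) * d"
proof -
 note I = resamp_integrable(1)[OF i(1) m(1) B(1) V(1)] resamp_integrable(1)[OF i(2) m(2) B(2) V(2)]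
 have "resamp i phi V - resamp i psi W = (\<integral>y. (exp (phi (V(i := y))) - 1) - (exp (psi (W(i := y))) - 1) \<partial>\<Gamma>)"
  unfolding resamp_def by (rule Bintegral_diff[OF I, symmetric])
 also have "\<bar>...\<bar> <= (\<integral>y. \<bar>(exp (phi (V(i := y))) - 1) - (exp (psi (W(i := y))) - 1)\<bar> \<partial>\<Gamma>)" by (rule integral_abs_bound)
 also have "... <= (\<integral>y. exp B * d \<partial>\<Gamma>)"
 proof (rule integral_mono)
  show "integrable \<Gamma> (%y. \<bar>(exp (phi (V(i := y))) - 1) - (exp (psi (W(i := y))) - 1)\<bar>)"
   by (intro integrable_abs Bintegrable_diff I)
  fix y
  have "\<bar>exp (phi (V(i := y))) - exp (psi (W(i := y)))\<bar> <= exp B * \<bar>phi (V(i := y)) - psi (W(i := y))\<bar>"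
   by (rule exp_diff_bound) (use B phase_upd[OF V(1) i(1)] phase_upd[OF V(2) i(2)] in auto)
  also have "... <= exp B * d" by (intro mult_left_mono d(2)) simp
  finally show "\<bar>(exp (phi (V(i := y))) - 1) - (exp (psi (W(i := y))) - 1)\<bar> <= exp B * d" by simp
 qed simp
 finally have "\<bar>resamp i phi V - resamp i psi W\<bar> <= exp B * d" by (simp add: G.prob_space)
 then show ?thesis using d(1) unfolding tst_def distrib_right by linarith
qed

text \<open>Conditional relative entropy of particle 1 given the particles 2..j, with respect to
  \<open>\<Gamma>\<close>, in dual form.\<close>

definition crel :: "nat => velocities measure => ennreal" where
 "crel j F = (SUP phi\<in>bdd (velM {1..j}). ennreal (\<integral>V. tst 1 phi V \<partial>F))"

lemma singleton_velM: "{1..1::nat} = {1}" by auto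

lemma integral_tensor_1:
 fixes g :: "velocities => real"
 assumes \<rho>: "\<rho> : space (prob_algebra borel)" and g: "g : bmeas (velM {1..1})"
 shows "(\<integral>V. g V \<partial>tensor 1 \<rho>) = (\<integral>y. g (\<lambda>i\<in>{1..1}. y) \<partial>\<rho>)"
proof -
 interpret product_sigma_finite "%_::nat. \<rho>"
  using \<rho> by (simp add: product_sigma_finite_def prob_space_imp_sigma_finite space_prob_algebra)
 have s: "sets \<rho> = sets borel" using \<rho> by (simp add: space_prob_algebra)
 have c: "(%y. \<lambda>i\<in>{1..1::nat}. y) : (borel :: (real^3) measure) \<rightarrow>\<^sub>M velM {1..1}"
  by (rule measurable_restrict) simp
 have m: "(%y. g (\<lambda>i\<in>{1..1}. y)) : bmeas \<rho>"
  using measurable_compose[OF c g] by (simp add: measurable_cong_sets[OF s refl])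
 have sp: "space (tensor 1 \<rho>) = phase 1" using sets_eq_imp_space_eq[OF RM.sets_tensor[OF \<rho>]] by (simp add: space_velM)
 have "(\<integral>V. g V \<partial>tensor 1 \<rho>) = (\<integral>V. g (\<lambda>i\<in>{1..1}. V 1) \<partial>tensor 1 \<rho>)"
 proof (rule Bintegral_cong[OF refl])
  fix V assume "V : space (tensor 1 \<rho>)"
  then have "(\<lambda>i\<in>{1..1}. V 1) = V" unfolding sp by (auto simp: phase_def fun_eq_iff restrict_def PiE_def extensional_def)
  then show "g V = g (\<lambda>i\<in>{1..1}. V 1)" by simp
 qed
 also have "... = (\<integral>y. g (\<lambda>i\<in>{1..1}. y) \<partial>\<rho>)"
  using product_integral_singleton[of "%y. g (\<lambda>i\<in>{1..1}. y)" 1] m unfolding tensor_def singleton_velM by simp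
 finally show ?thesis .
qed

lemma upd_1: "V : phase 1 ==> V(1 := y) = (\<lambda>i\<in>{1..1}. y)"
 by (auto simp: phase_def fun_eq_iff restrict_def PiE_def extensional_def)

lemma crel_1:
 assumes "law 1 F"
 shows "crel 1 F = dual F (tensor 1 \<Gamma>)"
proof -
 interpret F: prob_space F using assms by (simp add: law_def)
 have s: "sets F = sets (velM {1..1})" using assms by (simp add: law_def)
 have b: "bdd (tensor 1 \<Gamma>) = bdd (velM {1..1})"
  using measurable_cong_sets[OF ref_tensor_sets[of 1] refl] sets_eq_imp_space_eq[OF ref_tensor_sets[of 1]] unfolding bdd_def by metis
 have "(\<integral>V. tst 1 phi V \<partial>F) = (\<integral>x. phi x \<partial>F) - (\<integral>x. exp (phi x) - 1 \<partial>tensor 1 \<Gamma>)" if phi: "phi : bdd (velM {1..1})" for phi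
 proof -
  have m: "phi : bmeas (velM {1..1})" using phi by (simp add: bdd_def)
  have "(\<integral>x. exp (phi x) - 1 \<partial>tensor 1 \<Gamma>) = (\<integral>y. exp (phi (\<lambda>i\<in>{1..1}. y)) - 1 \<partial>\<Gamma>)" (is "?a = ?b")
   by (rule integral_tensor_1[OF ref_space]) (use m in measurable)
  then have "(\<integral>V. tst 1 phi V \<partial>F) = (\<integral>V. phi V - ?a \<partial>F)"
   using law_space[OF assms] by (intro Bintegral_cong) (auto simp: tst_def resamp_def upd_1)
  also have "... = (\<integral>V. phi V \<partial>F) - ?a"
   by (subst Bintegral_diff[OF bdd_integrable(1)[OF F.prob_space_axioms phi s]]) (auto simp: F.prob_space)
  finally show ?thesis .
 qed
 then show ?thesis unfolding crel_def dual_def b by (intro SUP_cong) auto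
qed

lemma bdd_comp:
 assumes phi: "phi : bdd (velM {1..n})" and f: "f : velM {1..n'} \<rightarrow>\<^sub>M velM {1..n}"
 shows "(%V. phi (f V)) : bdd (velM {1..n'})"
 using measurable_compose[OF f, of phi borel] measurable_space[OF f] phi unfolding bdd_def by blast

lemma frz_upd: "1 <= j ==> frz 1 j x' (x(1 := y)) = (frz 1 j x' x)(1 := y)" by (auto simp: frz_apply fun_eq_iff)

lemma restrict_upd: "1 <= (j::nat) ==> restrict (V(1 := y)) {1..j} = (restrict V {1..j})(1 := y)"
 by (rule ext) simp

lemma restr_meas2: "j <= n ==> (%V. restrict V {1..j}) : velM {1..n} \<rightarrow>\<^sub>M velM {1..j}"
 by (rule measurable_restrict_subset) auto

lemma tst_comp:
 assumes "!!y. f (V(1 := y)) = (f V)(1 := y)"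
 shows "tst 1 (%V. phi (f V)) V = tst 1 phi (f V)" by (simp add: tst_def resamp_def assms)

text \<open>As for quadratic integrands, the combined test is the sum of the products of
  \<open>q l\<close> with \<open>ph l\<close>. The multipliers do not involve particle 1, so they
  are unchanged when it is redrawn.\<close>

lemma tst_combine:
 fixes ph :: "nat => velocities => real" and n :: nat
 assumes b: "!!l. ph l : bdd (velM {1..1})"
 shows "\<exists>C\<ge>0. \<forall>j\<ge>1. \<forall>q. (\<forall>l\<le>n. q l : Qc 1 j) -->
   (\<exists>g\<in>tst 1 ` bdd (velM {1..j}). \<forall>V\<in>phase j. \<forall>l0\<le>n. \<bar>g V - tst 1 (ph l0) (restrict V {1..1})\<bar> \<le>
    C * (\<Sum>l\<le>n. \<bar>q l V - (if l = l0 then 1 else 0)\<bar>))"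
proof -
 have "\<forall>l. \<exists>B\<ge>0. \<forall>V\<in>phase 1. \<bar>ph l V\<bar> <= B" using bddD(2)[OF b refl] unfolding space_velM by blast
 from choice[OF this] obtain \<beta> where \<beta>: "!!l. \<beta> l >= 0" "!!l. \<forall>V\<in>phase 1. \<bar>ph l V\<bar> <= \<beta> l" by blast
 define B where "B = (\<Sum>l\<le>n. \<beta> l)"
 have B0: "B >= 0" unfolding B_def by (intro sum_nonneg \<beta>)
 have \<beta>B: "\<beta> l <= B" if "l <= n" for l unfolding B_def by (rule member_le_sum) (use \<beta> that in auto)
 have phB: "\<bar>ph l V\<bar> <= B" if "l <= n" "V : phase 1" for l V using \<beta>(2)[of l] \<beta>B[OF that(1)] that(2) by force
 have phm: "ph l : bmeas (velM {1..1})" for l using b by (simp add: bdd_def)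
 show ?thesis
 proof (intro exI[of _ "(1 + exp B) * B"] conjI allI impI)
  show "0 <= (1 + exp B) * B" using B0 by (simp add: add_nonneg_nonneg)
  fix j :: nat and q assume j: "1 <= j" and q: "\<forall>l\<le>n. q l : Qc 1 j"
  define phi where "phi V = (\<Sum>l\<le>n. q l V * ph l (restrict V {1..1}))" for V
  have qr: "0 <= q l V" "q l V <= 1" if "l <= n" for l V using q that by (auto simp: Qc_def)
  have phim: "phi : bmeas (velM {1..j})" unfolding phi_def[abs_def]
  proof (intro borel_measurable_sum borel_measurable_times)
   fix l assume "l : {..n}"
   then have "C_diff j 0 (q l)" using q by (auto simp: Qc_def)
   then show "q l : bmeas (velM {1..j})" by (rule C_diff_measurable)
   show "(%V. ph l (restrict V {1..1})) : bmeas (velM {1..j})"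
    by (rule measurable_compose[OF restr_meas2[OF j] phm])
  qed
  have phiB: "\<bar>phi V\<bar> <= B" for V unfolding phi_def B_def
  proof (rule order_trans[OF sum_abs sum_mono])
   fix l assume "l : {..n}"
   then have l: "l <= n" by simp
   have "\<bar>q l V * ph l (restrict V {1..1})\<bar> <= 1 * \<bar>ph l (restrict V {1..1})\<bar>"
    using qr[OF l, of V] by (simp add: abs_mult mult_left_le_one_le)
   then show "\<bar>q l V * ph l (restrict V {1..1})\<bar> <= \<beta> l" using \<beta>(2)[of l] restrict_phase[of V 1] by force
  qed
  have phi: "phi : bdd (velM {1..j})" unfolding bdd_vel using phim phiB by blast
  show "\<exists>g\<in>tst 1 ` bdd (velM {1..j}). \<forall>V\<in>phase j. \<forall>l0\<le>n. \<bar>g V - tst 1 (ph l0) (restrict V {1..1})\<bar> \<le>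
    (1 + exp B) * B * (\<Sum>l\<le>n. \<bar>q l V - (if l = l0 then 1 else 0)\<bar>)"
  proof (rule bexI[OF _ imageI[OF phi]], intro ballI allI impI)
   fix V l0 assume V: "V : phase j" and l0: "l0 <= n"
   define \<sigma> where "\<sigma> = (\<Sum>l\<le>n. \<bar>q l V - (if l = l0 then 1 else 0)\<bar>)"
   \<comment> \<open>Stated for every \<open>W\<close> with the same multipliers as
     \<open>V\<close>, in order to cover the configurations in which particle 1 has been
     redrawn.\<close>
   have key: "\<bar>phi W - ph l0 (restrict W {1..1})\<bar> <= B * \<sigma>" if W: "!!l. l <= n ==> q l W = q l V" for W
   proof -
    have "ph l0 (restrict W {1..1}) = (\<Sum>l\<le>n. if l = l0 then ph l0 (restrict W {1..1}) else 0)" using l0 by simp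
    then have "phi W - ph l0 (restrict W {1..1}) =
      (\<Sum>l\<le>n. q l W * ph l (restrict W {1..1}) - (if l = l0 then ph l0 (restrict W {1..1}) else 0))"
     unfolding phi_def by (simp only: sum_subtractf)
    also have "... = (\<Sum>l\<le>n. (q l V - (if l = l0 then 1 else 0)) * ph l (restrict W {1..1}))"
     by (rule sum.cong) (auto simp: W left_diff_distrib)
    also have "\<bar>...\<bar> <= (\<Sum>l\<le>n. \<bar>q l V - (if l = l0 then 1 else 0)\<bar> * B)"
    proof (rule order_trans[OF sum_abs sum_mono])
     fix l assume "l : {..n}"
     then show "\<bar>(q l V - (if l = l0 then 1 else 0)) * ph l (restrict W {1..1})\<bar> <= \<bar>q l V - (if l = l0 then 1 else 0)\<bar> * B"
      unfolding abs_mult by (intro mult_left_mono phB restrict_phase) auto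
    qed
    finally show ?thesis by (simp add: \<sigma>_def sum_distrib_left mult.commute)
   qed
   have "\<bar>tst 1 phi V - tst 1 (ph l0) (restrict V {1..1})\<bar> <= (1 + exp B) * (B * \<sigma>)"
   proof (rule tst_close[where n=j and n'=1])
    show "\<bar>phi V - ph l0 (restrict V {1..1})\<bar> <= B * \<sigma>" by (rule key) simp
    show "\<bar>phi (V(1 := y)) - ph l0 ((restrict V {1..1})(1 := y))\<bar> <= B * \<sigma>" for y
     unfolding restrict_upd[OF order_refl, symmetric]
    proof (rule key)
     fix l assume "l <= n"
     then have "\<forall>V W. (\<forall>i\<in>{1+1..j}. V i = W i) --> q l V = q l W" using q by (simp add: Qc_def)
     then have "(\<forall>i\<in>{1+1..j}. (V(1 := y)) i = V i) --> q l (V(1 := y)) = q l V" by blast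
     moreover have "\<forall>i\<in>{1+1..j}. (V(1 := y)) i = V i" by simp
     ultimately show "q l (V(1 := y)) = q l V" by blast
    qed
   qed (use j phim phiB phm phB[OF l0] V restrict_phase[of V 1] in auto)
   then show "\<bar>tst 1 phi V - tst 1 (ph l0) (restrict V {1..1})\<bar> \<le>
     (1 + exp B) * B * (\<Sum>l\<le>n. \<bar>q l V - (if l = l0 then 1 else 0)\<bar>)"
    by (simp only: \<sigma>_def mult.assoc)
  qed
 qed
qed

text \<open>\<open>tst\<close> integrates a test against \<open>\<rho>\<close> and, inside the
  exponential, against \<open>\<Gamma>\<close>. The average of the two laws dominates each of them
  up to the factor 2, so one L1 approximation serves both.\<close>

lemma average_measure:
 assumes "prob_space P1" "prob_space P2" "sets P1 = sets borel" "sets P2 = sets borel"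
 obtains mu where "prob_space mu" "sets mu = sets borel"
  "!!g :: real^3 => ennreal. g : bmeas borel ==> (\<integral>\<^sup>+x. g x \<partial>P1) <= 2 * (\<integral>\<^sup>+x. g x \<partial>mu)"
  "!!g :: real^3 => ennreal. g : bmeas borel ==> (\<integral>\<^sup>+x. g x \<partial>P2) <= 2 * (\<integral>\<^sup>+x. g x \<partial>mu)"
proof -
 define K where "K b = (if b then P1 else P2)" for b
 define mu where "mu = measure_pmf (bernoulli_pmf (1/2)) \<bind> K"
 have Kp: "prob_space (K b)" "sets (K b) = sets borel" for b using assms by (auto simp: K_def)
 have Km: "K : measure_pmf (bernoulli_pmf (1/2)) \<rightarrow>\<^sub>M subprob_algebra borel"
  using Kp by (auto simp: measurable_def space_subprob_algebra prob_space_imp_subprob_space)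
 have s: "sets mu = sets borel" unfolding mu_def by (rule sets_bind) (auto simp: Kp)
 have p: "prob_space mu" unfolding mu_def
  by (rule prob_space.prob_space_bind[OF measure_pmf.prob_space_axioms _ Km]) (simp add: Kp)
 have e: "(\<integral>\<^sup>+x. g x \<partial>mu) = (\<integral>\<^sup>+x. g x \<partial>P1) * ennreal (1/2) + (\<integral>\<^sup>+x. g x \<partial>P2) * ennreal (1/2)"
  if "g : bmeas borel" for g :: "real^3 => ennreal"
 proof -
  have "(\<integral>\<^sup>+x. g x \<partial>mu) = (\<integral>\<^sup>+b. (\<integral>\<^sup>+x. g x \<partial>K b) \<partial>measure_pmf (bernoulli_pmf (1/2)))"
   unfolding mu_def by (rule nn_integral_bind[OF that Km])
  also have "... = (\<integral>\<^sup>+x. g x \<partial>P1) * ennreal (1/2) + (\<integral>\<^sup>+x. g x \<partial>P2) * ennreal (1/2)"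
   by (subst nn_integral_bernoulli_pmf) (auto simp: K_def)
  finally show ?thesis .
 qed
 have t: "2 * (x * ennreal (1/2) + y * ennreal (1/2)) = x + y" for x y :: ennreal
 proof -
  have "2 * ennreal (1/2) = ennreal (2 * (1/2))" by (subst ennreal_mult) (simp_all only: ennreal_numeral)
  then have h: "2 * ennreal (1/2) = 1" by simp
  have "2 * (x * ennreal (1/2) + y * ennreal (1/2)) = (2 * ennreal (1/2)) * x + (2 * ennreal (1/2)) * y"
   by (simp only: distrib_left mult.assoc mult.commute[of x] mult.commute[of y])
  then show ?thesis by (simp only: h mult_1)
 qed
 show ?thesis by (rule that[OF p s]) (simp_all only: e t, auto)
qed

lemma tests_dense:
 obtains f :: "nat => real^3 => real" where "!!l. f l : bmeas borel"
  "!!(\<rho> :: (real^3) measure) phi e. \<rho> : space (prob_algebra borel) ==> phi : bdd (velM {1..1}) ==> e > 0 ==>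
   \<exists>l b. \<bar>(\<integral>V. tst 1 phi V \<partial>tensor 1 \<rho>) - (\<integral>V. tst 1 (%V. clip (real b) (f l (V 1))) V \<partial>tensor 1 \<rho>)\<bar> <= e"
proof -
 obtain f :: "nat => real^3 => real" where f: "!!l. f l : bmeas borel"
  "!!mu (phi :: real^3 => real) e. finite_measure mu ==> sets mu = sets borel ==> integrable mu phi ==> e > 0 ==>
   \<exists>l. (\<integral>\<^sup>+x. ennreal \<bar>phi x - f l x\<bar> \<partial>mu) < ennreal e" by (rule countable_L1_dense) (rule that)
 show ?thesis
 proof (rule that[OF f(1)])
  fix \<rho> :: "(real^3) measure" and phi and e :: real assume \<rho>: "\<rho> : space (prob_algebra borel)" and phi: "phi : bdd (velM {1..1})" and e: "e > 0"
  have P: "prob_space \<rho>" "sets \<rho> = sets borel" using \<rho> by (auto simp: space_prob_algebra)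
  obtain mu where mu: "prob_space mu" "sets mu = sets borel"
   "!!g :: real^3 => ennreal. g : bmeas borel ==> (\<integral>\<^sup>+x. g x \<partial>\<rho>) <= 2 * (\<integral>\<^sup>+x. g x \<partial>mu)"
   "!!g :: real^3 => ennreal. g : bmeas borel ==> (\<integral>\<^sup>+x. g x \<partial>\<Gamma>) <= 2 * (\<integral>\<^sup>+x. g x \<partial>mu)"
   by (rule average_measure[OF P(1) ref_prob P(2) ref_sets]) (rule that)
  obtain B where B: "B >= 0" "\<forall>V\<in>phase 1. \<bar>phi V\<bar> <= B" using bddD(2)[OF phi refl] unfolding space_velM by blast
  have m: "phi : bmeas (velM {1..1})" using phi by (simp add: bdd_def)
  obtain b :: nat where b: "B <= real b" using real_arch_simple by blast
  define h where "h y = phi (\<lambda>i\<in>{1..1}. y)" for y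
  have c: "(%y. \<lambda>i\<in>{1..1::nat}. y) : (borel :: (real^3) measure) \<rightarrow>\<^sub>M velM {1..1}"
   by (rule measurable_restrict) simp
  have hm: "h : bmeas borel" unfolding h_def[abs_def] by (rule measurable_compose[OF c m])
  have hb: "\<bar>h y\<bar> <= real b" for y using B(2) b restrict_phase[of "%_. y" 1] unfolding h_def by force
  \<comment> \<open>The term under \<open>\<rho>\<close> changes by at most \<open>2 * dl\<close>
    and the exponential term by at most \<open>exp (real b)\<close> times that; the two bounds add
    up to \<open>e\<close>.\<close>
  define dl where "dl = e / (2 * (1 + exp (real b)))"
  have eb: "1 + exp (real b) > 0" by (simp add: add_pos_pos)
  have dl: "dl > 0" unfolding dl_def using e eb by simp
  interpret M: prob_space mu by (rule mu(1))
  have "integrable mu h"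
   by (rule M.integrable_bounded[where B="real b"]) (use hm hb in \<open>auto simp: measurable_cong_sets[OF mu(2) refl]\<close>)
  from f(2)[OF M.finite_measure_axioms mu(2) this dl] obtain l where l: "(\<integral>\<^sup>+x. ennreal \<bar>h x - f l x\<bar> \<partial>mu) < ennreal dl" by blast
  define g where "g y = clip (real b) (f l y)" for y
  have gm: "g : bmeas borel" unfolding g_def[abs_def] clip_def using f(1)[of l] by measurable
  have gb: "\<bar>g y\<bar> <= real b" for y unfolding g_def by (rule clip_bound) simp
  have hg: "\<bar>h y - g y\<bar> <= \<bar>h y - f l y\<bar>" for y unfolding g_def by (rule clip_close[OF hb])
  have est: "integrable P h & integrable P g & (\<integral>y. \<bar>h y - g y\<bar> \<partial>P) <= 2 * dl"
   if P: "prob_space P" "sets P = sets borel" and le: "!!g :: real^3 => ennreal. g : bmeas borel ==> (\<integral>\<^sup>+x. g x \<partial>P) <= 2 * (\<integral>\<^sup>+x. g x \<partial>mu)" for P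
  proof -
   interpret P: prob_space P by fact
   have ih: "integrable P h" "integrable P g"
    by (rule P.integrable_bounded[where B="real b"]; use hm hb gm gb in \<open>auto simp: measurable_cong_sets[OF P(2) refl]\<close>)+
   have "ennreal (\<integral>y. \<bar>h y - g y\<bar> \<partial>P) = (\<integral>\<^sup>+y. ennreal \<bar>h y - g y\<bar> \<partial>P)"
    by (rule nn_integral_eq_integral[symmetric]) (use ih in auto)
   also have "... <= (\<integral>\<^sup>+y. ennreal \<bar>h y - f l y\<bar> \<partial>P)" by (intro nn_integral_mono ennreal_leI hg)
   also have "... <= 2 * (\<integral>\<^sup>+y. ennreal \<bar>h y - f l y\<bar> \<partial>mu)" by (rule le) (use hm f(1)[of l] in measurable)
   also have "... <= 2 * ennreal dl" using l by (intro mult_left_mono) auto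
   also have "... = ennreal (2 * dl)" using dl by (simp add: ennreal_mult)
   finally show ?thesis using ih dl by (simp add: ennreal_le_iff)
  qed
  note e1 = est[OF P mu(3)] and e2 = est[OF ref_prob ref_sets mu(4)]
  let ?psi = "%V. clip (real b) (f l (V 1))"
  have psi: "?psi : bdd (velM {1..1})"
  proof -
   have "(%V. V 1) : velM {1..1} \<rightarrow>\<^sub>M borel" by simp
   from measurable_compose[OF this gm] have "(%V. g (V 1)) : bmeas (velM {1..1})" .
   then show ?thesis unfolding bdd_vel using clip_bound[of "real b"] unfolding g_def by (auto intro!: exI[of _ "real b"])
  qed
  have val: "(\<integral>V. tst 1 psi V \<partial>tensor 1 \<rho>) = (\<integral>y. k y \<partial>\<rho>) - (\<integral>y. exp (k y) - 1 \<partial>\<Gamma>)"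
   if psi: "psi : bdd (velM {1..1})" and k: "!!y. psi (\<lambda>i\<in>{1..1}. y) = k y" "integrable \<rho> k" for psi k
  proof -
   interpret P: prob_space \<rho> by (rule P(1))
   have "(\<integral>V. tst 1 psi V \<partial>tensor 1 \<rho>) = (\<integral>y. tst 1 psi (\<lambda>i\<in>{1..1}. y) \<partial>\<rho>)"
    by (rule integral_tensor_1[OF \<rho> tst_props(1)[OF _ psi]]) simp
   also have "... = (\<integral>y. k y - (\<integral>y. exp (k y) - 1 \<partial>\<Gamma>) \<partial>\<rho>)"
    by (intro Bintegral_cong refl) (simp only: tst_def resamp_def upd_1[OF restrict_phase] k(1))
   also have "... = (\<integral>y. k y \<partial>\<rho>) - (\<integral>y. exp (k y) - 1 \<partial>\<Gamma>)"
    by (subst Bintegral_diff[OF k(2)]) (auto simp: P.prob_space)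
   finally show ?thesis .
  qed
  have vh: "(\<integral>V. tst 1 phi V \<partial>tensor 1 \<rho>) = (\<integral>y. h y \<partial>\<rho>) - (\<integral>y. exp (h y) - 1 \<partial>\<Gamma>)"
   by (rule val[OF phi h_def[symmetric] conjunct1[OF e1]])
  have vg: "(\<integral>V. tst 1 ?psi V \<partial>tensor 1 \<rho>) = (\<integral>y. g y \<partial>\<rho>) - (\<integral>y. exp (g y) - 1 \<partial>\<Gamma>)"
   by (rule val[OF psi _ conjunct1[OF conjunct2[OF e1]]]) (simp add: g_def)
  have ie: "integrable \<Gamma> (%y. exp (k y) - 1)" if "k : bmeas borel" "!!y. \<bar>k y\<bar> <= real b" for k
  proof -
   have "k : bdd \<Gamma>" using that unfolding bdd_def by (auto simp: measurable_cong_sets[OF ref_sets refl])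
   then show ?thesis by (rule bdd_integrable(2)[OF ref_prob _ refl])
  qed
  have d1: "\<bar>(\<integral>y. h y \<partial>\<rho>) - (\<integral>y. g y \<partial>\<rho>)\<bar> <= 2 * dl"
  proof -
   have "(\<integral>y. h y \<partial>\<rho>) - (\<integral>y. g y \<partial>\<rho>) = (\<integral>y. h y - g y \<partial>\<rho>)" using e1 by simp
   then show ?thesis using e1 integral_abs_bound[of \<rho> "%y. h y - g y"] by linarith
  qed
  have d2: "\<bar>(\<integral>y. exp (h y) - 1 \<partial>\<Gamma>) - (\<integral>y. exp (g y) - 1 \<partial>\<Gamma>)\<bar> <= exp (real b) * (2 * dl)"
  proof -
   have "(\<integral>y. exp (h y) - 1 \<partial>\<Gamma>) - (\<integral>y. exp (g y) - 1 \<partial>\<Gamma>) = (\<integral>y. (exp (h y) - 1) - (exp (g y) - 1) \<partial>\<Gamma>)"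
    by (rule Bintegral_diff[symmetric, OF ie[OF hm hb] ie[OF gm gb]])
   also have "\<bar>...\<bar> <= (\<integral>y. \<bar>(exp (h y) - 1) - (exp (g y) - 1)\<bar> \<partial>\<Gamma>)" by (rule integral_abs_bound)
   also have "... <= (\<integral>y. exp (real b) * \<bar>h y - g y\<bar> \<partial>\<Gamma>)"
    using exp_diff_bound[OF hb gb]
    by (intro integral_mono integrable_abs Bintegrable_diff ie hm hb gm gb integrable_mult_right) (use e2 in auto)
   also have "... = exp (real b) * (\<integral>y. \<bar>h y - g y\<bar> \<partial>\<Gamma>)" by simp
   also have "... <= exp (real b) * (2 * dl)" using e2 by (intro mult_left_mono) auto
   finally show ?thesis .
  qed
  have "2 * dl + exp (real b) * (2 * dl) = e"
  proof -
   have "2 * dl + exp (real b) * (2 * dl) = dl * (2 * (1 + exp (real b)))" by (simp add: algebra_simps)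
   also have "... = e" unfolding dl_def using eb by simp
   finally show ?thesis .
  qed
  then have "\<bar>(\<integral>V. tst 1 phi V \<partial>tensor 1 \<rho>) - (\<integral>V. tst 1 ?psi V \<partial>tensor 1 \<rho>)\<bar> <= e"
   unfolding vh vg using d1 d2 by linarith
  then show "\<exists>l b. \<bar>(\<integral>V. tst 1 phi V \<partial>tensor 1 \<rho>) - (\<integral>V. tst 1 (%V. clip (real b) (f l (V 1))) V \<partial>tensor 1 \<rho>)\<bar> <= e"
   by (intro exI)
 qed
qed

lemma crel_family: "\<exists>G. test_family \<nu> (%j. tst 1 ` bdd (velM {1..j})) 1 G"
proof -
 obtain f :: "nat => real^3 => real" where f: "!!l. f l : bmeas borel"
  "!!(\<rho> :: (real^3) measure) phi e. \<rho> : space (prob_algebra borel) ==> phi : bdd (velM {1..1}) ==> e > 0 ==>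
   \<exists>l b. \<bar>(\<integral>V. tst 1 phi V \<partial>tensor 1 \<rho>) - (\<integral>V. tst 1 (%V. clip (real b) (f l (V 1))) V \<partial>tensor 1 \<rho>)\<bar> <= e"
  by (rule tests_dense) (rule that)
 \<comment> \<open>Pairs of a dense function and a clipping level are enumerated from index 1 on;
   index 0 holds the zero test that the locale asks for.\<close>
 define ph :: "nat => velocities => real" where "ph l = (case l of 0 => (%V. 0) |
   Suc l => (%V. clip (real (snd (prod_decode l))) (f (fst (prod_decode l)) (V 1))))" for l
 have cl: "(%V. clip (real b) (f l (V 1))) : bdd (velM {1..1})" for b l
 proof -
  have "(%V. V 1) : velM {1..1} \<rightarrow>\<^sub>M borel" by simp
  from measurable_compose[OF this f(1)[of l]] have "(%V. f l (V 1)) : bmeas (velM {1..1})" .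
  then have "(%V. clip (real b) (f l (V 1))) : bmeas (velM {1..1})" unfolding clip_def by measurable
  then show ?thesis unfolding bdd_vel using clip_bound[of "real b"] by (auto intro!: exI[of _ "real b"])
 qed
 have z: "(%V. 0) : bdd (velM {1..1})" by (auto simp: bdd_def)
 have ph: "ph l : bdd (velM {1..1})" for l unfolding ph_def using cl z by (simp split: nat.split)
 have phE: "\<exists>k. ph k = (%V. clip (real b) (f l (V 1)))" for l b
  by (rule exI[of _ "Suc (prod_encode (l, b))"]) (simp add: ph_def)
 have "test_family \<nu> (%j. tst 1 ` bdd (velM {1..j})) 1 (%l. tst 1 (ph l))"
 proof
  fix j :: nat and g assume j: "1 <= j" and "g : tst 1 ` bdd (velM {1..j})"
  then obtain phi where phi: "phi : bdd (velM {1..j})" "g = tst 1 phi" by blast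
  have i: "1 : {1..j}" using j by simp
  show "g : bmeas (velM {1..j})" unfolding phi(2) by (rule tst_props(1)[OF i phi(1)])
  show "\<exists>B. \<forall>V\<in>phase j. \<bar>g V\<bar> <= B" unfolding phi(2) by (rule tst_props(2)[OF i phi(1)])
  show "\<exists>h\<in>tst 1 ` bdd (velM {1..1}). \<forall>x\<in>phase 1. h x = g (frz 1 j x' x)" for x'
  proof (rule bexI[OF _ imageI[OF bdd_comp[OF phi(1) frz_meas[OF j, of x']]]], rule ballI)
   show "tst 1 (%V. phi (frz 1 j x' V)) x = g (frz 1 j x' x)" for x
    unfolding phi(2) by (rule tst_comp) (rule frz_upd[OF j])
  qed
  show "\<exists>h B. \<forall>p::nat. h p : tst 1 ` bdd (velM {1..Suc j}) \<and>
   (\<forall>V\<in>phase (Suc j). \<bar>h p V\<bar> <= B & (%p. h p V) ----> g (restrict V {1..j}))"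
  proof -
   have c: "tst 1 (%V. phi (restrict V {1..j})) V = g (restrict V {1..j})" for V
    unfolding phi(2) by (rule tst_comp) (rule restrict_upd[OF j])
   obtain B where B: "\<forall>V\<in>phase j. \<bar>g V\<bar> <= B" unfolding phi(2) using tst_props(2)[OF i phi(1)] by blast
   have b: "(%V. phi (restrict V {1..j})) : bdd (velM {1..Suc j})"
    by (rule bdd_comp[OF phi(1) restr_meas2]) simp
   show ?thesis
   \<comment> \<open>A constant sequence serves as the extension: bounded tests carry no support
     condition, so the lifted test is already admissible.\<close>
   proof (intro exI[of _ "%_. tst 1 (%V. phi (restrict V {1..j}))"] exI[of _ B] allI conjI ballI)
    show "tst 1 (%V. phi (restrict V {1..j})) : tst 1 ` bdd (velM {1..Suc j})" using b by blast
   qed (auto simp: c B restrict_phase)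
  qed
 next
  show "tst 1 (ph l) : tst 1 ` bdd (velM {1..1})" for l using ph by blast
  show "\<forall>V\<in>phase 1. tst 1 (ph 0) V = 0" by (simp add: ph_def tst_def resamp_def)
  show "\<exists>C\<ge>0. \<forall>j\<ge>1. \<forall>q. (\<forall>l\<le>n. q l : Qc 1 j) -->
   (\<exists>g\<in>tst 1 ` bdd (velM {1..j}). \<forall>V\<in>phase j. \<forall>l0\<le>n. \<bar>g V - tst 1 (ph l0) (restrict V {1..1})\<bar> \<le>
    C * (\<Sum>l\<le>n. \<bar>q l V - (if l = l0 then 1 else 0)\<bar>))" for n by (rule tst_combine[OF ph])
  fix \<rho> g assume \<rho>: "\<rho> : space \<nu>" and "g : tst 1 ` bdd (velM {1..1})"
  then obtain phi where phi: "phi : bdd (velM {1..1})" "g = tst 1 phi" by blast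
  show "ennreal (\<integral>V. g V \<partial>tensor 1 \<rho>) <= (SUP l. ennreal (\<integral>V. tst 1 (ph l) V \<partial>tensor 1 \<rho>))" (is "_ <= ?S")
  proof (rule ennreal_le_epsilon)
   fix e :: real assume e: "0 < e"
   have "\<rho> : space (prob_algebra borel)" using measurable_space[OF idm \<rho>] .
   from f(2)[OF this phi(1) e] obtain l b where
    lb: "\<bar>(\<integral>V. tst 1 phi V \<partial>tensor 1 \<rho>) - (\<integral>V. tst 1 (%V. clip (real b) (f l (V 1))) V \<partial>tensor 1 \<rho>)\<bar> <= e" by blast
   obtain k where k: "ph k = (%V. clip (real b) (f l (V 1)))" using phE by blast
   have "(\<integral>V. g V \<partial>tensor 1 \<rho>) <= (\<integral>V. tst 1 (ph k) V \<partial>tensor 1 \<rho>) + e"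
    using lb unfolding k phi(2) by linarith
   then have "ennreal (\<integral>V. g V \<partial>tensor 1 \<rho>) <= ennreal ((\<integral>V. tst 1 (ph k) V \<partial>tensor 1 \<rho>) + e)" by (rule ennreal_leI)
   also have "... <= ennreal (\<integral>V. tst 1 (ph k) V \<partial>tensor 1 \<rho>) + ennreal e"
    using e by (cases "(\<integral>V. tst 1 (ph k) V \<partial>tensor 1 \<rho>) >= 0") (auto simp: ennreal_neg intro!: ennreal_leI)
   also have "... <= ?S + ennreal e" by (intro add_right_mono SUP_upper) auto
   finally show "ennreal (\<integral>V. g V \<partial>tensor 1 \<rho>) <= ?S + ennreal e" .
  qed
 qed
 then show ?thesis by blast
qed

lemma crel_mixture:
 shows dual_tensor_measurable: "(%\<rho>. dual (tensor 1 \<rho>) (tensor 1 \<Gamma>)) : bmeas \<nu>"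
  and crel_limit: "(%j. crel j (mixture j \<nu>)) ----> (\<integral>\<^sup>+\<rho>. dual (tensor 1 \<rho>) (tensor 1 \<Gamma>) \<partial>\<nu>)"
  and crel_mono: "!!i j. 1 <= i ==> i <= j ==> crel i (mixture i \<nu>) <= crel j (mixture j \<nu>)"
proof -
 obtain G where "test_family \<nu> (%j. tst 1 ` bdd (velM {1..j})) 1 G" using crel_family by blast
 then interpret F: test_family \<nu> "%j. tst 1 ` bdd (velM {1..j})" 1 G .
 have e: "F.S j F = crel j F" for j F by (simp add: F.S_def crel_def image_image)
 have d: "F.S 1 (tensor 1 \<rho>) = dual (tensor 1 \<rho>) (tensor 1 \<Gamma>)" if "\<rho> : space \<nu>" for \<rho>
  unfolding e by (rule crel_1[OF law_tensor[OF that]])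
 show "(%\<rho>. dual (tensor 1 \<rho>) (tensor 1 \<Gamma>)) : bmeas \<nu>"
  using F.S_meas by (subst (asm) measurable_cong[OF d])
 have "(\<integral>\<^sup>+\<rho>. F.S 1 (tensor 1 \<rho>) \<partial>\<nu>) = (\<integral>\<^sup>+\<rho>. dual (tensor 1 \<rho>) (tensor 1 \<Gamma>) \<partial>\<nu>)"
  by (rule nn_integral_cong) (rule d)
 then show "(%j. crel j (mixture j \<nu>)) ----> (\<integral>\<^sup>+\<rho>. dual (tensor 1 \<rho>) (tensor 1 \<Gamma>) \<partial>\<nu>)"
  using F.S_limit by (simp only: e)
 show "crel i (mixture i \<nu>) <= crel j (mixture j \<nu>)" if "1 <= i" "i <= j" for i j
  using F.S_mono[OF that] by (simp add: e)
qed

end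

section \<open>The chain rule\<close>

lemma bdd_cong: "sets M = sets N ==> bdd M = bdd N"
 using measurable_cong_sets[of M N "borel :: real measure" borel] sets_eq_imp_space_eq[of M N] unfolding bdd_def by simp

lemma nn_integral_distr_base:
 "T : M \<rightarrow>\<^sub>M N ==> f : bmeas N ==> (\<integral>\<^sup>+x. f x \<partial>distr M N T) = (\<integral>\<^sup>+x. f (T x) \<partial>M)"
 by (rule nn_integral_distr) simp_all

lemma mult_neg_ln_le_1:
 assumes "u >= (0::real)" shows "u * max 0 (- ln u) <= 1"
proof (cases "u = 0 \<or> ln u >= 0")
 case False
 then have u: "u > 0" "max 0 (- ln u) = - ln u" using assms by auto
 have "ln (1 / u) <= 1 / u - 1" by (rule ln_le_minus_one) (use u in simp)
 then have "u * - ln u <= u * (1 / u - 1)" using u by (intro mult_left_mono) (auto simp: ln_div)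
 also have "... <= 1" using u by (simp add: right_diff_distrib)
 finally show ?thesis unfolding u(2) .
qed auto

text \<open>The identity \<open>ent (k * h) + k = k * ent h + k * h * ln k + 1\<close> with the
  negative part of the logarithm moved to the left, so that it can be integrated in [0, infinity]
  without differences.\<close>

lemma ent_product:
 fixes h k :: real
 assumes "h >= 0" "k >= 0"
 shows "ent (k * h) + (k * h) * max 0 (- ln k) + k = k * ent h + (k * h) * max 0 (ln k) + 1"
proof (cases "h = 0 \<or> k = 0")
 case False
 then have "ln (k * h) = ln k + ln h" using assms by (simp add: ln_mult)
 then show ?thesis unfolding ent_def by (cases "ln k >= 0") (auto simp: max_def algebra_simps)
qed (auto simp: ent_def)

context reference begin

text \<open>The last particle of the mixture is redrawn from \<open>\<Gamma>\<close> independently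
  of the others, which amounts to the product of the mixture of one particle fewer with
  \<open>\<Gamma>\<close>. Relative entropy with respect to this law is the conditional term of the
  chain rule.\<close>

definition upd_law :: "nat => velocities measure" where
 "upd_law n = distr (mixture n \<nu> \<Otimes>\<^sub>M \<Gamma>) (velM {1..n}) (%x. (fst x)(n := snd x))"

lemma upd_law_sets: "sets (upd_law n) = sets (velM {1..n})" by (simp add: upd_law_def)

lemma upd_meas_mixture: "n >= 1 ==> (%x. (fst x)(n := snd x)) : mixture n \<nu> \<Otimes>\<^sub>M \<Gamma> \<rightarrow>\<^sub>M velM {1..n}"
 using upd_meas2[of n n] by (simp add: measurable_cong_sets[OF sets_pair_measure_cong[OF sets_mixture refl] refl])

lemma upd_law_prob:
 assumes n: "n >= 1" shows "prob_space (upd_law n)"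
proof -
 interpret M: prob_space "mixture n \<nu>" by (rule prob_mixture)
 interpret PG: pair_prob_space "mixture n \<nu>" \<Gamma> by unfold_locales
 show ?thesis unfolding upd_law_def by (rule PG.prob_space_distr[OF upd_meas_mixture[OF n]])
qed

lemma nn_upd_law:
 assumes n: "n >= 1" and f: "f : bmeas (velM {1..n})"
 shows "(\<integral>\<^sup>+V. f V \<partial>upd_law n) = (\<integral>\<^sup>+V. (\<integral>\<^sup>+y. f (V(n := y)) \<partial>\<Gamma>) \<partial>mixture n \<nu>)"
 using G.nn_integral_fst[OF measurable_compose[OF upd_meas_mixture[OF n] f]]
 unfolding upd_law_def nn_integral_distr_base[OF upd_meas_mixture[OF n] f] by simp

lemma integral_upd_law:
 assumes n: "n >= 1" and phi: "phi : bdd (velM {1..n})"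
 shows "(\<integral>V. exp (phi V) - 1 \<partial>upd_law n) = (\<integral>V. resamp n phi V \<partial>mixture n \<nu>)"
proof -
 interpret M: prob_space "mixture n \<nu>" by (rule prob_mixture)
 interpret PG: pair_prob_space "mixture n \<nu>" \<Gamma> by unfold_locales
 note um = upd_meas_mixture[OF n]
 have m: "(%V. exp (phi V) - 1) : bmeas (velM {1..n})" using phi by (auto simp: bdd_def)
 have "integrable (upd_law n) (%V. exp (phi V) - 1)"
  by (rule bdd_integrable(2)[OF upd_law_prob[OF n] phi upd_law_sets])
 then have i: "integrable (mixture n \<nu> \<Otimes>\<^sub>M \<Gamma>) (%x. exp (phi ((fst x)(n := snd x))) - 1)"
  unfolding upd_law_def using integrable_distr_eq[OF um m] by blast
 have "(\<integral>V. exp (phi V) - 1 \<partial>upd_law n) = (\<integral>x. exp (phi ((fst x)(n := snd x))) - 1 \<partial>(mixture n \<nu> \<Otimes>\<^sub>M \<Gamma>))"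
  unfolding upd_law_def by (rule integral_distr[OF um m])
 also have "... = (\<integral>V. resamp n phi V \<partial>mixture n \<nu>)"
  using PG.integral_fst'[OF i] by (simp add: resamp_def)
 finally show ?thesis .
qed

lemma tst_swp: "tst 1 phi (swp n V) = tst n (%V. phi (swp n V)) V"
proof -
 have "(swp n V)(1 := y) = swp n (V(n := y))" for y by (rule ext) (auto simp: Transposition.transpose_def)
 then show ?thesis by (simp only: tst_def resamp_def)
qed

text \<open>\<open>crel\<close> redraws particle 1 whereas \<open>upd_law n\<close> redraws particle
  \<open>n\<close>. Swapping the two leaves the mixture invariant and permutes the tests.\<close>

lemma crel_dual:
 assumes n: "n >= 1"
 shows "crel n (mixture n \<nu>) = dual (mixture n \<nu>) (upd_law n)"
proof -
 interpret M: prob_space "mixture n \<nu>" by (rule prob_mixture)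
 have nn: "n : {1..n}" "1 : {1..n}" using n by auto
 define w where "w phi = (\<integral>x. phi x \<partial>mixture n \<nu>) - (\<integral>x. exp (phi x) - 1 \<partial>upd_law n)" for phi :: "velocities => real"
 define v where "v phi = (\<integral>V. tst 1 phi V \<partial>mixture n \<nu>)" for phi
 have w: "w phi = (\<integral>V. tst n phi V \<partial>mixture n \<nu>)" if phi: "phi : bdd (velM {1..n})" for phi
 proof -
  obtain B where m: "phi : bmeas (velM {1..n})" and B: "\<forall>V\<in>phase n. \<bar>phi V\<bar> <= B" using phi by (auto simp: bdd_vel)
  have i1: "integrable (mixture n \<nu>) phi" by (rule bdd_integrable(1)[OF prob_mixture phi sets_mixture])
  have i2: "integrable (mixture n \<nu>) (resamp n phi)"
  proof (rule M.integrable_bounded[where B="exp B + 1"])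
   show "resamp n phi : bmeas (mixture n \<nu>)"
    using resamp_meas[OF nn(1) m] by (simp add: measurable_cong_sets[OF sets_mixture refl])
   show "\<bar>resamp n phi V\<bar> <= exp B + 1" if "V : space (mixture n \<nu>)" for V
    using that law_space[OF law_mixture] by (intro resamp_bound[OF nn(1) m B]) simp
  qed
  show ?thesis unfolding w_def integral_upd_law[OF n phi] tst_def
   by (rule Bintegral_diff[OF i1 i2, symmetric])
 qed
 have sw: "(%V. phi (swp n V)) : bdd (velM {1..n})" if "phi : bdd (velM {1..n})" for phi
  by (rule bdd_comp[OF that swp_meas[OF nn(1)]])
 have vw: "v phi = w (%V. phi (swp n V))" if phi: "phi : bdd (velM {1..n})" for phi
 proof -
  obtain B where B: "\<forall>V\<in>phase n. \<bar>tst 1 phi V\<bar> <= B" using tst_props(2)[OF nn(2) phi] by blast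
  have "v phi = (\<integral>V. tst 1 phi (swp n V) \<partial>mixture n \<nu>)" unfolding v_def
   by (rule integral_swp[OF nn(1) tst_props(1)[OF nn(2) phi], of B, symmetric]) (use B in blast)
  also have "... = w (%V. phi (swp n V))" unfolding tst_swp w[OF sw[OF phi]] ..
  finally show ?thesis .
 qed
 have inv: "swp n (swp n V) = V" for V by (rule ext) simp
 have wv: "w phi = v (%V. phi (swp n V))" if phi: "phi : bdd (velM {1..n})" for phi
  unfolding vw[OF sw[OF phi]] inv ..
 have "(SUP phi\<in>bdd (velM {1..n}). ennreal (v phi)) = (SUP phi\<in>bdd (velM {1..n}). ennreal (w phi))"
 proof (rule antisym; rule SUP_least)
  fix phi assume phi: "phi : bdd (velM {1..n})"
  show "ennreal (v phi) <= (SUP phi\<in>bdd (velM {1..n}). ennreal (w phi))"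
   unfolding vw[OF phi] by (rule SUP_upper[OF sw[OF phi]])
  show "ennreal (w phi) <= (SUP phi\<in>bdd (velM {1..n}). ennreal (v phi))"
   unfolding wv[OF phi] by (rule SUP_upper[OF sw[OF phi]])
 qed
 then show ?thesis unfolding crel_def dual_def bdd_cong[OF upd_law_sets] v_def w_def .
qed

lemma restr_mixture:
 assumes "j <= n" shows "distr (mixture n \<nu>) (velM {1..j}) (%V. restrict V {1..j}) = mixture j \<nu>"
proof -
 have e: "{1..n} \<inter> {1..j} = {1..j}" using assms by auto
 show ?thesis unfolding mixture_distr[of n] mixture_distr[of j]
  by (subst distr_distr[OF restr_meas2[OF assms] measurable_compose[OF snd_meas restr_meas]]) (simp only: o_def restrict_restrict e)
qed

lemma restr_tensor:
 assumes "j <= n" shows "distr (tensor n \<Gamma>) (velM {1..j}) (%V. restrict V {1..j}) = tensor j \<Gamma>"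
proof -
 have e: "{1..n} \<inter> {1..j} = {1..j}" using assms by auto
 have "(%X. restrict X {1..n}) : Pinf \<Gamma> \<rightarrow>\<^sub>M velM {1..n}"
  using RM.restr_meas[of n] RM.sets_PiM_rho[OF ref_space, of UNIV] unfolding Pinf_def by (simp cong: measurable_cong_sets)
 then show ?thesis unfolding RM.tensor_Pinf[OF ref_space, of n] RM.tensor_Pinf[OF ref_space, of j]
  by (subst distr_distr[OF restr_meas2[OF assms]]) (simp_all only: o_def restrict_restrict e)
qed

lemma restr_meas_mixture: "j <= n ==> (%V. restrict V {1..j}) : mixture n \<nu> \<rightarrow>\<^sub>M velM {1..j}"
 using restr_meas2[of j n] by (simp add: measurable_cong_sets[OF sets_mixture refl])

lemma restr_meas_tensor: "j <= n ==> (%V. restrict V {1..j}) : tensor n \<Gamma> \<rightarrow>\<^sub>M velM {1..j}"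
 using restr_meas2[of j n] by (simp add: measurable_cong_sets[OF ref_tensor_sets refl])

lemma nn_restr_mixture:
 "j <= n ==> f : bmeas (velM {1..j}) ==> (\<integral>\<^sup>+V. f (restrict V {1..j}) \<partial>mixture n \<nu>) = (\<integral>\<^sup>+V. f V \<partial>mixture j \<nu>)"
 using nn_integral_distr_base[OF restr_meas_mixture, of j n f] by (simp add: restr_mixture)

lemma nn_restr_tensor:
 "j <= n ==> f : bmeas (velM {1..j}) ==> (\<integral>\<^sup>+V. f (restrict V {1..j}) \<partial>tensor n \<Gamma>) = (\<integral>\<^sup>+V. f V \<partial>tensor j \<Gamma>)"
 using nn_integral_distr_base[OF restr_meas_tensor, of j n f] by (simp add: restr_tensor)

definition rent :: "nat => ennreal" where
 "rent n = dual (mixture n \<nu>) (tensor n \<Gamma>)"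

text \<open>A test of the first \<open>j\<close> particles is also a test of \<open>n\<close>
  particles, with the same value because restriction maps both laws to their counterparts for
  \<open>j\<close> particles.\<close>

lemma rent_restr:
 assumes "j <= n" shows "rent j <= rent n" unfolding rent_def[of j] dual_def
proof (rule SUP_least)
 fix phi assume "phi : bdd (tensor j \<Gamma>)"
 then have phi: "phi : bdd (velM {1..j})" by (simp only: bdd_cong[OF ref_tensor_sets])
 then have m: "phi : bmeas (velM {1..j})" by (simp add: bdd_def)
 have m2: "(%x. exp (phi x) - 1) : bmeas (velM {1..j})" using m by measurable
 have b: "(%V. phi (restrict V {1..j})) : bdd (tensor n \<Gamma>)"
  unfolding bdd_cong[OF ref_tensor_sets] by (rule bdd_comp[OF phi restr_meas2[OF assms]])
 have "(\<integral>x. phi x \<partial>mixture j \<nu>) = (\<integral>x. phi (restrict x {1..j}) \<partial>mixture n \<nu>)"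
  using integral_distr[OF restr_meas_mixture[OF assms] m] by (simp add: restr_mixture[OF assms])
 moreover have "(\<integral>x. exp (phi x) - 1 \<partial>tensor j \<Gamma>) = (\<integral>x. exp (phi (restrict x {1..j})) - 1 \<partial>tensor n \<Gamma>)"
  using integral_distr[OF restr_meas_tensor[OF assms] m2] by (simp add: restr_tensor[OF assms])
 ultimately show "ennreal ((\<integral>x. phi x \<partial>mixture j \<nu>) - (\<integral>x. exp (phi x) - 1 \<partial>tensor j \<Gamma>)) <= rent n"
  unfolding rent_def dual_def using SUP_upper[OF b, of "%phi. ennreal ((\<integral>x. phi x \<partial>mixture n \<nu>) - (\<integral>x. exp (phi x) - 1 \<partial>tensor n \<Gamma>))"] by simp
qed

lemma insert_Suc: "insert (Suc j) {1..j} = {1..Suc j}" by auto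

lemma add_meas: "(%x. (fst x)(Suc j := snd x)) : velM {1..j} \<Otimes>\<^sub>M \<Gamma> \<rightarrow>\<^sub>M velM {1..Suc j}"
proof -
 have "(%(f, y). f(Suc j := y)) : velM {1..j} \<Otimes>\<^sub>M (borel :: (real^3) measure) \<rightarrow>\<^sub>M velM (insert (Suc j) {1..j})"
  by (rule measurable_add_dim)
 then show ?thesis
  unfolding insert_Suc by (simp add: case_prod_beta' measurable_cong_sets[OF sets_pair_measure_cong[OF refl ref_sets] refl])
qed

lemma nn_tensor_Suc:
 assumes "f : bmeas (velM {1..Suc j})"
 shows "(\<integral>\<^sup>+V. f V \<partial>tensor (Suc j) \<Gamma>) = (\<integral>\<^sup>+W. (\<integral>\<^sup>+y. f (W(Suc j := y)) \<partial>\<Gamma>) \<partial>tensor j \<Gamma>)"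
proof -
 interpret product_sigma_finite "%_::nat. \<Gamma>"
  by (simp add: product_sigma_finite_def prob_space_imp_sigma_finite ref_prob)
 have "f : bmeas (tensor (Suc j) \<Gamma>)" using assms by (simp only: measurable_cong_sets[OF ref_tensor_sets refl])
 then have f: "f : bmeas (PiM (insert (Suc j) {1..j}) (%_. \<Gamma>))" unfolding insert_Suc tensor_def .
 have j: "finite {1..j}" "Suc j \<notin> {1..j}" by auto
 from product_nn_integral_insert[OF j f] show ?thesis unfolding insert_Suc tensor_def .
qed

lemma restr_upd_Suc: "W : phase j ==> restrict (W(Suc j := y)) {1..j} = W"
 by (auto simp: phase_def fun_eq_iff restrict_def PiE_def extensional_def)

lemma upd_restr_Suc: "V : phase (Suc j) ==> (restrict V {1..j})(Suc j := y) = V(Suc j := y)"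
 by (auto simp: phase_def fun_eq_iff restrict_def PiE_def extensional_def le_Suc_eq)

text \<open>Fubini in the last particle, which is independent of the others and has law
  \<open>\<Gamma>\<close> on both sides.\<close>

lemma upd_law_density:
 assumes k: "k : bmeas (velM {1..j})" and F: "mixture j \<nu> = density (tensor j \<Gamma>) (%W. ennreal (k W))"
 shows "upd_law (Suc j) = density (tensor (Suc j) \<Gamma>) (%V. ennreal (k (restrict V {1..j})))"
proof (rule measure_eqI)
 show "sets (upd_law (Suc j)) = sets (density (tensor (Suc j) \<Gamma>) (%V. ennreal (k (restrict V {1..j}))))"
  by (simp add: upd_law_sets ref_tensor_sets)
 fix A assume "A : sets (upd_law (Suc j))"
 then have A: "A : sets (velM {1..Suc j})" by (simp add: upd_law_sets)
 then have A': "A : sets (tensor (Suc j) \<Gamma>)" by (simp add: ref_tensor_sets)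
 have iA: "(indicator A :: velocities => ennreal) : bmeas (velM {1..Suc j})" using A by simp
 have kr: "(%V. k (restrict V {1..j})) : bmeas (velM {1..Suc j})"
  by (rule measurable_compose[OF restr_meas2 k]) simp
 define a where "a W = (\<integral>\<^sup>+y. indicator A (W(Suc j := y)) \<partial>\<Gamma>)" for W
 have am: "a : bmeas (velM {1..j})" unfolding a_def[abs_def]
  using measurable_compose[OF add_meas iA] by (intro G.borel_measurable_nn_integral) (simp add: case_prod_beta')
 have "emeasure (upd_law (Suc j)) A = (\<integral>\<^sup>+V. indicator A V \<partial>upd_law (Suc j))"
  using A by (simp add: upd_law_sets)
 also have "... = (\<integral>\<^sup>+V. a (restrict V {1..j}) \<partial>mixture (Suc j) \<nu>)"
 proof -
  have "(\<integral>\<^sup>+V. indicator A V \<partial>upd_law (Suc j)) = (\<integral>\<^sup>+V. (\<integral>\<^sup>+y. indicator A (V(Suc j := y)) \<partial>\<Gamma>) \<partial>mixture (Suc j) \<nu>)"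
   by (rule nn_upd_law[OF _ iA]) simp
  also have "... = (\<integral>\<^sup>+V. a (restrict V {1..j}) \<partial>mixture (Suc j) \<nu>)"
  proof (rule nn_integral_cong)
   fix V assume "V : space (mixture (Suc j) \<nu>)"
   then have "V : phase (Suc j)" using law_space[OF law_mixture] by simp
   then show "(\<integral>\<^sup>+y. indicator A (V(Suc j := y)) \<partial>\<Gamma>) = a (restrict V {1..j})"
    unfolding a_def by (simp only: upd_restr_Suc)
  qed
  finally show ?thesis .
 qed
 also have "... = (\<integral>\<^sup>+W. a W \<partial>mixture j \<nu>)" by (rule nn_restr_mixture[OF _ am]) simp
 also have "... = (\<integral>\<^sup>+W. ennreal (k W) * a W \<partial>tensor j \<Gamma>)"
  unfolding F by (rule nn_integral_density) (use k am in \<open>auto simp: measurable_cong_sets[OF ref_tensor_sets refl]\<close>)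
 also have "... = (\<integral>\<^sup>+W. (\<integral>\<^sup>+y. ennreal (k (restrict (W(Suc j := y)) {1..j})) * indicator A (W(Suc j := y)) \<partial>\<Gamma>) \<partial>tensor j \<Gamma>)"
 proof (rule nn_integral_cong)
  fix W assume "W : space (tensor j \<Gamma>)"
  then have W: "W : phase j" using law_space[OF ref_law] by simp
  have "(%y. W(Suc j := y)) : \<Gamma> \<rightarrow>\<^sub>M velM {1..Suc j}"
   using measurable_compose[OF measurable_Pair1' add_meas, of W j] W by (simp add: space_velM)
  from measurable_compose[OF this iA] show "ennreal (k W) * a W =
    (\<integral>\<^sup>+y. ennreal (k (restrict (W(Suc j := y)) {1..j})) * indicator A (W(Suc j := y)) \<partial>\<Gamma>)"
   unfolding restr_upd_Suc[OF W] a_def by (rule nn_integral_cmult[symmetric])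
 qed
 also have "... = (\<integral>\<^sup>+V. ennreal (k (restrict V {1..j})) * indicator A V \<partial>tensor (Suc j) \<Gamma>)"
  by (rule nn_tensor_Suc[symmetric]) (use kr iA in measurable)
 also have "... = emeasure (density (tensor (Suc j) \<Gamma>) (%V. ennreal (k (restrict V {1..j})))) A"
  by (rule emeasure_density[symmetric, OF _ A']) (use kr in \<open>simp add: measurable_cong_sets[OF ref_tensor_sets refl]\<close>)
 finally show "emeasure (upd_law (Suc j)) A = emeasure (density (tensor (Suc j) \<Gamma>) (%V. ennreal (k (restrict V {1..j})))) A" .
qed

text \<open>If \<open>kr\<close> is the density of the first \<open>j\<close> particles and
  \<open>h\<close> that of \<open>F\<close> with respect to \<open>Q\<close>, then \<open>F\<close>
  has density \<open>kr * h\<close> with respect to \<open>g\<close> and the logarithm splits. The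
  cases that \<open>rent j\<close> is infinite, or that \<open>dual F Q\<close> and
  \<open>dual F g\<close> both are, are treated apart.\<close>

lemma chain_rule: "rent (Suc j) = rent j + crel (Suc j) (mixture (Suc j) \<nu>)"
proof (cases "rent j < \<infinity>")
 case False
 then have "rent j = \<infinity>" by (simp add: less_top[symmetric])
 moreover have "rent (Suc j) = \<infinity>" using rent_restr[of j "Suc j"] calculation by (simp add: top_unique)
 ultimately show ?thesis by simp
next
 case True
 define F Q g where "F = mixture (Suc j) \<nu>" and "Q = upd_law (Suc j)" and "g = tensor (Suc j) \<Gamma>"
 have pF: "prob_space F" and pQ: "prob_space Q" and pg: "prob_space g"
  unfolding F_def Q_def g_def by (rule prob_mixture, rule upd_law_prob, simp, rule ref_tensor_prob)
 have sF: "sets F = sets (velM {1..Suc j})" and sQ: "sets Q = sets (velM {1..Suc j})" and sg: "sets g = sets (velM {1..Suc j})"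
  unfolding F_def Q_def g_def by (rule sets_mixture, rule upd_law_sets, rule ref_tensor_sets)
 have sj: "sets (mixture j \<nu>) = sets (tensor j \<Gamma>)" by (simp add: sets_mixture ref_tensor_sets)
 have crel: "crel (Suc j) (mixture (Suc j) \<nu>) = dual F Q" unfolding F_def Q_def by (rule crel_dual) simp
 obtain k where k: "k : bmeas (tensor j \<Gamma>)" "!!x. k x >= (0::real)"
  "mixture j \<nu> = density (tensor j \<Gamma>) (%x. ennreal (k x))"
  by (rule density_of_ac[OF prob_mixture ref_tensor_prob sj dual_ac[OF prob_mixture ref_tensor_prob sj True[unfolded rent_def]]]) (rule that)
 have km: "k : bmeas (velM {1..j})" using k(1) by (simp add: measurable_cong_sets[OF ref_tensor_sets refl])
 define kr where "kr V = k (restrict V {1..j})" for V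
 have krm: "kr : bmeas (velM {1..Suc j})" unfolding kr_def[abs_def]
  by (rule measurable_compose[OF restr_meas2 km]) simp
 have krg: "kr : bmeas g" using krm by (simp add: measurable_cong_sets[OF sg refl])
 have kr0: "kr V >= 0" for V unfolding kr_def by (rule k(2))
 have Q: "Q = density g (%V. ennreal (kr V))" unfolding Q_def g_def kr_def by (rule upd_law_density[OF km k(3)])
 \<comment> \<open>A \<open>Q\<close>-null set is \<open>g\<close>-null apart from the zero set of
   \<open>kr\<close>, and \<open>F\<close> gives that zero set measure 0 because the first
   \<open>j\<close> particles have density \<open>k\<close>.\<close>
 have acQ: "absolutely_continuous Q F" if fin: "dual F Q < \<infinity> \<or> dual F g < \<infinity>" using fin
 proof
  assume "dual F Q < \<infinity>"
  then show ?thesis by (intro dual_ac[OF pF pQ]) (simp_all add: sF sQ)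
 next
  assume "dual F g < \<infinity>"
  then have ac: "absolutely_continuous g F" by (intro dual_ac[OF pF pg]) (simp_all add: sF sg)
  show ?thesis unfolding absolutely_continuous_def
  proof
   fix N assume N: "N : null_sets Q"
   then have NF: "N : sets F" by (auto simp: null_sets_def sF sQ)
   have "AE V in g. V : N --> ennreal (kr V) = 0"
    using N krg unfolding Q by (subst (asm) null_sets_density_iff) auto
   then have a: "AE V in F. V : N --> ennreal (kr V) = 0"
    by (rule absolutely_continuous_AE[OF _ ac, rotated]) (simp add: sF sg)
   have "AE W in mixture j \<nu>. 0 < ennreal (k W)" unfolding k(3) by (subst AE_density) (use k(1) in auto)
   then have "AE W in distr F (velM {1..j}) (%V. restrict V {1..j}). 0 < ennreal (k W)"
    unfolding F_def by (simp only: restr_mixture[OF le_SucI[OF order_refl]])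
   then have "AE V in F. 0 < ennreal (kr V)"
    unfolding kr_def F_def by (subst (asm) AE_distr_iff[OF restr_meas_mixture]) (use km in \<open>simp_all, measurable?\<close>)
   with a have "AE V in F. V \<notin> N" by eventually_elim auto
   then show "N : null_sets F" using AE_iff_null_sets[OF NF] by simp
  qed
 qed
 show ?thesis
 proof (cases "dual F Q < \<infinity> \<or> dual F g < \<infinity>")
  case False
  then show ?thesis unfolding crel by (simp add: rent_def F_def[symmetric] g_def[symmetric] less_top[symmetric])
 next
  case True
  have sFQ: "sets F = sets Q" by (simp add: sF sQ)
  obtain h where h: "h : bmeas Q" "!!x. h x >= (0::real)" "F = density Q (%x. ennreal (h x))"
   by (rule density_of_ac[OF pF pQ sFQ acQ[OF True]]) (rule that)
  have hg: "h : bmeas g" using h(1) by (simp add: measurable_cong_sets[OF sQ refl] measurable_cong_sets[OF sg refl])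
  note [measurable] = hg krg
  have Fg: "F = density g (%V. ennreal (kr V * h V))"
   unfolding h(3) Q by (subst density_density_eq) (auto simp: ennreal_mult kr0 h(2))
  define P where "P u = max 0 (ln u)" for u :: real
  define M where "M u = max 0 (- ln u)" for u :: real
  have PMm: "P : bmeas borel" "M : bmeas borel" unfolding P_def[abs_def] M_def[abs_def] by measurable
  note [measurable] = PMm
  have PM0: "P u >= 0" "M u >= 0" for u by (auto simp: P_def M_def)
  \<comment> \<open>\<open>F\<close> and \<open>Q\<close> have the same marginal on the first
    \<open>j\<close> particles and \<open>kr\<close> depends on these only, so the factor
    \<open>h\<close> may be dropped.\<close>
  have move: "(\<integral>\<^sup>+V. ennreal (kr V * h V * f (kr V)) \<partial>g) = (\<integral>\<^sup>+V. ennreal (kr V * f (kr V)) \<partial>g)"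
   if f: "f : bmeas borel" "!!u. f u >= 0" for f :: "real => real"
  proof -
   note [measurable] = f(1)
   have fk: "(%W. ennreal (f (k W))) : bmeas (velM {1..j})" using km by measurable
   have "(\<integral>\<^sup>+V. ennreal (kr V * h V * f (kr V)) \<partial>g) = (\<integral>\<^sup>+V. ennreal (kr V * h V) * ennreal (f (kr V)) \<partial>g)"
    by (intro nn_integral_cong) (simp add: ennreal_mult kr0 h(2) f(2))
   also have "... = (\<integral>\<^sup>+V. ennreal (f (kr V)) \<partial>F)" unfolding Fg by (rule nn_integral_density[symmetric]) auto
   also have "... = (\<integral>\<^sup>+W. ennreal (f (k W)) \<partial>mixture j \<nu>)"
    unfolding F_def kr_def by (rule nn_restr_mixture[OF _ fk]) simp
   also have "... = (\<integral>\<^sup>+W. ennreal (k W) * ennreal (f (k W)) \<partial>tensor j \<Gamma>)"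
    unfolding k(3) by (rule nn_integral_density) (use k(1) in auto)
   also have "... = (\<integral>\<^sup>+W. ennreal (k W * f (k W)) \<partial>tensor j \<Gamma>)"
    by (intro nn_integral_cong) (simp add: ennreal_mult k(2) f(2))
   also have "... = (\<integral>\<^sup>+V. ennreal (kr V * f (kr V)) \<partial>g)"
    unfolding g_def kr_def by (rule nn_restr_tensor[symmetric]) (use km in measurable)
   finally show ?thesis .
  qed
  \<comment> \<open>\<open>a\<close> is the negative part of the integral of
    \<open>kr * ln kr\<close>; it is at most 1 and can therefore be cancelled at the end. The
    positive part \<open>b\<close> is eliminated by inserting \<open>e2\<close> into
    \<open>e1\<close>.\<close>
  define a b where "a = (\<integral>\<^sup>+V. ennreal (kr V * M (kr V)) \<partial>g)" and "b = (\<integral>\<^sup>+V. ennreal (kr V * P (kr V)) \<partial>g)"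
  interpret g: prob_space g by (rule pg)
  have one: "(\<integral>\<^sup>+V. ennreal (kr V) \<partial>g) = 1"
  proof -
   have "(\<integral>\<^sup>+V. ennreal (kr V) \<partial>g) = emeasure Q (space g)"
    unfolding Q by (subst emeasure_density) (auto intro!: nn_integral_cong)
   also have "space g = space Q" by (simp add: Q)
   finally show ?thesis using prob_space.emeasure_space_1[OF pQ] by simp
  qed
  have "a <= (\<integral>\<^sup>+V. 1 \<partial>g)" unfolding a_def M_def
   by (intro nn_integral_mono) (simp add: mult_neg_ln_le_1 kr0)
  then have a: "a + 1 ~= \<infinity>" by (auto simp: g.emeasure_space_1 top_unique)
  have R': "rent j = (\<integral>\<^sup>+V. ennreal (ent (kr V)) \<partial>g)"
  proof -
   have "rent j = (\<integral>\<^sup>+W. ennreal (ent (k W)) \<partial>tensor j \<Gamma>)"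
    unfolding rent_def by (rule dual_density[OF prob_mixture ref_tensor_prob k])
   also have "... = (\<integral>\<^sup>+V. ennreal (ent (kr V)) \<partial>g)"
    unfolding g_def kr_def by (rule nn_restr_tensor[symmetric]) (use km in measurable)
   finally show ?thesis .
  qed
  have kh0: "kr V * h V >= 0" for V using kr0 h(2) by simp
  have R: "rent (Suc j) = (\<integral>\<^sup>+V. ennreal (ent (kr V * h V)) \<partial>g)"
   unfolding rent_def F_def[symmetric] g_def[symmetric] by (rule dual_density[OF pF pg _ kh0 Fg]) measurable
  have S: "dual F Q = (\<integral>\<^sup>+V. ennreal (kr V * ent (h V)) \<partial>g)"
  proof -
   have "dual F Q = (\<integral>\<^sup>+V. ennreal (ent (h V)) \<partial>Q)" by (rule dual_density[OF pF pQ h])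
   also have "... = (\<integral>\<^sup>+V. ennreal (kr V) * ennreal (ent (h V)) \<partial>g)" unfolding Q by (rule nn_integral_density) auto
   also have "... = (\<integral>\<^sup>+V. ennreal (kr V * ent (h V)) \<partial>g)"
    by (intro nn_integral_cong) (simp add: ennreal_mult kr0 ent_nonneg h(2))
   finally show ?thesis .
  qed
  have sum3: "(\<integral>\<^sup>+V. ennreal (p V + q V + r V) \<partial>g) = (\<integral>\<^sup>+V. ennreal (p V) \<partial>g) + (\<integral>\<^sup>+V. ennreal (q V) \<partial>g) + (\<integral>\<^sup>+V. ennreal (r V) \<partial>g)"
   if "p : bmeas g" "q : bmeas g" "r : bmeas g" "!!V. p V >= 0" "!!V. q V >= 0" "!!V. r V >= 0" for p q r :: "velocities => real"
   using that by (simp add: nn_integral_add add_nonneg_nonneg)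
  have e1: "rent (Suc j) + a + 1 = dual F Q + b + 1"
  proof -
   have "(\<integral>\<^sup>+V. ennreal (ent (kr V * h V) + kr V * h V * M (kr V) + kr V) \<partial>g) =
     (\<integral>\<^sup>+V. ennreal (kr V * ent (h V) + kr V * h V * P (kr V) + 1) \<partial>g)"
    unfolding M_def P_def by (intro nn_integral_cong) (simp only: ent_product[OF h(2) kr0])
   moreover have "(\<integral>\<^sup>+V. ennreal (ent (kr V * h V) + kr V * h V * M (kr V) + kr V) \<partial>g) = rent (Suc j) + a + 1"
    unfolding R a_def one[symmetric] move[OF PMm(2) PM0(2), symmetric]
    by (rule sum3) (auto intro!: ent_nonneg mult_nonneg_nonneg kr0 h(2) PM0)
   moreover have "(\<integral>\<^sup>+V. ennreal (kr V * ent (h V) + kr V * h V * P (kr V) + 1) \<partial>g) = dual F Q + b + (\<integral>\<^sup>+V. ennreal 1 \<partial>g)"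
    unfolding S b_def move[OF PMm(1) PM0(1), symmetric]
    by (rule sum3) (auto intro!: ent_nonneg mult_nonneg_nonneg kr0 h(2) PM0)
   ultimately show ?thesis by (simp add: g.emeasure_space_1)
  qed
  have e2: "rent j + a + 1 = b + 1"
  proof -
   have "(\<integral>\<^sup>+V. ennreal (ent (kr V) + kr V * M (kr V) + kr V) \<partial>g) = (\<integral>\<^sup>+V. ennreal (0 + kr V * P (kr V) + 1) \<partial>g)"
    unfolding M_def P_def
   proof (intro nn_integral_cong)
    fix V
    have "ent (kr V) + kr V * max 0 (- ln (kr V)) + kr V = 0 + kr V * max 0 (ln (kr V)) + 1"
     using ent_product[OF zero_le_one kr0[of V]] by (simp add: ent_def)
    then show "ennreal (ent (kr V) + kr V * max 0 (- ln (kr V)) + kr V) = ennreal (0 + kr V * max 0 (ln (kr V)) + 1)"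
     by (rule arg_cong)
   qed
   moreover have "(\<integral>\<^sup>+V. ennreal (ent (kr V) + kr V * M (kr V) + kr V) \<partial>g) = rent j + a + 1"
    unfolding R' a_def one[symmetric] by (rule sum3) (auto intro!: ent_nonneg mult_nonneg_nonneg kr0 PM0)
   moreover have "(\<integral>\<^sup>+V. ennreal (0 + kr V * P (kr V) + 1) \<partial>g) = (\<integral>\<^sup>+V. ennreal 0 \<partial>g) + b + (\<integral>\<^sup>+V. ennreal 1 \<partial>g)"
    unfolding b_def by (rule sum3) (auto intro!: mult_nonneg_nonneg kr0 PM0)
   ultimately show ?thesis by (simp add: g.emeasure_space_1)
  qed
  have "(a + 1) + rent (Suc j) = rent (Suc j) + a + 1" by (simp only: ac_simps)
  also have "... = dual F Q + (rent j + a + 1)" unfolding e1 e2 by (simp only: ac_simps)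
  also have "... = (a + 1) + (rent j + dual F Q)" by (simp only: ac_simps)
  finally have "rent (Suc j) = rent j + dual F Q" using a by (simp only: ennreal_add_left_cancel) blast
  then show ?thesis by (simp only: crel)
 qed
qed

lemma rent_sum: "n >= 1 ==> rent n = (\<Sum>i\<in>{1..n}. crel i (mixture i \<nu>))"
proof (induction n rule: dec_induct)
 case base
 show ?case using crel_1[OF law_mixture[of 1]] by (simp add: rent_def)
next
 case (step n)
 then show ?case by (simp add: chain_rule insert_Suc[symmetric] add.commute)
qed

end

text \<open>Carries the chain rule over to the normalised entropy. As \<open>L\<close> may be
  infinite, the means are squeezed: each is at most \<open>L\<close>, and for fixed \<open>m\<close>
  the mean of the first \<open>n\<close> terms is at least \<open>1 - m / n\<close> times
  \<open>a m\<close>.\<close>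

lemma cesaro_ennreal:
 fixes a :: "nat => ennreal"
 assumes mono: "!!i j. 1 <= i ==> i <= j ==> a i <= a j" and lim: "a ----> L"
 defines "b \<equiv> %n. ennreal (1 / real n) * (\<Sum>i\<in>{1..n}. a i)"
 shows "!!i j. 1 <= i ==> i <= j ==> b i <= b j" and "b ----> L"
proof -
 have step: "b n <= b (Suc n)" if n: "n >= 1" for n
 proof -
  let ?S = "\<Sum>i\<in>{1..n}. a i"
  have "?S <= (\<Sum>i\<in>{1..n}. a (Suc n))" by (intro sum_mono mono) auto
  then have S: "?S <= ennreal (real n) * a (Suc n)" by (simp add: ennreal_of_nat_eq_real_of_nat)
  \<comment> \<open>This splitting of 1/n compares \<open>b n\<close> with \<open>b (Suc n)\<close>
    without subtraction: the extra share goes to the mean \<open>b n\<close>, which is at most the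
    new term \<open>a (Suc n)\<close>.\<close>
  have c1: "ennreal (1 / real n) = ennreal (1 / real (Suc n)) + ennreal (1 / real (Suc n)) * ennreal (1 / real n)"
  proof -
   have gen: "1 / x = 1 / (x + 1) + 1 / (x + 1) * (1 / x)" if "x > 0" for x :: real
   proof -
    have "1 / (x + 1) + 1 / (x + 1) * (1 / x) = 1 / (x + 1) * (1 + 1 / x)" by (simp add: distrib_left)
    also have "1 + 1 / x = (x + 1) / x" using that by (simp add: add_divide_distrib)
    finally show ?thesis using that by simp
   qed
   have n1: "real (Suc n) = real n + 1" and n0: "real n > 0" using n by auto
   have "1 / real n = 1 / real (Suc n) + 1 / real (Suc n) * (1 / real n)" unfolding n1 by (rule gen[OF n0])
   then have "ennreal (1 / real n) = ennreal (1 / real (Suc n) + 1 / real (Suc n) * (1 / real n))" by (rule arg_cong)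
   also have "... = ennreal (1 / real (Suc n)) + ennreal (1 / real (Suc n) * (1 / real n))" by (rule ennreal_plus) auto
   also have "ennreal (1 / real (Suc n) * (1 / real n)) = ennreal (1 / real (Suc n)) * ennreal (1 / real n)" by (rule ennreal_mult) auto
   finally show ?thesis .
  qed
  have "ennreal (1 / real n) * ?S <= ennreal (1 / real n) * (ennreal (real n) * a (Suc n))" by (rule mult_left_mono[OF S]) simp
  also have "... = a (Suc n)" using n by (simp add: mult.assoc[symmetric] ennreal_mult[symmetric])
  finally have le: "ennreal (1 / real n) * ?S <= a (Suc n)" .
  have "b n = ennreal (1 / real (Suc n)) * ?S + ennreal (1 / real (Suc n)) * (ennreal (1 / real n) * ?S)"
   unfolding b_def by (subst c1) (simp only: distrib_right mult.assoc)
  also have "... <= ennreal (1 / real (Suc n)) * ?S + ennreal (1 / real (Suc n)) * a (Suc n)"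
   by (intro add_left_mono mult_left_mono le) simp
  also have "... = b (Suc n)" unfolding b_def by (simp add: distrib_left add.commute atLeastAtMostSuc_conv)
  finally show ?thesis .
 qed
 show bm: "b i <= b j" if "1 <= i" "i <= j" for i j
  using that(2,1) by (induction j rule: dec_induct) (auto intro: order_trans step)
 have aL: "a i <= L" if "1 <= i" for i by (rule LIMSEQ_le_const[OF lim]) (use mono that in blast)
 have bL: "b n <= L" if n: "n >= 1" for n
 proof -
  have "(\<Sum>i\<in>{1..n}. a i) <= (\<Sum>i\<in>{1..n}. L)" by (intro sum_mono aL) simp
  then have S: "(\<Sum>i\<in>{1..n}. a i) <= ennreal (real n) * L" by (simp add: ennreal_of_nat_eq_real_of_nat)
  have "b n <= ennreal (1 / real n) * (ennreal (real n) * L)" unfolding b_def by (rule mult_left_mono[OF S]) simp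
  also have "... = L" using n by (simp add: mult.assoc[symmetric] ennreal_mult[symmetric])
  finally show ?thesis .
 qed
 have ab: "a m <= (SUP n\<in>{1..}. b n)" if m: "m >= 1" for m
 proof -
  have low: "ennreal (1 - real m / real n) * a m <= b n" if n: "n >= m" for n
  proof -
   have "(\<Sum>i\<in>{m..n}. a m) <= (\<Sum>i\<in>{1..n}. a i)"
    by (rule order_trans[OF sum_mono sum_mono2]) (use m mono in auto)
   then have S: "ennreal (real (Suc n - m)) * a m <= (\<Sum>i\<in>{1..n}. a i)" by (simp add: ennreal_of_nat_eq_real_of_nat)
   have "ennreal (1 - real m / real n) * a m <= ennreal (1 / real n * real (Suc n - m)) * a m"
    by (intro mult_right_mono ennreal_leI) (use n m in \<open>auto simp: field_simps of_nat_diff\<close>)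
   also have "... = ennreal (1 / real n) * (ennreal (real (Suc n - m)) * a m)"
    by (subst ennreal_mult) (auto simp: mult.assoc)
   also have "... <= b n" unfolding b_def by (rule mult_left_mono[OF S]) simp
   finally show ?thesis .
  qed
  have "(%n. 1 - real m / real n) ----> 1" by real_asymp
  then have "(%n. ennreal (1 - real m / real n)) ----> ennreal 1" by (rule tendsto_ennrealI)
  then have "(%n. ennreal (1 - real m / real n) * a m) ----> ennreal 1 * a m" by (intro tendsto_mult_ennreal) auto
  then have "ennreal 1 * a m <= (SUP n\<in>{1..}. b n)"
  proof (rule LIMSEQ_le_const2)
   show "\<exists>N. \<forall>n\<ge>N. ennreal (1 - real m / real n) * a m <= (SUP n\<in>{1..}. b n)"
   proof (intro exI[of _ m] allI impI)
    fix n assume n: "m <= n"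
    have "b n <= (SUP n\<in>{1..}. b n)" by (rule SUP_upper) (use n m in simp)
    with low[OF n] show "ennreal (1 - real m / real n) * a m <= (SUP n\<in>{1..}. b n)" by (rule order_trans)
   qed
  qed
  then show ?thesis by simp
 qed
 have "L <= (SUP n\<in>{1..}. b n)" by (rule LIMSEQ_le_const2[OF lim]) (use ab in blast)
 moreover have "(SUP n\<in>{1..}. b n) <= L" by (rule SUP_least) (simp add: bL)
 ultimately have L: "L = (SUP n\<in>{1..}. b n)" by (rule antisym)
 also have "... = (SUP n. b (Suc n))"
 proof (rule antisym; rule SUP_least)
  fix n :: nat assume "n : {1..}"
  then have "Suc (n - 1) = n" by simp
  then show "b n <= (SUP n. b (Suc n))" using SUP_upper[of "n - 1" UNIV "%n. b (Suc n)"] by simp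
 qed (auto intro: SUP_upper)
 finally have "L = (SUP n. b (Suc n))" .
 moreover have "(%n. b (Suc n)) ----> (SUP n. b (Suc n))"
  by (rule LIMSEQ_SUP) (auto simp: incseq_def intro!: bm)
 ultimately show "b ----> L" by (simp add: filterlim_sequentially_Suc)
qed

section \<open>Entropy relative to a Gaussian\<close>

lemma ext_integral_cong:
 "(AE x in M. f x = g x) ==> ext_integral M f = ext_integral M g"
 unfolding ext_integral_def by (intro arg_cong2[where f="(-)"] arg_cong[where f=enn2ereal] nn_integral_cong_AE) auto

text \<open>The positive part \<open>p\<close> and the negative part \<open>q\<close> of the sum
  satisfy p + B^- = A + B^+ + q. This is integrated in \<open>ennreal\<close>; since
  \<open>q\<close> is below B^-, every term that has to be moved across is finite.\<close>

lemma ext_integral_add: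
 fixes A :: "'a => ennreal" and B :: "'a => real"
 assumes A: "A : bmeas M" and B: "integrable M B"
 shows "ext_integral M (%x. enn2ereal (A x) + ereal (B x)) = enn2ereal (\<integral>\<^sup>+x. A x \<partial>M) + ereal (\<integral>x. B x \<partial>M)"
proof -
 define p q where "p x = e2ennreal (enn2ereal (A x) + ereal (B x))"
  and "q x = e2ennreal (- (enn2ereal (A x) + ereal (B x)))" for x
 note [measurable] = A borel_measurable_integrable[OF B]
 have pm [measurable]: "p : bmeas M" and qm [measurable]: "q : bmeas M"
  unfolding p_def[abs_def] q_def[abs_def] by measurable
 have e: "p x + ennreal (- B x) = A x + ennreal (B x) + q x" for x
 proof (cases "A x")
  case (real a)
  have "p x = ennreal (a + B x)" "q x = ennreal (- (a + B x))" using real by (simp_all add: p_def q_def enn2ereal_ennreal)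
  then show ?thesis using real by (cases "B x >= 0"; cases "a + B x >= 0")
    (simp_all add: ennreal_neg ennreal_plus[symmetric] del: ennreal_plus)
 next
  case top
  then have "enn2ereal (A x) + ereal (B x) = \<infinity>" by simp
  then show ?thesis using top by (simp add: p_def q_def)
 qed
 have qle: "q x <= ennreal (- B x)" for x
 proof (cases "A x")
  case (real a)
  have "q x = ennreal (- (a + B x))" using real by (simp add: q_def enn2ereal_ennreal)
  then show ?thesis using real by (simp add: ennreal_leI)
 next
  case top
  then have "enn2ereal (A x) + ereal (B x) = \<infinity>" by simp
  then show ?thesis by (simp add: q_def e2ennreal_neg)
 qed
 have fin: "(\<integral>\<^sup>+x. ennreal (B x) \<partial>M) ~= \<infinity>" "(\<integral>\<^sup>+x. ennreal (- B x) \<partial>M) ~= \<infinity>"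
  using real_integrable_def[of M B] B by auto
 have fq: "(\<integral>\<^sup>+x. q x \<partial>M) ~= \<infinity>"
 proof -
  have "(\<integral>\<^sup>+x. q x \<partial>M) <= (\<integral>\<^sup>+x. ennreal (- B x) \<partial>M)" by (rule nn_integral_mono[OF qle])
  then show ?thesis using fin(2) by (auto simp: top_unique)
 qed
 have "(\<integral>\<^sup>+x. p x + ennreal (- B x) \<partial>M) = (\<integral>\<^sup>+x. A x + ennreal (B x) + q x \<partial>M)" by (simp only: e)
 then have s: "(\<integral>\<^sup>+x. p x \<partial>M) + (\<integral>\<^sup>+x. ennreal (- B x) \<partial>M) = (\<integral>\<^sup>+x. A x \<partial>M) + (\<integral>\<^sup>+x. ennreal (B x) \<partial>M) + (\<integral>\<^sup>+x. q x \<partial>M)"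
  by (simp add: nn_integral_add)
 have fin2: "enn2ereal x - enn2ereal y = enn2ereal a + ereal (enn2real b - enn2real c)"
  if h: "x + c = a + b + y" "b ~= \<infinity>" "c ~= \<infinity>" "y ~= \<infinity>" for x y a b c :: ennreal
 proof -
  obtain b' where b: "b = ennreal b'" "b' >= 0" using h(2) by (cases b) auto
  obtain c' where c: "c = ennreal c'" "c' >= 0" using h(3) by (cases c) auto
  obtain y' where y: "y = ennreal y'" "y' >= 0" using h(4) by (cases y) auto
  show ?thesis
  proof (cases a)
   case (real a')
   then have "x ~= \<infinity>" using h(1) b c y by (auto simp: ennreal_plus[symmetric] simp del: ennreal_plus)
   then obtain x' where x: "x = ennreal x'" "x' >= 0" by (cases x) auto
   have "ennreal (x' + c') = ennreal (a' + b' + y')" using h(1) real b c x y by (simp add: ennreal_plus)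
   then have "x' + c' = a' + b' + y'" using real b c x y by (subst (asm) ennreal_inj) auto
   then show ?thesis using real b c x y by (simp add: enn2ereal_ennreal)
  next
   case top
   then have "x = \<infinity>" using h(1) c by (cases x) (auto simp: ennreal_plus[symmetric] simp del: ennreal_plus)
   then show ?thesis using top y by (simp add: enn2ereal_ennreal)
  qed
 qed
 show ?thesis unfolding ext_integral_def p_def[symmetric] q_def[symmetric] real_lebesgue_integral_def[OF B]
  by (rule fin2[OF s fin fq])
qed

definition gauss :: "real^3 => real" where
 "gauss x = (\<Prod>b\<in>Basis. std_normal_density (x \<bullet> b))"

lemma gauss_pos: "gauss x > 0" unfolding gauss_def by (intro prod_pos) (simp add: normal_density_pos)

lemma gauss_meas [measurable]: "gauss : bmeas borel" unfolding gauss_def[abs_def] by measurable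

text \<open>Logarithm of the normalising factor of the standard Gaussian on \<open>real^3\<close>,
  that is -(3/2) ln(2 pi).\<close>

definition log_const :: real where
 "log_const = (\<Sum>b\<in>(Basis :: (real^3) set). ln (1 / sqrt (2 * pi)))"

lemma ln_gauss: "ln (gauss x) = log_const - (norm x)\<^sup>2 / 2"
proof -
 have "ln (gauss x) = (\<Sum>b\<in>Basis. ln (std_normal_density (x \<bullet> b)))" unfolding gauss_def
  by (rule ln_prod) (auto simp: less_imp_neq[OF normal_density_pos[of 1 0], symmetric])
 also have "... = (\<Sum>b\<in>Basis. ln (1 / sqrt (2 * pi)) - (x \<bullet> b)\<^sup>2 / 2)"
 proof (rule sum.cong[OF refl])
  fix b :: "real^3"
  have "ln (c * exp t) = ln c + t" if "c > 0" for c t :: real using that by (simp add: ln_mult)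
  from this[of "1 / sqrt (2 * pi)" "- (x \<bullet> b)\<^sup>2 / 2"]
  show "ln (std_normal_density (x \<bullet> b)) = ln (1 / sqrt (2 * pi)) - (x \<bullet> b)\<^sup>2 / 2"
   by (simp add: std_normal_density_def)
 qed
 also have "... = log_const - (\<Sum>b\<in>Basis. (x \<bullet> b)\<^sup>2) / 2"
  by (simp only: sum_subtractf log_const_def sum_divide_distrib)
 also have "(\<Sum>b\<in>Basis. (x \<bullet> b)\<^sup>2) = (norm x)\<^sup>2"
  unfolding power2_norm_eq_inner euclidean_inner[of x x] by (simp add: power2_eq_square)
 finally show ?thesis .
qed

definition Gam :: "(real^3) measure" where
 "Gam = density lborel (%x. ennreal (gauss x))"

lemma Gam_sets: "sets Gam = sets borel" by (simp add: Gam_def)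

lemma Gam_prob: "prob_space Gam"
proof
 interpret N: prob_space "density lborel (%x. ennreal (std_normal_density x))" by (rule prob_space_normal_density) simp
 have one: "(\<integral>\<^sup>+x. ennreal (std_normal_density x) \<partial>lborel) = 1"
  using N.emeasure_space_1 by (simp add: emeasure_density)
 have "emeasure Gam (space Gam) = (\<integral>\<^sup>+x. (\<Prod>b\<in>Basis. ennreal (std_normal_density ((x :: real^3) \<bullet> b))) \<partial>lborel)"
  unfolding Gam_def by (simp add: emeasure_density gauss_def prod_ennreal)
 also have "... = (\<Prod>b\<in>(Basis :: (real^3) set). (\<integral>\<^sup>+x. ennreal (std_normal_density x) \<partial>lborel))"
  by (rule nn_integral_lborel_prod) auto
 finally show "emeasure Gam (space Gam) = 1" by (simp only: one prod.neutral_const)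
qed

definition gauss_n :: "nat => velocities => real" where
 "gauss_n n V = (\<Prod>i\<in>{1..n}. gauss (V i))"

lemma gauss_n_pos: "gauss_n n V > 0" unfolding gauss_n_def by (intro prod_pos) (simp add: gauss_pos)

lemma gauss_n_meas: "gauss_n n : bmeas (velM {1..n})" unfolding gauss_n_def[abs_def]
proof (rule borel_measurable_prod)
 fix i assume "i : {1..n}"
 then have "(%V. V i) : velM {1..n} \<rightarrow>\<^sub>M borel" by simp
 from measurable_compose[OF this gauss_meas] show "(%V. gauss (V i)) : bmeas (velM {1..n})" .
qed

lemma ln_gauss_n: "ln (gauss_n n V) = real n * log_const - (\<Sum>i\<in>{1..n}. (norm (V i))\<^sup>2 / 2)"
proof -
 have "ln (gauss_n n V) = (\<Sum>i\<in>{1..n}. ln (gauss (V i)))"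
  unfolding gauss_n_def by (rule ln_prod) (auto simp: less_imp_neq[OF gauss_pos, symmetric])
 then show ?thesis by (simp add: ln_gauss sum_subtractf)
qed

lemma tensor_Gam: "tensor n Gam = density (leb n) (%V. ennreal (gauss_n n V))"
proof -
 interpret G: prob_space Gam by (rule Gam_prob)
 interpret P: product_sigma_finite "%_::nat. Gam" by (simp add: product_sigma_finite_def G.sigma_finite_measure_axioms)
 interpret Leb: product_sigma_finite "%_::nat. lborel :: (real^3) measure" by (rule product_sigma_finite_lborel)
 have "density (leb n) (%V. ennreal (gauss_n n V)) = PiM {1..n} (%_. Gam)"
 proof (rule P.PiM_eqI)
  show "sets (density (leb n) (%V. ennreal (gauss_n n V))) = sets (PiM {1..n} (%_. Gam))"
   unfolding sets_density leb_def by (rule sets_PiM_cong) (simp_all add: Gam_sets)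
  fix A :: "nat => (real^3) set" assume A: "!!i. i : {1..n} ==> A i : sets Gam"
  then have Ab: "A i : sets borel" if "i : {1..n}" for i using that by (simp add: Gam_sets)
  have PA: "PiE {1..n} A : sets (leb n)" unfolding leb_def by (rule sets_PiM_I_finite) (auto simp: Ab)
  have gm: "(%V. ennreal (gauss_n n V)) : bmeas (leb n)"
   using measurable_compose[OF gauss_n_meas measurable_ennreal] by (simp only: meas_leb)
  have "emeasure (density (leb n) (%V. ennreal (gauss_n n V))) (PiE {1..n} A) =
    (\<integral>\<^sup>+V. ennreal (gauss_n n V) * indicator (PiE {1..n} A) V \<partial>leb n)"
   by (rule emeasure_density[OF gm PA])
  also have "... = (\<integral>\<^sup>+V. (\<Prod>i\<in>{1..n}. ennreal (gauss (V i)) * indicator (A i) (V i)) \<partial>leb n)"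
  proof (rule nn_integral_cong)
   fix V assume "V : space (leb n)"
   then have V: "V : phase n" by (simp add: space_leb)
   show "ennreal (gauss_n n V) * indicator (PiE {1..n} A) V = (\<Prod>i\<in>{1..n}. ennreal (gauss (V i)) * indicator (A i) (V i))"
   proof (cases "V : PiE {1..n} A")
    case True
    then have "V i : A i" if "i : {1..n}" for i using that by (rule PiE_mem)
    then show ?thesis using True by (simp add: gauss_n_def prod_ennreal gauss_pos less_imp_le)
   next
    case False
    then obtain i where i: "i : {1..n}" "V i \<notin> A i" using V by (auto simp: phase_def PiE_def Pi_def)
    have "(\<Prod>i\<in>{1..n}. ennreal (gauss (V i)) * indicator (A i) (V i)) = 0"
     by (rule prod_zero) (simp, rule bexI[OF _ i(1)], simp add: i(2))
    then show ?thesis using False by simp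
   qed
  qed
  also have "... = (\<Prod>i\<in>{1..n}. \<integral>\<^sup>+x. ennreal (gauss x) * indicator (A i) x \<partial>lborel)"
   unfolding leb_def by (rule Leb.product_nn_integral_prod) (use Ab in auto)
  also have "... = (\<Prod>i\<in>{1..n}. emeasure Gam (A i))"
   unfolding Gam_def by (intro prod.cong refl emeasure_density[symmetric]) (use Ab in auto)
  finally show "emeasure (density (leb n) (%V. ennreal (gauss_n n V))) (PiE {1..n} A) = (\<Prod>i\<in>{1..n}. emeasure Gam (A i))" .
 qed simp
 then show ?thesis by (simp add: tensor_def)
qed

text \<open>Applied with \<open>g\<close> the Gaussian density: the first term is nonnegative and
  gives the relative entropy, while the remainder is integrable under a second moment bound because
  \<open>ln g\<close> is quadratic. This keeps the entropy from being indeterminate.\<close>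

lemma entropy_split:
 assumes "f >= 0" "g > 0"
 shows "f * ln f = g * ent (f / g) + (f - g + f * ln g)"
proof (cases "f = 0")
 case False
 then have e: "ln f = ln (f / g) + ln g" using assms by (simp add: ln_div)
 have "f * (l + m) = g * (f / g * l - f / g + 1) + (f - g + f * m)" for l m using assms(2) by (simp add: field_simps)
 from this[of "ln (f / g)" "ln g"] show ?thesis unfolding ent_def e .
qed (simp add: ent_def)

text \<open>\<open>e\<close> is half the second moment of one particle, so
  \<open>ln (gauss_n n V)\<close> has mean \<open>real n * (log_const - enn2real e)\<close>, and
  after division by \<open>n\<close> the offset no longer depends on \<open>n\<close>. Laws without
  density have infinite relative entropy, in accordance with the default value of
  \<open>H_fun\<close>.\<close>

lemma H_dual:
 assumes F: "law n F" and n: "n >= 1" and e: "!!i. i : {1..n} ==> (\<integral>\<^sup>+V. ennreal ((norm (V i))\<^sup>2 / 2) \<partial>F) = e" and fin: "e < \<infinity>"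
 shows "H_fun n F = enn2ereal (ennreal (1 / real n) * dual F (tensor n Gam)) + ereal (log_const - enn2real e)"
proof -
 interpret F: prob_space F using F by (simp add: law_def)
 interpret L: sigma_finite_measure "leb n" by (rule sigma_finite_leb)
 let ?T = "tensor n Gam"
 have sF: "sets F = sets (velM {1..n})" using F by (simp add: law_def)
 have pT: "prob_space ?T" unfolding tensor_def by (intro prob_space_PiM Gam_prob)
 have sT: "sets ?T = sets (leb n)" by (simp add: tensor_Gam)
 have sFT: "sets F = sets ?T" by (simp add: sT sF sets_leb)
 have gm: "gauss_n n : bmeas (leb n)" using gauss_n_meas by (simp only: meas_leb)
 note [measurable] = gm
 have g0: "gauss_n n V >= 0" for V using gauss_n_pos[of n V] by simp
 have nm: "(%V. (norm (V i))\<^sup>2 / 2) : bmeas F" if "i : {1..n}" for i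
 proof -
  have "(%V. V i) : F \<rightarrow>\<^sub>M borel" using that by (simp add: measurable_cong_sets[OF sF refl])
  then show ?thesis by measurable
 qed
 have ni: "integrable F (%V. (norm (V i))\<^sup>2 / 2)" if "i : {1..n}" for i
  by (rule integrableI_nonneg[OF nm[OF that]]) (use e[OF that] fin in auto)
 have nI: "(\<integral>V. (norm (V i))\<^sup>2 / 2 \<partial>F) = enn2real e" if "i : {1..n}" for i
  by (subst integral_eq_nn_integral[OF nm[OF that]]) (use e[OF that] in auto)
 have si: "integrable F (%V. \<Sum>i\<in>{1..n}. (norm (V i))\<^sup>2 / 2)" by (rule Bintegrable_sum) (rule ni)
 have ci: "integrable F (%V. real n * log_const)" by simp
 have lm: "(%V. ln (gauss_n n V)) : bmeas (velM {1..n})" using gauss_n_meas by measurable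
 have li: "integrable F (%V. ln (gauss_n n V))" unfolding ln_gauss_n by (rule Bintegrable_diff[OF ci si])
 have lI: "(\<integral>V. ln (gauss_n n V) \<partial>F) = real n * (log_const - enn2real e)"
 proof -
  have "(\<integral>V. ln (gauss_n n V) \<partial>F) = (\<integral>V. real n * log_const \<partial>F) - (\<integral>V. (\<Sum>i\<in>{1..n}. (norm (V i))\<^sup>2 / 2) \<partial>F)"
   unfolding ln_gauss_n by (rule Bintegral_diff[OF ci si])
  also have "(\<integral>V. (\<Sum>i\<in>{1..n}. (norm (V i))\<^sup>2 / 2) \<partial>F) = (\<Sum>i\<in>{1..n}. \<integral>V. (norm (V i))\<^sup>2 / 2 \<partial>F)"
   by (rule Bintegral_sum) (rule ni)
  also have "... = (\<Sum>i\<in>{1..n}. enn2real e)" by (intro sum.cong refl nI)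
  also have "... = real n * enn2real e" by simp
  finally show ?thesis by (simp add: F.prob_space right_diff_distrib)
 qed
 have scale: "ereal (1 / real n) * (enn2ereal d + ereal (real n * t)) = enn2ereal (ennreal (1 / real n) * d) + ereal t" for d t
 proof (cases d)
  case (real r)
  then show ?thesis using n by (simp add: enn2ereal_ennreal ennreal_mult[symmetric] field_simps)
 next
  case top
  then show ?thesis using n by (simp add: ennreal_mult_top)
 qed
 show ?thesis
 proof (cases "has_density n F")
  case True
  note D = dens_density[OF F True]
  define f where "f = dens n F"
  have fm [measurable]: "f : bmeas (leb n)" using D(1) by (simp add: f_def)
  have f0: "f V >= 0" for V by (simp add: f_def dens_nonneg)
  have fg0: "f V / gauss_n n V >= 0" for V using f0 g0 by simp
  have fgm: "(%V. f V / gauss_n n V) : bmeas ?T" by (subst measurable_cong_sets[OF sT refl]) measurable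
  have FT: "F = density ?T (%V. ennreal (f V / gauss_n n V))"
  proof -
   have "density ?T (%V. ennreal (f V / gauss_n n V)) = density (leb n) (%V. ennreal (gauss_n n V) * ennreal (f V / gauss_n n V))"
    unfolding tensor_Gam by (rule density_density_eq) measurable
   also have "(%V. ennreal (gauss_n n V) * ennreal (f V / gauss_n n V)) = (%V. ennreal (f V))"
    using gauss_n_pos[of n] by (auto simp: fun_eq_iff ennreal_mult[symmetric] g0 fg0 less_imp_neq[symmetric])
   finally show ?thesis using D(2) by (simp add: f_def)
  qed
  define A where "A V = ennreal (gauss_n n V * ent (f V / gauss_n n V))" for V
  define B where "B V = f V - gauss_n n V + f V * ln (gauss_n n V)" for V
  have Am: "A : bmeas (leb n)" unfolding A_def[abs_def] by measurable
  have dA: "dual F ?T = (\<integral>\<^sup>+V. A V \<partial>leb n)"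
  proof -
   have "dual F ?T = (\<integral>\<^sup>+V. ennreal (ent (f V / gauss_n n V)) \<partial>?T)"
    by (rule dual_density[OF F.prob_space_axioms pT fgm fg0 FT])
   also have "... = (\<integral>\<^sup>+V. ennreal (gauss_n n V) * ennreal (ent (f V / gauss_n n V)) \<partial>leb n)"
    unfolding tensor_Gam by (rule nn_integral_density) measurable
   also have "... = (\<integral>\<^sup>+V. A V \<partial>leb n)" unfolding A_def
    by (intro nn_integral_cong) (simp add: ennreal_mult g0 ent_nonneg[OF fg0])
   finally show ?thesis .
  qed
  have mass: "integrable (leb n) h & (\<integral>V. h V \<partial>leb n) = 1"
   if "prob_space M" "M = density (leb n) (%V. ennreal (h V))" "h : bmeas (leb n)" "!!V. h V >= 0" for M h
  proof -
   have "(\<integral>\<^sup>+V. ennreal (h V) \<partial>leb n) = emeasure M (space M)"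
    unfolding that(2) using that(3) by (simp add: emeasure_density cong: nn_integral_cong)
   then have i: "(\<integral>\<^sup>+V. ennreal (h V) \<partial>leb n) = 1" using prob_space.emeasure_space_1[OF that(1)] by simp
   have "integrable (leb n) h" by (rule integrableI_nonneg[OF that(3)]) (use that(4) i in auto)
   moreover have "(\<integral>V. h V \<partial>leb n) = 1" by (subst integral_eq_nn_integral[OF that(3)]) (use that(4) i in auto)
   ultimately show ?thesis ..
  qed
  note mf = mass[OF F.prob_space_axioms D(2)[folded f_def] fm f0] and mg = mass[OF pT tensor_Gam gm g0]
  have fl: "integrable (leb n) (%V. f V * ln (gauss_n n V))" using law_integral(2)[OF F True lm] li by (simp add: f_def)
  have flI: "(\<integral>V. f V * ln (gauss_n n V) \<partial>leb n) = real n * (log_const - enn2real e)"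
   using law_integral(1)[OF F True lm] lI by (simp add: f_def)
  have Bi: "integrable (leb n) B" unfolding B_def[abs_def]
   by (intro Bintegrable_add Bintegrable_diff fl) (use mf mg in auto)
  have BI: "(\<integral>V. B V \<partial>leb n) = real n * (log_const - enn2real e)" unfolding B_def using mf mg fl flI by simp
  have "H_fun n F = ereal (1 / real n) * ext_integral (leb n) (%V. ereal (f V * ln (f V)))"
   using True by (simp add: H_fun_def f_def)
  also have "(%V. ereal (f V * ln (f V))) = (%V. enn2ereal (A V) + ereal (B V))"
  proof
   fix V
   have "gauss_n n V * ent (f V / gauss_n n V) >= 0" by (intro mult_nonneg_nonneg g0 ent_nonneg fg0)
   then show "ereal (f V * ln (f V)) = enn2ereal (A V) + ereal (B V)"
    unfolding A_def B_def entropy_split[OF f0 gauss_n_pos[of n V]] by (simp add: enn2ereal_ennreal)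
  qed
  also have "ext_integral (leb n) (%V. enn2ereal (A V) + ereal (B V)) = enn2ereal (dual F ?T) + ereal (real n * (log_const - enn2real e))"
   unfolding ext_integral_add[OF Am Bi] dA BI ..
  finally show ?thesis unfolding scale .
 next
  case False
  have "dual F ?T = \<infinity>"
  proof (rule ccontr)
   assume "dual F ?T ~= \<infinity>"
   then have "dual F ?T < \<infinity>" by (simp add: less_top)
   from dual_ac[OF F.prob_space_axioms pT sFT this]
   obtain h where h: "h : bmeas ?T" "!!x. h x >= (0::real)" "F = density ?T (%x. ennreal (h x))"
    by (rule density_of_ac[OF F.prob_space_axioms pT sFT]) (rule that)
   have hm: "h : bmeas (leb n)" using h(1) by (simp only: measurable_cong_sets[OF sT refl])
   note [measurable] = hm
   have Fd: "F = density (leb n) (%V. ennreal (gauss_n n V) * ennreal (h V))"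
    unfolding h(3) tensor_Gam by (rule density_density_eq) measurable
   have dm: "(%V. ennreal (gauss_n n V) * ennreal (h V)) : bmeas (leb n)" by measurable
   have "has_density n F" unfolding has_density_def by (rule bexI[OF _ dm]) (rule Fd[symmetric])
   then show False using False by simp
  qed
  then show ?thesis using False n by (simp add: H_fun_def ennreal_mult_top)
 qed
qed

lemma (in mixing) H_limit:
 assumes m2: "(\<integral>\<^sup>+V. ennreal ((norm (V 1))\<^sup>2) \<partial>mixture 1 \<nu>) < \<infinity>"
 shows "(%j. H_fun j (mixture j \<nu>)) ----> ext_integral \<nu> (%\<rho>. H_fun 1 (tensor 1 \<rho>))"
  and "mono_on {1..} (%j. H_fun j (mixture j \<nu>))"
proof -
 interpret R: reference \<nu> Gam by (intro reference.intro reference_axioms.intro mixing_axioms Gam_prob Gam_sets)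
 define s where "s x = ennreal ((norm x)\<^sup>2 / 2)" for x :: "real^3"
 have sm: "s : bmeas borel" unfolding s_def[abs_def] by measurable
 define \<sigma> where "\<sigma> \<rho> = (\<integral>\<^sup>+x. s x \<partial>\<rho>)" for \<rho>
 have \<sigma>m: "\<sigma> : bmeas \<nu>" unfolding \<sigma>_def[abs_def]
  by (rule measurable_compose[OF measurable_prob_algebraD[OF idm] nn_integral_measurable_subprob_algebra[OF sm]])
 have sim: "(%V. s (V i)) : bmeas (velM {1..n})" if "i : {1..n}" for i n
 proof -
  have "(%V. V i) : velM {1..n} \<rightarrow>\<^sub>M borel" using that by simp
  from measurable_compose[OF this sm] show ?thesis .
 qed
 have ten: "(\<integral>\<^sup>+V. s (V i) \<partial>tensor n \<rho>) = \<sigma> \<rho>" if \<rho>: "\<rho> : space \<nu>" and i: "i : {1..n}" for \<rho> i n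
 proof -
  interpret product_prob_space "%_::nat. \<rho>" "{1..n}"
   using rho(1)[OF \<rho>] by (simp add: product_prob_space_def product_prob_space_axioms_def
    product_sigma_finite_def prob_space_imp_sigma_finite)
  have sm': "s : bmeas \<rho>" using sm by (simp add: measurable_cong_sets[OF rho(2)[OF \<rho>] refl])
  have c: "(%V. V i) : tensor n \<rho> \<rightarrow>\<^sub>M \<rho>" unfolding tensor_def using i by simp
  have "distr (tensor n \<rho>) \<rho> (%V. V i) = \<rho>" unfolding tensor_def by (rule PiM_component[OF i])
  then show ?thesis using nn_integral_distr_base[OF c sm'] by (simp add: \<sigma>_def)
 qed
 define e where "e = (\<integral>\<^sup>+\<rho>. \<sigma> \<rho> \<partial>\<nu>)"
 have mix: "(\<integral>\<^sup>+V. s (V i) \<partial>mixture n \<nu>) = e" if i: "i : {1..n}" for i n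
  unfolding nn_mixture[OF sim[OF i]] e_def by (intro nn_integral_cong ten i)
 have e_fin: "e < \<infinity>"
 proof -
  have "e = (\<integral>\<^sup>+V. s (V 1) \<partial>mixture 1 \<nu>)" by (rule mix[symmetric]) simp
  also have "... <= (\<integral>\<^sup>+V. ennreal ((norm (V 1))\<^sup>2) \<partial>mixture 1 \<nu>)"
   unfolding s_def by (intro nn_integral_mono ennreal_leI) simp
  finally show ?thesis using m2 by (rule le_less_trans)
 qed
 define L where "L = (\<integral>\<^sup>+\<rho>. dual (tensor 1 \<rho>) (tensor 1 Gam) \<partial>\<nu>)"
 define b where "b n = ennreal (1 / real n) * R.rent n" for n
 have bsum: "b n = ennreal (1 / real n) * (\<Sum>i\<in>{1..n}. R.crel i (mixture i \<nu>))" if "n >= 1" for n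
  unfolding b_def R.rent_sum[OF that] ..
 note ces = cesaro_ennreal[of "%i. R.crel i (mixture i \<nu>)", OF R.crel_mono R.crel_limit]
 have bmono: "b i <= b j" if "1 <= i" "i <= j" for i j
  using ces(1)[OF _ _ that] bsum[OF that(1)] bsum[OF order_trans[OF that]] by simp
 have blim: "b ----> L"
 proof (rule Lim_transform_eventually)
  show "(%n. ennreal (1 / real n) * (\<Sum>i\<in>{1..n}. R.crel i (mixture i \<nu>))) ----> L"
   unfolding L_def by (rule ces(2))
  show "\<forall>\<^sub>F n in sequentially. ennreal (1 / real n) * (\<Sum>i\<in>{1..n}. R.crel i (mixture i \<nu>)) = b n"
   using eventually_ge_at_top[of 1] by eventually_elim (simp add: bsum)
 qed
 have Hmix: "H_fun n (mixture n \<nu>) = enn2ereal (b n) + ereal (log_const - enn2real e)" if n: "n >= 1" for n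
  unfolding b_def R.rent_def by (rule H_dual[OF law_mixture n _ e_fin]) (rule mix[unfolded s_def])
 have ext: "ext_integral \<nu> (%\<rho>. H_fun 1 (tensor 1 \<rho>)) = enn2ereal L + ereal (log_const - enn2real e)"
 proof -
  \<comment> \<open>A finite mean second moment gives a finite second moment for almost every
    \<open>\<rho>\<close>, and for those \<open>H_dual\<close> applies with one particle.\<close>
  have "AE \<rho> in \<nu>. \<sigma> \<rho> ~= \<infinity>"
   by (rule nn_integral_PInf_AE[OF \<sigma>m]) (use e_fin e_def in auto)
  then have "AE \<rho> in \<nu>. H_fun 1 (tensor 1 \<rho>) = enn2ereal (dual (tensor 1 \<rho>) (tensor 1 Gam)) + ereal (log_const - enn2real (\<sigma> \<rho>))"
  proof (rule AE_mp, intro AE_I2 impI)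
   fix \<rho> assume \<rho>: "\<rho> : space \<nu>" and f: "\<sigma> \<rho> ~= \<infinity>"
   have "H_fun 1 (tensor 1 \<rho>) = enn2ereal (ennreal (1 / real 1) * dual (tensor 1 \<rho>) (tensor 1 Gam)) + ereal (log_const - enn2real (\<sigma> \<rho>))"
    by (rule H_dual[OF law_tensor[OF \<rho>] order_refl]) (rule ten[OF \<rho>, unfolded s_def], assumption, use f in \<open>simp add: less_top\<close>)
   then show "H_fun 1 (tensor 1 \<rho>) = enn2ereal (dual (tensor 1 \<rho>) (tensor 1 Gam)) + ereal (log_const - enn2real (\<sigma> \<rho>))" by simp
  qed
  then have "ext_integral \<nu> (%\<rho>. H_fun 1 (tensor 1 \<rho>)) =
    ext_integral \<nu> (%\<rho>. enn2ereal (dual (tensor 1 \<rho>) (tensor 1 Gam)) + ereal (log_const - enn2real (\<sigma> \<rho>)))"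
   by (rule ext_integral_cong)
  also have "... = enn2ereal L + ereal (log_const - enn2real e)"
  proof -
   have rm: "(%\<rho>. enn2real (\<sigma> \<rho>)) : bmeas \<nu>" using \<sigma>m by measurable
   have ee: "(\<integral>\<^sup>+\<rho>. ennreal (enn2real (\<sigma> \<rho>)) \<partial>\<nu>) = e"
    unfolding e_def using \<open>AE \<rho> in \<nu>. \<sigma> \<rho> ~= \<infinity>\<close>
    by (intro nn_integral_cong_AE) (auto elim!: eventually_mono simp: less_top)
   have ri: "integrable \<nu> (%\<rho>. enn2real (\<sigma> \<rho>))" by (rule integrableI_nonneg[OF rm]) (use ee e_fin in auto)
   have rI: "(\<integral>\<rho>. enn2real (\<sigma> \<rho>) \<partial>\<nu>) = enn2real e" by (subst integral_eq_nn_integral[OF rm]) (use ee in auto)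
   have ci: "integrable \<nu> (%\<rho>. log_const)" by simp
   have I: "(\<integral>\<rho>. log_const - enn2real (\<sigma> \<rho>) \<partial>\<nu>) = log_const - enn2real e"
    unfolding Bintegral_diff[OF ci ri] rI by (simp add: prob_space)
   have "integrable \<nu> (%\<rho>. log_const - enn2real (\<sigma> \<rho>))" by (rule Bintegrable_diff[OF ci ri])
   from ext_integral_add[OF R.dual_tensor_measurable this] show ?thesis unfolding L_def I .
  qed
  finally show ?thesis .
 qed
 have "(%n. enn2ereal (b n)) ----> enn2ereal L"
  by (rule continuous_on_tendsto_compose[OF continuous_on_enn2ereal blim]) auto
 then have "(%n. enn2ereal (b n) + ereal (log_const - enn2real e)) ----> enn2ereal L + ereal (log_const - enn2real e)"
  by (rule tendsto_add_ereal_general1[rotated, OF _ tendsto_const]) simp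
 then show "(%j. H_fun j (mixture j \<nu>)) ----> ext_integral \<nu> (%\<rho>. H_fun 1 (tensor 1 \<rho>))"
  unfolding ext
 proof (rule Lim_transform_eventually)
  show "\<forall>\<^sub>F n in sequentially. enn2ereal (b n) + ereal (log_const - enn2real e) = H_fun n (mixture n \<nu>)"
   using eventually_ge_at_top[of 1] by eventually_elim (simp add: Hmix)
 qed
 show "mono_on {1..} (%j. H_fun j (mixture j \<nu>))"
 proof (rule mono_onI)
  fix i j :: nat assume "i : {1..}" "j : {1..}" "i <= j"
  then have ij: "1 <= i" "1 <= j" "i <= j" by auto
  have "enn2ereal (b i) <= enn2ereal (b j)" using bmono[OF ij(1,3)] by (simp only: less_eq_ennreal.rep_eq)
  then show "H_fun i (mixture i \<nu>) <= H_fun j (mixture j \<nu>)"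
   unfolding Hmix[OF ij(1)] Hmix[OF ij(2)] by (rule add_right_mono)
 qed
qed

section \<open>The Borel structure of the weak topology\<close>

lemma space_weak_borel: "space weak_borel = (prob_measures :: 'a::topological_space measure set)"
 and sets_weak_borel: "openin weak_topology U ==> U : sets (weak_borel :: 'a measure measure)"
proof -
 have "topspace (weak_topology :: 'a measure topology) <= prob_measures"
  unfolding weak_topology_def topology_generated_by_topspace by blast
 then have s: "{U. openin weak_topology U} <= Pow (prob_measures :: 'a measure set)" using openin_subset by fast
 show "space weak_borel = (prob_measures :: 'a measure set)" unfolding weak_borel_def by (rule space_measure_of[OF s])
 show "openin weak_topology U ==> U : sets (weak_borel :: 'a measure measure)"
  unfolding weak_borel_def sets_measure_of[OF s] by auto
qed

lemma integral_weak_measurable: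
 fixes phi :: "'a::topological_space => real"
 assumes "continuous_on UNIV phi" "bounded (range phi)"
 shows "(%\<rho>. \<integral>x. phi x \<partial>\<rho>) : bmeas weak_borel"
proof (rule borel_measurableI)
 fix U :: "real set" assume "open U"
 then have "openin weak_topology {\<rho>\<in>prob_measures. (\<integral>x. phi x \<partial>\<rho>) : U}"
  unfolding weak_topology_def by (intro topology_generated_by_Basis) (use assms in blast)
 from sets_weak_borel[OF this] show "(%\<rho>. \<integral>x. phi x \<partial>\<rho>) -` U \<inter> space weak_borel : sets weak_borel"
  by (simp add: space_weak_borel vimage_def Int_def conj_commute)
qed

text \<open>Links the weak topology to the sigma-algebra used throughout. Open sets generate, and
  the indicator of an open set is the limit of the bounded continuous functions
  \<open>phi n\<close>, whose integrals are measurable by definition of the topology.\<close>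

lemma weak_borel_prob_algebra: "(%\<rho>. \<rho>) : weak_borel \<rightarrow>\<^sub>M prob_algebra (borel :: 'a::metric_space measure)"
proof (rule measurable_prob_algebra_generated[where G="{S. open S}" and \<Omega>=UNIV])
 show "sets (borel :: 'a measure) = sigma_sets UNIV {S. open S}" by (simp add: borel_def)
 show "Int_stable {S :: 'a set. open S}" by (auto simp: Int_stable_def)
 fix \<rho> :: "'a measure" assume "\<rho> : space weak_borel"
 then show "prob_space \<rho>" "sets \<rho> = sets borel" by (auto simp: space_weak_borel prob_measures_def)
next
 fix A :: "'a set" assume "A : {S. open S}"
 then have A: "open A" by simp
 show "(%\<rho>. emeasure \<rho> A) : bmeas weak_borel"
 \<comment> \<open>The whole space is split off because the distance to its empty complement is 0 by
   convention, so that \<open>phi n\<close> would not converge to the indicator.\<close>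
 proof (cases "A = UNIV")
  case True
  have "emeasure \<rho> A = 1" if "\<rho> : space weak_borel" for \<rho>
   using that True prob_space.emeasure_space_1[of \<rho>] sets_eq_imp_space_eq[of \<rho> borel]
   by (simp add: space_weak_borel prob_measures_def)
  then show ?thesis by (subst measurable_cong) auto
 next
  case False
  then have ne: "- A ~= {}" by auto
  define phi where "phi n x = min 1 (real n * infdist x (- A))" for n x
  have c: "continuous_on UNIV (phi n)" for n unfolding phi_def[abs_def] by (intro continuous_intros)
  have r: "0 <= phi n x & phi n x <= 1" for n x by (simp add: phi_def infdist_nonneg)
  have bd: "bounded (range (phi n))" for n unfolding bounded_iff using r by (intro exI[of _ 1]) auto
  have lim: "(%n. phi n x) ----> indicator A x" for x
  proof (cases "x : A")
   case True
   have "infdist x (- A) > 0" using True ne A infdist_pos_not_in_closed[of "- A" x] by (simp add: closed_Compl)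
   then have "\<forall>\<^sub>F n in sequentially. real n * infdist x (- A) >= 1" by real_asymp
   then have "\<forall>\<^sub>F n in sequentially. indicator A x = phi n x" by eventually_elim (simp add: phi_def True)
   then show ?thesis by (rule tendsto_eventually[OF eventually_mono]) simp
  next
   case False
   then have "infdist x (- A) = 0" by (intro infdist_zero) simp
   then show ?thesis using False by (simp add: phi_def)
  qed
  have l: "(%n. \<integral>x. phi n x \<partial>\<rho>) ----> measure \<rho> A" if \<rho>: "\<rho> : space weak_borel" for \<rho>
  proof -
   have p: "prob_space \<rho>" "sets \<rho> = sets borel" using \<rho> by (auto simp: space_weak_borel prob_measures_def)
   interpret prob_space \<rho> by (rule p)
   have AM: "A : sets \<rho>" using A p(2) by simp
   have "(%n. \<integral>x. phi n x \<partial>\<rho>) ----> (\<integral>x. indicator A x \<partial>\<rho>)"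
   proof (rule integral_dominated_convergence[where w="%_. 1"])
    show "phi n : bmeas \<rho>" for n
     using borel_measurable_continuous_onI[OF c] by (simp add: measurable_cong_sets[OF p(2) refl])
    show "AE x in \<rho>. (%n. phi n x) ----> indicat_real A x" by (rule AE_I2, rule lim)
    show "AE x in \<rho>. norm (phi n x) <= 1" for n using r by (intro AE_I2) simp
   qed (use AM in auto)
   then show ?thesis using AM sets.sets_into_space[OF AM] by (simp add: Int_absorb2)
  qed
  have "(%\<rho>. measure \<rho> A) : bmeas weak_borel"
   by (rule borel_measurable_LIMSEQ_real[OF l], assumption) (rule integral_weak_measurable[OF c bd])
  then have "(%\<rho>. ennreal (measure \<rho> A)) : bmeas weak_borel" by measurable
  moreover have "emeasure \<rho> A = ennreal (measure \<rho> A)" if "\<rho> : space weak_borel" for \<rho>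
   using that by (intro finite_measure.emeasure_eq_measure) (simp add: space_weak_borel prob_measures_def prob_space.finite_measure)
  ultimately show ?thesis by (subst measurable_cong) auto
 qed
qed auto

theorem proposition6p6:
  fixes \<gamma> :: real and A :: "nat \<Rightarrow> real \<Rightarrow> real" and \<nu> :: "(real^3) measure measure"
  assumes "-3 \<le> \<gamma>" "\<gamma> \<le> -2"
    and "kernel_approx \<gamma> A"
    and "prob_space \<nu>" "sets \<nu> = sets weak_borel"
    and "(SUP j\<in>{1..}. I_fun j (mixture j \<nu>)) < \<infinity>"
    and "(\<integral>\<^sup>+V. ennreal ((norm (V 1))\<^sup>2) \<partial>mixture 1 \<nu>) < \<infinity>"
  shows "(\<lambda>j. H_fun j (mixture j \<nu>)) \<longlonglongrightarrow> ext_integral \<nu> (\<lambda>\<rho>. H_fun 1 (tensor 1 \<rho>))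
    \<and> mono_on {1..} (\<lambda>j. H_fun j (mixture j \<nu>))
    \<and> (\<lambda>j. I_fun j (mixture j \<nu>)) \<longlonglongrightarrow> (\<integral>\<^sup>+\<rho>. I_fun 1 (tensor 1 \<rho>) \<partial>\<nu>)
    \<and> mono_on {1..} (\<lambda>j. I_fun j (mixture j \<nu>))
    \<and> (\<lambda>j. D_reg (A j) j (mixture j \<nu>)) \<longlonglongrightarrow> (\<integral>\<^sup>+\<rho>. D_fun A 2 (tensor 2 \<rho>) \<partial>\<nu>)
    \<and> mono_on {2..} (\<lambda>j. D_reg (A j) j (mixture j \<nu>))
    \<and> (\<exists>L. (\<lambda>j. K_reg (A j) j (mixture j \<nu>)) \<longlonglongrightarrow> L
          \<and> L \<le> (\<integral>\<^sup>+\<rho>. K_fun A 2 (tensor 2 \<rho>) \<partial>\<nu>)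
          \<and> (\<integral>\<^sup>+\<rho>. K_fun A 2 (tensor 2 \<rho>) \<partial>\<nu>) \<le> 16 * L)
    \<and> mono_on {2..} (\<lambda>j. K_reg (A j) j (mixture j \<nu>))"
proof -
 interpret P: prob_space \<nu> by fact
 have "(%\<rho>. \<rho>) : \<nu> \<rightarrow>\<^sub>M prob_algebra borel"
  using weak_borel_prob_algebra by (simp only: measurable_cong_sets[OF assms(5) refl])
 then interpret mixing \<nu> by unfold_locales
 \<comment> \<open>A law without density has infinite \<open>I_fun\<close> by definition, so the
   bound on the Fisher information provides densities for all mixtures.\<close>
 have hd: "has_density j (mixture j \<nu>)" if "j >= 1" for j
 proof (rule ccontr)
  assume "~ has_density j (mixture j \<nu>)"
  then have "I_fun j (mixture j \<nu>) = \<infinity>" by (simp add: I_fun_def)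
  moreover have "I_fun j (mixture j \<nu>) <= (SUP j\<in>{1..}. I_fun j (mixture j \<nu>))"
   by (rule SUP_upper) (use that in simp)
  ultimately show False using assms(6) by simp
 qed
 define L where "L = (\<integral>\<^sup>+\<rho>. K_fun A 2 (tensor 2 \<rho>) \<partial>\<nu>)"
 \<comment> \<open>The limit is \<open>L\<close> itself, so the first inequality is an equality and
   the second follows from \<open>L \<le> 16 * L\<close>.\<close>
 have "1 * L <= 16 * L" by (rule mult_right_mono) auto
 then have K: "\<exists>L'. (%j. K_reg (A j) j (mixture j \<nu>)) ----> L' & L' <= L & L <= 16 * L'"
  using K_limit(1)[OF assms(3)] by (intro exI[of _ L]) (simp add: L_def)
 show ?thesis by (intro conjI H_limit[OF assms(7)] I_limit[OF hd] D_limit[OF assms(3)] K_limit(2)[OF assms(3)] K[unfolded L_def])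
qed

end
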